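(* Suppose that $F_\bullet=(F\le F_1,F_2\le F_0)$ is an injective diamond of rings with $F$ a field and each $F_i$ ($i=0,1,2$) a finite direct product of fields. Write $F_i=\prod_{v\in\mathcal V_i}F_v$ where each $F_v$ is a field. Assume moreover that patching holds for $F_\bullet$. Then: (a) The sequence $0\to\operatorname{Br}(F)\to\operatorname{Br}(F_1)\times\operatorname{Br}(F_2)\to\operatorname{Br}(F_0)$ is exact, where the map on the right is given by taking the difference of the restrictions of the two Brauer classes. (b) For a class $\alpha\in\operatorname{Br}(F)$, we have $\operatorname{ind}(\alpha)=\operatorname{lcm}\{\operatorname{ind}(\alpha_v)\mid v\in\mathcal V_1\cup\mathcal V_2\}$, where $\alpha_v$ is the image of $\alpha$ in $\operatorname{Br}(F_v)$.
   Context: An injective diamond of rings $R_\bullet=(R\le R_1,R_2\le R_0)$ is a commutative square of injective ring homomorphisms $R\to R_i\to R_0$ ($i=1,2$), regarded as inclusions. Patching holds for $R_\bullet$ if for every $n\ge1$, inside $\operatorname{GL}_n(R_0)$, one has $\operatorname{GL}_n(R)=\operatorname{GL}_n(R_1)\cap\operatorname{GL}_n(R_2)$ and every element of $\operatorname{GL}_n(R_0)$ is a product $g_1g_2$ with $g_i\in\operatorname{GL}_n(R_i)$. For a finite product of fields, $\operatorname{Br}(\prod F_v)=\prod\operatorname{Br}(F_v)$. $\operatorname{ind}$ is the degree of the division algebra representing a Brauer class. *)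

theory Defs
  imports
    "HOL-Algebra.QuotRing"
    "HOL-Algebra.Product_Groups"
    "Jordan_Normal_Form.Missing_VectorSpace"
begin

section \<open>Diamonds of rings and patching\<close>

definition injective_ring_hom ::
    "('a, 'm) ring_scheme \<Rightarrow> ('b, 'n) ring_scheme \<Rightarrow> ('a \<Rightarrow> 'b) \<Rightarrow> bool" where
  "injective_ring_hom R S h \<longleftrightarrow> h \<in> ring_hom R S \<and> inj_on h (carrier R)"

text \<open>The maps are \<open>i1 : R \<rightarrow> R1\<close>, \<open>i2 : R \<rightarrow> R2\<close>, \<open>j1 : R1 \<rightarrow> R0\<close>, \<open>j2 : R2 \<rightarrow> R0\<close>.\<close>

definition injective_diamond ::
    "'a ring \<Rightarrow> 'b ring \<Rightarrow> 'c ring \<Rightarrow> 'd ring \<Rightarrow>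
     ('a \<Rightarrow> 'b) \<Rightarrow> ('a \<Rightarrow> 'c) \<Rightarrow> ('b \<Rightarrow> 'd) \<Rightarrow> ('c \<Rightarrow> 'd) \<Rightarrow> bool" where
  "injective_diamond R R1 R2 R0 i1 i2 j1 j2 \<longleftrightarrow>
     ring R \<and> ring R1 \<and> ring R2 \<and> ring R0 \<and>
     injective_ring_hom R R1 i1 \<and> injective_ring_hom R R2 i2 \<and>
     injective_ring_hom R1 R0 j1 \<and> injective_ring_hom R2 R0 j2 \<and>
     (\<forall>x\<in>carrier R. j1 (i1 x) = j2 (i2 x))"

definition mat_ring :: "('a, 'm) ring_scheme \<Rightarrow> nat \<Rightarrow> (nat \<times> nat \<Rightarrow> 'a) ring" where
  "mat_ring R n =
     \<lparr>carrier = {..<n} \<times> {..<n} \<rightarrow>\<^sub>E carrier R,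
      mult = (\<lambda>M N. restrict (\<lambda>(i, j). \<Oplus>\<^bsub>R\<^esub>k\<in>{..<n}. M (i, k) \<otimes>\<^bsub>R\<^esub> N (k, j))
                         ({..<n} \<times> {..<n})),
      one = restrict (\<lambda>(i, j). if i = j then \<one>\<^bsub>R\<^esub> else \<zero>\<^bsub>R\<^esub>) ({..<n} \<times> {..<n}),
      zero = (\<lambda>p\<in>{..<n} \<times> {..<n}. \<zero>\<^bsub>R\<^esub>),
      add = (\<lambda>M N. \<lambda>p\<in>{..<n} \<times> {..<n}. M p \<oplus>\<^bsub>R\<^esub> N p)\<rparr>"

definition GL :: "nat \<Rightarrow> ('a, 'm) ring_scheme \<Rightarrow> (nat \<times> nat \<Rightarrow> 'a) set" where
  "GL n R = Units (mat_ring R n)"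

definition map_entries :: "nat \<Rightarrow> ('a \<Rightarrow> 'b) \<Rightarrow> (nat \<times> nat \<Rightarrow> 'a) \<Rightarrow> (nat \<times> nat \<Rightarrow> 'b)" where
  "map_entries n h M = (\<lambda>p\<in>{..<n} \<times> {..<n}. h (M p))"

definition patching_holds ::
    "'a ring \<Rightarrow> 'b ring \<Rightarrow> 'c ring \<Rightarrow> 'd ring \<Rightarrow>
     ('a \<Rightarrow> 'b) \<Rightarrow> ('a \<Rightarrow> 'c) \<Rightarrow> ('b \<Rightarrow> 'd) \<Rightarrow> ('c \<Rightarrow> 'd) \<Rightarrow> bool" where
  "patching_holds R R1 R2 R0 i1 i2 j1 j2 \<longleftrightarrow>
     (\<forall>n\<ge>1.
        map_entries n (j1 \<circ> i1) ` GL n R = map_entries n j1 ` GL n R1 \<inter> map_entries n j2 ` GL n R2 \<and>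
        (\<forall>g\<in>GL n R0. \<exists>g1\<in>GL n R1. \<exists>g2\<in>GL n R2.
           g = map_entries n j1 g1 \<otimes>\<^bsub>mat_ring R0 n\<^esub> map_entries n j2 g2))"

definition product_ring :: "'i set \<Rightarrow> ('i \<Rightarrow> ('a, 'm) ring_scheme) \<Rightarrow> ('i \<Rightarrow> 'a) ring" where
  "product_ring V K =
     \<lparr>carrier = (\<Pi>\<^sub>E v\<in>V. carrier (K v)),
      mult = (\<lambda>x y. \<lambda>v\<in>V. x v \<otimes>\<^bsub>K v\<^esub> y v),
      one = (\<lambda>v\<in>V. \<one>\<^bsub>K v\<^esub>),
      zero = (\<lambda>v\<in>V. \<zero>\<^bsub>K v\<^esub>),
      add = (\<lambda>x y. \<lambda>v\<in>V. x v \<oplus>\<^bsub>K v\<^esub> y v)\<rparr>"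


section \<open>Algebras over a field\<close>

text \<open>The library locale \<open>algebra\<close> is restricted to commutative algebras.\<close>

locale assoc_algebra = vectorspace K A + ring A
  for K :: "('a, 'm) ring_scheme" (structure) and A :: "('a, 'b, 'n) module_scheme" (structure) +
  assumes smult_mult_left:
      "\<lbrakk>k \<in> carrier K; x \<in> carrier A; y \<in> carrier A\<rbrakk>
       \<Longrightarrow> (k \<odot>\<^bsub>A\<^esub> x) \<otimes>\<^bsub>A\<^esub> y = k \<odot>\<^bsub>A\<^esub> (x \<otimes>\<^bsub>A\<^esub> y)"
    and smult_mult_right:
      "\<lbrakk>k \<in> carrier K; x \<in> carrier A; y \<in> carrier A\<rbrakk>
       \<Longrightarrow> x \<otimes>\<^bsub>A\<^esub> (k \<odot>\<^bsub>A\<^esub> y) = k \<odot>\<^bsub>A\<^esub> (x \<otimes>\<^bsub>A\<^esub> y)"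

definition simple_ring :: "('a, 'm) ring_scheme \<Rightarrow> bool" where
  "simple_ring A \<longleftrightarrow> ring A \<and> carrier A \<noteq> {\<zero>\<^bsub>A\<^esub>} \<and>
     (\<forall>I. ideal I A \<longrightarrow> I = {\<zero>\<^bsub>A\<^esub>} \<or> I = carrier A)"

definition ring_center :: "('a, 'm) ring_scheme \<Rightarrow> 'a set" where
  "ring_center A = {z \<in> carrier A. \<forall>x\<in>carrier A. z \<otimes>\<^bsub>A\<^esub> x = x \<otimes>\<^bsub>A\<^esub> z}"

definition central_simple_algebra ::
    "('a, 'm) ring_scheme \<Rightarrow> ('a, 'b, 'n) module_scheme \<Rightarrow> bool" where
  "central_simple_algebra K A \<longleftrightarrow>
     assoc_algebra K A \<and> vectorspace.fin_dim K A \<and> simple_ring A \<and>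
     ring_center A = {k \<odot>\<^bsub>A\<^esub> \<one>\<^bsub>A\<^esub> | k. k \<in> carrier K}"

definition algebra_iso ::
    "('a, 'm) ring_scheme \<Rightarrow> ('a, 'b, 'n) module_scheme \<Rightarrow> ('a, 'c, 'p) module_scheme \<Rightarrow> bool" where
  "algebra_iso K A B \<longleftrightarrow>
     (\<exists>h\<in>ring_iso A B. \<forall>k\<in>carrier K. \<forall>x\<in>carrier A. h (k \<odot>\<^bsub>A\<^esub> x) = k \<odot>\<^bsub>B\<^esub> h x)"

definition ring_with_smult ::
    "('b, 'm) ring_scheme \<Rightarrow> ('a \<Rightarrow> 'b \<Rightarrow> 'b) \<Rightarrow> ('a, 'b) module" where
  "ring_with_smult R s =
     \<lparr>carrier = carrier R, mult = mult R, one = one R, zero = zero R, add = add R, smult = s\<rparr>"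

definition mat_algebra ::
    "('a, 'b, 'n) module_scheme \<Rightarrow> nat \<Rightarrow> ('a, nat \<times> nat \<Rightarrow> 'b) module" where
  "mat_algebra A n =
     ring_with_smult (mat_ring A n) (\<lambda>k M. \<lambda>p\<in>{..<n} \<times> {..<n}. k \<odot>\<^bsub>A\<^esub> M p)"

text \<open>A ring \<open>L\<close> as an algebra over the source of a homomorphism \<open>h\<close> into \<open>L\<close>.\<close>

definition algebra_via :: "('b, 'm) ring_scheme \<Rightarrow> ('a \<Rightarrow> 'b) \<Rightarrow> ('a, 'b) module" where
  "algebra_via L h = ring_with_smult L (\<lambda>k x. h k \<otimes>\<^bsub>L\<^esub> x)"


section \<open>Tensor products of algebras\<close>

definition basis_elt :: "('a, 'm) ring_scheme \<Rightarrow> 'g \<Rightarrow> 'g \<Rightarrow> 'a" where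
  "basis_elt K g = (\<lambda>x. if x = g then \<one>\<^bsub>K\<^esub> else \<zero>\<^bsub>K\<^esub>)"

definition monoid_algebra ::
    "('a, 'm) ring_scheme \<Rightarrow> ('g, 'n) monoid_scheme \<Rightarrow> ('a, 'g \<Rightarrow> 'a) module" where
  "monoid_algebra K G =
     \<lparr>carrier = {f. (\<forall>g\<in>carrier G. f g \<in> carrier K) \<and> (\<forall>g. g \<notin> carrier G \<longrightarrow> f g = \<zero>\<^bsub>K\<^esub>) \<and>
                    finite {g. f g \<noteq> \<zero>\<^bsub>K\<^esub>}},
      mult = (\<lambda>f h x. \<Oplus>\<^bsub>K\<^esub>y\<in>{g. f g \<noteq> \<zero>\<^bsub>K\<^esub>}. \<Oplus>\<^bsub>K\<^esub>z\<in>{g. h g \<noteq> \<zero>\<^bsub>K\<^esub>}.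
                 if y \<otimes>\<^bsub>G\<^esub> z = x then f y \<otimes>\<^bsub>K\<^esub> h z else \<zero>\<^bsub>K\<^esub>),
      one = basis_elt K \<one>\<^bsub>G\<^esub>,
      zero = (\<lambda>x. \<zero>\<^bsub>K\<^esub>),
      add = (\<lambda>f h x. f x \<oplus>\<^bsub>K\<^esub> h x),
      smult = (\<lambda>k f x. k \<otimes>\<^bsub>K\<^esub> f x)\<rparr>"

text \<open>
  The tensor product of \<open>A\<close> and \<open>B\<close> over \<open>K\<close> is the free \<open>K\<close>-module on \<open>A \<times> B\<close> modulo the
  bilinearity relations. The free module is taken with its monoid algebra structure for the
  componentwise multiplication of \<open>A \<times> B\<close>; the span of the relations is then already a
  two-sided ideal, and the quotient ring carries \<open>(a \<otimes> b) (a' \<otimes> b') = aa' \<otimes> bb'\<close>.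
\<close>

definition tensor_free ::
    "('a, 'm) ring_scheme \<Rightarrow> ('a, 'b, 'n) module_scheme \<Rightarrow> ('a, 'c, 'p) module_scheme
     \<Rightarrow> ('a, 'b \<times> 'c \<Rightarrow> 'a) module" where
  "tensor_free K A B = monoid_algebra K (A \<times>\<times> B)"

definition tensor_relations ::
    "('a, 'm) ring_scheme \<Rightarrow> ('a, 'b, 'n) module_scheme \<Rightarrow> ('a, 'c, 'p) module_scheme
     \<Rightarrow> ('b \<times> 'c \<Rightarrow> 'a) set" where
  "tensor_relations K A B =
     (let M = tensor_free K A B; e = (\<lambda>a b. basis_elt K (a, b)) in
      {e (a \<oplus>\<^bsub>A\<^esub> a') b \<ominus>\<^bsub>M\<^esub> (e a b \<oplus>\<^bsub>M\<^esub> e a' b) | a a' b.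
         a \<in> carrier A \<and> a' \<in> carrier A \<and> b \<in> carrier B} \<union>
      {e a (b \<oplus>\<^bsub>B\<^esub> b') \<ominus>\<^bsub>M\<^esub> (e a b \<oplus>\<^bsub>M\<^esub> e a b') | a b b'.
         a \<in> carrier A \<and> b \<in> carrier B \<and> b' \<in> carrier B} \<union>
      {e (k \<odot>\<^bsub>A\<^esub> a) b \<ominus>\<^bsub>M\<^esub> (k \<odot>\<^bsub>M\<^esub> e a b) | k a b.
         k \<in> carrier K \<and> a \<in> carrier A \<and> b \<in> carrier B} \<union>
      {e a (k \<odot>\<^bsub>B\<^esub> b) \<ominus>\<^bsub>M\<^esub> (k \<odot>\<^bsub>M\<^esub> e a b) | k a b.
         k \<in> carrier K \<and> a \<in> carrier A \<and> b \<in> carrier B})"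

definition tensor_ideal ::
    "('a, 'm) ring_scheme \<Rightarrow> ('a, 'b, 'n) module_scheme \<Rightarrow> ('a, 'c, 'p) module_scheme
     \<Rightarrow> ('b \<times> 'c \<Rightarrow> 'a) set" where
  "tensor_ideal K A B = genideal (tensor_free K A B) (tensor_relations K A B)"

definition pure_tensor ::
    "('a, 'm) ring_scheme \<Rightarrow> ('a, 'b, 'n) module_scheme \<Rightarrow> ('a, 'c, 'p) module_scheme
     \<Rightarrow> 'b \<Rightarrow> 'c \<Rightarrow> ('b \<times> 'c \<Rightarrow> 'a) set" where
  "pure_tensor K A B a b = tensor_ideal K A B +>\<^bsub>tensor_free K A B\<^esub> basis_elt K (a, b)"

definition tensor_algebra ::
    "('a, 'm) ring_scheme \<Rightarrow> ('a, 'b, 'n) module_scheme \<Rightarrow> ('a, 'c, 'p) module_scheme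
     \<Rightarrow> ('a, ('b \<times> 'c \<Rightarrow> 'a) set) module" where
  "tensor_algebra K A B =
     ring_with_smult (tensor_free K A B Quot tensor_ideal K A B)
       (\<lambda>k Z. \<Union>x\<in>Z. tensor_ideal K A B +>\<^bsub>tensor_free K A B\<^esub> (k \<odot>\<^bsub>tensor_free K A B\<^esub> x))"

text \<open>The \<open>L\<close>-algebra \<open>A \<otimes>\<^sub>K L\<close> for a field homomorphism \<open>h : K \<rightarrow> L\<close>.\<close>

definition base_change ::
    "('a, 'm) ring_scheme \<Rightarrow> ('c, 'p) ring_scheme \<Rightarrow> ('a \<Rightarrow> 'c) \<Rightarrow> ('a, 'b, 'n) module_scheme
     \<Rightarrow> ('c, ('b \<times> 'c \<Rightarrow> 'a) set) module" where
  "base_change K L h A =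
     ring_with_smult (tensor_algebra K A (algebra_via L h))
       (\<lambda>l Z. pure_tensor K A (algebra_via L h) \<one>\<^bsub>A\<^esub> l
              \<otimes>\<^bsub>tensor_algebra K A (algebra_via L h)\<^esub> Z)"


section \<open>The Brauer group\<close>

definition brauer_equiv ::
    "('a, 'm) ring_scheme \<Rightarrow> ('a, 'b, 'n) module_scheme \<Rightarrow> ('a, 'c, 'p) module_scheme \<Rightarrow> bool" where
  "brauer_equiv K A B \<longleftrightarrow>
     (\<exists>m\<ge>1. \<exists>n\<ge>1. algebra_iso K (mat_algebra A m) (mat_algebra B n))"

text \<open>
  Brauer classes are sets of central simple algebras whose elements have type \<open>nat \<Rightarrow> 'a\<close>, where
  \<open>'a\<close> is the element type of the field. Every finite-dimensional \<open>K\<close>-algebra is isomorphic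
  to one of this type (through coordinates with respect to a basis), so no class is lost.
  The argument \<open>C\<close> of \<open>brauer_class\<close> may have elements of any type.
\<close>

type_synonym 'a brauer_elt = "('a, nat \<Rightarrow> 'a) module set"

definition brauer_class ::
    "('a, 'm) ring_scheme \<Rightarrow> ('a, 'b, 'n) module_scheme \<Rightarrow> 'a brauer_elt" where
  "brauer_class K C = {A. central_simple_algebra K A \<and> brauer_equiv K A C}"

definition Br :: "('a, 'm) ring_scheme \<Rightarrow> 'a brauer_elt monoid" where
  "Br K =
     \<lparr>carrier = {brauer_class K A | A :: ('a, nat \<Rightarrow> 'a) module. central_simple_algebra K A},
      mult = (\<lambda>\<alpha> \<beta>. \<Union>A\<in>\<alpha>. \<Union>B\<in>\<beta>. brauer_class K (tensor_algebra K A B)),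
      one = brauer_class K (algebra_via K (\<lambda>k. k))\<rparr>"

definition Br_res ::
    "('a, 'm) ring_scheme \<Rightarrow> ('b, 'n) ring_scheme \<Rightarrow> ('a \<Rightarrow> 'b) \<Rightarrow> 'a brauer_elt \<Rightarrow> 'b brauer_elt" where
  "Br_res K L h \<alpha> = (\<Union>A\<in>\<alpha>. brauer_class L (base_change K L h A))"

definition division_algebra ::
    "('a, 'm) ring_scheme \<Rightarrow> ('a, 'b, 'n) module_scheme \<Rightarrow> bool" where
  "division_algebra K D \<longleftrightarrow>
     assoc_algebra K D \<and> Units D = carrier D - {\<zero>\<^bsub>D\<^esub>}"

text \<open>The degree of a central simple algebra is the square root of its dimension.\<close>

definition csa_degree :: "('a, 'm) ring_scheme \<Rightarrow> ('a, 'b, 'n) module_scheme \<Rightarrow> nat" where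
  "csa_degree K A = (THE d. d ^ 2 = vectorspace.dim K A)"

definition ind :: "('a, 'm) ring_scheme \<Rightarrow> 'a brauer_elt \<Rightarrow> nat" where
  "ind K \<alpha> = (THE d. \<exists>D\<in>\<alpha>. division_algebra K D \<and> csa_degree K D = d)"


section \<open>Brauer groups of finite products of fields\<close>

definition Br_prod :: "'i set \<Rightarrow> ('i \<Rightarrow> ('a, 'm) ring_scheme) \<Rightarrow> ('i \<Rightarrow> 'a brauer_elt) monoid" where
  "Br_prod V K = product_group V (\<lambda>v. Br (K v))"

definition Br_res_to_prod ::
    "('a, 'm) ring_scheme \<Rightarrow> 'i set \<Rightarrow> ('i \<Rightarrow> ('b, 'n) ring_scheme) \<Rightarrow> ('a \<Rightarrow> 'i \<Rightarrow> 'b)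
     \<Rightarrow> 'a brauer_elt \<Rightarrow> 'i \<Rightarrow> 'b brauer_elt" where
  "Br_res_to_prod K V L h \<alpha> = (\<lambda>v\<in>V. Br_res K (L v) (\<lambda>x. h x v) \<alpha>)"

definition factor_elt :: "'i set \<Rightarrow> ('i \<Rightarrow> ('a, 'm) ring_scheme) \<Rightarrow> 'i \<Rightarrow> 'a \<Rightarrow> 'i \<Rightarrow> 'a" where
  "factor_elt V K v x = (\<lambda>u\<in>V. if u = v then x else \<zero>\<^bsub>K u\<^esub>)"

text \<open>
  A ring homomorphism \<open>h\<close> from a finite product of fields \<open>K v\<close> (\<open>v \<in> V\<close>) to a product of
  fields \<open>L w\<close> (\<open>w \<in> W\<close>) has, for each \<open>w\<close>, a \<open>w\<close>-component that factors through the
  projection to \<open>K v\<close> for exactly one \<open>v\<close>: the one whose idempotent \<open>factor_elt V K v \<one>\<close> has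
  \<open>w\<close>-component \<open>\<one>\<close> under \<open>h\<close>.
\<close>

definition factor_below ::
    "'i set \<Rightarrow> ('i \<Rightarrow> ('a, 'm) ring_scheme) \<Rightarrow> ('j \<Rightarrow> ('b, 'n) ring_scheme)
     \<Rightarrow> (('i \<Rightarrow> 'a) \<Rightarrow> 'j \<Rightarrow> 'b) \<Rightarrow> 'j \<Rightarrow> 'i" where
  "factor_below V K L h w = (THE v. v \<in> V \<and> h (factor_elt V K v \<one>\<^bsub>K v\<^esub>) w = \<one>\<^bsub>L w\<^esub>)"

definition Br_res_prod ::
    "'i set \<Rightarrow> ('i \<Rightarrow> ('a, 'm) ring_scheme) \<Rightarrow> 'j set \<Rightarrow> ('j \<Rightarrow> ('b, 'n) ring_scheme)
     \<Rightarrow> (('i \<Rightarrow> 'a) \<Rightarrow> 'j \<Rightarrow> 'b) \<Rightarrow> ('i \<Rightarrow> 'a brauer_elt) \<Rightarrow> 'j \<Rightarrow> 'b brauer_elt" where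
  "Br_res_prod V K W L h \<beta> =
     (\<lambda>w\<in>W. let v = factor_below V K L h w
            in Br_res (K v) (L w) (\<lambda>x. h (factor_elt V K v x) w) (\<beta> v))"


section \<open>Exactness\<close>

text \<open>
  Exactness of \<open>0 \<rightarrow> G \<rightarrow> H \<rightarrow> I\<close>, as in the library's \<open>exact_seq\<close>, which needs all groups to
  have the same element type.
\<close>

definition left_exact_seq ::
    "('a, 'm) monoid_scheme \<Rightarrow> ('b, 'n) monoid_scheme \<Rightarrow> ('c, 'p) monoid_scheme
     \<Rightarrow> ('a \<Rightarrow> 'b) \<Rightarrow> ('b \<Rightarrow> 'c) \<Rightarrow> bool" where
  "left_exact_seq G H I f g \<longleftrightarrow>
     group_hom G H f \<and> group_hom H I g \<and>
     kernel G H f = {\<one>\<^bsub>G\<^esub>} \<and> kernel H I g = f ` carrier G"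

end

theory Submission imports Defs begin

text \<open>
  Everything is read off structure constants. Patching factors a change of basis over \<open>F\<^sub>0\<close> through \<open>F\<^sub>1\<close>
  and \<open>F\<^sub>2\<close>, so central simple algebras over the \<open>F\<^sub>v\<close> that become isomorphic over \<open>F\<^sub>0\<close> acquire common
  structure constants in \<open>F = F\<^sub>1 \<inter> F\<^sub>2\<close>. An algebra over \<open>F\<close> split by all \<open>F\<^sub>v\<close> is split: by Skolem-Noether
  its matrix representations over \<open>F\<^sub>1\<close> and \<open>F\<^sub>2\<close> are conjugate over \<open>F\<^sub>0\<close>, and factoring the conjugating matrix makes
  them agree. For the index, glue algebras of degree the least common multiple of the local indices.
\<close>

text \<open>Structure constants are the common currency because the algebras live in unrelated types
  (cosets for tensor products and base changes, functions for matrix and glued algebras): equal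
  constants give isomorphic algebras whatever their elements are. Central simplicity is recast as a
  condition on constants, the linear independence of the operators sending x to e_i x e_j, which can
  be tested over any extension field and so descends from a single factor of F_1 to F. A change of
  basis exists only between algebras of equal dimension. Local classes are therefore represented in
  one common degree, and passing from equal classes to isomorphic algebras rests on Wedderburn's
  theorem, the uniqueness of the division algebra in a class and the fact that its dimension is a
  square. The first two, and Skolem-Noether for matrix algebras, come from one notion: nonzero
  idempotents whose corner is a division ring. The square comes from a maximal subfield and the
  density theorem. The equality F = F_1 \<inter> F_2 is a statement about elements, while patching
  speaks of invertible matrices; elementary 2 by 2 matrices translate between the two.\<close>

abbreviation (input) rmult ("(_ *[_] _)" [70, 0, 71] 70) where "x *[R] y \<equiv> x \<otimes>\<^bsub>R\<^esub> y"
abbreviation (input) radd ("(_ +[_] _)" [65, 0, 66] 65) where "x +[R] y \<equiv> x \<oplus>\<^bsub>R\<^esub> y"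
abbreviation (input) rsmult ("(_ *.[_] _)" [70, 0, 71] 70) where "k *.[M] x \<equiv> k \<odot>\<^bsub>M\<^esub> x"
abbreviation (input) rzero ("0[_]") where "0[R] \<equiv> \<zero>\<^bsub>R\<^esub>"
abbreviation (input) rone ("1[_]") where "1[R] \<equiv> \<one>\<^bsub>R\<^esub>"
abbreviation (input) cmem (infix ":." 50) where "x :. R \<equiv> x \<in> carrier R"

abbreviation (input) fmem (infixr "->." 60) where "I ->. R \<equiv> I \<rightarrow> carrier R"
abbreviation (input) "csa \<equiv> central_simple_algebra"
abbreviation (input) "vdim \<equiv> vectorspace.dim"
abbreviation (input) "MR \<equiv> mat_ring"
abbreviation (input) "MA \<equiv> mat_algebra"
abbreviation (input) "mape \<equiv> map_entries"
syntax "_fsum" :: "'r => idt => 'i set => 'a => 'a" ("(3\<Oplus>[_]_:_./ _)" [0, 0, 51, 10] 10)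
translations "\<Oplus>[G]i:A. b" => "CONST finsum G (%i. b) A"
lemmas (in abelian_monoid) fcong = finsum_cong'[OF refl]

section \<open>Finite sums\<close>

lemma (in abelian_monoid) finsum_swap:
 assumes "finite A" "finite B" "!!a b. a:A==>b:B==>f a b:.G"
 shows "(\<Oplus>a\<in>A. \<Oplus>b\<in>B. f a b) = (\<Oplus>b\<in>B. \<Oplus>a\<in>A. f a b)"
 using assms(1,3)
proof (induction A rule: finite_induct)
 case empty then show ?case by simp
next
 case (insert x F)
 have "(\<Oplus>a\<in>insert x F. \<Oplus>b\<in>B. f a b) = (\<Oplus>b\<in>B. f x b) \<oplus> (\<Oplus>a\<in>F. \<Oplus>b\<in>B. f a b)"
  by (rule finsum_insert) (use insert in "auto intro!: finsum_closed")
 also have "(\<Oplus>a\<in>F. \<Oplus>b\<in>B. f a b) = (\<Oplus>b\<in>B. \<Oplus>a\<in>F. f a b)"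
  using insert by simp
 also have "(\<Oplus>b\<in>B. f x b) \<oplus> (\<Oplus>b\<in>B. \<Oplus>a\<in>F. f a b) = (\<Oplus>b\<in>B. f x b \<oplus> (\<Oplus>a\<in>F. f a b))"
  by (rule finsum_addf[symmetric]) (use insert in "auto intro!: finsum_closed")
 also have "... = (\<Oplus>b\<in>B. \<Oplus>a\<in>insert x F. f a b)"
  by (rule finsum_cong') (use insert in "auto intro!: finsum_closed")
 finally show ?case .
qed

lemma (in abelian_monoid) finsum_Times:
 assumes "finite A" "finite B" "!!a b. a:A==>b:B==>f (a,b):.G"
 shows "(\<Oplus>p\<in>A \<times> B. f p) = (\<Oplus>a\<in>A. \<Oplus>b\<in>B. f (a,b))"
 using assms(1,3)
proof (induction A rule: finite_induct)
 case empty then show ?case by simp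
next
 case (insert x F)
 have eq: "insert x F \<times> B = Pair x ` B \<union> F \<times> B" by auto
 have "(\<Oplus>p\<in>insert x F \<times> B. f p) = (\<Oplus>p\<in>Pair x ` B. f p) \<oplus> (\<Oplus>p\<in>F \<times> B. f p)"
  unfolding eq by (rule finsum_Un_disjoint) (use insert assms(2) in auto)
 also have "(\<Oplus>p\<in>Pair x ` B. f p) = (\<Oplus>b\<in>B. f (x,b))"
  by (rule finsum_reindex) (use insert in "auto simp: inj_on_def")
 also have "(\<Oplus>p\<in>F \<times> B. f p) = (\<Oplus>a\<in>F. \<Oplus>b\<in>B. f (a,b))" using insert by simp
 also have "(\<Oplus>b\<in>B. f (x,b)) \<oplus> (\<Oplus>a\<in>F. \<Oplus>b\<in>B. f (a,b)) = (\<Oplus>a\<in>insert x F. \<Oplus>b\<in>B. f (a,b))"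
  by (rule finsum_insert[symmetric]) (use insert in "auto intro!: finsum_closed")
 finally show ?case .
qed

lemma (in abelian_monoid) finsum_delta:
 assumes "finite A" "i:A" "f i:.G"
 shows "(\<Oplus>j\<in>A. if j = i then f j else \<zero>) = f i"
proof -
 have "(\<Oplus>j\<in>A. if j = i then f j else \<zero>) = (\<Oplus>j\<in>{i}. f j)"
  by (rule add.finprod_mono_neutral_cong) (use assms in auto)
 then show ?thesis using assms by simp
qed

lemma (in abelian_monoid) finsum_all_zero:
 "(!!i. i:A==>f i = \<zero>)==>(\<Oplus>i\<in>A. f i) = \<zero>"
 by (rule add.finprod_one_eqI)

lemma (in abelian_monoid) finsum_superset:
 assumes "finite B" "A <= B" "!!i. i:B - A==>f i = \<zero>" "!!i. i:A==>f i:.G"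
 shows "(\<Oplus>i\<in>A. f i) = (\<Oplus>i\<in>B. f i)"
proof -
 have "f:B->.G" using assms(3,4) by (metis DiffI Pi_I zero_closed)
 then show ?thesis
  by (intro add.finprod_mono_neutral_cong) (use assms finite_subset in auto)
qed

lemma (in abelian_monoid) finsum_bij:
 assumes "bij_betw \<pi> I J" "!!j. j:J==>f j:.G"
 shows "(\<Oplus>i\<in>I. f (\<pi> i)) = (\<Oplus>j\<in>J. f j)"
proof -
 have "J = \<pi> ` I" "inj_on \<pi> I" using assms(1) by (auto simp: bij_betw_def)
 then show ?thesis using finsum_reindex[of f \<pi> I] assms(2) by auto
qed

lemma additive_zero:
 assumes "abelian_group G" "abelian_group H" "h:carrier G->.H"
  and "!!x y. x:.G==>y:.G==>h (x+[G]y) = h x+[H]h y"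
 shows "h 0[G] = 0[H]"
proof -
 interpret G: abelian_group G by fact
 interpret H: abelian_group H by fact
 have "h 0[G]+[H]h 0[G] = h 0[G]"
  using assms(4)[of "0[G]" "0[G]"] by simp
 then show ?thesis using assms(3) H.add.r_cancel_one' by (metis G.zero_closed H.add.l_cancel_one' PiE)
qed

text \<open>Stated for a bare additive map, so that one lemma covers linear and semilinear maps,
  ring homomorphisms, coordinate functionals, one-sided multiplications and evaluation at a matrix
  entry. Over an infinite index set both sums are zero by convention.\<close>

lemma additive_finsum:
 assumes "abelian_group G" "abelian_group H" "h:carrier G->.H"
  and "!!x y. x:.G==>y:.G==>h (x+[G]y) = h x+[H]h y"
  and "!!i. i:A==>f i:.G"
 shows "h (\<Oplus>[G]i:A. f i) = (\<Oplus>[H]i:A. h (f i))"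
proof -
 interpret G: abelian_group G by fact
 interpret H: abelian_group H by fact
 have h0: "h 0[G] = 0[H]" by (rule additive_zero[OF assms(1-4)])
 show ?thesis
 proof (cases "finite A")
  case True
  then show ?thesis using assms(5)
  proof (induction A rule: finite_induct)
   case (insert x F)
   have fF: "f:F->.G" using insert by auto
   have "h (\<Oplus>[G]i:insert x F. f i) = h (f x+[G](\<Oplus>[G]i:F. f i))" using insert by simp
   also have "... = h (f x)+[H](\<Oplus>[H]i:F. h (f i))" using insert fF by (simp add: assms(4))
   also have "... = (\<Oplus>[H]i:insert x F. h (f i))" using insert assms(3) by (subst H.finsum_insert) auto
   finally show ?case .
  qed (simp add: h0)
 qed (simp add: h0)
qed

lemma (in ring) finsum_left: "x:.R==>(!!i. i:A==>f i:.R) ==>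
  x \<otimes> (\<Oplus>i\<in>A. f i) = (\<Oplus>i\<in>A. x \<otimes> f i)"
 by (rule additive_finsum) (auto simp: r_distr intro: abelian_group_axioms)

lemma (in ring) finsum_right: "x:.R==>(!!i. i:A==>f i:.R) ==>
  (\<Oplus>i\<in>A. f i) \<otimes> x = (\<Oplus>i\<in>A. f i \<otimes> x)"
 using additive_finsum[of R R "%y. y \<otimes> x" A f]
 by (auto simp: l_distr intro: abelian_group_axioms)

lemma (in module) smult_finsum: "k:.R==>(!!i. i:A==>f i:.M) ==>
  k*.[M](\<Oplus>[M]i:A. f i) = (\<Oplus>[M]i:A. k*.[M]f i)"
 by (rule additive_finsum) (auto simp: smult_r_distr intro: M.abelian_group_axioms)

lemma (in module) finsum_smult: "x:.M==>(!!i. i:A==>f i:.R) ==>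
  (\<Oplus>i\<in>A. f i)*.[M]x = (\<Oplus>[M]i:A. f i*.[M]x)"
 using additive_finsum[of R M "%y. y*.[M]x" A f]
 by (auto simp: smult_l_distr intro: M.abelian_group_axioms R.abelian_group_axioms)

lemma ring_hom_finsum:
 assumes "ring R" "ring S" "h:ring_hom R S" "!!i. i:A==>f i:.R"
 shows "h (\<Oplus>[R]i:A. f i) = (\<Oplus>[S]i:A. h (f i))"
 using assms by (intro additive_finsum) (auto simp: ring_hom_add ring_hom_closed ring.is_abelian_group)

lemma ring_hom_zero_ring:
 assumes "ring R" "ring S" "h:ring_hom R S"
 shows "h 0[R] = 0[S]"
 using assms by (intro additive_zero) (auto simp: ring_hom_add ring_hom_closed ring.is_abelian_group)

section \<open>Bases indexed by finite sets\<close>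

text \<open>Combinations of an indexed family rather than of a set of vectors: structure constants
  need named basis elements, and the bases of tensor products and matrix algebras are indexed by
  products of index sets.\<close>

definition lc :: "('a, 'b, 'n) module_scheme=>'i set=>('i=>'a)=>('i=>'b)=>'b" where
 "lc V I f e = (\<Oplus>[V]i:I. f i*.[V]e i)"

definition indep_family ::
 "('a, 'm) ring_scheme=>('a, 'b, 'n) module_scheme=>'i set=>('i=>'b)=>bool" where
 "indep_family K V I e \<longleftrightarrow> finite I & e:I->.V &
   (ALL f:I->.K. lc V I f e = 0[V] --> (ALL i:I. f i = 0[K]))"

definition span_family ::
 "('a, 'm) ring_scheme=>('a, 'b, 'n) module_scheme=>'i set=>('i=>'b)=>bool" where
 "span_family K V I e \<longleftrightarrow> finite I & e:I->.V &
   (ALL x:carrier V. EX f:I->.K. x = lc V I f e)"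

definition basis_family ::
 "('a, 'm) ring_scheme=>('a, 'b, 'n) module_scheme=>'i set=>('i=>'b)=>bool" where
 "basis_family K V I e \<longleftrightarrow> indep_family K V I e & span_family K V I e"

definition coord ::
 "('a, 'm) ring_scheme=>('a, 'b, 'n) module_scheme=>'i set=>('i=>'b)=>'b=>'i=>'a" where
 "coord K V I e x = (SOME f. f:I \<rightarrow>\<^sub>E carrier K & x = lc V I f e)"

lemma basis_familyD:
 assumes "basis_family K V I e"
 shows "finite I" "e:I->.V" "!!i. i:I==>e i:.V"
 using assms by (auto simp: basis_family_def indep_family_def)

context vectorspace
begin

lemma lc_closed: "e:I->.V==>f:I->.K==>lc V I f e:.V"
 unfolding lc_def by (intro M.finsum_closed) auto

lemma lc_cong: "e:I->.V==>f:I->.K ==>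
  (!!i. i:I==>f i = g i)==>(!!i. i:I==>e i = e' i)==>lc V I f e = lc V I g e'"
 unfolding lc_def
 by (rule M.finsum_cong') (auto simp: Pi_iff dest!: sym[of "f _"] sym[of "e _"])

lemma lc_add: "e:I->.V==>f:I->.K==>g:I->.K ==>
  lc V I f e+[V]lc V I g e = lc V I (%i. f i+[K]g i) e"
 unfolding lc_def
 by (rule trans[OF M.finsum_addf[symmetric] M.finsum_cong']) (auto simp: Pi_iff smult_l_distr)

lemma lc_smult: "e:I->.V==>f:I->.K==>k:.K ==>
  k*.[V]lc V I f e = lc V I (%i. k*[K]f i) e"
 unfolding lc_def
 by (subst smult_finsum) (auto simp: Pi_iff smult_assoc1 intro!: M.finsum_cong')

lemma smult_minus_one: "x:.V==>(\<ominus>\<^bsub>K\<^esub> 1[K])*.[V]x = \<ominus>\<^bsub>V\<^esub> x"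
 by (simp add: smult_l_minus)

lemma lc_delta:
 assumes "finite I" "e:I->.V" "i:I"
 shows "lc V I (%j. if j = i then 1[K] else 0[K]) e = e i"
proof -
 have "lc V I (%j. if j = i then 1[K] else 0[K]) e = (\<Oplus>[V]j:I. if j = i then e j else 0[V])"
  unfolding lc_def by (rule M.finsum_cong') (use assms in "auto simp: smult_l_null dest: Pi_mem")
 also have "... = e i" by (rule M.finsum_delta) (use assms in auto)
 finally show ?thesis .
qed

lemma lc_zero: "e:I->.V==>(!!i. i:I==>f i = 0[K])==>lc V I f e = 0[V]"
 unfolding lc_def by (rule M.finsum_all_zero) (auto simp: Pi_iff smult_l_null)

lemma indep_family_unique:
 assumes "indep_family K V I e" "f:I->.K" "g:I->.K" "lc V I f e = lc V I g e" "i:I"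
 shows "f i = g i"
proof -
 have e: "e:I->.V" using assms(1) by (simp add: indep_family_def)
 let ?h = "%i. f i+[K](\<ominus>\<^bsub>K\<^esub> 1[K])*[K]g i"
 have gm: "(%i. (\<ominus>\<^bsub>K\<^esub> 1[K])*[K]g i):I->.K" using assms(3) by auto
 have "lc V I ?h e = lc V I f e+[V](\<ominus>\<^bsub>K\<^esub> 1[K])*.[V]lc V I g e"
  using lc_add[OF e assms(2) gm] lc_smult[OF e assms(3),of "\<ominus>\<^bsub>K\<^esub> 1[K]"] by simp
 also have "... = 0[V]"
  using lc_closed[OF e assms(2)] lc_closed[OF e assms(3)] assms(4)
  by (simp only: smult_minus_one M.r_neg)
 finally have "lc V I ?h e = 0[V]" .
 moreover have "?h:I->.K" using assms(2,3) by auto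
 ultimately have "?h i = 0[K]" using assms(1,5) unfolding indep_family_def by blast
 then show ?thesis using assms(2,3,5)
  by (metis PiE R.l_minus R.l_one R.minus_equality R.add.inv_inv R.add.inv_closed R.one_closed R.a_comm)
qed

lemma coord_props:
 assumes "basis_family K V I e" "x:.V"
 shows "coord K V I e x:I \<rightarrow>\<^sub>E carrier K" "lc V I (coord K V I e x) e = x"
proof -
 obtain f where f: "f:I->.K" "x = lc V I f e" and e: "e:I->.V"
  using assms unfolding basis_family_def span_family_def by blast
 have "restrict f I:I \<rightarrow>\<^sub>E carrier K & x = lc V I (restrict f I) e"
  using f e by (auto intro!: lc_cong)
 from someI[of "%f. f:I \<rightarrow>\<^sub>E carrier K & x = lc V I f e", OF this]
 show "coord K V I e x:I \<rightarrow>\<^sub>E carrier K" "lc V I (coord K V I e x) e = x"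
  unfolding coord_def by auto
qed

lemma coord_Pi: "basis_family K V I e==>x:.V==>coord K V I e x:I->.K"
 using coord_props(1) by (auto simp: PiE_iff)

lemma coord_closed: "basis_family K V I e==>x:.V==>i:I==>coord K V I e x i:.K"
 using coord_Pi by blast

lemma coord_lc:
 assumes "basis_family K V I e" "f:I->.K" "i:I"
 shows "coord K V I e (lc V I f e) i = f i"
proof -
 have e: "e:I->.V" and ind: "indep_family K V I e" using assms(1) by (auto simp: basis_family_def indep_family_def)
 show ?thesis
  by (rule indep_family_unique[OF ind coord_Pi[OF assms(1) lc_closed[OF e assms(2)]] assms(2)
     coord_props(2)[OF assms(1) lc_closed[OF e assms(2)]] assms(3)])
qed

lemma coord_basis:
 assumes "basis_family K V I e" "i:I" "j:I"
 shows "coord K V I e (e i) j = (if j = i then 1[K] else 0[K])"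
proof -
 have "e i = lc V I (%j. if j = i then 1[K] else 0[K]) e"
  using assms by (intro lc_delta[symmetric]) (auto simp: basis_family_def indep_family_def)
 then show ?thesis using coord_lc[OF assms(1) _ assms(3),of "%j. if j = i then 1[K] else 0[K]"] by auto
qed

lemma coord_add:
 assumes B: "basis_family K V I e" and x: "x:.V" and y: "y:.V" and i: "i:I"
 shows "coord K V I e (x+[V]y) i = coord K V I e x i+[K]coord K V I e y i"
proof -
 have e: "e:I->.V" using B by (simp add: basis_familyD)
 note cx = coord_Pi[OF B x] and cy = coord_Pi[OF B y]
 have "x+[V]y = lc V I (%i. coord K V I e x i+[K]coord K V I e y i) e"
  using lc_add[OF e cx cy] coord_props(2)[OF B x] coord_props(2)[OF B y] by simp
 then show ?thesis
  using coord_lc[OF B _ i,of "%i. coord K V I e x i+[K]coord K V I e y i"] cx cy by (auto simp: Pi_iff)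
qed

lemma coord_smult:
 assumes B: "basis_family K V I e" and x: "x:.V" and k: "k:.K" and i: "i:I"
 shows "coord K V I e (k*.[V]x) i = k*[K]coord K V I e x i"
proof -
 have e: "e:I->.V" using B by (simp add: basis_familyD)
 note cx = coord_Pi[OF B x]
 have "k*.[V]x = lc V I (%i. k*[K]coord K V I e x i) e"
  using lc_smult[OF e cx k] coord_props(2)[OF B x] by simp
 then show ?thesis
  using coord_lc[OF B _ i,of "%i. k*[K]coord K V I e x i"] cx k by (auto simp: Pi_iff)
qed

lemma coord_eqI:
 assumes B: "basis_family K V I e" and x: "x:.V" and y: "y:.V"
  and "!!i. i:I==>coord K V I e x i = coord K V I e y i"
 shows "x = y"
proof -
 have e: "e:I->.V" using B by (simp add: basis_familyD)
 have "lc V I (coord K V I e x) e = lc V I (coord K V I e y) e"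
  by (rule lc_cong[OF e coord_Pi[OF B x]]) (use assms in auto)
 then show ?thesis using coord_props(2) B x y by metis
qed

text \<open>The bridge to bases as sets of vectors: an independent family has no repetitions, so it
  may be replaced by its image when the dimension theory of vector spaces is applied.\<close>

lemma indep_family_inj:
 assumes "indep_family K V I e"
 shows "inj_on e I"
proof (rule inj_onI,rule ccontr)
 fix i j assume ij: "i:I" "j:I" "e i = e j" "i ~= j"
 have e: "finite I" "e:I->.V" using assms by (auto simp: indep_family_def)
 have "lc V I (%l. if l = i then 1[K] else 0[K]) e = lc V I (%l. if l = j then 1[K] else 0[K]) e"
  using lc_delta[OF e] ij by simp
 from indep_family_unique[OF assms _ _ this ij(1)] ij(4) show False by auto
qed

lemma lincomb_image:
 assumes "inj_on e I" "e:I->.V" "a:e ` I->.K"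
 shows "lincomb a (e ` I) = lc V I (a \<circ> e) e"
 unfolding lincomb_def lc_def o_def
 by (rule M.finsum_reindex) (use assms in "auto simp: Pi_iff")

lemma indep_family_lin_indpt:
 assumes "indep_family K V I e"
 shows "lin_indpt (e ` I)"
proof (rule finite_lin_indpt2)
 have e: "finite I" "e:I->.V" using assms by (auto simp: indep_family_def)
 show "finite (e ` I)" "e ` I <= carrier V" using e by auto
 fix a assume a: "a:e ` I->.K" "lincomb a (e ` I) = 0[V]"
 then have "lc V I (a \<circ> e) e = 0[V]" using lincomb_image[OF indep_family_inj[OF assms] e(2)] by simp
 moreover have "a \<circ> e:I->.K" using a by auto
 ultimately show "ALL v:e ` I. a v = 0[K]" using assms unfolding indep_family_def by fastforce
qed

lemma lc_in_span:
 assumes "finite I" "e:I->.V" "f:I->.K"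
 shows "lc V I f e:span (e ` I)"
proof -
 have sub: "e ` I <= carrier V" using assms by auto
 have m: "k*.[V]x:span (e ` I)" if "k:.K" "x:span (e ` I)" for k x
  using span_is_submodule[OF sub] that by (auto simp: submodule_def)
 have "(\<Oplus>[V]i:J. f i*.[V]e i):span (e ` I)" if "finite J" "J <= I" for J
  using that
 proof (induction J rule: finite_induct)
  case empty then show ?case by (simp add: span_zero)
 next
  case (insert x F)
  have "f x*.[V]e x:span (e ` I)" using insert assms sub by (intro m span_mem) auto
  moreover have "(\<Oplus>[V]i:insert x F. f i*.[V]e i) = f x*.[V]e x+[V](\<Oplus>[V]i:F. f i*.[V]e i)"
   by (rule M.finsum_insert) (use insert assms in "auto simp: Pi_iff subset_iff")
  ultimately show ?case using span_add1[OF sub] insert by auto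
 qed
 then show ?thesis unfolding lc_def using assms(1) by auto
qed

lemma span_family_gen_set:
 assumes "span_family K V I e"
 shows "gen_set (e ` I)"
proof
 have e: "finite I" "e:I->.V" using assms by (auto simp: span_family_def)
 then have sub: "e ` I <= carrier V" by auto
 show "span (e ` I) <= carrier V" using span_closed[OF sub] by auto
 show "carrier V <= span (e ` I)" using assms lc_in_span[OF e] unfolding span_family_def by fastforce
qed

lemma basis_family_basis:
 assumes "basis_family K V I e"
 shows "basis (e ` I)"
proof -
 have i: "indep_family K V I e" and s: "span_family K V I e" using assms by (auto simp: basis_family_def)
 have "e ` I <= carrier V" using i by (auto simp: indep_family_def)
 then show ?thesis unfolding basis_def
  by (intro conjI indep_family_lin_indpt[OF i] span_family_gen_set[OF s])
qed

lemma basis_family_dim: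
 assumes "basis_family K V I e"
 shows "fin_dim" "dim = card I"
proof -
 have e: "finite I" "inj_on e I"
  using basis_familyD(1)[OF assms] indep_family_inj[of I e] assms by (simp_all add: basis_family_def)
 show "fin_dim" unfolding fin_dim_def using basis_family_basis[OF assms,unfolded basis_def] e(1) by blast
 show "dim = card I" using dim_basis[OF _ basis_family_basis[OF assms]] e by (simp add: card_image)
qed

lemma basis_family_of_basis:
 assumes "basis B" "finite B" "bij_betw e I B"
 shows "basis_family K V I e"
proof -
 have B: "B <= carrier V" "lin_indpt B" "gen_set B" using assms(1) unfolding basis_def by blast+
 have e: "finite I" "inj_on e I" "e ` I = B" "e:I->.V"
  using assms(2,3) B(1) by (auto simp: bij_betw_def dest: finite_imageD)
 let ?g = "inv_into I e"
 have lcB: "lc V I f e = lincomb (f \<circ> ?g) B" if "f:I->.K" for f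
 proof -
  have "lincomb (f \<circ> ?g) (e ` I) = lc V I (f \<circ> ?g \<circ> e) e"
   by (rule lincomb_image) (use e that in "auto simp: inv_into_f_f")
  also have "... = lc V I f e" by (rule lc_cong) (use e that in "auto simp: inv_into_f_f")
  finally show ?thesis using e by simp
 qed
 have "indep_family K V I e" unfolding indep_family_def
 proof (intro conjI ballI impI)
  fix f i assume f: "f:I->.K" "lc V I f e = 0[V]" "i:I"
  have "f \<circ> ?g:B \<rightarrow> {0[K]}"
   by (rule not_lindepD[OF B(2) assms(2) subset_refl]) (use f lcB e in "auto simp: inv_into_f_f")
  then have "(f \<circ> ?g) (e i) = 0[K]" using e f by blast
  then show "f i = 0[K]" using e f by (simp add: inv_into_f_f)
 qed (use e in auto)
 moreover have "span_family K V I e" unfolding span_family_def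
 proof (intro conjI ballI)
  fix x assume "x:.V"
  then obtain a where a: "a:B->.K" "lincomb a B = x"
   using finite_in_span[OF assms(2) B(1)] B(3) by blast
  have "x = lc V I (a \<circ> e) e" using a lincomb_image[OF e(2,4)] e(3) by metis
  moreover have "a \<circ> e:I->.K" using a e by auto
  ultimately show "EX f:I->.K. x = lc V I f e" by blast
 qed (use e in auto)
 ultimately show ?thesis by (simp add: basis_family_def)
qed

lemma basis_family_exists:
 assumes "fin_dim"
 shows "EX e. basis_family K V {..<dim} e"
proof -
 obtain B where B: "finite B" "basis B" using finite_basis_exists[OF assms] by blast
 then obtain e where "bij_betw e {..<card B} B" using ex_bij_betw_nat_finite by (auto simp: atLeast0LessThan)
 then show ?thesis using basis_family_of_basis[OF B(2,1)] dim_basis[OF B] by auto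
qed

lemma indep_family_card: "indep_family K V I e==>fin_dim==>card I <= dim"
 using li_le_dim(2)[of "e ` I"] indep_family_lin_indpt[of I e] indep_family_inj[of I e]
 by (simp add: card_image image_subset_iff) (simp add: indep_family_def Pi_iff)

lemma indep_family_basis:
 assumes "indep_family K V I e" "fin_dim" "card I = dim"
 shows "basis_family K V I e"
proof -
 have e: "finite I" "inj_on e I" "e ` I <= carrier V"
  using indep_family_inj[OF assms(1)] assms(1) by (auto simp: indep_family_def)
 have "basis (e ` I)"
  by (rule dim_li_is_basis[OF assms(2) _ e(3) indep_family_lin_indpt[OF assms(1)]])
    (use assms e in "auto simp: card_image")
 then show ?thesis using basis_family_of_basis e by (auto simp: bij_betw_def)
qed

text \<open>A generating set has at least \<open>dim\<close> elements, so the bound on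
  \<open>card I\<close> forces the family to be injective and its image to be a basis. A change of
  basis by an invertible matrix then only needs the spanning half.\<close>

lemma span_family_basis:
 assumes "span_family K V I e" "card I <= dim"
 shows "basis_family K V I e"
proof -
 have e: "finite I" "e ` I <= carrier V" using assms by (auto simp: span_family_def)
 have gen: "gen_set (e ` I)" by (rule span_family_gen_set[OF assms(1)])
 then have fd: "fin_dim" unfolding fin_dim_def using e by blast
 have "card (e ` I) <= card I" using e card_image_le by blast
 then have b: "basis (e ` I)"
  using dim_gen_is_basis[OF _ e(2) gen] e(1) assms(2) by simp
 then have "dim = card (e ` I)" using dim_basis e by blast
 then have "inj_on e I" using e assms(2) \<open>card (e ` I) <= card I\<close> by (intro eq_card_imp_inj_on) auto
 then show ?thesis using basis_family_of_basis[OF b] e by (auto simp: bij_betw_def)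
qed

end

section \<open>Linear maps\<close>

lemma module_homI:
 assumes "!!x. x:.M==>h x:.N"
  "!!x y. x:.M==>y:.M==>h (x+[M]y) = h x+[N]h y"
  "!!k x. k:.R==>x:.M==>h (k*.[M]x) = k*.[N]h x"
 shows "h:module_hom R M N"
 using assms by (auto simp: module_hom_def)

lemma module_homD:
 assumes "h:module_hom R M N"
 shows "!!x. x:.M==>h x:.N"
  "!!x y. x:.M==>y:.M==>h (x+[M]y) = h x+[N]h y"
  "!!k x. k:.R==>x:.M==>h (k*.[M]x) = k*.[N]h x"
 using assms by (auto simp: module_hom_def)

lemma module_hom_lc:
 assumes "vectorspace K V" "vectorspace K W" "h:module_hom K V W" "e:I->.V" "f:I->.K"
 shows "h (lc V I f e) = lc W I f (%i. h (e i))"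
proof -
 interpret V: vectorspace K V by fact
 interpret W: vectorspace K W by fact
 have "h (lc V I f e) = (\<Oplus>[W]i:I. h (f i*.[V]e i))" unfolding lc_def
  by (rule additive_finsum) (use module_homD[OF assms(3)] assms(4,5) in "auto intro: V.M.abelian_group_axioms W.M.abelian_group_axioms")
 also have "... = lc W I f (%i. h (e i))" unfolding lc_def
  by (rule W.M.finsum_cong') (use module_homD[OF assms(3)] assms(4,5) in "auto simp: Pi_iff")
 finally show ?thesis .
qed

lemma module_hom_eqI:
 assumes "vectorspace K V" "vectorspace K W" "h:module_hom K V W" "h':module_hom K V W"
  and B: "basis_family K V I e" and "!!i. i:I==>h (e i) = h' (e i)" and x: "x:.V"
 shows "h x = h' x"
proof -
 interpret V: vectorspace K V by fact
 interpret W: vectorspace K W by fact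
 have e: "e:I->.V" using B by (simp add: basis_familyD)
 note cx = V.coord_Pi[OF B x]
 have "h x = lc W I (coord K V I e x) (%i. h (e i))"
  using module_hom_lc[OF assms(1-3) e cx] V.coord_props(2)[OF B x] by simp
 also have "... = lc W I (coord K V I e x) (%i. h' (e i))"
  by (rule W.lc_cong) (use cx e assms(6) module_homD[OF assms(3)] in auto)
 also have "... = h' x"
  using module_hom_lc[OF assms(1,2,4) e cx] V.coord_props(2)[OF B x] by simp
 finally show ?thesis .
qed

lemma lin_ext:
 assumes "vectorspace K V" "vectorspace K W" and B: "basis_family K V I e" and f: "f:I->.W"
 shows "(%x. lc W I (coord K V I e x) f):module_hom K V W"
  and "!!i. i:I==>lc W I (coord K V I e (e i)) f = f i"
proof -
 interpret V: vectorspace K V by fact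
 interpret W: vectorspace K W by fact
 show "(%x. lc W I (coord K V I e x) f):module_hom K V W"
 proof (rule module_homI)
  fix x assume x: "x:.V"
  show "lc W I (coord K V I e x) f:.W" by (rule W.lc_closed[OF f V.coord_Pi[OF B x]])
  { fix y assume y: "y:.V"
   show "lc W I (coord K V I e (x+[V]y)) f = lc W I (coord K V I e x) f+[W]lc W I (coord K V I e y) f"
    unfolding W.lc_add[OF f V.coord_Pi[OF B x] V.coord_Pi[OF B y]]
    by (rule W.lc_cong[OF f V.coord_Pi[OF B]]) (use x y V.coord_add[OF B x y] in auto) }
  { fix k assume k: "k:.K"
   show "lc W I (coord K V I e (k*.[V]x)) f = k*.[W]lc W I (coord K V I e x) f"
    unfolding W.lc_smult[OF f V.coord_Pi[OF B x] k]
    by (rule W.lc_cong[OF f V.coord_Pi[OF B]]) (use x k V.coord_smult[OF B x k] in auto) }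
 qed
 fix i assume i: "i:I"
 have "lc W I (coord K V I e (e i)) f = lc W I (%j. if j = i then 1[K] else 0[K]) f"
  by (rule W.lc_cong[OF f V.coord_Pi[OF B]]) (use i basis_familyD(3)[OF B i] V.coord_basis[OF B i] in auto)
 then show "lc W I (coord K V I e (e i)) f = f i"
  using W.lc_delta[OF basis_familyD(1)[OF B] f i] by simp
qed

lemma basis_family_reindex:
 assumes "vectorspace K V" "basis_family K V J f" "bij_betw \<pi> I J"
 shows "basis_family K V I (%i. f (\<pi> i))"
proof -
 interpret V: vectorspace K V by fact
 have inj: "inj_on f J" using assms(2) by (intro V.indep_family_inj) (simp add: basis_family_def)
 have "bij_betw f J (f ` J)" using inj by (simp add: bij_betw_def)
 then have "bij_betw (f \<circ> \<pi>) I (f ` J)" using assms(3) bij_betw_trans by blast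
 then show ?thesis
  using V.basis_family_of_basis[OF V.basis_family_basis[OF assms(2)]] basis_familyD(1)[OF assms(2)] by (auto simp: o_def)
qed

lemma basis_family_hom:
 assumes "vectorspace K V" "vectorspace K W" "h:module_hom K V W" "bij_betw h (carrier V) (carrier W)"
  and B: "basis_family K V I e"
 shows "basis_family K W I (%i. h (e i))"
proof -
 interpret V: vectorspace K V by fact
 interpret W: vectorspace K W by fact
 have e: "finite I" "e:I->.V" using B by (auto simp: basis_familyD)
 have he: "(%i. h (e i)):I->.W" using module_homD(1)[OF assms(3)] e by auto
 have h0: "h 0[V] = 0[W]"
  by (rule additive_zero[OF V.M.abelian_group_axioms W.M.abelian_group_axioms]) (use module_homD[OF assms(3)] in auto)
 have "indep_family K W I (%i. h (e i))" unfolding indep_family_def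
 proof (intro conjI ballI impI)
  fix f i assume f: "f:I->.K" "lc W I f (%i. h (e i)) = 0[W]" "i:I"
  then have "h (lc V I f e) = h 0[V]" using module_hom_lc[OF assms(1-3) e(2) f(1)] h0 by simp
  then have "lc V I f e = 0[V]" using assms(4) V.lc_closed[OF e(2) f(1)] by (auto simp: bij_betw_def inj_on_def)
  then show "f i = 0[K]" using B f unfolding basis_family_def indep_family_def by blast
 qed (use e he in auto)
 moreover have "span_family K W I (%i. h (e i))" unfolding span_family_def
 proof (intro conjI ballI)
  fix y assume "y:.W"
  then obtain x where x: "x:.V" "y = h x" using assms(4) by (auto simp: bij_betw_def)
  then have "y = lc W I (coord K V I e x) (%i. h (e i))"
   using module_hom_lc[OF assms(1-3) e(2) V.coord_Pi[OF B x(1)]] V.coord_props(2)[OF B x(1)] by simp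
  then show "EX f:I->.K. y = lc W I f (%i. h (e i))" using V.coord_Pi[OF B x(1)] by blast
 qed (use e he in auto)
 ultimately show ?thesis by (simp add: basis_family_def)
qed

lemma lin_ext_bij:
 assumes "vectorspace K V" "vectorspace K W" and B: "basis_family K V I e" and C: "basis_family K W I f"
 shows "bij_betw (%x. lc W I (coord K V I e x) f) (carrier V) (carrier W)"
proof -
 interpret V: vectorspace K V by fact
 interpret W: vectorspace K W by fact
 have f: "f:I->.W" and e: "e:I->.V" using B C by (auto simp: basis_familyD)
 show ?thesis
 proof (rule bij_betw_byWitness[where f' = "%y. lc V I (coord K W I f y) e"])
  show "ALL x:carrier V. lc V I (coord K W I f (lc W I (coord K V I e x) f)) e = x"
  proof
   fix x assume x: "x:.V"
   have "lc V I (coord K W I f (lc W I (coord K V I e x) f)) e = lc V I (coord K V I e x) e"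
    by (rule V.lc_cong[OF e W.coord_Pi[OF C W.lc_closed[OF f V.coord_Pi[OF B x]]]])
     (use W.coord_lc[OF C V.coord_Pi[OF B x]] in auto)
   then show "lc V I (coord K W I f (lc W I (coord K V I e x) f)) e = x" using V.coord_props(2)[OF B x] by simp
  qed
  show "ALL x:carrier W. lc W I (coord K V I e (lc V I (coord K W I f x) e)) f = x"
  proof
   fix x assume x: "x:.W"
   have "lc W I (coord K V I e (lc V I (coord K W I f x) e)) f = lc W I (coord K W I f x) f"
    by (rule W.lc_cong[OF f V.coord_Pi[OF B V.lc_closed[OF e W.coord_Pi[OF C x]]]])
     (use V.coord_lc[OF B W.coord_Pi[OF C x]] in auto)
   then show "lc W I (coord K V I e (lc V I (coord K W I f x) e)) f = x" using W.coord_props(2)[OF C x] by simp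
  qed
 qed (use V.lc_closed[OF e W.coord_Pi[OF C]] W.lc_closed[OF f V.coord_Pi[OF B]] in auto)
qed

section \<open>Structure constants\<close>

text \<open>The value \<open>c i j k\<close> is the coefficient of \<open>e k\<close> in the product
  of \<open>e i\<close> and \<open>e j\<close>. The unit is not recorded: it is recovered from its
  uniqueness, or its coordinates are carried along separately.\<close>

definition has_sc ::
 "('a, 'm) ring_scheme=>('a, 'b, 'n) module_scheme=>'i set=>('i=>'b)=>('i=>'i=>'i=>'a)=>bool" where
 "has_sc K A I e c \<longleftrightarrow> basis_family K A I e & (ALL i:I. ALL j:I. c i j:I->.K) &
   (ALL i:I. ALL j:I. e i*[A]e j = lc A I (c i j) e)"

lemma has_scD:
 assumes "has_sc K A I e c"
 shows "basis_family K A I e" "finite I" "e:I->.A" "!!i j. i:I==>j:I==>c i j:I->.K"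
  "!!i j k. i:I==>j:I==>k:I==>c i j k:.K"
  "!!i j. i:I==>j:I==>e i*[A]e j = lc A I (c i j) e"
 using assms by (auto simp: has_sc_def basis_family_def indep_family_def Pi_iff)

context assoc_algebra
begin

lemma vs: "vectorspace K A" ..

lemma alg_ring: "ring A" ..

lemma left_mult_hom: "a:.A==>(%x. a*[A]x):module_hom K A A"
 by (rule module_homI) (auto simp: r_distr smult_mult_right)

lemma right_mult_hom: "a:.A==>(%x. x*[A]a):module_hom K A A"
 by (rule module_homI) (auto simp: l_distr smult_mult_left)

end

lemma module_hom_comp:
 "h:module_hom K A B==>g:module_hom K B C==>(%x. g (h x)):module_hom K A C"
 by (auto simp: module_hom_def Pi_iff)

text \<open>Bilinearity in two stages. With a basis element fixed on the right, both sides are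
  linear in the left factor; with an arbitrary left factor fixed, both are linear in the right
  one.\<close>

lemma module_hom_mult_on_basis:
 assumes A: "assoc_algebra K A" and B: "assoc_algebra K B" and e: "basis_family K A I e"
  and h: "h:module_hom K A B"
  and m: "!!i j. i:I==>j:I==>h (e i*[A]e j) = h (e i)*[B]h (e j)"
  and x: "x:.A" and y: "y:.A"
 shows "h (x*[A]y) = h x*[B]h y"
proof -
 interpret A: assoc_algebra K A by fact
 interpret B: assoc_algebra K B by fact
 note hD = module_homD[OF h] and eD = basis_familyD[OF e]
 have 1: "h (x*[A]e j) = h x*[B]h (e j)" if j: "j:I" for j
  by (rule module_hom_eqI[OF A.vs B.vs module_hom_comp[OF A.right_mult_hom h] module_hom_comp[OF h B.right_mult_hom] e])
   (use eD j hD m x in auto)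
 show ?thesis
  by (rule module_hom_eqI[OF A.vs B.vs module_hom_comp[OF A.left_mult_hom h] module_hom_comp[OF h B.left_mult_hom] e])
   (use hD x y 1 in auto)
qed

lemma iso_of_has_sc:
 assumes A: "assoc_algebra K A" and B: "assoc_algebra K B"
  and e: "has_sc K A I e c" and f: "has_sc K B I f c"
 obtains h where "h:ring_iso A B" "h:module_hom K A B" "!!i. i:I==>h (e i) = f i"
proof -
 interpret A: assoc_algebra K A by fact
 interpret B: assoc_algebra K B by fact
 note eD = has_scD[OF e] and fD = has_scD[OF f]
 define h where "h = (%x. lc B I (coord K A I e x) f)"
 have h: "h:module_hom K A B" and he: "!!i. i:I==>h (e i) = f i" and bij: "bij_betw h (carrier A) (carrier B)"
  unfolding h_def using lin_ext[OF A.vs B.vs eD(1) fD(3)] lin_ext_bij[OF A.vs B.vs eD(1) fD(1)] by auto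
 note hD = module_homD[OF h]
 have mult: "h (x*[A]y) = h x*[B]h y" if "x:.A" "y:.A" for x y
 proof (rule module_hom_mult_on_basis[OF A B eD(1) h _ that])
  fix i j assume ij: "i:I" "j:I"
  have "h (e i*[A]e j) = lc B I (c i j) (%i. h (e i))"
   using module_hom_lc[OF A.vs B.vs h eD(3) eD(4)[OF ij]] eD(6)[OF ij] by simp
  also have "... = lc B I (c i j) f"
   by (rule B.lc_cong) (use ij eD(3) eD(4)[OF ij] he hD(1) in "auto simp: he fD(3)[unfolded Pi_iff,rule_format]")
  finally show "h (e i*[A]e j) = h (e i)*[B]h (e j)" using fD(6)[OF ij] he ij by simp
 qed
 \<comment> \<open>The constants say nothing about the unit. By surjectivity \<open>1[B]\<close> is
   \<open>h u\<close>, and multiplying \<open>h 1[A]\<close> by it gives \<open>h u\<close>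
   back.\<close>
 have "h 1[A] = 1[B]"
 proof -
  obtain u where u: "u:.A" "h u = 1[B]" using bij_betw_imp_surj_on[OF bij] B.one_closed by (metis imageE)
  have "h 1[A] = h 1[A]*[B]h u" using u hD(1) by simp
  also have "... = h u" using mult[of "1[A]" u] u by simp
  finally show ?thesis using u by simp
 qed
 then have "h:ring_iso A B" using hD mult bij by (intro ring_iso_memI) (auto simp: bij_betw_def)
 then show ?thesis using that h he by blast
qed

lemma algebra_iso_iff: "algebra_iso K A B \<longleftrightarrow> (EX h. h:ring_iso A B & h:module_hom K A B)"
 unfolding algebra_iso_def module_hom_def by (auto simp: ring_iso_def ring_hom_def)

lemma algebra_iso_of_has_sc:
 assumes A: "assoc_algebra K A" and B: "assoc_algebra K B"
  and e: "has_sc K A I e c" and f: "has_sc K B I f c"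
 shows "algebra_iso K A B"
 using iso_of_has_sc[OF assms] unfolding algebra_iso_iff by blast

lemma algebra_iso_refl: "algebra_iso K A A"
 unfolding algebra_iso_def using ring_iso_set_refl[of A] by (intro bexI[of _ id]) auto

lemma algebra_iso_trans: "algebra_iso K A B==>algebra_iso K B C==>algebra_iso K A C"
 unfolding algebra_iso_iff
proof (elim exE conjE)
 fix h g assume *: "h:ring_iso A B" "h:module_hom K A B" "g:ring_iso B C" "g:module_hom K B C"
 have "g \<circ> h:ring_iso A C" by (rule ring_iso_set_trans[OF *(1,3)])
 moreover have "g \<circ> h:module_hom K A C" unfolding comp_def by (rule module_hom_comp[OF *(2,4)])
 ultimately show "EX h. h:ring_iso A C & h:module_hom K A C" by blast
qed

lemma algebra_iso_sym:
 assumes A: "assoc_algebra K A" and iso: "algebra_iso K A B"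
 shows "algebra_iso K B A"
proof -
 interpret A: assoc_algebra K A by fact
 obtain h where h: "h:ring_iso A B" "h:module_hom K A B" using iso by (auto simp: algebra_iso_iff)
 let ?g = "inv_into (carrier A) h"
 have bij: "bij_betw h (carrier A) (carrier B)" using h by (simp add: ring_iso_def)
 have g: "?g:ring_iso B A" by (rule ring_iso_set_sym[OF A.alg_ring h(1)])
 have "?g (k*.[B]y) = k*.[A]?g y" if ky: "k:.K" "y:.B" for k y
 proof -
  obtain x where x: "x:.A" "y = h x" using bij_betw_imp_surj_on[OF bij] ky(2) by (metis imageE)
  then show ?thesis using ky module_homD(3)[OF h(2),of k x] bij
   by (metis A.smult_closed bij_betw_inv_into_left)
 qed
 then show ?thesis using g unfolding algebra_iso_def by blast
qed

lemma has_sc_hom: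
 assumes A: "assoc_algebra K A" and B: "assoc_algebra K B" and e: "has_sc K A I e c"
  and h: "h:ring_iso A B" "h:module_hom K A B"
 shows "has_sc K B I (%i. h (e i)) c"
proof -
 interpret A: assoc_algebra K A by fact
 interpret B: assoc_algebra K B by fact
 note eD = has_scD[OF e]
 have bij: "bij_betw h (carrier A) (carrier B)" using h by (simp add: ring_iso_def)
 have "h (e i)*[B]h (e j) = lc B I (c i j) (%i. h (e i))" if ij: "i:I" "j:I" for i j
  using module_hom_lc[OF A.vs B.vs h(2) eD(3) eD(4)[OF ij]] eD(6)[OF ij] ring_iso_memE(2)[OF h(1),of "e i" "e j"] eD(3) ij
  by (simp add: Pi_iff)
 then show ?thesis using basis_family_hom[OF A.vs B.vs h(2) bij eD(1)] eD(4) by (auto simp: has_sc_def)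
qed

lemma has_sc_iso:
 assumes "assoc_algebra K A" "assoc_algebra K B" "has_sc K A I e c" "algebra_iso K A B"
 obtains f where "has_sc K B I f c"
proof -
 obtain h where "h:ring_iso A B" "h:module_hom K A B" using assms(4) unfolding algebra_iso_iff by blast
 from that[OF has_sc_hom[OF assms(1-3) this]] show ?thesis .
qed

lemma has_sc_reindex:
 assumes A: "assoc_algebra K A" and f: "has_sc K A J f d" and \<pi>: "bij_betw \<pi> I J"
 shows "has_sc K A I (%i. f (\<pi> i)) (%i j k. d (\<pi> i) (\<pi> j) (\<pi> k))"
proof -
 interpret A: assoc_algebra K A by fact
 note fD = has_scD[OF f]
 have \<pi>I: "!!i. i:I==>\<pi> i:J" using \<pi> by (auto simp: bij_betw_def)
 have "lc A I (%k. d i j (\<pi> k)) (%k. f (\<pi> k)) = lc A J (d i j) f" if "i:J" "j:J" for i j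
  unfolding lc_def by (rule A.M.finsum_bij[OF \<pi>]) (use fD(3,4) that in "auto simp: Pi_iff")
 then show ?thesis unfolding has_sc_def using basis_family_reindex[OF A.vs fD(1) \<pi>] fD \<pi>I by auto
qed

lemma has_sc_exists:
 assumes A: "assoc_algebra K A" and e: "basis_family K A I e"
 shows "has_sc K A I e (%i j. coord K A I e (e i*[A]e j))"
proof -
 interpret A: assoc_algebra K A by fact
 show ?thesis unfolding has_sc_def using e A.coord_Pi[OF e] A.coord_props(2)[OF e] basis_familyD[OF e] by auto
qed

lemma has_sc_cong:
 assumes "has_sc K A I e c" "!!i j k. i:I==>j:I==>k:I==>c i j k = c' i j k" "vectorspace K A"
 shows "has_sc K A I e c'"
proof -
 interpret vectorspace K A by fact
 note eD = has_scD[OF assms(1)]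
 have 1: "e i*[A]e j = lc A I (c' i j) e" if "i:I" "j:I" for i j
  unfolding eD(6)[OF that] by (rule lc_cong[OF eD(3) eD(4)[OF that]]) (simp_all add: assms(2) that)
 have 2: "c' i j:I->.K" if "i:I" "j:I" for i j
  using eD(5)[OF that] assms(2)[OF that] by simp
 show ?thesis unfolding has_sc_def by (intro conjI ballI eD(1) 1 2)
qed

section \<open>Monoid algebras\<close>

text \<open>The linear map on the free module that sends the basis element of \<open>g\<close> to
  \<open>\<phi> g\<close>, that is, its universal property. Computations in the monoid algebra go
  through this map rather than through convolution sums.\<close>

definition ext :: "('a, 'm) ring_scheme=>('a, 'b, 'n) module_scheme=>('g=>'b)=>('g=>'a)=>'b" where
 "ext K N \<phi> f = (\<Oplus>[N]y:{g. f g ~= 0[K]}. f y*.[N]\<phi> y)"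

lemma finsum_ring_with_smult [simp]: "finsum (ring_with_smult R s) = finsum R"
 by (intro HOL.ext) (simp add: finsum_def finprod_def ring_with_smult_def)

lemma ring_with_smult_sel [simp]:
 "carrier (ring_with_smult R s) = carrier R" "mult (ring_with_smult R s) = mult R"
 "one (ring_with_smult R s) = one R" "zero (ring_with_smult R s) = zero R"
 "add (ring_with_smult R s) = add R" "smult (ring_with_smult R s) = s"
 by (auto simp: ring_with_smult_def)

lemma ring_ring_with_smult: "ring R==>ring (ring_with_smult R s)"
 using ring.ring_iso_imp_img_ring[of R id "ring_with_smult R s"]
 by (simp add: ring_with_smult_def ring_iso_def ring_hom_def)

lemma assoc_algebraI:
 assumes "field K" "ring R"
  "!!k x. k:.K==>x:.R==>s k x:.R"
  "!!k l x. k:.K==>l:.K==>x:.R==>s (k+[K]l) x = s k x+[R]s l x"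
  "!!k x y. k:.K==>x:.R==>y:.R==>s k (x+[R]y) = s k x+[R]s k y"
  "!!k l x. k:.K==>l:.K==>x:.R==>s (k*[K]l) x = s k (s l x)"
  "!!x. x:.R==>s 1[K] x = x"
  "!!k x y. k:.K==>x:.R==>y:.R==>s k x*[R]y = s k (x*[R]y)"
  "!!k x y. k:.K==>x:.R==>y:.R==>x*[R]s k y = s k (x*[R]y)"
 shows "assoc_algebra K (ring_with_smult R s)"
proof -
 interpret F: field K by fact
 interpret R: ring "ring_with_smult R s" by (rule ring_ring_with_smult[OF assms(2)])
 have "module K (ring_with_smult R s)"
  by (rule moduleI[OF F.cring_axioms R.abelian_group_axioms]) (simp_all add: assms(3-7))
 then have "vectorspace K (ring_with_smult R s)" using assms(1) by (simp add: vectorspace_def)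
 then show ?thesis
  by (intro assoc_algebra.intro assoc_algebra_axioms.intro R.ring_axioms) (simp_all add: assms(8,9))
qed

lemma algebra_via_alg:
 assumes "field K" "cring L" "h:ring_hom K L"
 shows "assoc_algebra K (algebra_via L h)"
proof -
 interpret F: field K by fact
 interpret L: cring L by fact
 show ?thesis unfolding algebra_via_def
  by (rule assoc_algebraI[OF assms(1) L.ring_axioms])
   (simp_all add: ring_hom_closed[OF assms(3)] ring_hom_add[OF assms(3)] ring_hom_mult[OF assms(3)]
    ring_hom_one[OF assms(3)] L.l_distr L.r_distr L.m_assoc L.m_lcomm)
qed

locale monoid_alg = K: cring K + G: monoid G for K (structure) and G (structure)
begin

abbreviation "M \<equiv> monoid_algebra K G"
abbreviation "supp f \<equiv> {g. f g ~= 0[K]}"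

lemma M_sel: "zero M = (%x. 0[K])" "one M = basis_elt K 1[G]" "f+[M]h = (%x. f x+[K]h x)"
 "k*.[M]f = (%x. k*[K]f x)"
 by (auto simp: monoid_algebra_def)

lemma M_memI: "(!!g. g:.G==>f g:.K)==>(!!g. g \<notin> carrier G==>f g = 0[K]) ==>
  finite (supp f)==>f:.M"
 by (simp add: monoid_algebra_def)

lemma M_mem:
 assumes "f:.M"
 shows "f g:.K" "finite (supp f)" "supp f <= carrier G" "g \<notin> carrier G==>f g = 0[K]"
proof -
 have f: "!!g. g:.G==>f g:.K" "!!g. g \<notin> carrier G==>f g = 0[K]" "finite (supp f)"
  using assms by (simp_all add: monoid_algebra_def)
 show "f g:.K" using f(1,2)[of g] by (cases "g:.G") simp_all
 show "supp f <= carrier G" using f(2) by blast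
qed (use assms in "simp_all add: monoid_algebra_def")

lemma supp_in: "f:.M==>f g ~= 0[K]==>g:.G"
 using M_mem(4) by blast

lemma basis_elt_mem: "g:.G==>basis_elt K g:.M"
 by (rule M_memI) (auto simp: basis_elt_def)

lemma zero_mem: "zero M:.M" by (rule M_memI) (auto simp: M_sel)

lemma add_mem:
 assumes f: "f:.M" and h: "h:.M"
 shows "f+[M]h:.M"
 unfolding M_sel
proof (rule M_memI)
 have "supp (%x. f x+[K]h x) <= supp f \<union> supp h" by auto
 then show "finite (supp (%x. f x+[K]h x))"
  using M_mem(2)[OF f] M_mem(2)[OF h] finite_subset by blast
qed (simp_all add: M_mem[OF f] M_mem[OF h])

lemma smult_mem:
 assumes f: "f:.M" and k: "k:.K"
 shows "k*.[M]f:.M"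
 unfolding M_sel
proof (rule M_memI)
 have "supp (%x. k*[K]f x) <= supp f" using k by auto
 then show "finite (supp (%x. k*[K]f x))"
  using M_mem(2)[OF f] finite_subset by blast
qed (simp_all add: M_mem[OF f] k)

lemma M_abelian: "abelian_group M"
proof (rule abelian_groupI)
 fix f assume f: "f:.M"
 let ?n = "%x. \<ominus>\<^bsub>K\<^esub> f x"
 have "?n:.M"
 proof (rule M_memI)
  have "supp ?n <= supp f" by auto
  then show "finite (supp ?n)" using M_mem(2)[OF f] finite_subset by blast
 qed (simp_all add: M_mem[OF f])
 moreover have "?n+[M]f = zero M" by (simp add: M_sel M_mem(1)[OF f] K.l_neg)
 ultimately show "EX y:carrier M. y+[M]f = 0[M]" by blast
next
 show "!!x y. x:.M==>y:.M==>x+[M]y:.M" by (rule add_mem)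
 show "0[M]:.M" by (rule zero_mem)
qed (simp_all add: M_mem(1) M_sel K.a_ac)

end

locale monoid_alg_module = monoid_alg K G + N: module K N for K (structure) and G (structure) and N (structure)
begin

abbreviation "ex \<equiv> ext K N"

lemma ex_sup:
 assumes f: "f:.M" and S: "finite S" "supp f <= S" and \<phi>: "!!g. g:.G==>\<phi> g:.N"
 shows "ex \<phi> f = (\<Oplus>[N]y:S \<inter> carrier G. f y*.[N]\<phi> y)"
 unfolding ext_def
 by (rule N.M.finsum_superset) (use S M_mem[OF f] \<phi> in "auto simp: N.smult_l_null")

lemma ex_closed: "f:.M==>(!!g. g:.G==>\<phi> g:.N)==>ex \<phi> f:.N"
 unfolding ext_def using supp_in[of f] M_mem(1)[of f] by (intro N.M.finsum_closed) (auto intro!: N.smult_closed)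

lemma ex_cong:
 assumes "f:.M" "!!g. g:.G==>\<phi> g:.N" "!!g. g:.G==>\<phi> g = \<psi> g"
 shows "ex \<phi> f = ex \<psi> f"
 unfolding ext_def
proof (rule N.M.fcong)
 have *: "!!g. f g ~= 0[K]==>g:.G" using M_mem(3)[OF assms(1)] by auto
 have **: "!!g. g:.G==>\<psi> g:.N" using assms(2,3) by metis
 show "(%y. f y*.[N]\<psi> y):supp f->.N" using M_mem(1)[OF assms(1)] * ** by auto
 show "!!i. i:supp f==>f i*.[N]\<phi> i = f i*.[N]\<psi> i" using * assms(3) by auto
qed

lemma ex_add:
 assumes f: "f:.M" and h: "h:.M" and \<phi>: "!!g. g:.G==>\<phi> g:.N"
 shows "ex \<phi> (f+[M]h) = ex \<phi> f+[N]ex \<phi> h"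
proof -
 let ?S = "supp f \<union> supp h"
 have S: "finite ?S" using M_mem f h by auto
 have 1: "ex \<phi> f = (\<Oplus>[N]y:?S \<inter> carrier G. f y*.[N]\<phi> y)" by (rule ex_sup[OF f S]) (use \<phi> in auto)
 have 2: "ex \<phi> h = (\<Oplus>[N]y:?S \<inter> carrier G. h y*.[N]\<phi> y)" by (rule ex_sup[OF h S]) (use \<phi> in auto)
 have 3: "ex \<phi> (f+[M]h) = (\<Oplus>[N]y:?S \<inter> carrier G. (f+[M]h) y*.[N]\<phi> y)"
  by (rule ex_sup[OF add_mem[OF f h] S]) (use \<phi> M_mem[OF f] in "auto simp: M_sel")
 show ?thesis unfolding 1 2 3
  by (rule trans[OF N.M.finsum_cong' N.M.finsum_addf])
   (use M_mem(1)[OF f] M_mem(1)[OF h] \<phi> in "auto simp: M_sel N.smult_l_distr")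
qed

lemma ex_smult:
 assumes f: "f:.M" and k: "k:.K" and \<phi>: "!!g. g:.G==>\<phi> g:.N"
 shows "ex \<phi> (k*.[M]f) = k*.[N]ex \<phi> f"
proof -
 have S: "finite (supp f)" using M_mem f by auto
 have 1: "ex \<phi> f = (\<Oplus>[N]y:supp f \<inter> carrier G. f y*.[N]\<phi> y)" by (rule ex_sup[OF f S]) (use \<phi> in auto)
 have 3: "ex \<phi> (k*.[M]f) = (\<Oplus>[N]y:supp f \<inter> carrier G. (k*.[M]f) y*.[N]\<phi> y)"
  by (rule ex_sup[OF smult_mem[OF f k] S]) (use \<phi> M_mem[OF f] k in "auto simp: M_sel")
 have "k*.[N]ex \<phi> f = (\<Oplus>[N]y:supp f \<inter> carrier G. k*.[N](f y*.[N]\<phi> y))" unfolding 1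
  by (rule N.smult_finsum[OF k]) (use M_mem(1)[OF f] \<phi> in auto)
 also have "... = ex \<phi> (k*.[M]f)" unfolding 3
  by (rule N.M.finsum_cong') (use M_mem(1)[OF f] k \<phi> in "auto simp: M_sel N.smult_assoc1")
 finally show ?thesis by simp
qed

lemma ex_add2:
 assumes f: "f:.M" and \<phi>: "!!g. g:.G==>\<phi> g:.N" "!!g. g:.G==>\<psi> g:.N"
 shows "ex (%g. \<phi> g+[N]\<psi> g) f = ex \<phi> f+[N]ex \<psi> f"
proof -
 have S: "!!g. f g ~= 0[K]==>g:.G" using M_mem[OF f] by auto
 show ?thesis unfolding ext_def
  by (rule trans[OF N.M.finsum_cong' N.M.finsum_addf])
   (use M_mem(1)[OF f] \<phi> S in "auto simp: N.smult_r_distr")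
qed

lemma ex_smult2:
 assumes f: "f:.M" and k: "k:.K" and \<phi>: "!!g. g:.G==>\<phi> g:.N"
 shows "ex (%g. k*.[N]\<phi> g) f = k*.[N]ex \<phi> f"
proof -
 have S: "!!g. f g ~= 0[K]==>g:.G" using M_mem[OF f] by auto
 have "k*.[N]ex \<phi> f = (\<Oplus>[N]y:supp f. k*.[N](f y*.[N]\<phi> y))" unfolding ext_def
  by (rule N.smult_finsum[OF k]) (use M_mem(1)[OF f] \<phi> S in auto)
 also have "... = ex (%g. k*.[N]\<phi> g) f" unfolding ext_def
  by (rule N.M.finsum_cong') (use M_mem(1)[OF f] k \<phi> S in "auto simp: N.smult_assoc1[symmetric] K.m_comm")
 finally show ?thesis by simp
qed

lemma ex_basis:
 assumes "g:.G" "\<phi> g:.N" "1[K] ~= 0[K]"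
 shows "ex \<phi> (basis_elt K g) = \<phi> g"
proof -
 have "supp (basis_elt K g) = {g}" using assms(3) by (auto simp: basis_elt_def)
 then show ?thesis unfolding ext_def using assms by (simp add: basis_elt_def)
qed

text \<open>A linear extension evaluated on a convolution product is an iterated extension over the
  two factors. This is the only place where the convolution sum is unfolded; associativity and the
  unit laws are read off from it.\<close>

lemma ex_mult:
 assumes f: "f:.M" and h: "h:.M" and \<phi>: "!!g. g:.G==>\<phi> g:.N"
 shows "f*[M]h:.M" "ex \<phi> (f*[M]h) = ex (%y. ex (%z. \<phi> (y*[G]z)) h) f"
proof -
 let ?S = "supp f" and ?T = "supp h"
 \<comment> \<open>A finite set containing the support of the product, over which the extension may
   be summed instead.\<close>
 let ?U = "(%(y,z). y*[G]z) ` (?S \<times> ?T)"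
 have fin: "finite ?S" "finite ?T" "finite ?U" using M_mem f h by auto
 have fk: "!!y. f y:.K" and hk: "!!y. h y:.K" using M_mem f h by auto
 have ST: "!!y. y:?S==>y:.G" "!!y. y:?T==>y:.G" using supp_in f h by auto
 have UG: "?U <= carrier G" using ST by auto
 let ?w = "%x y z. if y*[G]z = x then f y*[K]h z else 0[K]"
 have wk: "!!x y z. ?w x y z:.K" using fk hk by auto
 have val: "(f*[M]h) x = (\<Oplus>[K]y:?S. \<Oplus>[K]z:?T. ?w x y z)" for x
  by (simp add: monoid_algebra_def)
 have valk: "(f*[M]h) x:.K" for x unfolding val using wk by (intro K.finsum_closed) auto
 have out: "(f*[M]h) x = 0[K]" if "x \<notin> ?U" for x unfolding val
  by (intro K.finsum_all_zero) (use that in auto)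
 show mem: "f*[M]h:.M"
 proof (rule M_memI[OF valk])
  fix g assume "g \<notin> carrier G" then show "(f*[M]h) g = 0[K]" using UG out by blast
 next
  have "supp (f*[M]h) <= ?U" using out by blast
  then show "finite (supp (f*[M]h))" using fin(3) finite_subset by blast
 qed
 have "ex \<phi> (f*[M]h) = (\<Oplus>[N]x:?U \<inter> carrier G. (f*[M]h) x*.[N]\<phi> x)"
  by (rule ex_sup[OF mem fin(3)]) (use out \<phi> in blast)+
 also have "?U \<inter> carrier G = ?U" using UG by blast
 also have "(\<Oplus>[N]x:?U. (f*[M]h) x*.[N]\<phi> x) =
   (\<Oplus>[N]x:?U. \<Oplus>[N]y:?S. \<Oplus>[N]z:?T. ?w x y z*.[N]\<phi> x)"
 proof (rule N.M.fcong)
  show "(%x. \<Oplus>[N]y:?S. \<Oplus>[N]z:?T. ?w x y z*.[N]\<phi> x):?U->.N"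
   by (intro Pi_I N.M.finsum_closed N.smult_closed wk \<phi>) (use UG in blast)
  fix x assume "x:?U"
  then have x: "\<phi> x:.N" using UG \<phi> by blast
  have "(f*[M]h) x*.[N]\<phi> x = (\<Oplus>[N]y:?S. (\<Oplus>[K]z:?T. ?w x y z)*.[N]\<phi> x)"
   unfolding val by (rule N.finsum_smult[OF x]) (use wk in "intro K.finsum_closed,auto")
  also have "... = (\<Oplus>[N]y:?S. \<Oplus>[N]z:?T. ?w x y z*.[N]\<phi> x)"
  proof (rule N.M.fcong)
   show "(%y. \<Oplus>[N]z:?T. ?w x y z*.[N]\<phi> x):?S->.N"
    by (intro Pi_I N.M.finsum_closed N.smult_closed wk x)
   show "(\<Oplus>[K]z:?T. ?w x y z)*.[N]\<phi> x = (\<Oplus>[N]z:?T. ?w x y z*.[N]\<phi> x)" for y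
    by (rule N.finsum_smult[OF x wk])
  qed
  finally show "(f*[M]h) x*.[N]\<phi> x = (\<Oplus>[N]y:?S. \<Oplus>[N]z:?T. ?w x y z*.[N]\<phi> x)" .
 qed
 also have "... = (\<Oplus>[N]y:?S. \<Oplus>[N]x:?U. \<Oplus>[N]z:?T. ?w x y z*.[N]\<phi> x)"
  by (rule N.M.finsum_swap[OF fin(3,1)],rule N.M.finsum_closed,rule Pi_I,rule N.smult_closed[OF wk])
   (use UG \<phi> in blast)
 also have "... = (\<Oplus>[N]y:?S. f y*.[N]ex (%z. \<phi> (y*[G]z)) h)"
 proof (rule N.M.fcong)
  have exk: "ex (%z. \<phi> (y*[G]z)) h:.N" if "y:.G" for y
   by (rule ex_closed[OF h]) (use \<phi> that in auto)
  show "(%y. f y*.[N]ex (%z. \<phi> (y*[G]z)) h):?S->.N"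
   by (intro Pi_I N.smult_closed fk exk ST)
  fix y assume y: "y:?S"
  have "(\<Oplus>[N]x:?U. \<Oplus>[N]z:?T. ?w x y z*.[N]\<phi> x) = (\<Oplus>[N]z:?T. \<Oplus>[N]x:?U. ?w x y z*.[N]\<phi> x)"
   by (rule N.M.finsum_swap[OF fin(3,2)],rule N.smult_closed[OF wk]) (use UG \<phi> in blast)
  also have "... = (\<Oplus>[N]z:?T. f y*.[N](h z*.[N]\<phi> (y*[G]z)))"
  proof (rule N.M.fcong)
   have \<phi>yz: "\<phi> (y*[G]z):.N" if "z:?T" for z using ST y that \<phi> by auto
   show "(%z. f y*.[N](h z*.[N]\<phi> (y*[G]z))):?T->.N"
    by (intro Pi_I N.smult_closed fk hk \<phi>yz)
   fix z assume z: "z:?T"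
   have "(\<Oplus>[N]x:?U. ?w x y z*.[N]\<phi> x) =
    (\<Oplus>[N]x:?U. if x = y*[G]z then (f y*[K]h z)*.[N]\<phi> x else 0[N])"
    by (rule N.M.fcong) (use UG \<phi> fk hk \<phi>yz[OF z] in "auto simp: N.smult_l_null")
   also have "... = (f y*[K]h z)*.[N]\<phi> (y*[G]z)"
    by (rule N.M.finsum_delta[OF fin(3)]) (use y z fk hk \<phi>yz[OF z] in auto)
   also have "... = f y*.[N](h z*.[N]\<phi> (y*[G]z))"
    by (rule N.smult_assoc1[OF fk hk \<phi>yz[OF z]])
   finally show "(\<Oplus>[N]x:?U. ?w x y z*.[N]\<phi> x) = f y*.[N](h z*.[N]\<phi> (y*[G]z))" .
  qed
  also have "... = f y*.[N]ex (%z. \<phi> (y*[G]z)) h" unfolding ext_def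
   by (rule N.smult_finsum[symmetric,OF fk]) (use ST y \<phi> hk in auto)
  finally show "(\<Oplus>[N]x:?U. \<Oplus>[N]z:?T. ?w x y z*.[N]\<phi> x) = f y*.[N]ex (%z. \<phi> (y*[G]z)) h" .
 qed
 also have "... = ex (%y. ex (%z. \<phi> (y*[G]z)) h) f" by (simp add: ext_def[of K N _ f])
 finally show "ex \<phi> (f*[M]h) = ex (%y. ex (%z. \<phi> (y*[G]z)) h) f" .
qed

end

context monoid_alg
begin

text \<open>The coefficient ring as a module over itself. The coefficient of an element at
  \<open>x\<close> is the linear extension of the delta function at \<open>x\<close>, so identities
  between elements can be tested coefficientwise with \<open>ex_mult\<close>.\<close>

abbreviation "KK \<equiv> ring_with_smult K (%k x. k*[K]x)"

lemma KK_module: "module K KK"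
 by (rule moduleI)
  (auto simp: K.l_distr K.r_distr K.m_assoc intro!: K.cring_axioms ring.is_abelian_group ring_ring_with_smult K.ring_axioms)

interpretation KK: monoid_alg_module K G KK
 by (intro monoid_alg_module.intro monoid_alg_axioms KK_module)

abbreviation "dl x \<equiv> (%y. if y = x then 1[K] else 0[K])"

lemma ext_dl:
 assumes f: "f:.M"
 shows "ext K KK (dl x) f = f x"
proof (cases "f x = 0[K]")
 case True
 then show ?thesis unfolding ext_def
  by (simp,intro K.finsum_all_zero) (use M_mem(1)[OF f] in auto)
next
 case False
 have "ext K KK (dl x) f = (\<Oplus>[K]y:supp f. if y = x then f y else 0[K])"
  unfolding ext_def by (simp,rule K.fcong) (use M_mem(1)[OF f] in auto)
 also have "... = f x" by (rule K.finsum_delta) (use False M_mem[OF f] in auto)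
 finally show ?thesis .
qed

lemma mult_val:
 assumes f: "f:.M" and h: "h:.M"
 shows "(f*[M]h) x = ext K KK (%y. ext K KK (%z. dl x (y*[G]z)) h) f"
 using KK.ex_mult[OF f h,of "dl x"] ext_dl[of "f*[M]h" x] by simp

lemma mult_mem: "f:.M==>h:.M==>f*[M]h:.M"
 using KK.ex_mult(1)[of f h "%x. 0[K]"] by simp

lemma dl_closed: "dl x y:.KK" by simp

lemma ext_dl_closed: "h:.M==>ext K KK (%z. dl x (t z)) h:.KK"
 by (rule KK.ex_closed) auto

lemma M_ring:
 assumes nz: "1[K] ~= 0[K]"
 shows "ring M"
proof (rule ringI)
 show "abelian_group M" by (rule M_abelian)
 show "monoid M"
 proof (rule monoidI)
  show 1: "1[M]:.M" by (simp add: M_sel basis_elt_mem)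
  fix f assume f: "f:.M"
  { fix h assume h: "h:.M" show "f*[M]h:.M" by (rule mult_mem[OF f h]) 
   fix g assume g: "g:.M"
   show "f*[M]h*[M]g = f*[M](h*[M]g)"
   proof (rule HOL.ext)
    fix x
    have "(f*[M]h*[M]g) x = ext K KK (%u. ext K KK (%z. dl x (u*[G]z)) g) (f*[M]h)"
     by (rule mult_val[OF mult_mem[OF f h] g])
    also have "... = ext K KK (%y. ext K KK (%w. ext K KK (%z. dl x (y*[G]w*[G]z)) g) h) f"
     by (rule KK.ex_mult(2)[OF f h ext_dl_closed[OF g]])
    also have "... = ext K KK (%y. ext K KK (%v. dl x (y*[G]v)) (h*[M]g)) f"
    proof (rule KK.ex_cong[OF f])
     fix y assume y: "y:.G"
     show "ext K KK (%w. ext K KK (%z. dl x (y*[G]w*[G]z)) g) h:.KK"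
      by (rule KK.ex_closed[OF h ext_dl_closed[OF g]])
     have "ext K KK (%v. dl x (y*[G]v)) (h*[M]g) = ext K KK (%w. ext K KK (%z. dl x (y*[G](w*[G]z))) g) h"
      by (rule KK.ex_mult(2)[OF h g]) auto
     also have "... = ext K KK (%w. ext K KK (%z. dl x (y*[G]w*[G]z)) g) h"
      by (rule KK.ex_cong[OF h ext_dl_closed[OF g]],rule KK.ex_cong[OF g dl_closed]) (simp add: G.m_assoc y)
     finally show "ext K KK (%w. ext K KK (%z. dl x (y*[G]w*[G]z)) g) h = ext K KK (%v. dl x (y*[G]v)) (h*[M]g)" by simp
    qed
    also have "... = (f*[M](h*[M]g)) x" by (rule mult_val[OF f mult_mem[OF h g],symmetric])
    finally show "(f*[M]h*[M]g) x = (f*[M](h*[M]g)) x" .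
   qed }
  show "1[M]*[M]f = f"
  proof (rule HOL.ext)
   fix x
   have "(1[M]*[M]f) x = ext K KK (%z. dl x (1[G]*[G]z)) f"
    unfolding mult_val[OF 1 f] unfolding M_sel(2)
    by (rule KK.ex_basis[OF G.one_closed _ nz]) (rule ext_dl_closed[OF f])
   also have "... = ext K KK (dl x) f" by (rule KK.ex_cong[OF f]) auto
   finally show "(1[M]*[M]f) x = f x" using ext_dl[OF f] by simp
  qed
  show "f*[M]1[M] = f"
  proof (rule HOL.ext)
   fix x
   have "(f*[M]1[M]) x = ext K KK (dl x) f"
    unfolding mult_val[OF f 1]
   proof (rule KK.ex_cong[OF f ext_dl_closed[OF 1]])
    fix y assume y: "y:.G"
    show "ext K KK (%z. dl x (y*[G]z)) 1[M] = dl x y"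
     unfolding M_sel(2) by (subst KK.ex_basis) (use nz y in auto)
   qed
   then show "(f*[M]1[M]) x = f x" using ext_dl[OF f] by simp
  qed
 qed
next
 fix f h g assume fhg: "f:.M" "h:.M" "g:.M"
 show "(f+[M]h)*[M]g = f*[M]g+[M]h*[M]g"
 proof (rule HOL.ext)
  fix x
  show "((f+[M]h)*[M]g) x = (f*[M]g+[M]h*[M]g) x"
   unfolding mult_val[OF add_mem[OF fhg(1,2)] fhg(3)]
   using KK.ex_add[OF fhg(1,2) ext_dl_closed[OF fhg(3)]] by (simp add: M_sel(3) mult_val fhg)
 qed
 show "g*[M](f+[M]h) = g*[M]f+[M]g*[M]h"
 proof (rule HOL.ext)
  fix x
  have "(g*[M](f+[M]h)) x = ext K KK (%y. ext K KK (%z. dl x (y*[G]z)) f+[KK]ext K KK (%z. dl x (y*[G]z)) h) g"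
   unfolding mult_val[OF fhg(3) add_mem[OF fhg(1,2)]]
   by (rule KK.ex_cong[OF fhg(3) ext_dl_closed[OF add_mem[OF fhg(1,2)]]]) (rule KK.ex_add[OF fhg(1,2) dl_closed])
  also have "... = (g*[M]f) x+[K](g*[M]h) x"
   using KK.ex_add2[OF fhg(3) ext_dl_closed[OF fhg(1)] ext_dl_closed[OF fhg(2)]] by (simp add: mult_val fhg)
  finally show "(g*[M](f+[M]h)) x = (g*[M]f+[M]g*[M]h) x" by (simp add: M_sel(3))
 qed
qed

lemma smult_mult_l:
 assumes "f:.M" "h:.M" "k:.K"
 shows "(k*.[M]f)*[M]h = k*.[M](f*[M]h)"
proof (rule HOL.ext)
 fix x
 show "((k*.[M]f)*[M]h) x = (k*.[M](f*[M]h)) x"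
  unfolding mult_val[OF smult_mem[OF assms(1,3)] assms(2)]
  using KK.ex_smult[OF assms(1,3) ext_dl_closed[OF assms(2)]] by (simp add: M_sel(4) mult_val assms)
qed

lemma smult_mult_r:
 assumes "f:.M" "h:.M" "k:.K"
 shows "f*[M](k*.[M]h) = k*.[M](f*[M]h)"
proof (rule HOL.ext)
 fix x
 have "(f*[M](k*.[M]h)) x = ext K KK (%y. k*.[KK]ext K KK (%z. dl x (y*[G]z)) h) f"
  unfolding mult_val[OF assms(1) smult_mem[OF assms(2,3)]]
  by (rule KK.ex_cong[OF assms(1) ext_dl_closed[OF smult_mem[OF assms(2,3)]]]) (rule KK.ex_smult[OF assms(2,3) dl_closed])
 also have "... = (k*.[M](f*[M]h)) x"
  using KK.ex_smult2[OF assms(1,3) ext_dl_closed[OF assms(2)]] by (simp add: M_sel(4) mult_val assms)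
 finally show "(f*[M](k*.[M]h)) x = (k*.[M](f*[M]h)) x" .
qed

lemma basis_elt_mult:
 assumes "g:.G" "h:.G" "1[K] ~= 0[K]"
 shows "basis_elt K g*[M]basis_elt K h = basis_elt K (g*[G]h)"
proof (rule HOL.ext)
 fix x
 have "(basis_elt K g*[M]basis_elt K h) x = ext K KK (%z. dl x (g*[G]z)) (basis_elt K h)"
  unfolding mult_val[OF basis_elt_mem[OF assms(1)] basis_elt_mem[OF assms(2)]]
  by (rule KK.ex_basis[OF assms(1) _ assms(3)]) (rule ext_dl_closed[OF basis_elt_mem[OF assms(2)]])
 also have "... = dl x (g*[G]h)" by (rule KK.ex_basis[OF assms(2) _ assms(3)]) auto
 finally show "(basis_elt K g*[M]basis_elt K h) x = basis_elt K (g*[G]h) x" by (auto simp: basis_elt_def)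
qed

end

section \<open>The tensor product of two algebras\<close>

lemma additive_diff_zero:
 assumes G: "abelian_group G" and H: "abelian_group H" and h: "h:carrier G->.H"
  and add: "!!x y. x:.G==>y:.G==>h (x+[G]y) = h x+[H]h y"
  and xy: "x:.G" "y:.G"
 shows "h (x \<ominus>\<^bsub>G\<^esub> y) = 0[H] \<longleftrightarrow> h x = h y"
proof -
 interpret G: abelian_group G by fact
 interpret H: abelian_group H by fact
 have hc: "h x:.H" "h y:.H" "h (x \<ominus>\<^bsub>G\<^esub> y):.H" using h xy by auto
 have "h (x \<ominus>\<^bsub>G\<^esub> y)+[H]h y = h x"
  using add[of "x \<ominus>\<^bsub>G\<^esub> y" y] xy by (simp add: G.minus_eq G.a_assoc G.l_neg)
 then show ?thesis using hc by (metis H.l_zero H.add.r_cancel_one' H.add.l_cancel_one')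
qed

locale tensor = A: assoc_algebra K A + B: assoc_algebra K B
 for K :: "('a, 'm) ring_scheme" and A :: "('a, 'b, 'n) module_scheme" and B :: "('a, 'c, 'p) module_scheme"
begin

sublocale monoid_alg K "A \<times>\<times> B"
 by (intro monoid_alg.intro A.R.cring_axioms DirProd_monoid A.is_monoid B.is_monoid)

lemma nz: "1[K] ~= 0[K]" by (rule A.one_not_zero)

lemma tf: "tensor_free K A B = M" by (simp add: tensor_free_def)

abbreviation "J \<equiv> tensor_ideal K A B"
abbreviation "T \<equiv> tensor_algebra K A B"
abbreviation "\<iota> \<equiv> pure_tensor K A B"
abbreviation "el a b \<equiv> basis_elt K (a,b)"
abbreviation "q f \<equiv> J +>\<^bsub>M\<^esub> f"

lemma M_ring': "ring M" by (rule M_ring[OF nz])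

interpretation MR: ring M by (rule M_ring')

lemma G_mem: "p:.(A \<times>\<times> B) \<longleftrightarrow> fst p:.A & snd p:.B"
 by (simp add: mem_Times_iff)

lemma el_mem: "a:.A==>b:.B==>el a b:.M"
 by (rule basis_elt_mem) simp

lemma rel_sub: "tensor_relations K A B <= carrier M"
 unfolding tensor_relations_def Let_def tf
 by (auto intro!: MR.minus_closed MR.a_closed smult_mem el_mem)

lemma J_ideal: "ideal J M"
 unfolding tensor_ideal_def tf by (rule MR.genideal_ideal[OF rel_sub])

interpretation JI: ideal J M by (rule J_ideal)

lemma rel_J: "tensor_relations K A B <= J"
 unfolding tensor_ideal_def tf by (rule MR.genideal_self[OF rel_sub])

lemma q_hom: "q:ring_hom M (M Quot J)" using JI.rcos_ring_hom .

lemma T_carrier: "carrier T = q ` carrier M"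
 by (auto simp: tensor_algebra_def tf FactRing_def A_RCOSETS_def')

lemma q_eq: "f:.M==>h:.M==>q f = q h \<longleftrightarrow> f \<ominus>\<^bsub>M\<^esub> h:J"
 using MR.quotient_eq_iff_same_a_r_cos[OF J_ideal] by blast

lemma T_ops:
 "f:.M==>h:.M==>q f+[T]q h = q (f+[M]h)"
 "f:.M==>h:.M==>q f*[T]q h = q (f*[M]h)"
 "1[T] = q 1[M]" "0[T] = q 0[M]"
 using ring_hom_add[OF q_hom] ring_hom_mult[OF q_hom] ring_hom_one[OF q_hom]
  ring_hom_zero_ring[OF M_ring' JI.quotient_is_ring q_hom]
 by (simp_all add: tensor_algebra_def tf)

text \<open>Scalars act as multiples of the unit, so a two-sided ideal is a subspace. Scalar
  multiplication on cosets is well defined for this reason.\<close>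

lemma J_smult:
 assumes "f:J" "k:.K" shows "k*.[M]f:J"
proof -
 have f: "f:.M" using assms(1) JI.a_subset by blast
 have "k*.[M]f = (k*.[M]1[M])*[M]f" using smult_mult_l[OF _ f assms(2),of "1[M]"] f by simp
 then show ?thesis using JI.I_l_closed[OF assms(1) smult_mem[OF MR.one_closed assms(2)]] by simp
qed

lemma smult_add:
 assumes "f:.M" "h:.M" "k:.K"
 shows "k*.[M](f+[M]h) = k*.[M]f+[M]k*.[M]h"
 using assms by (simp add: M_sel M_mem(1) A.R.r_distr)

lemma q_smult_cong:
 assumes f: "f:.M" and h: "h:.M" and "q f = q h" and k: "k:.K"
 shows "q (k*.[M]f) = q (k*.[M]h)"
proof -
 have d: "f \<ominus>\<^bsub>M\<^esub> h:J" using q_eq[OF f h] assms(3) by simp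
 have "k*.[M](f \<ominus>\<^bsub>M\<^esub> h)+[M]k*.[M]h = k*.[M]f"
  using smult_add[OF MR.minus_closed[OF f h] h k] f h by (simp add: MR.minus_eq MR.a_assoc MR.l_neg)
 then have "k*.[M]f \<ominus>\<^bsub>M\<^esub> k*.[M]h = k*.[M](f \<ominus>\<^bsub>M\<^esub> h)"
  using smult_mem[OF f k] smult_mem[OF h k] smult_mem[OF MR.minus_closed[OF f h] k]
  by (metis MR.add.inv_solve_right MR.minus_eq)
 then show ?thesis using q_eq[OF smult_mem[OF f k] smult_mem[OF h k]] J_smult[OF d k] by simp
qed

lemma T_smult:
 assumes f: "f:.M" and k: "k:.K"
 shows "k*.[T]q f = q (k*.[M]f)"
proof -
 have eq: "k*.[T]q f = (\<Union>x\<in>q f. q (k*.[M]x))" by (simp add: tensor_algebra_def tf)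
 have sub: "q f <= carrier M" by (rule MR.a_r_coset_subset_G[OF JI.a_subset f])
 have "q (k*.[M]x) = q (k*.[M]f)" if x: "x:q f" for x
 proof (rule q_smult_cong[OF _ f _ k])
  show "x:.M" using sub x by blast
  show "q x = q f" by (rule MR.a_repr_independence[symmetric,OF x f JI.a_subgroup])
 qed
 moreover have "f:q f" by (rule JI.a_rcos_self[OF f])
 ultimately show ?thesis unfolding eq by blast
qed

lemma T_alg: "assoc_algebra K T"
proof -
 have R: "ring (M Quot J)" by (rule JI.quotient_is_ring)
 have ops: "add T = add (M Quot J)" "mult T = mult (M Quot J)" "carrier T = carrier (M Quot J)"
  by (simp_all add: tensor_algebra_def tf)
 have c: "!!x. x:.(M Quot J) \<longleftrightarrow> (EX f:carrier M. x = q f)" using T_carrier ops(3) by auto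
 have sm: "(\<Union>x\<in>q f. q (k*.[M]x)) = q (k*.[M]f)" if "f:.M" "k:.K" for f k
  using T_smult[OF that] by (simp add: tensor_algebra_def tf)
 note o1 = T_ops(1,2)[unfolded ops]
 show ?thesis unfolding tensor_algebra_def tf
 proof (rule assoc_algebraI[OF A.field_axioms R],unfold c,goal_cases)
  case (1 k x) then show ?case using sm smult_mem by blast
 next
  case (2 k l x)
  then obtain f where f: "f:.M" "x = q f" by blast
  have "(k+[K]l)*.[M]f = k*.[M]f+[M]l*.[M]f"
   using f 2 by (simp add: M_sel M_mem(1) A.R.l_distr)
  then show ?case using 2 f by (simp add: sm o1 smult_mem)
 next
  case (3 k x y)
  then obtain f h where f: "f:.M" "x = q f" and h: "h:.M" "y = q h" by blast
  show ?case unfolding f(2) h(2) o1(1)[OF f(1) h(1)] sm[OF f(1) 3(1)] sm[OF h(1) 3(1)] sm[OF add_mem[OF f(1) h(1)] 3(1)]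
   smult_add[OF f(1) h(1) 3(1)] by (rule o1(1)[symmetric,OF smult_mem[OF f(1) 3(1)] smult_mem[OF h(1) 3(1)]])
 next
  case (4 k l x)
  then obtain f where f: "f:.M" "x = q f" by blast
  have "(k*[K]l)*.[M]f = k*.[M](l*.[M]f)"
   using f 4 by (simp add: M_sel M_mem(1) A.R.m_assoc)
  then show ?case using 4 f by (simp add: sm smult_mem)
 next
  case (5 x)
  then obtain f where f: "f:.M" "x = q f" by blast
  have "1[K]*.[M]f = f" using f by (simp add: M_sel M_mem(1))
  then show ?case using f by (simp add: sm)
 next
  case (6 k x y)
  then obtain f h where f: "f:.M" "x = q f" and h: "h:.M" "y = q h" by blast
  show ?case unfolding f(2) h(2) o1(2)[OF f(1) h(1)] sm[OF f(1) 6(1)] sm[OF mult_mem[OF f(1) h(1)] 6(1)]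
   o1(2)[OF smult_mem[OF f(1) 6(1)] h(1)] smult_mult_l[OF f(1) h(1) 6(1)] by (rule refl)
 next
  case (7 k x y)
  then obtain f h where f: "f:.M" "x = q f" and h: "h:.M" "y = q h" by blast
  show ?case unfolding f(2) h(2) o1(2)[OF f(1) h(1)] sm[OF h(1) 7(1)] sm[OF mult_mem[OF f(1) h(1)] 7(1)]
   o1(2)[OF f(1) smult_mem[OF h(1) 7(1)]] smult_mult_r[OF f(1) h(1) 7(1)] by (rule refl)
 qed
qed

sublocale T: assoc_algebra K T by (rule T_alg)

lemma iota: "\<iota> a b = q (el a b)" by (simp add: pure_tensor_def tf)

lemma iota_closed: "a:.A==>b:.B==>\<iota> a b:.T"
 unfolding iota T_carrier using el_mem by blast

lemma iota_one: "\<iota> 1[A] 1[B] = 1[T]"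
 unfolding iota T_ops M_sel by (simp add: DirProd_def)

lemma iota_mult:
 assumes "a:.A" "b:.B" "a':.A" "b':.B"
 shows "\<iota> a b*[T]\<iota> a' b' = \<iota> (a*[A]a') (b*[B]b')"
 unfolding iota T_ops(2)[OF el_mem[OF assms(1,2)] el_mem[OF assms(3,4)]]
 using assms basis_elt_mult[of "(a,b)" "(a',b')"] nz by simp

lemma iota_add_left:
 assumes "a:.A" "a':.A" "b:.B"
 shows "\<iota> (a+[A]a') b = \<iota> a b+[T]\<iota> a' b"
proof -
 have "el (a+[A]a') b \<ominus>\<^bsub>M\<^esub> (el a b+[M]el a' b):tensor_relations K A B"
  unfolding tensor_relations_def Let_def tf using assms by blast
 then have "q (el (a+[A]a') b) = q (el a b+[M]el a' b)"
  using assms rel_J by (subst q_eq) (auto intro!: el_mem add_mem)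
 then show ?thesis unfolding iota using assms by (simp add: T_ops el_mem)
qed

lemma iota_add_right:
 assumes "a:.A" "b:.B" "b':.B"
 shows "\<iota> a (b+[B]b') = \<iota> a b+[T]\<iota> a b'"
proof -
 have "el a (b+[B]b') \<ominus>\<^bsub>M\<^esub> (el a b+[M]el a b'):tensor_relations K A B"
  unfolding tensor_relations_def Let_def tf using assms by blast
 then have "q (el a (b+[B]b')) = q (el a b+[M]el a b')"
  using assms rel_J by (subst q_eq) (auto intro!: el_mem add_mem)
 then show ?thesis unfolding iota using assms by (simp add: T_ops el_mem)
qed

lemma iota_smult_left:
 assumes "k:.K" "a:.A" "b:.B"
 shows "\<iota> (k*.[A]a) b = k*.[T]\<iota> a b"
proof -
 have "el (k*.[A]a) b \<ominus>\<^bsub>M\<^esub> (k*.[M]el a b):tensor_relations K A B"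
  unfolding tensor_relations_def Let_def tf using assms by blast
 then have "q (el (k*.[A]a) b) = q (k*.[M]el a b)"
  using assms rel_J by (subst q_eq) (auto intro!: el_mem smult_mem)
 then show ?thesis unfolding iota using assms by (simp add: T_smult el_mem)
qed

lemma iota_smult_right:
 assumes "k:.K" "a:.A" "b:.B"
 shows "\<iota> a (k*.[B]b) = k*.[T]\<iota> a b"
proof -
 have "el a (k*.[B]b) \<ominus>\<^bsub>M\<^esub> (k*.[M]el a b):tensor_relations K A B"
  unfolding tensor_relations_def Let_def tf using assms by blast
 then have "q (el a (k*.[B]b)) = q (k*.[M]el a b)"
  using assms rel_J by (subst q_eq) (auto intro!: el_mem smult_mem)
 then show ?thesis unfolding iota using assms by (simp add: T_smult el_mem)
qed

lemma iota_finsum_left: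
 assumes "b:.B" "!!i. i:I==>f i:.A"
 shows "\<iota> (\<Oplus>[A]i:I. f i) b = (\<Oplus>[T]i:I. \<iota> (f i) b)"
 using additive_finsum[of A T "%a. \<iota> a b" I f] assms iota_add_left iota_closed
 by (simp add: A.M.abelian_group_axioms T.M.abelian_group_axioms)

lemma iota_finsum_right:
 assumes "a:.A" "!!i. i:I==>f i:.B"
 shows "\<iota> a (\<Oplus>[B]i:I. f i) = (\<Oplus>[T]i:I. \<iota> a (f i))"
 using additive_finsum[of B T "%b. \<iota> a b" I f] assms iota_add_right iota_closed
 by (simp add: B.M.abelian_group_axioms T.M.abelian_group_axioms)

text \<open>Turns a coset into an explicit sum of pure tensors. The induction runs over a finite set
  containing the support, so that splitting off one point only has to keep the support of the rest
  inside a smaller set.\<close>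

lemma q_ext:
 assumes f: "f:.M"
 shows "q f = ext K T (%p. \<iota> (fst p) (snd p)) f"
proof -
 have *: "q h = ext K T (%p. \<iota> (fst p) (snd p)) h" if "finite S" "h:.M" "supp h <= S" for S h
  using that
 proof (induction S arbitrary: h rule: finite_induct)
  case empty
  then have "h = zero M" by (auto simp: M_sel)
  then show ?case by (simp add: ext_def T_ops(4) M_sel(1))
 next
  case (insert p S)
  interpret TM: monoid_alg_module K "A \<times>\<times> B" T
   by (intro monoid_alg_module.intro monoid_alg_axioms T.module_axioms)
  have io: "!!p. p:.(A \<times>\<times> B)==>\<iota> (fst p) (snd p):.T" by (auto simp: iota_closed)
  show ?case
  proof (cases "h p = 0[K]")
   case True
   then have "supp h <= S" using insert.prems by auto
   then show ?thesis using insert by blast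
  next
   case False
   then have p: "p:.(A \<times>\<times> B)" using supp_in insert.prems by blast
   have hp: "h p:.K" using insert.prems M_mem(1) by blast
   let ?u = "h p*.[M]basis_elt K p"
   let ?g = "%x. if x = p then 0[K] else h x"
   have um: "?u:.M" by (rule smult_mem[OF basis_elt_mem[OF p] hp])
   have "supp ?g <= supp h" by auto
   then have gm: "?g:.M" using M_mem[OF insert.prems(1)] finite_subset[of "supp ?g" "supp h"]
    by (intro M_memI) auto
   have hu: "h = ?u+[M]?g"
    using M_mem(1)[OF insert.prems(1)] by (auto simp: M_sel basis_elt_def fun_eq_iff)
   have "supp ?g <= S" using insert.prems by auto
   then have IH: "q ?g = ext K T (%p. \<iota> (fst p) (snd p)) ?g" using insert.IH gm by blast
   have "q h = q ?u+[T]q ?g" using T_ops(1)[OF um gm] hu by simp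
   also have "q ?u = h p*.[T]\<iota> (fst p) (snd p)"
    using T_smult[OF basis_elt_mem[OF p] hp] by (simp add: iota)
   also have "... = ext K T (%p. \<iota> (fst p) (snd p)) ?u"
    using TM.ex_smult[OF basis_elt_mem[OF p] hp io] TM.ex_basis[where \<phi> = "%p. \<iota> (fst p) (snd p)", OF p io[OF p] nz] by simp
   finally have "q h = ext K T (%p. \<iota> (fst p) (snd p)) ?u+[T]ext K T (%p. \<iota> (fst p) (snd p)) ?g"
    unfolding IH .
   also have "... = ext K T (%p. \<iota> (fst p) (snd p)) h"
    using TM.ex_add[OF um gm io] hu by simp
   finally show ?thesis .
  qed
 qed
 show ?thesis by (rule*[OF M_mem(2)[OF f] f subset_refl])
qed

end

section \<open>Linear independence in tensor products\<close>

locale tensor_basis = tensor K A B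
 for K :: "('a, 'm) ring_scheme" and A :: "('a, 'b, 'n) module_scheme" and B :: "('a, 'c, 'p) module_scheme" +
 fixes I :: "'i set" and e :: "'i=>'b"
 assumes e: "basis_family K A I e"
begin

interpretation MR: ring M by (rule M_ring')
interpretation BM: monoid_alg_module K "A \<times>\<times> B" B
 by (intro monoid_alg_module.intro monoid_alg_axioms B.module_axioms)
interpretation TM: monoid_alg_module K "A \<times>\<times> B" T
 by (intro monoid_alg_module.intro monoid_alg_axioms T.module_axioms)

abbreviation "co a i \<equiv> coord K A I e a i"

text \<open>Contraction with the i-th coordinate functional, a \<otimes> b \<mapsto> a_i b, on the
  basis elements of the free module; \<open>\<Psi> i\<close> is its linear extension. These maps
  supply the independence that a presentation by generators and relations leaves open.\<close>

definition "\<Phi> i p = co (fst p) i*.[B]snd p"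
definition "\<Psi> i f = ext K B (\<Phi> i) f"

lemma finI: "finite I" and ei: "i:I==>e i:.A"
 using basis_familyD[OF e] by auto

lemma Phi_closed: "i:I==>p:.(A \<times>\<times> B)==>\<Phi> i p:.B"
 by (auto simp: \<Phi>_def A.coord_closed[OF e])

lemma Psi_closed: "i:I==>f:.M==>\<Psi> i f:.B"
 unfolding \<Psi>_def by (rule BM.ex_closed[OF _ Phi_closed])

lemma Psi_add: "i:I==>f:.M==>h:.M==>\<Psi> i (f+[M]h) = \<Psi> i f+[B]\<Psi> i h"
 unfolding \<Psi>_def by (rule BM.ex_add[OF _ _ Phi_closed])

lemma Psi_smult: "i:I==>f:.M==>k:.K==>\<Psi> i (k*.[M]f) = k*.[B]\<Psi> i f"
 unfolding \<Psi>_def by (rule BM.ex_smult[OF _ _ Phi_closed])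

lemma Psi_el: "i:I==>a:.A==>b:.B==>\<Psi> i (el a b) = co a i*.[B]b"
 unfolding \<Psi>_def by (subst BM.ex_basis) (auto simp: nz Phi_closed \<Phi>_def A.coord_closed[OF e])

lemma Psi_minus: "i:I==>f:.M==>h:.M==>\<Psi> i (f \<ominus>\<^bsub>M\<^esub> h) = 0[B] \<longleftrightarrow> \<Psi> i f = \<Psi> i h"
 by (rule additive_diff_zero[OF M_abelian B.M.abelian_group_axioms]) (auto simp: Psi_closed Psi_add)

lemma ex_hom:
 assumes "h:module_hom K B B" "f:.M" "!!g. g:.(A \<times>\<times> B)==>\<phi> g:.B"
 shows "ext K B (%g. h (\<phi> g)) f = h (ext K B \<phi> f)"
 unfolding ext_def
proof -
 note hD = module_homD[OF assms(1)]
 have "h (\<Oplus>[B]y:supp f. f y*.[B]\<phi> y) = (\<Oplus>[B]y:supp f. h (f y*.[B]\<phi> y))"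
  by (rule additive_finsum[OF B.M.abelian_group_axioms B.M.abelian_group_axioms])
   (use hD(1,2) M_mem(1)[OF assms(2)] supp_in[OF assms(2)] assms(3) in auto)
 also have "... = (\<Oplus>[B]y:supp f. f y*.[B]h (\<phi> y))"
  by (rule B.M.fcong)
   (use hD(1,3) M_mem(1)[OF assms(2)] supp_in[OF assms(2)] assms(3) in auto)
 finally show "(\<Oplus>[B]y:supp f. f y*.[B]h (\<phi> y)) = h (\<Oplus>[B]y:supp f. f y*.[B]\<phi> y)" by simp
qed

lemma ex_fsum:
 assumes "f:.M" "!!j g. j:I==>g:.(A \<times>\<times> B)==>\<phi> j g:.B"
 shows "ext K B (%g. \<Oplus>[B]j:I. \<phi> j g) f = (\<Oplus>[B]j:I. ext K B (\<phi> j) f)"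
proof -
 have "ext K B (%g. \<Oplus>[B]j:I. \<phi> j g) f = (\<Oplus>[B]y:supp f. \<Oplus>[B]j:I. f y*.[B]\<phi> j y)" unfolding ext_def
  by (rule B.M.fcong)
   (use M_mem(1)[OF assms(1)] supp_in[OF assms(1)] assms(2) in "auto simp: B.smult_finsum intro!: B.M.finsum_closed")
 also have "... = (\<Oplus>[B]j:I. \<Oplus>[B]y:supp f. f y*.[B]\<phi> j y)"
  by (rule B.M.finsum_swap) (use M_mem(1,2)[OF assms(1)] supp_in[OF assms(1)] assms(2) finI in auto)
 finally show ?thesis by (simp add: ext_def)
qed

text \<open>The tensor ideal is a generated two-sided ideal, so vanishing of the contractions on the
  relations does not at once give vanishing on it. Their common kernel is shown to be an ideal
  containing the relations, and minimality does the rest.\<close>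

definition "JJ = {f:carrier M. ALL i:I. \<Psi> i f = 0[B]}"

lemma co_mult_left:
 assumes a: "a:.A" and x: "x:.A" and i: "i:I"
 shows "co (a*[A]x) i = (\<Oplus>[K]j:I. co x j*[K]co (a*[A]e j) i)"
  "co (x*[A]a) i = (\<Oplus>[K]j:I. co x j*[K]co (e j*[A]a) i)"
proof -
 have gen: "co (h x) i = (\<Oplus>[K]j:I. co x j*[K]co (h (e j)) i)" if h: "h:module_hom K A A" for h
 proof -
  have he: "(%j. h (e j)):I->.A" using module_homD(1)[OF h] ei by auto
  have "co (h x) i = co (lc A I (co x) (%j. h (e j))) i"
   using module_hom_lc[OF A.vs A.vs h basis_familyD(2)[OF e] A.coord_Pi[OF e x]] A.coord_props(2)[OF e x] by simp
  also have "... = (\<Oplus>[K]j:I. co (co x j*.[A]h (e j)) i)" unfolding lc_def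
   by (rule additive_finsum[of A K "%y. co y i", OF A.M.abelian_group_axioms A.R.abelian_group_axioms])
    (use A.coord_closed[OF e _ i] A.coord_add[OF e _ _ i] A.coord_closed[OF e x] he in auto)
  also have "... = (\<Oplus>[K]j:I. co x j*[K]co (h (e j)) i)"
   by (rule A.R.fcong)
    (use A.coord_closed[OF e _ i] A.coord_smult[OF e _ _ i] A.coord_closed[OF e x] he in "auto simp: Pi_iff")
  finally show ?thesis .
 qed
 show "co (a*[A]x) i = (\<Oplus>[K]j:I. co x j*[K]co (a*[A]e j) i)" by (rule gen[OF A.left_mult_hom[OF a]])
 show "co (x*[A]a) i = (\<Oplus>[K]j:I. co x j*[K]co (e j*[A]a) i)" by (rule gen[OF A.right_mult_hom[OF a]])
qed

text \<open>The coordinates of a product are linear in the coordinates of either factor. Hence a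
  contraction preceded by multiplication with (a, b) is a combination of all contractions, each
  followed by multiplication with b, and it vanishes wherever these do.\<close>

lemma ext_prod_JJ:
 assumes f: "f:JJ" and i: "i:I" and a: "a:.A" and b: "b:.B"
 shows "ext K B (%z. \<Phi> i ((a,b)*[A \<times>\<times> B]z)) f = 0[B]"
  "ext K B (%z. \<Phi> i (z*[A \<times>\<times> B](a,b))) f = 0[B]"
proof -
 have fm: "f:.M" and f0: "!!j. j:I==>ext K B (\<Phi> j) f = 0[B]" using f by (auto simp: JJ_def \<Psi>_def)
 have ci: "co y i:.K" if "y:.A" for y by (rule A.coord_closed[OF e that i])
 have gen: "ext K B \<phi> f = 0[B]"
  if h: "h:module_hom K B B" and w: "!!j. j:I==>w j:.K"
   and \<phi>: "!!z. z:.(A \<times>\<times> B)==>\<phi> z = (\<Oplus>[K]j:I. co (fst z) j*[K]w j)*.[B]h (snd z)" for h w \<phi>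
 proof -
  note hD = module_homD[OF h]
  have h0: "h 0[B] = 0[B]"
   by (rule additive_zero[OF B.M.abelian_group_axioms B.M.abelian_group_axioms]) (use hD in auto)
  have wh: "(%x. w j*.[B]h x):module_hom K B B" if "j:I" for j
   by (rule module_homI) (use that w hD in "auto simp: B.smult_r_distr B.smult_assoc1[symmetric] A.R.m_comm")
  have eq: "\<phi> z = (\<Oplus>[B]j:I. w j*.[B]h (\<Phi> j z))" if z: "z:.(A \<times>\<times> B)" for z
  proof -
   have cz: "!!j. j:I==>co (fst z) j:.K" and sz: "snd z:.B"
    using z A.coord_closed[OF e] by (auto simp: G_mem)
   have "\<phi> z = (\<Oplus>[B]j:I. (co (fst z) j*[K]w j)*.[B]h (snd z))"
    unfolding \<phi>[OF z] by (rule B.finsum_smult) (use cz sz hD(1) w in auto)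
   also have "... = (\<Oplus>[B]j:I. w j*.[B]h (\<Phi> j z))"
    by (rule B.M.fcong)
     (use cz sz hD w in "auto simp: \<Phi>_def B.smult_assoc1[symmetric] A.R.m_comm")
   finally show ?thesis .
  qed
  have \<phi>c: "\<phi> z:.B" if z: "z:.(A \<times>\<times> B)" for z
   unfolding eq[OF z] using w hD(1) Phi_closed z by (intro B.M.finsum_closed) auto
  have "ext K B \<phi> f = ext K B (%z. \<Oplus>[B]j:I. w j*.[B]h (\<Phi> j z)) f"
   by (rule BM.ex_cong[OF fm \<phi>c eq])
  also have "... = (\<Oplus>[B]j:I. ext K B (%z. w j*.[B]h (\<Phi> j z)) f)"
   by (rule ex_fsum[OF fm]) (use w hD(1) Phi_closed in auto)
  also have "... = 0[B]"
  proof (rule B.M.finsum_all_zero)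
   fix j assume j: "j:I"
   have "ext K B (%z. w j*.[B]h (\<Phi> j z)) f = w j*.[B]h (ext K B (\<Phi> j) f)"
    by (rule ex_hom[OF wh[OF j] fm Phi_closed[OF j]])
   then show "ext K B (%z. w j*.[B]h (\<Phi> j z)) f = 0[B]" using f0[OF j] h0 w[OF j] by simp
  qed
  finally show ?thesis .
 qed
 show "ext K B (%z. \<Phi> i ((a,b)*[A \<times>\<times> B]z)) f = 0[B]"
  by (rule gen[OF B.left_mult_hom[OF b],of "%j. co (a*[A]e j) i"])
   (rule ci,simp add: a ei,clarsimp simp: \<Phi>_def co_mult_left(1)[OF a _ i])
 show "ext K B (%z. \<Phi> i (z*[A \<times>\<times> B](a,b))) f = 0[B]"
  by (rule gen[OF B.right_mult_hom[OF b],of "%j. co (e j*[A]a) i"])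
   (rule ci,simp add: a ei,clarsimp simp: \<Phi>_def co_mult_left(2)[OF a _ i])
qed

lemma ext_zero_fun:
 assumes "f:.M" "!!y. y:.(A \<times>\<times> B)==>\<phi> y = 0[B]"
 shows "ext K B \<phi> f = 0[B]"
 unfolding ext_def
 by (rule B.M.finsum_all_zero) (use assms supp_in[OF assms(1)] M_mem(1)[OF assms(1)] in auto)

lemma ext_swap:
 assumes "f:.M" "h:.M"
  "!!y z. y:.(A \<times>\<times> B)==>z:.(A \<times>\<times> B)==>\<phi> y z:.B"
 shows "ext K B (%y. ext K B (\<phi> y) h) f = ext K B (%z. ext K B (%y. \<phi> y z) f) h"
proof -
 note fm = M_mem[OF assms(1)] and hm = M_mem[OF assms(2)]
 note fs = supp_in[OF assms(1)] and hs = supp_in[OF assms(2)]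
 have c: "f y*.[B](h z*.[B]\<phi> y z):.B" "h z*.[B]\<phi> y z:.B" if "y:supp f" "z:supp h" for y z
  using that fs hs assms(3) fm(1) hm(1) by blast+
 have "ext K B (%y. ext K B (\<phi> y) h) f = (\<Oplus>[B]y:supp f. \<Oplus>[B]z:supp h. f y*.[B](h z*.[B]\<phi> y z))" unfolding ext_def
  by (rule B.M.fcong,intro Pi_I B.M.finsum_closed c,assumption+) (rule B.smult_finsum[OF fm(1) c(2)])
 also have "... = (\<Oplus>[B]z:supp h. \<Oplus>[B]y:supp f. f y*.[B](h z*.[B]\<phi> y z))"
  by (rule B.M.finsum_swap[OF fm(2) hm(2)]) (use fm(1) hm(1) fs hs assms(3) in auto)
 also have "... = ext K B (%z. ext K B (%y. \<phi> y z) f) h" unfolding ext_def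
 proof (rule B.M.fcong)
  show "(%z. h z*.[B](\<Oplus>[B]y:supp f. f y*.[B]\<phi> y z)):supp h->.B"
   using fm(1) hm(1) fs hs assms(3) by (auto intro!: B.M.finsum_closed B.smult_closed)
  fix z assume z: "z:supp h"
  have "h z*.[B](\<Oplus>[B]y:supp f. f y*.[B]\<phi> y z) = (\<Oplus>[B]y:supp f. h z*.[B](f y*.[B]\<phi> y z))"
   by (rule B.smult_finsum[OF hm(1)]) (use fm(1) hs z fs assms(3) in auto)
  also have "... = (\<Oplus>[B]y:supp f. f y*.[B](h z*.[B]\<phi> y z))"
   by (rule B.M.fcong)
    (use fm(1) hm(1) hs z fs assms(3) in "auto simp: B.smult_assoc1[symmetric] A.R.m_comm")
  finally show "(\<Oplus>[B]y:supp f. f y*.[B](h z*.[B]\<phi> y z)) = h z*.[B](\<Oplus>[B]y:supp f. f y*.[B]\<phi> y z)" by simp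
 qed
 finally show ?thesis .
qed

lemma JJ_ideal: "ideal JJ M"
proof (rule idealI[OF M_ring'])
 have P0: "\<Psi> i 0[M] = 0[B]" if "i:I" for i
  by (rule additive_zero[OF M_abelian B.M.abelian_group_axioms]) (use that in "auto simp: Psi_closed Psi_add")
 show "subgroup JJ (add_monoid M)"
 proof (rule MR.add.subgroupI,goal_cases)
  case 1 show ?case by (auto simp: JJ_def)
 next
  case 2 have "0[M]:JJ" using P0 by (auto simp: JJ_def) then show ?case by blast
 next
  case (3 f)
  then have f: "f:.M" "!!i. i:I==>\<Psi> i f = 0[B]" by (auto simp: JJ_def)
  have "\<Psi> i (\<ominus>\<^bsub>M\<^esub> f) = 0[B]" if i: "i:I" for i
   using Psi_add[OF i f(1),of "\<ominus>\<^bsub>M\<^esub> f"] f i P0[OF i] Psi_closed[OF i,of "\<ominus>\<^bsub>M\<^esub> f"] by (simp add: MR.r_neg)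
  then show ?case using f by (auto simp: JJ_def a_inv_def[symmetric])
 next
  case (4 f h) then show ?case by (auto simp: JJ_def Psi_add)
 qed
 fix f x assume f: "f:JJ" and x: "x:.M"
 have fm: "f:.M" using f by (simp add: JJ_def)
 have "\<Psi> i (x*[M]f) = 0[B]" if i: "i:I" for i
  unfolding \<Psi>_def BM.ex_mult(2)[where \<phi> = "\<Phi> i", OF x fm Phi_closed[OF i],simplified]
  by (rule ext_zero_fun[OF x]) (use ext_prod_JJ(1)[OF f i] in auto)
 then show "x*[M]f:JJ" using mult_mem[OF x fm] by (simp add: JJ_def)
 have "\<Psi> i (f*[M]x) = 0[B]" if i: "i:I" for i
 proof -
  \<comment> \<open>The order of the two extensions is exchanged so that the inner one runs over
    \<open>f\<close>, where the vanishing is known.\<close>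
  have "\<Psi> i (f*[M]x) = ext K B (%z. ext K B (%y. \<Phi> i (y*[A \<times>\<times> B]z)) f) x"
   unfolding \<Psi>_def BM.ex_mult(2)[where \<phi> = "\<Phi> i", OF fm x Phi_closed[OF i],simplified]
   by (rule ext_swap[OF fm x]) (use Phi_closed[OF i] G.m_closed in auto)
  also have "... = 0[B]"
   by (rule ext_zero_fun[OF x]) (use ext_prod_JJ(2)[OF f i] in auto)
  finally show ?thesis .
 qed
 then show "f*[M]x:JJ" using mult_mem[OF fm x] by (simp add: JJ_def)
qed

lemma rel_JJ: "tensor_relations K A B <= JJ"
proof
 fix r assume "r:tensor_relations K A B"
 then obtain x y where r: "r = x \<ominus>\<^bsub>M\<^esub> y" "x:.M" "y:.M" "!!i. i:I==>\<Psi> i x = \<Psi> i y"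
  unfolding tensor_relations_def Let_def tf
 proof (elim UnE CollectE exE conjE,goal_cases)
  case (1 a a' b)
  then show ?case
   by (intro 1(1)[of "el (a+[A]a') b" "el a b+[M]el a' b"])
    (simp_all add: el_mem add_mem Psi_el Psi_add A.coord_add[OF e] B.smult_l_distr A.coord_closed[OF e])
 next
  case (2 a b b')
  then show ?case
   by (intro 2(1)[of "el a (b+[B]b')" "el a b+[M]el a b'"])
    (simp_all add: el_mem add_mem Psi_el Psi_add B.smult_r_distr A.coord_closed[OF e])
 next
  case (3 k a b)
  then show ?case
   by (intro 3(1)[of "el (k*.[A]a) b" "k*.[M]el a b"])
    (simp_all add: el_mem smult_mem Psi_el Psi_smult A.coord_smult[OF e] B.smult_assoc1 A.coord_closed[OF e])
 next
  case (4 k a b)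
  then show ?case
   by (intro 4(1)[of "el a (k*.[B]b)" "k*.[M]el a b"])
    (simp_all add: el_mem smult_mem Psi_el Psi_smult B.smult_assoc1[symmetric] A.R.m_comm A.coord_closed[OF e])
 qed
 then show "r:JJ" by (simp add: JJ_def Psi_minus)
qed

lemma J_JJ: "J <= JJ"
 unfolding tensor_ideal_def tf by (rule MR.genideal_minimal[OF JJ_ideal rel_JJ])

lemma iota_expand:
 assumes a: "a:.A" and b: "b:.B"
 shows "\<iota> a b = (\<Oplus>[T]i:I. \<iota> (e i) (co a i*.[B]b))"
proof -
 have "\<iota> a b = \<iota> (\<Oplus>[A]i:I. co a i*.[A]e i) b" using A.coord_props(2)[OF e a] by (simp add: lc_def)
 also have "... = (\<Oplus>[T]i:I. \<iota> (co a i*.[A]e i) b)"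
  by (rule iota_finsum_left[OF b]) (simp add: A.coord_closed[OF e a] ei)
 also have "... = (\<Oplus>[T]i:I. \<iota> (e i) (co a i*.[B]b))"
  by (rule T.M.fcong)
   (auto simp: A.coord_closed[OF e a] ei b iota_closed iota_smult_left iota_smult_right)
 finally show ?thesis .
qed

text \<open>Normal form \<Sum> e_i \<otimes> b_i with coefficients in \<open>B\<close>. Only
  \<open>A\<close> carries a finite basis here, so that \<open>B\<close> may be an extension field
  of infinite degree, as in base change.\<close>

lemma tensor_span:
 assumes z: "z:.T"
 obtains b where "!!i. i:I==>b i:.B" "z = (\<Oplus>[T]i:I. \<iota> (e i) (b i))"
proof -
 obtain f where f: "f:.M" "z = q f" using z T_carrier by auto
 have fk: "!!y. f y:.K" and fs: "!!y. y:supp f==>fst y:.A & snd y:.B"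
  using M_mem(1)[OF f(1)] supp_in[OF f(1)] by (auto simp: G_mem)
 have cb: "!!y i. y:supp f==>i:I==>co (fst y) i*.[B]snd y:.B"
  using fs A.coord_closed[OF e] by auto
 have "z = (\<Oplus>[T]y:supp f. f y*.[T]\<iota> (fst y) (snd y))" using q_ext[OF f(1)] f(2) by (simp add: ext_def)
 also have "... = (\<Oplus>[T]y:supp f. \<Oplus>[T]i:I. \<iota> (e i) (f y*.[B](co (fst y) i*.[B]snd y)))"
 proof (rule T.M.fcong)
  show "(%y. \<Oplus>[T]i:I. \<iota> (e i) (f y*.[B](co (fst y) i*.[B]snd y))):supp f->.T"
   by (intro Pi_I T.M.finsum_closed iota_closed ei B.smult_closed fk cb)
  fix y assume y: "y:supp f"
  have "f y*.[T]\<iota> (fst y) (snd y) = f y*.[T](\<Oplus>[T]i:I. \<iota> (e i) (co (fst y) i*.[B]snd y))"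
   using iota_expand fs[OF y] by simp
  also have "... = (\<Oplus>[T]i:I. f y*.[T]\<iota> (e i) (co (fst y) i*.[B]snd y))"
   by (rule T.smult_finsum[OF fk]) (simp add: iota_closed ei cb[OF y])
  also have "... = (\<Oplus>[T]i:I. \<iota> (e i) (f y*.[B](co (fst y) i*.[B]snd y)))"
   by (rule T.M.fcong) (simp_all add: iota_closed ei cb[OF y] fk iota_smult_right)
  finally show "f y*.[T]\<iota> (fst y) (snd y) = (\<Oplus>[T]i:I. \<iota> (e i) (f y*.[B](co (fst y) i*.[B]snd y)))" .
 qed
 also have "... = (\<Oplus>[T]i:I. \<Oplus>[T]y:supp f. \<iota> (e i) (f y*.[B](co (fst y) i*.[B]snd y)))"
  by (rule T.M.finsum_swap[OF M_mem(2)[OF f(1)] finI]) (intro iota_closed ei B.smult_closed fk cb)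
 also have "... = (\<Oplus>[T]i:I. \<iota> (e i) (\<Oplus>[B]y:supp f. f y*.[B](co (fst y) i*.[B]snd y)))"
 proof (rule T.M.fcong)
  show "(%i. \<iota> (e i) (\<Oplus>[B]y:supp f. f y*.[B](co (fst y) i*.[B]snd y))):I->.T"
   by (intro Pi_I iota_closed ei B.M.finsum_closed B.smult_closed fk cb)
  fix i assume i: "i:I"
  show "(\<Oplus>[T]y:supp f. \<iota> (e i) (f y*.[B](co (fst y) i*.[B]snd y))) = \<iota> (e i) (\<Oplus>[B]y:supp f. f y*.[B](co (fst y) i*.[B]snd y))"
   by (rule iota_finsum_right[symmetric,OF ei[OF i]]) (intro B.smult_closed fk cb i)
 qed
 finally have zz: "z = (\<Oplus>[T]i:I. \<iota> (e i) (\<Oplus>[B]y:supp f. f y*.[B](co (fst y) i*.[B]snd y)))" .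
 have cc: "(\<Oplus>[B]y:supp f. f y*.[B](co (fst y) i*.[B]snd y)):.B" if i: "i:I" for i
  using i by (intro B.M.finsum_closed Pi_I B.smult_closed fk cb)
 show ?thesis by (rule that[OF cc zz])
qed

text \<open>The obvious representative of the sum lies in the tensor ideal, hence in the common
  kernel of the contractions; but \<open>\<Psi> k\<close> returns exactly \<open>b k\<close> on
  it.\<close>

lemma tensor_indep:
 assumes b: "!!i. i:I==>b i:.B" and z: "(\<Oplus>[T]i:I. \<iota> (e i) (b i)) = 0[T]" and k: "k:I"
 shows "b k = 0[B]"
proof -
 let ?f = "\<Oplus>[M]i:I. el (e i) (b i)"
 have fm: "?f:.M" by (intro MR.finsum_closed Pi_I el_mem ei b)
 have "q ?f = (\<Oplus>[T]i:I. q (el (e i) (b i)))"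
  by (rule additive_finsum[OF M_abelian T.M.abelian_group_axioms])
   (auto simp: T_carrier T_ops el_mem ei b)
 then have "q ?f = q 0[M]" using z by (simp add: iota T_ops)
 then have "?f \<ominus>\<^bsub>M\<^esub> 0[M]:JJ" using q_eq[OF fm] J_JJ by auto
 then have "\<Psi> k ?f = \<Psi> k 0[M]" using Psi_minus[OF k fm MR.zero_closed] k by (simp add: JJ_def)
 also have "\<Psi> k 0[M] = 0[B]"
  by (rule additive_zero[OF M_abelian B.M.abelian_group_axioms]) (use k in "auto simp: Psi_closed Psi_add")
 finally have 0: "\<Psi> k ?f = 0[B]" .
 have "\<Psi> k ?f = (\<Oplus>[B]i:I. \<Psi> k (el (e i) (b i)))"
  by (rule additive_finsum[OF M_abelian B.M.abelian_group_axioms])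
   (use k in "auto simp: Psi_closed Psi_add el_mem ei b")
 also have "... = (\<Oplus>[B]i:I. if i = k then b i else 0[B])"
  by (rule B.M.fcong)
   (use k b in "auto simp: Psi_el ei A.coord_basis[OF e]")
 also have "... = b k" by (rule B.M.finsum_delta) (use finI k b in auto)
 finally show ?thesis using 0 by simp
qed

end

section \<open>Structure constants of the standard constructions\<close>

text \<open>Kronecker product of two systems of structure constants. It describes tensor products,
  matrix algebras (with \<open>mu\<close> as one factor) and the algebra of sandwich matrices (with
  the opposite constants as one factor).\<close>

definition kron :: "('a, 'm) ring_scheme=>('i=>'i=>'i=>'a)=>('j=>'j=>'j=>'a)
  =>'i \<times> 'j=>'i \<times> 'j=>'i \<times> 'j=>'a" where
 "kron K c d p q r = c (fst p) (fst q) (fst r)*[K]d (snd p) (snd q) (snd r)"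

context tensor_basis
begin

lemma tensor_lc:
 assumes f: "f:J'->.B" and J': "finite J'" and t: "t:I \<times> J'->.K"
 shows "lc T (I \<times> J') t (%p. \<iota> (e (fst p)) (f (snd p))) = (\<Oplus>[T]i:I. \<iota> (e i) (lc B J' (%j. t (i,j)) f))"
proof -
 have tk: "!!i j. i:I==>j:J'==>t (i,j):.K" and fk: "!!j. j:J'==>f j:.B" using t f by auto
 have "lc T (I \<times> J') t (%p. \<iota> (e (fst p)) (f (snd p))) = (\<Oplus>[T]i:I. \<Oplus>[T]j:J'. t (i,j)*.[T]\<iota> (e i) (f j))"
  unfolding lc_def by (subst T.M.finsum_Times[OF finI J']) (simp_all add: tk fk ei iota_closed)
 also have "... = (\<Oplus>[T]i:I. \<iota> (e i) (lc B J' (%j. t (i,j)) f))"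
 proof (rule T.M.fcong)
  show "(%i. \<iota> (e i) (lc B J' (%j. t (i,j)) f)):I->.T"
   using tk by (intro Pi_I iota_closed ei B.lc_closed[OF f]) auto
  fix i assume i: "i:I"
  have "(\<Oplus>[T]j:J'. t (i,j)*.[T]\<iota> (e i) (f j)) = (\<Oplus>[T]j:J'. \<iota> (e i) (t (i,j)*.[B]f j))"
   by (rule T.M.fcong) (simp_all add: tk[OF i] fk ei[OF i] iota_closed iota_smult_right)
  also have "... = \<iota> (e i) (lc B J' (%j. t (i,j)) f)" unfolding lc_def
   by (rule iota_finsum_right[symmetric,OF ei[OF i]]) (simp add: tk[OF i] fk)
  finally show "(\<Oplus>[T]j:J'. t (i,j)*.[T]\<iota> (e i) (f j)) = \<iota> (e i) (lc B J' (%j. t (i,j)) f)" .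
 qed
 finally show ?thesis .
qed

lemma tensor_basis_family:
 assumes f: "basis_family K B J' f"
 shows "basis_family K T (I \<times> J') (%p. \<iota> (e (fst p)) (f (snd p)))"
proof -
 note fD = basis_familyD[OF f]
 have mem: "(%p. \<iota> (e (fst p)) (f (snd p))):I \<times> J'->.T" using ei fD by (auto intro!: iota_closed)
 have "indep_family K T (I \<times> J') (%p. \<iota> (e (fst p)) (f (snd p)))" unfolding indep_family_def
 proof (intro conjI ballI impI)
  fix t p assume t: "t:I \<times> J'->.K" "lc T (I \<times> J') t (%p. \<iota> (e (fst p)) (f (snd p))) = 0[T]" "p:I \<times> J'"
  obtain i j where p: "p = (i,j)" "i:I" "j:J'" using t(3) by auto
  have tk: "!!i. i:I==>(%j. t (i,j)):J'->.K" using t(1) by auto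
  have "lc B J' (%j. t (i,j)) f = 0[B]"
   by (rule tensor_indep[of "%i. lc B J' (%j. t (i,j)) f", OF _ _ p(2)])
    (use t tensor_lc[OF fD(2,1) t(1)] B.lc_closed[OF fD(2) tk] in auto)
  then show "t p = 0[K]" using f tk[OF p(2)] p(1,3) unfolding basis_family_def indep_family_def by blast
 qed (use finI fD mem in auto)
 moreover have "span_family K T (I \<times> J') (%p. \<iota> (e (fst p)) (f (snd p)))" unfolding span_family_def
 proof (intro conjI ballI)
  fix z assume "z:.T"
  then obtain b where b: "!!i. i:I==>b i:.B" "z = (\<Oplus>[T]i:I. \<iota> (e i) (b i))" using tensor_span by blast
  define t where "t = (%p. coord K B J' f (b (fst p)) (snd p))"
  have t: "t:I \<times> J'->.K" using b(1) B.coord_closed[OF f] by (auto simp: t_def)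
  have "lc T (I \<times> J') t (%p. \<iota> (e (fst p)) (f (snd p))) = (\<Oplus>[T]i:I. \<iota> (e i) (lc B J' (%j. t (i,j)) f))"
   by (rule tensor_lc[OF fD(2,1) t])
  also have "... = z" unfolding b(2)
   by (rule T.M.fcong) (use b(1) B.coord_props(2)[OF f] ei in "auto simp: t_def intro!: iota_closed")
  finally show "EX t:I \<times> J'->.K. z = lc T (I \<times> J') t (%p. \<iota> (e (fst p)) (f (snd p)))" using t by blast
 qed (use finI fD mem in auto)
 ultimately show ?thesis by (simp add: basis_family_def)
qed

lemma iota_lc:
 assumes f: "f:J'->.B" "finite J'" and c: "c:I->.K" and d: "d:J'->.K"
 shows "\<iota> (lc A I c e) (lc B J' d f) = lc T (I \<times> J') (%p. c (fst p)*[K]d (snd p)) (%p. \<iota> (e (fst p)) (f (snd p)))"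
proof -
 let ?y = "lc B J' d f"
 have y: "?y:.B" by (rule B.lc_closed[OF f(1) d])
 have ck: "!!i. i:I==>c i:.K" and dk: "!!i. i:J'==>d i:.K" using c d by auto
 have t: "(%p. c (fst p)*[K]d (snd p)):I \<times> J'->.K" using ck dk by auto
 have "\<iota> (lc A I c e) ?y = (\<Oplus>[T]i:I. \<iota> (c i*.[A]e i) ?y)" unfolding lc_def[of A]
  by (rule iota_finsum_left[OF y]) (simp add: ck ei)
 also have "... = (\<Oplus>[T]i:I. \<iota> (e i) (lc B J' (%j. c i*[K]d j) f))"
 proof (rule T.M.fcong)
  show "(%i. \<iota> (e i) (lc B J' (%j. c i*[K]d j) f)):I->.T"
   using ck dk by (intro Pi_I iota_closed ei B.lc_closed[OF f(1)]) auto
  fix i assume i: "i:I"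
  show "\<iota> (c i*.[A]e i) ?y = \<iota> (e i) (lc B J' (%j. c i*[K]d j) f)"
   unfolding B.lc_smult[OF f(1) d ck[OF i],symmetric]
   by (simp only: iota_smult_left[OF ck[OF i] ei[OF i] y] iota_smult_right[OF ck[OF i] ei[OF i] y])
 qed
 finally show ?thesis unfolding tensor_lc[OF f t] by simp
qed

end

lemma has_sc_tensor:
 assumes A: "assoc_algebra K A" and B: "assoc_algebra K B" and e: "has_sc K A I e c" and f: "has_sc K B J f d"
 shows "has_sc K (tensor_algebra K A B) (I \<times> J) (%p. pure_tensor K A B (e (fst p)) (f (snd p))) (kron K c d)"
proof -
 note eD = has_scD[OF e] and fD = has_scD[OF f]
 interpret tensor_basis K A B I e
  by (intro tensor_basis.intro tensor.intro A B tensor_basis_axioms.intro eD(1))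
 show ?thesis unfolding has_sc_def
 proof (intro conjI ballI)
  show "basis_family K T (I \<times> J) (%p. \<iota> (e (fst p)) (f (snd p)))" by (rule tensor_basis_family[OF fD(1)])
  fix p q assume pq: "p:I \<times> J" "q:I \<times> J"
  then have pq': "fst p:I" "snd p:J" "fst q:I" "snd q:J" by auto
  show "kron K c d p q:I \<times> J->.K" using eD(5)[OF pq'(1,3)] fD(5)[OF pq'(2,4)] by (auto simp: kron_def)
  have fJ: "!!j. j:J==>f j:.B" using fD(3) by auto
  have "\<iota> (e (fst p)) (f (snd p))*[T]\<iota> (e (fst q)) (f (snd q)) =
    \<iota> (lc A I (c (fst p) (fst q)) e) (lc B J (d (snd p) (snd q)) f)"
   unfolding iota_mult[OF ei[OF pq'(1)] fJ[OF pq'(2)] ei[OF pq'(3)] fJ[OF pq'(4)]] eD(6)[OF pq'(1,3)] fD(6)[OF pq'(2,4)] ..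
  also have "... = lc T (I \<times> J) (kron K c d p q) (%p. \<iota> (e (fst p)) (f (snd p)))"
   unfolding iota_lc[OF fD(3,2) eD(4)[OF pq'(1,3)] fD(4)[OF pq'(2,4)]] by (simp add: kron_def[abs_def])
  finally show "\<iota> (e (fst p)) (f (snd p))*[T]\<iota> (e (fst q)) (f (snd q)) = lc T (I \<times> J) (kron K c d p q) (%p. \<iota> (e (fst p)) (f (snd p)))" .
 qed
qed

lemma tensor_alg:
 assumes "assoc_algebra K A" "assoc_algebra K B"
 shows "assoc_algebra K (tensor_algebra K A B)"
proof -
 interpret tensor K A B by (intro tensor.intro assms)
 show ?thesis by (rule T_alg)
qed

section \<open>Base change along a field homomorphism\<close>

locale field_hom = K: field K + L: field L for K :: "('a, 'm) ring_scheme" and L :: "('b, 'n) ring_scheme" +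
 fixes h assumes hom: "h:ring_hom K L"
begin

lemma hom_closed: "x:.K==>h x:.L" by (rule ring_hom_closed[OF hom])
lemma hom_zero: "h 0[K] = 0[L]" by (rule ring_hom_zero_ring[OF K.ring_axioms L.ring_axioms hom])
lemmas hom_add = ring_hom_add[OF hom] and hom_mult = ring_hom_mult[OF hom] and hom_one = ring_hom_one[OF hom]

lemma hom_eq_zero: assumes "x:.K" "h x = 0[L]" shows "x = 0[K]"
proof (rule ccontr)
 assume "x ~= 0[K]"
 then have "x:Units K" using assms(1) K.field_Units by auto
 then have "inv\<^bsub>K\<^esub> x:.K" "inv\<^bsub>K\<^esub> x*[K]x = 1[K]" by auto
 then have "h (inv\<^bsub>K\<^esub> x)*[L]0[L] = 1[L]" using hom_mult[of "inv\<^bsub>K\<^esub> x" x] assms hom_one by simp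
 then show False using hom_closed[OF \<open>inv\<^bsub>K\<^esub> x:.K\<close>] by simp
qed

lemma hom_inj: assumes "x:.K" "y:.K" "h x = h y" shows "x = y"
proof -
 have "h (x \<ominus>\<^bsub>K\<^esub> y) = 0[L]"
  by (subst additive_diff_zero[OF K.abelian_group_axioms L.abelian_group_axioms]) (use assms hom_closed hom_add in auto)
 then show ?thesis using hom_eq_zero[of "x \<ominus>\<^bsub>K\<^esub> y"] assms by simp
qed

lemma hom_finsum: "(!!i. i:I==>f i:.K)==>h (\<Oplus>[K]i:I. f i) = (\<Oplus>[L]i:I. h (f i))"
 by (rule ring_hom_finsum[OF K.ring_axioms L.ring_axioms hom])

end

lemma base_change_alg:
 assumes A: "assoc_algebra K A" and L: "field L" and h: "h:ring_hom K L"
 shows "assoc_algebra L (base_change K L h A)"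
proof -
 interpret A: assoc_algebra K A by fact
 interpret L: field L by fact
 interpret tensor K A "algebra_via L h"
  by (intro tensor.intro A algebra_via_alg A.field_axioms L.cring_axioms h)
 have c: "carrier (algebra_via L h) = carrier L" "1[algebra_via L h] = 1[L]" "mult (algebra_via L h) = mult L" "add (algebra_via L h) = add L"
  by (simp_all add: algebra_via_def)
 have io: "!!l. l:.L==>\<iota> 1[A] l:.T" by (rule iota_closed) (auto simp: c)
 \<comment> \<open>Scalars act by left multiplication with 1 \<otimes> l. Their compatibility with
   the right factor of a product requires these elements to be central, which is checked on pure
   tensors.\<close>
 have ioc: "\<iota> 1[A] l*[T]z = z*[T]\<iota> 1[A] l" if l: "l:.L" and z: "z:.T" for l z
 proof -
  obtain f where f: "f:.M" "z = q f" using z T_carrier by auto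
  have zz: "z = (\<Oplus>[T]y:supp f. f y*.[T]\<iota> (fst y) (snd y))" using q_ext[OF f(1)] f(2) by (simp add: ext_def)
  have fk: "!!y. f y:.K" by (rule M_mem(1)[OF f(1)])
  have fs: "!!y. y:supp f==>fst y:.A" "!!y. y:supp f==>snd y:.L"
   using supp_in[OF f(1)] by (auto simp: c)
  have it: "!!y. y:supp f==>\<iota> (fst y) (snd y):.T" by (rule iota_closed) (auto simp: c fs)
  have "\<iota> 1[A] l*[T]z = (\<Oplus>[T]y:supp f. \<iota> 1[A] l*[T](f y*.[T]\<iota> (fst y) (snd y)))"
   unfolding zz by (rule T.finsum_left[OF io[OF l]]) (simp add: fk it)
  also have "... = (\<Oplus>[T]y:supp f. (f y*.[T]\<iota> (fst y) (snd y))*[T]\<iota> 1[A] l)"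
  proof (rule T.M.fcong)
   show "(%y. (f y*.[T]\<iota> (fst y) (snd y))*[T]\<iota> 1[A] l):supp f->.T"
    by (intro Pi_I T.m_closed T.smult_closed fk it io l)
   fix y assume y: "y:supp f"
   have "\<iota> 1[A] l*[T]\<iota> (fst y) (snd y) = \<iota> (fst y) (snd y)*[T]\<iota> 1[A] l"
    using fs[OF y] l by (simp add: iota_mult c L.m_comm)
   then show "\<iota> 1[A] l*[T](f y*.[T]\<iota> (fst y) (snd y)) = (f y*.[T]\<iota> (fst y) (snd y))*[T]\<iota> 1[A] l"
    by (simp add: T.smult_mult_left[OF fk it[OF y] io[OF l]] T.smult_mult_right[OF fk io[OF l] it[OF y]])
  qed
  also have "... = z*[T]\<iota> 1[A] l"
   unfolding zz by (rule T.finsum_right[symmetric,OF io[OF l]]) (simp add: fk it)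
  finally show ?thesis .
 qed
 show ?thesis unfolding base_change_def
 proof (rule assoc_algebraI[OF L T.alg_ring],goal_cases)
  case (1 k x) then show ?case by (intro T.m_closed io)
 next
  case (2 k l x) then show ?case
   using iota_add_right[of "1[A]" k l] by (simp add: c io T.l_distr)
 next
  case (3 k x y) then show ?case by (simp add: io T.r_distr)
 next
  case (4 k l x) then show ?case
   using iota_mult[of "1[A]" k "1[A]" l] by (simp add: c io T.m_assoc[symmetric])
 next
  case (5 x) then show ?case using iota_one by (simp add: c)
 next
  case (6 k x y) then show ?case by (simp add: io T.m_assoc)
 next
  case (7 k x y)
  then have "x*[T](\<iota> 1[A] k*[T]y) = (x*[T]\<iota> 1[A] k)*[T]y" by (simp add: io T.m_assoc)
  also have "... = \<iota> 1[A] k*[T](x*[T]y)" unfolding ioc[OF 7(1,2),symmetric] by (rule T.m_assoc[OF io[OF 7(1)] 7(2,3)])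
  finally show ?case .
 qed
qed

lemma has_sc_base_change:
 assumes A: "assoc_algebra K A" and L: "field L" and h: "h:ring_hom K L" and e: "has_sc K A I e c"
 shows "has_sc L (base_change K L h A) I (%i. pure_tensor K A (algebra_via L h) (e i) 1[L]) (%i j k. h (c i j k))"
proof -
 note eD = has_scD[OF e]
 interpret A: assoc_algebra K A by fact
 interpret field_hom K L h by (intro field_hom.intro A.field_axioms L field_hom_axioms.intro h)
 interpret tensor_basis K A "algebra_via L h" I e
  by (intro tensor_basis.intro tensor.intro A algebra_via_alg A.field_axioms L.cring_axioms h tensor_basis_axioms.intro eD(1))
 have c: "carrier (algebra_via L h) = carrier L" "1[algebra_via L h] = 1[L]" "mult (algebra_via L h) = mult L" "zero (algebra_via L h) = zero L"
  "smult (algebra_via L h) = (%k x. h k*[L]x)"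
  by (simp_all add: algebra_via_def)
 let ?BC = "base_change K L h A"
 interpret BC: assoc_algebra L ?BC by (rule base_change_alg[OF A L h])
 have b: "carrier ?BC = carrier T" "mult ?BC = mult T" "zero ?BC = zero T" "finsum ?BC = finsum T"
  "smult ?BC = (%l Z. \<iota> 1[A] l*[T]Z)"
  by (simp_all add: base_change_def)
 have io: "!!i. i:I==>\<iota> (e i) 1[L]:.T" by (rule iota_closed) (auto simp: c ei)
 \<comment> \<open>Combinations of the e_i \<otimes> 1 with coefficients in \<open>L\<close> are
   exactly the normal forms \<Sum> e_i \<otimes> t_i, so \<open>tensor_span\<close> and
   \<open>tensor_indep\<close> give a basis over \<open>L\<close> at once.\<close>
 have lcb: "lc ?BC I t (%i. \<iota> (e i) 1[L]) = (\<Oplus>[T]i:I. \<iota> (e i) (t i))" if t: "t:I->.L" for t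
  unfolding lc_def b
 proof (rule T.M.fcong)
  show "(%i. \<iota> (e i) (t i)):I->.T" using t by (auto intro!: iota_closed simp: c ei)
  fix i assume i: "i:I"
  then have ti: "t i:.L" using t by auto
  then show "\<iota> 1[A] (t i)*[T]\<iota> (e i) 1[L] = \<iota> (e i) (t i)" using ei[OF i] by (simp add: iota_mult c)
 qed
 have mem: "(%i. \<iota> (e i) 1[L]):I->.?BC" using io by (simp add: b)
 have "basis_family L ?BC I (%i. \<iota> (e i) 1[L])" unfolding basis_family_def
 proof
  show "indep_family L ?BC I (%i. \<iota> (e i) 1[L])" unfolding indep_family_def
  proof (intro conjI ballI impI)
   fix t i assume t: "t:I->.L" "lc ?BC I t (%i. \<iota> (e i) 1[L]) = 0[?BC]" "i:I"
   then show "t i = 0[L]" using tensor_indep[of t i] lcb[OF t(1)] by (simp add: c b Pi_iff)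
  qed (use finI mem in auto)
  show "span_family L ?BC I (%i. \<iota> (e i) 1[L])" unfolding span_family_def
  proof (intro conjI ballI)
   fix z assume "z:.?BC"
   then have "z:.T" by (simp add: b)
   then obtain t where t: "!!i. i:I==>t i:.(algebra_via L h)" "z = (\<Oplus>[T]i:I. \<iota> (e i) (t i))"
    using tensor_span by blast
   then have "t:I->.L" by (simp add: c)
   then show "EX t:I->.L. z = lc ?BC I t (%i. \<iota> (e i) 1[L])" using lcb t(2) by blast
  qed (use finI mem in auto)
 qed
 moreover have "\<iota> (e i) 1[L]*[?BC]\<iota> (e j) 1[L] = lc ?BC I (%k. h (c i j k)) (%i. \<iota> (e i) 1[L])"
  if ij: "i:I" "j:I" for i j
 proof -
  have ck: "!!k. k:I==>c i j k:.K" using eD(5) ij by blast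
  have "\<iota> (e i) 1[L]*[?BC]\<iota> (e j) 1[L] = \<iota> (e i*[A]e j) 1[L]" using ei ij by (simp add: b iota_mult c)
  also have "... = (\<Oplus>[T]k:I. \<iota> (c i j k*.[A]e k) 1[L])" unfolding eD(6)[OF ij] lc_def
   by (rule iota_finsum_left) (use ck ei in "auto simp: c")
  also have "... = (\<Oplus>[T]k:I. \<iota> (e k) (h (c i j k)))"
  proof (rule T.M.fcong)
   show "(%k. \<iota> (e k) (h (c i j k))):I->.T" using ck ei hom_closed by (auto intro!: iota_closed simp: c)
   fix k assume k: "k:I"
   show "\<iota> (c i j k*.[A]e k) 1[L] = \<iota> (e k) (h (c i j k))"
    using iota_smult_left[OF ck[OF k] ei[OF k],of "1[L]"] iota_smult_right[OF ck[OF k] ei[OF k],of "1[L]"]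
     hom_closed[OF ck[OF k]] by (simp add: c)
  qed
  also have "... = lc ?BC I (%k. h (c i j k)) (%i. \<iota> (e i) 1[L])"
   by (rule lcb[symmetric]) (use ck hom_closed in auto)
  finally show ?thesis .
 qed
 ultimately show ?thesis unfolding has_sc_def using eD(5) hom_closed by auto
qed

section \<open>Matrix algebras\<close>

abbreviation sq :: "nat=>(nat \<times> nat) set" where "sq n \<equiv> {..<n} \<times> {..<n}"

lemma mat_ring_sel:
 "carrier (MR R n) = sq n \<rightarrow>\<^sub>E carrier R"
 "zero (MR R n) = (\<lambda>p\<in>sq n. 0[R])"
 "one (MR R n) = restrict (%(i,j). if i = j then 1[R] else 0[R]) (sq n)"
 "M+[MR R n]N = (\<lambda>p\<in>sq n. M p+[R]N p)"
 "M*[MR R n]N = restrict (%(i,j). \<Oplus>[R]k:{..<n}. M (i,k)*[R]N (k,j)) (sq n)"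
 by (auto simp: mat_ring_def)

lemma mat_mult_entry: "i < n==>j < n==>(M*[MR R n]N) (i,j) = (\<Oplus>[R]k:{..<n}. M (i,k)*[R]N (k,j))"
 by (simp add: mat_ring_sel)

lemma mat_eqI:
 assumes "M:.(MR R n)" "N:.(MR R n)" "!!i j. i < n==>j < n==>M (i,j) = N (i,j)"
 shows "M = N"
 by (rule PiE_ext[of M "sq n" "%_. carrier R"]) (use assms in "auto simp: mat_ring_sel")

lemma mat_entry: "M:.(MR R n)==>i < n==>j < n==>M (i,j):.R"
 by (auto simp: mat_ring_sel PiE_iff)

lemma mat_entry': "M:.(MR R n)==>p:sq n==>M p:.R"
 by (auto simp: mat_ring_sel PiE_iff)

context ring
begin

lemma mat_mult_closed:
 assumes "M:.(MR R n)" "N:.(MR R n)"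
 shows "M*[MR R n]N:.(MR R n)"
proof -
 have "(\<Oplus>k\<in>{..<n}. M (i,k) \<otimes> N (k,j)):.R" if "i < n" "j < n" for i j
  using that mat_entry[OF assms(1)] mat_entry[OF assms(2)] by (intro finsum_closed) auto
 then show ?thesis by (auto simp: mat_ring_sel(1,5))
qed

lemma mat_one_closed: "1[MR R n]:.(MR R n)"
 by (auto simp: mat_ring_sel)

lemma mat_one_mult:
 assumes M: "M:.(MR R n)"
 shows "1[MR R n]*[MR R n]M = M" "M*[MR R n]1[MR R n] = M"
proof -
 show "1[MR R n]*[MR R n]M = M"
 proof (rule mat_eqI[OF mat_mult_closed[OF mat_one_closed M] M])
  fix i j assume ij: "i < n" "j < n"
  have "(1[MR R n]*[MR R n]M) (i,j) = (\<Oplus>k\<in>{..<n}. if k = i then M (k,j) else \<zero>)"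
   unfolding mat_mult_entry[OF ij]
   by (rule fcong) (use ij mat_entry[OF M] in "auto simp: mat_ring_sel")
  also have "... = M (i,j)" by (rule finsum_delta) (use ij mat_entry[OF M] in auto)
  finally show "(1[MR R n]*[MR R n]M) (i,j) = M (i,j)" .
 qed
 show "M*[MR R n]1[MR R n] = M"
 proof (rule mat_eqI[OF mat_mult_closed[OF M mat_one_closed] M])
  fix i j assume ij: "i < n" "j < n"
  have "(M*[MR R n]1[MR R n]) (i,j) = (\<Oplus>k\<in>{..<n}. if k = j then M (i,k) else \<zero>)"
   unfolding mat_mult_entry[OF ij]
   by (rule fcong) (use ij mat_entry[OF M] in "auto simp: mat_ring_sel")
  also have "... = M (i,j)" by (rule finsum_delta) (use ij mat_entry[OF M] in auto)
  finally show "(M*[MR R n]1[MR R n]) (i,j) = M (i,j)" .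
 qed
qed

lemma mat_mult_assoc:
 assumes M: "M:.(MR R n)" and N: "N:.(MR R n)" and P: "P:.(MR R n)"
 shows "M*[MR R n]N*[MR R n]P = M*[MR R n](N*[MR R n]P)"
proof (rule mat_eqI[OF mat_mult_closed[OF mat_mult_closed[OF M N] P] mat_mult_closed[OF M mat_mult_closed[OF N P]]])
 fix i j assume ij: "i < n" "j < n"
 note m = mat_entry[OF M] mat_entry[OF N] mat_entry[OF P]
 have "(M*[MR R n]N*[MR R n]P) (i,j) = (\<Oplus>k\<in>{..<n}. \<Oplus>l\<in>{..<n}. M (i,l) \<otimes> N (l,k) \<otimes> P (k,j))"
  unfolding mat_mult_entry[OF ij]
 proof (rule fcong)
  show "(%k. \<Oplus>l\<in>{..<n}. M (i,l) \<otimes> N (l,k) \<otimes> P (k,j)):{..<n}->.R"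
   using m ij by (intro Pi_I finsum_closed) auto
  fix k assume "k:{..<n}"
  then have k: "k < n" by simp
  show "(M*[MR R n]N) (i,k) \<otimes> P (k,j) = (\<Oplus>l\<in>{..<n}. M (i,l) \<otimes> N (l,k) \<otimes> P (k,j))"
   unfolding mat_mult_entry[OF ij(1) k] by (rule finsum_right) (use m ij k in auto)
 qed
 also have "... = (\<Oplus>l\<in>{..<n}. \<Oplus>k\<in>{..<n}. M (i,l) \<otimes> N (l,k) \<otimes> P (k,j))"
  by (rule finsum_swap) (use m ij in auto)
 also have "... = (M*[MR R n](N*[MR R n]P)) (i,j)"
  unfolding mat_mult_entry[OF ij]
 proof (rule fcong)
  show "(%k. M (i,k) \<otimes> (N*[MR R n]P) (k,j)):{..<n}->.R"
   using m ij mat_entry[OF mat_mult_closed[OF N P]] by auto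
  fix l assume "l:{..<n}"
  then have l: "l < n" by simp
  have "M (i,l) \<otimes> (N*[MR R n]P) (l,j) = (\<Oplus>k\<in>{..<n}. M (i,l) \<otimes> (N (l,k) \<otimes> P (k,j)))"
   unfolding mat_mult_entry[OF l ij(2)] by (rule finsum_left) (use m ij l in auto)
  also have "... = (\<Oplus>k\<in>{..<n}. M (i,l) \<otimes> N (l,k) \<otimes> P (k,j))"
   by (rule fcong) (use m ij l in "auto simp: m_assoc")
  finally show "(\<Oplus>k\<in>{..<n}. M (i,l) \<otimes> N (l,k) \<otimes> P (k,j)) = M (i,l) \<otimes> (N*[MR R n]P) (l,j)" by simp
 qed
 finally show "(M*[MR R n]N*[MR R n]P) (i,j) = (M*[MR R n](N*[MR R n]P)) (i,j)" .
qed

lemma mat_ring_ring: "ring (MR R n)"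
proof (rule ringI)
 show "abelian_group (MR R n)"
 proof (rule abelian_groupI)
  fix M assume M: "M:.(MR R n)"
  show "0[MR R n]+[MR R n]M = M"
   by (rule mat_eqI[where R = R and n = n]) (use M mat_entry'[OF M] in "auto simp: mat_ring_sel")
  let ?N = "\<lambda>p\<in>sq n. \<ominus> M p"
  have "?N:.(MR R n)" using mat_entry'[OF M] by (auto simp: mat_ring_sel)
  moreover have "?N+[MR R n]M = 0[MR R n]" using mat_entry'[OF M] by (auto simp: mat_ring_sel l_neg)
  ultimately show "EX N:carrier (MR R n). N+[MR R n]M = 0[MR R n]" by blast
 next
  fix M N assume "M:.(MR R n)" "N:.(MR R n)"
  note m = this mat_entry'[OF this(1)] mat_entry'[OF this(2)]
  show "M+[MR R n]N:.(MR R n)" using m(3,4) by (auto simp: mat_ring_sel)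
  show "M+[MR R n]N = N+[MR R n]M" using m(3,4) by (auto simp: mat_ring_sel a_comm intro!: restrict_ext)
  fix P assume P: "P:.(MR R n)"
  show "M+[MR R n]N+[MR R n]P = M+[MR R n](N+[MR R n]P)"
   using m(3,4) mat_entry'[OF P] by (auto simp: mat_ring_sel a_assoc intro!: restrict_ext)
 qed (auto simp: mat_ring_sel)
 show "monoid (MR R n)"
  by (rule monoidI) (rule mat_mult_closed mat_one_closed mat_mult_assoc mat_one_mult; assumption)+
next
 fix M N P assume M: "M:.(MR R n)" and N: "N:.(MR R n)" and P: "P:.(MR R n)"
 note m = mat_entry[OF M] mat_entry[OF N] mat_entry[OF P]
 have "M+[MR R n]N = (\<lambda>p\<in>sq n. M p \<oplus> N p)" by (simp add: mat_ring_sel)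
 have s: "(M+[MR R n]N) (i,j) = M (i,j) \<oplus> N (i,j)" if "i < n" "j < n" for i j using that by (simp add: mat_ring_sel)
 show "(M+[MR R n]N)*[MR R n]P = M*[MR R n]P+[MR R n]N*[MR R n]P"
  unfolding mat_ring_sel(4,5)
 proof (rule restrict_ext,clarsimp)
  fix i j assume ij: "i < n" "j < n"
  show "(\<Oplus>k\<in>{..<n}. (if k < n then M (i,k) \<oplus> N (i,k) else undefined) \<otimes> P (k,j)) = (\<Oplus>k\<in>{..<n}. M (i,k) \<otimes> P (k,j)) \<oplus> (\<Oplus>k\<in>{..<n}. N (i,k) \<otimes> P (k,j))"
   by (rule trans[OF finsum_cong' finsum_addf]) (use m ij in "auto simp: l_distr")
 qed
 show "P*[MR R n](M+[MR R n]N) = P*[MR R n]M+[MR R n]P*[MR R n]N"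
  unfolding mat_ring_sel(4,5)
 proof (rule restrict_ext,clarsimp)
  fix i j assume ij: "i < n" "j < n"
  show "(\<Oplus>k\<in>{..<n}. P (i,k) \<otimes> (if k < n then M (k,j) \<oplus> N (k,j) else undefined)) = (\<Oplus>k\<in>{..<n}. P (i,k) \<otimes> M (k,j)) \<oplus> (\<Oplus>k\<in>{..<n}. P (i,k) \<otimes> N (k,j))"
   by (rule trans[OF finsum_cong' finsum_addf]) (use m ij in "auto simp: r_distr")
 qed
qed

end

lemma mat_algebra_alg:
 assumes A: "assoc_algebra K A"
 shows "assoc_algebra K (MA A n)"
proof -
 interpret A: assoc_algebra K A by fact
 show ?thesis unfolding mat_algebra_def
 proof (rule assoc_algebraI[OF A.field_axioms A.mat_ring_ring],goal_cases)
  case (1 k x) then show ?case using mat_entry'[OF 1(2)] by (auto simp: mat_ring_sel)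
 next
  case (2 k l x) then show ?case using mat_entry'[OF 2(3)] by (auto simp: mat_ring_sel A.smult_l_distr intro!: restrict_ext)
 next
  case (3 k x y) then show ?case using mat_entry'[OF 3(2)] mat_entry'[OF 3(3)] by (auto simp: mat_ring_sel A.smult_r_distr intro!: restrict_ext)
 next
  case (4 k l x) then show ?case using mat_entry'[OF 4(3)] by (auto simp: A.smult_assoc1 intro!: restrict_ext)
 next
  case (5 x)
  show ?case by (rule mat_eqI[where R = A and n = n]) (use 5 mat_entry'[OF 5] in "auto simp: mat_ring_sel")
 next
  case (6 k x y)
  note m = mat_entry[OF 6(2)] mat_entry[OF 6(3)]
  show ?case unfolding mat_ring_sel(5)
  proof (rule restrict_ext,clarsimp)
   fix i j assume ij: "i < n" "j < n"
   have "(\<Oplus>[A]l:{..<n}. (if l < n then k*.[A]x (i,l) else undefined)*[A]y (l,j)) = (\<Oplus>[A]l:{..<n}. k*.[A](x (i,l)*[A]y (l,j)))"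
    by (rule A.M.fcong) (use m ij 6(1) in "auto simp: A.smult_mult_left")
   also have "... = k*.[A](\<Oplus>[A]l:{..<n}. x (i,l)*[A]y (l,j))"
    by (rule A.smult_finsum[symmetric]) (use m ij 6(1) in auto)
   finally show "(\<Oplus>[A]l:{..<n}. (if l < n then k*.[A]x (i,l) else undefined)*[A]y (l,j)) = k*.[A](\<Oplus>[A]l:{..<n}. x (i,l)*[A]y (l,j))" .
  qed
 next
  case (7 k x y)
  note m = mat_entry[OF 7(2)] mat_entry[OF 7(3)]
  show ?case unfolding mat_ring_sel(5)
  proof (rule restrict_ext,clarsimp)
   fix i j assume ij: "i < n" "j < n"
   have "(\<Oplus>[A]l:{..<n}. x (i,l)*[A](if l < n then k*.[A]y (l,j) else undefined)) = (\<Oplus>[A]l:{..<n}. k*.[A](x (i,l)*[A]y (l,j)))"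
    by (rule A.M.fcong) (use m ij 7(1) in "auto simp: A.smult_mult_right")
   also have "... = k*.[A](\<Oplus>[A]l:{..<n}. x (i,l)*[A]y (l,j))"
    by (rule A.smult_finsum[symmetric]) (use m ij 7(1) in auto)
   finally show "(\<Oplus>[A]l:{..<n}. x (i,l)*[A](if l < n then k*.[A]y (l,j) else undefined)) = k*.[A](\<Oplus>[A]l:{..<n}. x (i,l)*[A]y (l,j))" .
  qed
 qed
qed

lemma mat_algebra_sel:
 "carrier (MA A n) = carrier (MR A n)" "mult (MA A n) = mult (MR A n)"
 "one (MA A n) = one (MR A n)" "zero (MA A n) = zero (MR A n)"
 "add (MA A n) = add (MR A n)" "finsum (MA A n) = finsum (MR A n)"
 "k*.[MA A n]M = (\<lambda>p\<in>sq n. k*.[A]M p)"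
 by (simp_all add: mat_algebra_def)

definition munit :: "('b, 'm) ring_scheme=>nat=>nat \<times> nat=>'b=>nat \<times> nat=>'b" where
 "munit A n p x = (\<lambda>q\<in>sq n. if q = p then x else 0[A])"

text \<open>The structure constants of the matrix units, whose indices are pairs of a row and a
  column.\<close>

definition mu :: "('a, 'm) ring_scheme=>nat \<times> nat=>nat \<times> nat=>nat \<times> nat=>'a" where
 "mu K p q r = (if snd p = fst q & r = (fst p,snd q) then 1[K] else 0[K])"

lemma (in ring) munit_closed: "x:.R==>munit R n p x:.(MR R n)"
 by (auto simp: munit_def mat_ring_sel)

lemma (in ring) munit_mult:
 assumes x: "x:.R" "y:.R" and p: "p:sq n" "q:sq n"
 shows "munit R n p x*[MR R n]munit R n q y =
  (if snd p = fst q then munit R n (fst p,snd q) (x \<otimes> y) else 0[MR R n])"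
proof (rule mat_eqI[OF mat_mult_closed[OF munit_closed[OF x(1)] munit_closed[OF x(2)]]])
 show "(if snd p = fst q then munit R n (fst p,snd q) (x \<otimes> y) else 0[MR R n]):.(MR R n)"
  using munit_closed x by (auto simp: mat_ring_sel)
 fix i j assume ij: "i < n" "j < n"
 have sp: "snd p < n" using p by auto
 have "(munit R n p x*[MR R n]munit R n q y) (i,j) =
  (\<Oplus>k\<in>{..<n}. if k = snd p then (if i = fst p & q = (k,j) then x \<otimes> y else \<zero>) else \<zero>)"
  unfolding mat_mult_entry[OF ij]
  by (rule fcong) (use ij x in "auto simp: munit_def")
 also have "... = (if i = fst p & q = (snd p,j) then x \<otimes> y else \<zero>)"
  by (rule finsum_delta) (use sp x in auto)
 also have "... = (if snd p = fst q then munit R n (fst p,snd q) (x \<otimes> y) else 0[MR R n]) (i,j)"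
  using ij by (auto simp: munit_def mat_ring_sel prod_eq_iff)
 finally show "(munit R n p x*[MR R n]munit R n q y) (i,j) = (if snd p = fst q then munit R n (fst p,snd q) (x \<otimes> y) else 0[MR R n]) (i,j)" .
qed

lemma (in ring) mat_finsum_entry:
 assumes "p:sq n" "!!s. s:S==>X s:.(MR R n)"
 shows "(\<Oplus>[MR R n]s:S. X s) p = (\<Oplus>s\<in>S. X s p)"
 by (rule additive_finsum[of "MR R n" R "%M. M p"])
  (use assms mat_entry'[OF _ assms(1)] in "auto simp: mat_ring_sel(4) abelian_group_axioms ring.is_abelian_group[OF mat_ring_ring]")

lemma has_sc_mat:
 assumes A: "assoc_algebra K A" and e: "has_sc K A I e c"
 shows "has_sc K (MA A n) (sq n \<times> I) (%p. munit A n (fst p) (e (snd p))) (kron K (mu K) c)"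
proof -
 note eD = has_scD[OF e]
 interpret A: assoc_algebra K A by fact
 let ?M = "MA A n"
 interpret M: assoc_algebra K ?M by (rule mat_algebra_alg[OF A])
 let ?\<epsilon> = "%p. munit A n (fst p) (e (snd p))"
 have eI: "!!i. i:I==>e i:.A" using eD(3) by auto
 have mem: "?\<epsilon>:sq n \<times> I->.?M" using eI by (auto simp: mat_algebra_sel A.munit_closed)
 \<comment> \<open>The entry at \<open>p\<close> sees only the basis elements placed at
   \<open>p\<close> and is a combination in \<open>A\<close>, which reduces independence and
   spanning to \<open>A\<close>, entry by entry.\<close>
 have entry: "lc ?M (sq n \<times> I) t ?\<epsilon> p = lc A I (%k. t (p,k)) e" if t: "t:sq n \<times> I->.K" and p: "p:sq n" for t p
 proof -
  have tk: "!!q k. q:sq n==>k:I==>t (q,k):.K" using t by auto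
  have "lc ?M (sq n \<times> I) t ?\<epsilon> p = (\<Oplus>[A]s:sq n \<times> I. (t s*.[?M]?\<epsilon> s) p)"
   unfolding lc_def mat_algebra_sel(6)
  proof (rule A.mat_finsum_entry[OF p])
   fix s assume s: "s:sq n \<times> I"
   show "t s*.[?M]?\<epsilon> s:.(MR A n)"
    using M.smult_closed[OF _ funcset_mem[OF mem s],of "t s"] t s by (auto simp: mat_algebra_sel(1))
  qed
  also have "... = (\<Oplus>[A]q:sq n. \<Oplus>[A]k:I. (t (q,k)*.[?M]?\<epsilon> (q,k)) p)"
   by (rule A.M.finsum_Times) (use eD(2) tk eI p in "auto simp: mat_algebra_sel(7) munit_def")
  also have "... = (\<Oplus>[A]q:sq n. if q = p then lc A I (%k. t (q,k)) e else 0[A])"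
  proof (rule A.M.fcong)
   show "(%q. if q = p then lc A I (%k. t (q,k)) e else 0[A]):sq n->.A"
    using A.lc_closed[OF eD(3)] tk by auto
   fix q assume q: "q:sq n"
   show "(\<Oplus>[A]k:I. (t (q,k)*.[?M]?\<epsilon> (q,k)) p) = (if q = p then lc A I (%k. t (q,k)) e else 0[A])"
   proof (cases "q = p")
    case True
    then show ?thesis unfolding lc_def
     by (simp,intro A.M.fcong) (use tk[OF q] eI p in "auto simp: mat_algebra_sel(7) munit_def")
   next
    case False
    then show ?thesis
     by (simp,intro A.M.finsum_all_zero) (use tk[OF q] eI p in "auto simp: mat_algebra_sel(7) munit_def")
   qed
  qed
  also have "... = lc A I (%k. t (p,k)) e" by (rule A.M.finsum_delta) (use p tk A.lc_closed[OF eD(3)] in auto)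
  finally show ?thesis .
 qed
 have "basis_family K ?M (sq n \<times> I) ?\<epsilon>" unfolding basis_family_def
 proof
  show "indep_family K ?M (sq n \<times> I) ?\<epsilon>" unfolding indep_family_def
  proof (intro conjI ballI impI)
   fix t s assume t: "t:sq n \<times> I->.K" "lc ?M (sq n \<times> I) t ?\<epsilon> = 0[?M]" and s: "s:sq n \<times> I"
   have p: "fst s:sq n" "snd s:I" using s by auto
   have "lc A I (%k. t (fst s,k)) e = 0[A]"
    using entry[OF t(1) p(1)] t(2) p(1) by (simp add: mat_algebra_sel mat_ring_sel)
   moreover have "(%k. t (fst s,k)):I->.K" using t(1) p by auto
   ultimately have "t (fst s,snd s) = 0[K]" using eD(1) p(2) unfolding basis_family_def indep_family_def by blast
   then show "t s = 0[K]" by simp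
  qed (use eD(2) mem in auto)
  show "span_family K ?M (sq n \<times> I) ?\<epsilon>" unfolding span_family_def
  proof (intro conjI ballI)
   fix X assume X: "X:.?M"
   then have Xm: "X:.(MR A n)" by (simp add: mat_algebra_sel)
   define t where "t = (%s. coord K A I e (X (fst s)) (snd s))"
   have t: "t:sq n \<times> I->.K" using A.coord_closed[OF eD(1)] mat_entry'[OF Xm] by (auto simp: t_def)
   have "X = lc ?M (sq n \<times> I) t ?\<epsilon>"
   proof (rule mat_eqI[OF Xm])
    show "lc ?M (sq n \<times> I) t ?\<epsilon>:.(MR A n)" using M.lc_closed[OF mem t] by (simp add: mat_algebra_sel)
    fix i j assume ij: "i < n" "j < n"
    have "lc ?M (sq n \<times> I) t ?\<epsilon> (i,j) = lc A I (%k. t ((i,j),k)) e" by (rule entry[OF t]) (use ij in auto)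
    then show "X (i,j) = lc ?M (sq n \<times> I) t ?\<epsilon> (i,j)"
     using A.coord_props(2)[OF eD(1) mat_entry[OF Xm ij]] by (simp add: t_def)
   qed
   then show "EX t:sq n \<times> I->.K. X = lc ?M (sq n \<times> I) t ?\<epsilon>" using t by blast
  qed (use eD(2) mem in auto)
 qed
 moreover have "?\<epsilon> s*[?M]?\<epsilon> s' = lc ?M (sq n \<times> I) (kron K (mu K) c s s') ?\<epsilon>"
  and "kron K (mu K) c s s':sq n \<times> I->.K"
  if s: "s:sq n \<times> I" "s':sq n \<times> I" for s s'
 proof -
  have s': "fst s:sq n" "snd s:I" "fst s':sq n" "snd s':I" using s by auto
  note cc = eD(4)[OF s'(2,4)]
  have ck: "!!k. k:I==>c (snd s) (snd s') k:.K" using cc by auto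
  show t: "kron K (mu K) c s s':sq n \<times> I->.K" using ck by (auto simp: kron_def mu_def)
  have ee: "e (snd s)*[A]e (snd s'):.A" using eI s' by auto
  show "?\<epsilon> s*[?M]?\<epsilon> s' = lc ?M (sq n \<times> I) (kron K (mu K) c s s') ?\<epsilon>"
  proof (rule mat_eqI[where R = A and n = n])
   show "?\<epsilon> s*[?M]?\<epsilon> s':.(MR A n)"
    using M.m_closed[OF funcset_mem[OF mem s(1)] funcset_mem[OF mem s(2)]] by (simp add: mat_algebra_sel(1))
   show "lc ?M (sq n \<times> I) (kron K (mu K) c s s') ?\<epsilon>:.(MR A n)"
    using M.lc_closed[OF mem t] by (simp add: mat_algebra_sel)
   fix i j assume ij: "i < n" "j < n"
   have "lc ?M (sq n \<times> I) (kron K (mu K) c s s') ?\<epsilon> (i,j) = lc A I (%k. mu K (fst s) (fst s') (i,j)*[K]c (snd s) (snd s') k) e"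
    using entry[OF t,of "(i,j)"] ij by (simp add: kron_def)
   also have "... = mu K (fst s) (fst s') (i,j)*.[A]lc A I (c (snd s) (snd s')) e"
    by (rule A.lc_smult[symmetric,OF eD(3) cc]) (simp add: mu_def)
   also have "... = (?\<epsilon> s*[?M]?\<epsilon> s') (i,j)"
    unfolding eD(6)[OF s'(2,4),symmetric] mat_algebra_sel(2) A.munit_mult[OF eI[OF s'(2)] eI[OF s'(4)] s'(1,3)]
    using ij ee by (auto simp: mu_def munit_def mat_ring_sel)
   finally show "(?\<epsilon> s*[?M]?\<epsilon> s') (i,j) = lc ?M (sq n \<times> I) (kron K (mu K) c s s') ?\<epsilon> (i,j)" by simp
  qed
 qed
 ultimately show ?thesis unfolding has_sc_def by blast
qed

section \<open>Algebras with given structure constants\<close>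

lemma (in vectorspace) lc_finsum:
 assumes e: "e:I->.V" and I: "finite I" and S: "finite S" and t: "!!s i. s:S==>i:I==>t s i:.K"
 shows "(\<Oplus>[V]s:S. lc V I (t s) e) = lc V I (%i. \<Oplus>[K]s:S. t s i) e"
proof -
 have ei: "!!i. i:I==>e i:.V" using e by auto
 have "(\<Oplus>[V]s:S. lc V I (t s) e) = (\<Oplus>[V]i:I. \<Oplus>[V]s:S. t s i*.[V]e i)" unfolding lc_def
  by (rule M.finsum_swap[OF S I]) (simp add: t ei)
 also have "... = lc V I (%i. \<Oplus>[K]s:S. t s i) e" unfolding lc_def
  by (rule M.fcong) (simp_all add: finsum_smult t ei R.finsum_closed Pi_iff)
 finally show ?thesis .
qed

lemma (in assoc_algebra) lc_mult:
 assumes e: "has_sc K A I e c" and x: "x:I->.K" and y: "y:I->.K"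
 shows "lc A I x e*[A]lc A I y e = lc A I (%k. \<Oplus>[K]i:I. \<Oplus>[K]j:I. x i*[K]y j*[K]c i j k) e"
proof -
 note eD = has_scD[OF e]
 have ei: "!!i. i:I==>e i:.A" and xk: "!!i. i:I==>x i:.K" and yk: "!!i. i:I==>y i:.K"
  using eD(3) x y by auto
 have yc: "lc A I y e:.A" by (rule lc_closed[OF eD(3) y])
 have "lc A I x e*[A]lc A I y e = (\<Oplus>[A]i:I. (x i*.[A]e i)*[A]lc A I y e)" unfolding lc_def[of A I x]
  by (rule finsum_right[OF yc]) (simp add: xk ei)
 also have "... = (\<Oplus>[A]i:I. lc A I (%k. \<Oplus>[K]j:I. x i*[K]y j*[K]c i j k) e)"
 proof (rule M.fcong)
  have ck: "!!i j k. i:I==>j:I==>k:I==>x i*[K]y j*[K]c i j k:.K" using xk yk eD(5) by auto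
  show "(%i. lc A I (%k. \<Oplus>[K]j:I. x i*[K]y j*[K]c i j k) e):I->.A"
   using ck by (intro Pi_I lc_closed[OF eD(3)] R.finsum_closed) auto
  fix i assume i: "i:I"
  have "(x i*.[A]e i)*[A]lc A I y e = (\<Oplus>[A]j:I. (x i*.[A]e i)*[A](y j*.[A]e j))" unfolding lc_def
   by (rule finsum_left) (simp_all add: xk ei yk i)
  also have "... = (\<Oplus>[A]j:I. lc A I (%k. x i*[K]y j*[K]c i j k) e)"
  proof (rule M.fcong)
   show "(%j. lc A I (%k. x i*[K]y j*[K]c i j k) e):I->.A"
    using ck i by (intro Pi_I lc_closed[OF eD(3)]) auto
   fix j assume j: "j:I"
   have "(x i*.[A]e i)*[A](y j*.[A]e j) = (x i*[K]y j)*.[A](e i*[A]e j)"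
    using xk[OF i] yk[OF j] ei[OF i] ei[OF j] by (simp add: smult_mult_left smult_mult_right smult_assoc1[symmetric] R.m_comm)
   also have "... = lc A I (%k. x i*[K]y j*[K]c i j k) e" unfolding eD(6)[OF i j]
    by (rule lc_smult[OF eD(3) eD(4)[OF i j]]) (simp add: xk yk i j)
   finally show "(x i*.[A]e i)*[A](y j*.[A]e j) = lc A I (%k. x i*[K]y j*[K]c i j k) e" .
  qed
  also have "... = lc A I (%k. \<Oplus>[K]j:I. x i*[K]y j*[K]c i j k) e"
   by (rule lc_finsum[OF eD(3,2,2)]) (use ck i in auto)
  finally show "(x i*.[A]e i)*[A]lc A I y e = lc A I (%k. \<Oplus>[K]j:I. x i*[K]y j*[K]c i j k) e" .
 qed
 also have "... = lc A I (%k. \<Oplus>[K]i:I. \<Oplus>[K]j:I. x i*[K]y j*[K]c i j k) e"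
  by (rule lc_finsum[OF eD(3,2,2)]) (intro R.finsum_closed Pi_I R.m_closed xk yk eD(5))
 finally show ?thesis .
qed

text \<open>An algebra structure can be verified after an injective semilinear map into a known algebra.\<close>

lemma assoc_algebra_embed:
 fixes R :: "'b ring"
 assumes K: "field K" and A: "assoc_algebra L A" and h: "h:ring_hom K L"
  and j: "!!x. x:.R==>j x:.A" "inj_on j (carrier R)"
  and cl: "0[R]:.R" "1[R]:.R" "!!x y. x:.R==>y:.R==>x+[R]y:.R"
   "!!x y. x:.R==>y:.R==>x*[R]y:.R"
   "!!k x. k:.K==>x:.R==>s k x:.R"
  and pr: "j 0[R] = 0[A]" "j 1[R] = 1[A]" "!!x y. x:.R==>y:.R==>j (x+[R]y) = j x+[A]j y"
   "!!x y. x:.R==>y:.R==>j (x*[R]y) = j x*[A]j y"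
   "!!k x. k:.K==>x:.R==>j (s k x) = h k*.[A]j x"
 shows "assoc_algebra K (ring_with_smult R s)"
proof -
 interpret K: field K by fact
 interpret A: assoc_algebra L A by fact
 have eqI: "x = y" if "x:.R" "y:.R" "j x = j y" for x y using j(2) that by (auto simp: inj_on_def)
 note S = cl pr j(1)
 have hc: "!!k. k:.K==>h k:.L" by (rule ring_hom_closed[OF h])
 have ab: "abelian_group R"
 proof (rule abelian_groupI)
  fix x assume x: "x:.R"
  show "0[R]+[R]x = x" by (rule eqI) (simp_all add: S x)
  have m: "\<ominus>\<^bsub>K\<^esub> 1[K]:.K" by simp
  have "h (\<ominus>\<^bsub>K\<^esub> 1[K])+[L]1[L] = h 0[K]"
   using ring_hom_add[OF h m K.one_closed] ring_hom_one[OF h] by (simp add: K.l_neg)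
  then have "h (\<ominus>\<^bsub>K\<^esub> 1[K])+[L]1[L] = 0[L]" using ring_hom_zero_ring[OF K.ring_axioms A.R.ring_axioms h] by simp
  then have "h (\<ominus>\<^bsub>K\<^esub> 1[K])*.[A]j x+[A]j x = 0[A]"
   using A.smult_l_distr[OF hc[OF m] A.R.one_closed j(1)[OF x]] j(1)[OF x] by simp
  then have "s (\<ominus>\<^bsub>K\<^esub> 1[K]) x+[R]x = 0[R]" by (intro eqI) (simp_all add: S x)
  then show "EX y:carrier R. y+[R]x = 0[R]" using cl(5)[OF m x] by blast
 next
  fix x y assume xy: "x:.R" "y:.R"
  show "x+[R]y = y+[R]x" by (rule eqI) (simp_all add: S xy A.M.a_comm)
  fix z assume z: "z:.R"
  show "x+[R]y+[R]z = x+[R](y+[R]z)" by (rule eqI) (simp_all add: S xy z A.M.a_assoc)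
 qed (simp_all add: cl)
 have "ring R"
 proof (rule ringI[OF ab])
  show "monoid R"
  proof (rule monoidI)
   fix x y z assume xyz: "x:.R" "y:.R" "z:.R"
   show "x*[R]y*[R]z = x*[R](y*[R]z)" by (rule eqI) (simp_all add: S xyz A.m_assoc)
  next
   fix x assume x: "x:.R"
   show "1[R]*[R]x = x" by (rule eqI) (simp_all add: S x)
   show "x*[R]1[R] = x" by (rule eqI) (simp_all add: S x)
  qed (simp_all add: cl)
 next
  fix x y z assume xyz: "x:.R" "y:.R" "z:.R"
  show "(x+[R]y)*[R]z = x*[R]z+[R]y*[R]z" by (rule eqI) (simp_all add: S xyz A.l_distr)
  show "z*[R](x+[R]y) = z*[R]x+[R]z*[R]y" by (rule eqI) (simp_all add: S xyz A.r_distr)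
 qed
 then show ?thesis
  by (intro assoc_algebraI[OF K],assumption,simp add: cl)
   (rule eqI; simp add: S hc ring_hom_add[OF h] ring_hom_mult[OF h] ring_hom_one[OF h]
     A.smult_l_distr A.smult_r_distr A.smult_assoc1 A.smult_mult_left A.smult_mult_right)+
qed

text \<open>The algebra of coordinate vectors with prescribed constants. The coordinates
  \<open>u\<close> of the unit are a separate argument; in gluing they are obtained by descent, just
  as the constants are.\<close>

definition calg :: "('a, 'm) ring_scheme=>'i set=>('i=>'i=>'i=>'a)=>('i=>'a)=>('a, 'i=>'a) module" where
 "calg K I c u = ring_with_smult
   \<lparr>carrier = I \<rightarrow>\<^sub>E carrier K,
   mult = (%x y. \<lambda>k\<in>I. \<Oplus>[K]i:I. \<Oplus>[K]j:I. x i*[K]y j*[K]c i j k),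
   one = restrict u I,zero = (\<lambda>i\<in>I. 0[K]),add = (%x y. \<lambda>i\<in>I. x i+[K]y i)\<rparr>
   (%k x. \<lambda>i\<in>I. k*[K]x i)"

text \<open>The algebra laws over \<open>K\<close> are inherited from \<open>A\<close> through the
  injection that reads coordinates over \<open>K\<close> as coordinates over \<open>L\<close>. With
  the identity for \<open>h\<close> this copies an algebra; with the map from F to a factor of F_1
  it constructs the glued algebra.\<close>

lemma calg_embed:
 fixes K :: "('a, 'm) ring_scheme" and L :: "('l, 'n) ring_scheme" and I :: "'i set"
 assumes K: "field K" and A: "assoc_algebra L A" and f: "has_sc L A I f d" and h: "h:ring_hom K L"
  and c: "!!i j k. i:I==>j:I==>k:I==>c i j k:.K"
   "!!i j k. i:I==>j:I==>k:I==>h (c i j k) = d i j k"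
  and u: "!!i. i:I==>u i:.K" "lc A I (%i. h (u i)) f = 1[A]"
 shows "assoc_algebra K (calg K I c u)" "has_sc K (calg K I c u) I (%i. \<lambda>j\<in>I. if j = i then 1[K] else 0[K]) c"
proof -
 note fD = has_scD[OF f]
 interpret A: assoc_algebra L A by fact
 interpret field_hom K L h by (intro field_hom.intro K A.field_axioms field_hom_axioms.intro h)
 let ?R = "\<lparr>carrier = I \<rightarrow>\<^sub>E carrier K,
   mult = (%x y. \<lambda>k\<in>I. \<Oplus>[K]i:I. \<Oplus>[K]j:I. x i*[K]y j*[K]c i j k),
   one = restrict u I,zero = (\<lambda>i\<in>I. 0[K]),add = (%x y. \<lambda>i\<in>I. x i+[K]y i)\<rparr>"
 let ?j = "%x. lc A I (%i. h (x i)) f"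
 let ?C = "calg K I c u"
 have xk: "!!x i. x:I \<rightarrow>\<^sub>E carrier K==>i:I==>x i:.K" by auto
 have hx: "(%i. h (x i)):I->.L" if "x:I \<rightarrow>\<^sub>E carrier K" for x using xk[OF that] hom_closed by auto
 have cs: "(\<Oplus>[K]i:I. \<Oplus>[K]j:I. x i*[K]y j*[K]c i j k):.K" 
   if "x:I \<rightarrow>\<^sub>E carrier K" "y:I \<rightarrow>\<^sub>E carrier K" "k:I" for x y k
  using that by (intro K.finsum_closed Pi_I K.m_closed c xk)
 show alg: "assoc_algebra K ?C" unfolding calg_def
 proof (rule assoc_algebra_embed[OF K A h,of _ ?j],goal_cases)
  case (1 x) then show ?case using A.lc_closed[OF fD(3) hx] by simp
 next
  case 2
  show ?case
  proof (rule inj_onI)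
   fix x y assume xy: "x:.?R" "y:.?R" "?j x = ?j y"
   have "h (x i) = h (y i)" if "i:I" for i
    using A.indep_family_unique[of I f "%i. h (x i)" "%i. h (y i)" i] fD(1) xy hx that by (simp add: basis_family_def)
   then have "!!i. i:I==>x i = y i" using hom_inj xy xk by simp
   then show "x = y" using xy by (intro PiE_ext[where k = I and s = "%_. carrier K"]) auto
  qed
 next
  case (6 x y) then show ?case using cs by simp
 next
  case 8 show ?case by (simp,rule A.lc_zero[OF fD(3)]) (simp add: hom_zero)
 next
  case 9
  have "?j (restrict u I) = lc A I (%i. h (u i)) f" by (rule A.lc_cong[OF fD(3)]) (use u hom_closed in auto)
  then show ?case using u(2) by simp
 next
  case (10 x y)
  then have xy: "x:I \<rightarrow>\<^sub>E carrier K" "y:I \<rightarrow>\<^sub>E carrier K" by auto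
  have "?j (\<lambda>i\<in>I. x i+[K]y i) = lc A I (%i. h (x i)+[L]h (y i)) f"
   by (rule A.lc_cong[OF fD(3)]) (use xy xk hom_closed hom_add in auto)
  then show ?case using A.lc_add[OF fD(3) hx[OF xy(1)] hx[OF xy(2)]] by simp
 next
  case (11 x y)
  then have xy: "x:I \<rightarrow>\<^sub>E carrier K" "y:I \<rightarrow>\<^sub>E carrier K" by auto
  have "?j (\<lambda>k\<in>I. \<Oplus>[K]i:I. \<Oplus>[K]j:I. x i*[K]y j*[K]c i j k) =
    lc A I (%k. \<Oplus>[L]i:I. \<Oplus>[L]j:I. h (x i)*[L]h (y j)*[L]d i j k) f"
  proof (rule A.lc_cong[OF fD(3)])
   show "(%i. h ((\<lambda>k\<in>I. \<Oplus>[K]i:I. \<Oplus>[K]j:I. x i*[K]y j*[K]c i j k) i)):I->.L"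
    using cs[OF xy] hom_closed by auto
   fix k assume k: "k:I"
   have t: "!!i j. i:I==>j:I==>x i*[K]y j*[K]c i j k:.K" using xk xy c k by auto
   have "h (\<Oplus>[K]i:I. \<Oplus>[K]j:I. x i*[K]y j*[K]c i j k) = (\<Oplus>[L]i:I. h (\<Oplus>[K]j:I. x i*[K]y j*[K]c i j k))"
    by (rule hom_finsum) (intro K.finsum_closed Pi_I t)
   also have "... = (\<Oplus>[L]i:I. \<Oplus>[L]j:I. h (x i)*[L]h (y j)*[L]d i j k)"
   proof (rule A.R.fcong)
    have t': "!!i j. i:I==>j:I==>h (x i)*[L]h (y j)*[L]d i j k:.L"
     using xk xy fD(5) k hom_closed by auto
    show "(%i. \<Oplus>[L]j:I. h (x i)*[L]h (y j)*[L]d i j k):I->.L" by (intro Pi_I A.R.finsum_closed t')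
    fix i assume i: "i:I"
    have "h (\<Oplus>[K]j:I. x i*[K]y j*[K]c i j k) = (\<Oplus>[L]j:I. h (x i*[K]y j*[K]c i j k))"
     by (rule hom_finsum) (intro t i)
    also have "... = (\<Oplus>[L]j:I. h (x i)*[L]h (y j)*[L]d i j k)"
     by (rule A.R.fcong) (use t' i xk[OF xy(1)] xk[OF xy(2)] c k hom_mult in auto)
    finally show "h (\<Oplus>[K]j:I. x i*[K]y j*[K]c i j k) = (\<Oplus>[L]j:I. h (x i)*[L]h (y j)*[L]d i j k)" .
   qed
   finally show "h ((\<lambda>k\<in>I. \<Oplus>[K]i:I. \<Oplus>[K]j:I. x i*[K]y j*[K]c i j k) k) = (\<Oplus>[L]i:I. \<Oplus>[L]j:I. h (x i)*[L]h (y j)*[L]d i j k)"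
    using k by simp
  qed (simp)
  then show ?case using A.lc_mult[OF f hx[OF xy(1)] hx[OF xy(2)]] by simp
 next
  case (12 k x)
  then have x: "x:I \<rightarrow>\<^sub>E carrier K" by auto
  have "?j (\<lambda>i\<in>I. k*[K]x i) = lc A I (%i. h k*[L]h (x i)) f"
   by (rule A.lc_cong[OF fD(3)]) (use x xk 12(1) hom_closed hom_mult in auto)
  then show ?case using A.lc_smult[OF fD(3) hx[OF x] hom_closed[OF 12(1)]] by simp
 qed (use u in auto)
 interpret C: assoc_algebra K ?C by (rule alg)
 let ?\<delta> = "%i. \<lambda>j\<in>I. if j = i then 1[K] else 0[K]"
 have C_sel: "carrier ?C = I \<rightarrow>\<^sub>E carrier K" "zero ?C = (\<lambda>i\<in>I. 0[K])" "x+[?C]y = (\<lambda>i\<in>I. x i+[K]y i)" "k*.[?C]x = (\<lambda>i\<in>I. k*[K]x i)"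
  "x*[?C]y = (\<lambda>k\<in>I. \<Oplus>[K]i:I. \<Oplus>[K]j:I. x i*[K]y j*[K]c i j k)" for x y k
  by (simp_all add: calg_def)
 have \<delta>m: "?\<delta>:I->.?C" by (auto simp: C_sel)
 have lcC: "lc ?C I t ?\<delta> = restrict t I" if t: "t:I->.K" for t
 proof (rule PiE_ext[where k = I and s = "%_. carrier K"])
  show "lc ?C I t ?\<delta>:I \<rightarrow>\<^sub>E carrier K" using C.lc_closed[OF \<delta>m t] by (simp add: C_sel)
  show "restrict t I:I \<rightarrow>\<^sub>E carrier K" using t by auto
  fix i assume i: "i:I"
  have tk: "!!k. k:I==>t k:.K" using t by auto
  have "lc ?C I t ?\<delta> i = (\<Oplus>[K]k:I. (t k*.[?C]?\<delta> k) i)" unfolding lc_def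
   by (rule additive_finsum[of ?C K "%x. x i", OF C.M.abelian_group_axioms K.abelian_group_axioms])
    (use i tk in "auto simp: C_sel")
  also have "... = (\<Oplus>[K]k:I. if k = i then t k else 0[K])"
   by (rule K.fcong) (use i tk in "auto simp: C_sel")
  also have "... = t i" by (rule K.finsum_delta) (use i tk fD(2) in auto)
  finally show "lc ?C I t ?\<delta> i = restrict t I i" using i by simp
 qed
 have "basis_family K ?C I ?\<delta>" unfolding basis_family_def
 proof
  show "indep_family K ?C I ?\<delta>" unfolding indep_family_def
  proof (intro conjI ballI impI)
   fix t i assume t: "t:I->.K" "lc ?C I t ?\<delta> = 0[?C]" "i:I"
   then have "restrict t I i = (\<lambda>i\<in>I. 0[K]) i" using lcC by (simp add: C_sel)
   then show "t i = 0[K]" using t(3) by simp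
  qed (use fD(2) \<delta>m in auto)
  show "span_family K ?C I ?\<delta>" unfolding span_family_def
  proof (intro conjI ballI)
   fix x assume x: "x:.?C"
   then have xx: "x:I \<rightarrow>\<^sub>E carrier K" by (simp add: C_sel)
   have "x = lc ?C I x ?\<delta>" using xx lcC[of x] by (simp add: extensional_restrict PiE_iff Pi_iff)
   then show "EX t:I->.K. x = lc ?C I t ?\<delta>" using xx by auto
  qed (use fD(2) \<delta>m in auto)
 qed
 moreover have "?\<delta> i*[?C]?\<delta> j = lc ?C I (c i j) ?\<delta>" if ij: "i:I" "j:I" for i j
 proof -
  have cij: "c i j:I->.K" using c(1) ij by auto
  have "?\<delta> i*[?C]?\<delta> j = restrict (c i j) I" unfolding C_sel
  proof (rule restrict_ext)
   fix k assume k: "k:I"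
   have "(\<Oplus>[K]i':I. \<Oplus>[K]j':I. ?\<delta> i i'*[K]?\<delta> j j'*[K]c i' j' k) = (\<Oplus>[K]i':I. if i' = i then c i' j k else 0[K])"
   proof (rule K.fcong)
    show "(%i'. if i' = i then c i' j k else 0[K]):I->.K" using c k ij by auto
    fix i' assume i': "i':I"
    have "(\<Oplus>[K]j':I. ?\<delta> i i'*[K]?\<delta> j j'*[K]c i' j' k) = (\<Oplus>[K]j':I. if j' = j then (if i' = i then c i' j' k else 0[K]) else 0[K])"
     by (rule K.fcong) (use c(1)[OF i' _ k] i' in auto)
    also have "... = (if i' = i then c i' j k else 0[K])" by (rule K.finsum_delta) (use c(1)[OF i' _ k] ij fD(2) in auto)
    finally show "(\<Oplus>[K]j':I. ?\<delta> i i'*[K]?\<delta> j j'*[K]c i' j' k) = (if i' = i then c i' j k else 0[K])" .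
   qed
   also have "... = c i j k" by (rule K.finsum_delta) (use c ij k fD(2) in auto)
   finally show "(\<Oplus>[K]i':I. \<Oplus>[K]j':I. ?\<delta> i i'*[K]?\<delta> j j'*[K]c i' j' k) = c i j k" .
  qed
  then show ?thesis using lcC[OF cij] by simp
 qed
 ultimately show "has_sc K ?C I ?\<delta> c" unfolding has_sc_def using c(1) by auto
qed

text \<open>Changes the type of the elements to functions from the index type. For an index set of
  natural numbers this is the type in which representatives of Brauer classes live.\<close>

lemma has_sc_calg:
 fixes K :: "('a, 'm) ring_scheme" and I :: "'i set"
 assumes A: "assoc_algebra K A" and f: "has_sc K A I f c"
 obtains B :: "('a, 'i=>'a) module" and e where "assoc_algebra K B" "has_sc K B I e c" "algebra_iso K A B"
proof -
 note fD = has_scD[OF f]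
 interpret A: assoc_algebra K A by fact
 let ?u = "coord K A I f 1[A]"
 have id: "(%x. x):ring_hom K K" by (auto simp: ring_hom_def)
 have u: "!!i. i:I==>?u i:.K" "lc A I ?u f = 1[A]"
  using A.coord_closed[OF fD(1) A.one_closed] A.coord_props(2)[OF fD(1) A.one_closed] by auto
 have C: "assoc_algebra K (calg K I c ?u)" "has_sc K (calg K I c ?u) I (%i. \<lambda>j\<in>I. if j = i then 1[K] else 0[K]) c"
  by (rule calg_embed[OF A.field_axioms A f id]; (assumption | simp add: fD(5) u))+
 show ?thesis by (rule that[OF C algebra_iso_of_has_sc[OF A C(1) f C(2)]])
qed

section \<open>The opposite algebra and the base field\<close>

definition opp :: "('a, 'b, 'n) module_scheme=>('a, 'b) module" where
 "opp A = ring_with_smult \<lparr>carrier = carrier A,mult = (%x y. y*[A]x),one = one A,zero = zero A,add = add A\<rparr> (smult A)"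

lemma opp_sel: "carrier (opp A) = carrier A" "x*[opp A]y = y*[A]x" "one (opp A) = one A" "zero (opp A) = zero A"
 "add (opp A) = add A" "smult (opp A) = smult A" "finsum (opp A) = finsum A"
 by (auto simp: opp_def finsum_def finprod_def fun_eq_iff)

lemma opp_alg:
 assumes A: "assoc_algebra K A"
 shows "assoc_algebra K (opp A)"
proof -
 interpret A: assoc_algebra K A by fact
 let ?R = "\<lparr>carrier = carrier A,mult = (%x y. y*[A]x),one = one A,zero = zero A,add = add A\<rparr>"
 have "abelian_group ?R"
 proof (rule abelian_groupI)
  fix x assume "x:.?R"
  then show "EX y:carrier ?R. y+[?R]x = 0[?R]" by (auto intro!: bexI[of _ "\<ominus>\<^bsub>A\<^esub> x"] simp: A.M.l_neg)
 qed (simp_all add: A.M.a_ac)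
 moreover have "monoid ?R" by (rule monoidI) (simp_all add: A.m_assoc)
 ultimately have R: "ring ?R" by (rule ringI) (simp_all add: A.l_distr A.r_distr)
 show ?thesis unfolding opp_def
  by (rule assoc_algebraI[OF A.field_axioms R])
   (simp_all add: A.smult_l_distr A.smult_r_distr A.smult_assoc1 A.smult_mult_left A.smult_mult_right)
qed

lemma has_sc_opp:
 assumes "has_sc K A I e c"
 shows "has_sc K (opp A) I e (%i j. c j i)"
proof -
 have lc: "lc (opp A) I = lc A I" by (intro HOL.ext) (simp add: lc_def opp_sel)
 show ?thesis using assms
  unfolding has_sc_def basis_family_def indep_family_def span_family_def lc opp_sel by blast
qed

lemma self_alg: "field K==>assoc_algebra K (algebra_via K (%k. k))"
 by (rule algebra_via_alg) (auto simp: field_def domain_def ring_hom_def)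

lemma has_sc_self:
 assumes "field K"
 shows "has_sc K (algebra_via K (%k. k)) {()} (%_. 1[K]) (%_ _ _. 1[K])"
proof -
 interpret field K by fact
 let ?S = "algebra_via K (%k. k)"
 have lc: "lc ?S {()} f (%_. 1[K]) = f ()" if "f ():.K" for f
  using that by (simp add: lc_def algebra_via_def)
 show ?thesis unfolding has_sc_def basis_family_def indep_family_def span_family_def
 proof (intro conjI ballI impI,goal_cases)
  case (3 f i) then show ?case using lc[of f] by (simp add: algebra_via_def)
 next
  case (6 x) then show ?case using lc[of "%_. x"] by (intro bexI[of _ "%_. x"]) (auto simp: algebra_via_def)
 next
  case (8 i j) then show ?case using lc[of "%_. 1[K]"] by (simp add: algebra_via_def)
 qed (auto simp: algebra_via_def)
qed

section \<open>Sandwich operators and the density theorem\<close>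

text \<open>Sums of operators sending x to a x s, with \<open>a\<close> arbitrary and
  \<open>s\<close> in \<open>S\<close>. For central simple algebras \<open>S\<close> is the whole
  ring; for the dimension of a division algebra it is a maximal subfield.\<close>

inductive_set sw :: "('b, 'm) ring_scheme=>'b set=>('b=>'b) set" for R S where
 base: "a:.R==>s:S==>(%x. a*[R]x*[R]s):sw R S"
| add: "f:sw R S==>g:sw R S==>(%x. f x+[R]g x):sw R S"

locale sandwich = ring R for R (structure) +
 fixes S
 assumes S: "S <= carrier R" "\<one>:S" "!!s t. s:S==>t:S==>s \<otimes> t:S"
begin

lemma Sc: "s:S==>s:.R" using S by auto

lemma sw_closed: "f:sw R S==>x:.R==>f x:.R"
 by (induction rule: sw.induct) (auto simp: Sc)

lemma sw_add: "f:sw R S==>x:.R==>y:.R==>f (x \<oplus> y) = f x \<oplus> f y"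
proof (induction rule: sw.induct)
 case (base a s) then show ?case by (simp add: Sc r_distr l_distr)
next
 case (add f g)
 then have "f x:.R" "f y:.R" "g x:.R" "g y:.R" using sw_closed by auto
 then show ?case using add by (simp add: a_ac)
qed

lemma sw_zero: "f:sw R S==>f \<zero> = \<zero>"
 by (rule additive_zero[OF abelian_group_axioms abelian_group_axioms]) (auto simp: sw_closed sw_add)

lemma sw_left:
 assumes "f:sw R S" "a:.R"
 shows "EX g:sw R S. ALL x:carrier R. g x = a \<otimes> f x"
 using assms(1)
proof (induction rule: sw.induct)
 case (base b s)
 show ?case using base assms(2) by (intro bexI[OF _ sw.base[of "a \<otimes> b" R s S]]) (auto simp: m_assoc Sc)
next
 case (add f g)
 then obtain f' g' where *: "f':sw R S" "g':sw R S" "!!x. x:.R==>f' x = a \<otimes> f x" "!!x. x:.R==>g' x = a \<otimes> g x" by blast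
 show ?case using * add.hyps assms(2) sw_closed by (intro bexI[OF _ sw.add[OF *(1,2)]]) (auto simp: r_distr)
qed

lemma sw_right:
 assumes "f:sw R S" "t:S"
 shows "EX g:sw R S. ALL x:carrier R. g x = f x \<otimes> t"
 using assms(1)
proof (induction rule: sw.induct)
 case (base b s)
 show ?case using base assms(2) by (intro bexI[OF _ sw.base[of b R "s \<otimes> t" S]]) (auto simp: m_assoc Sc S(3))
next
 case (add f g)
 then obtain f' g' where *: "f':sw R S" "g':sw R S" "!!x. x:.R==>f' x = f x \<otimes> t" "!!x. x:.R==>g' x = g x \<otimes> t" by blast
 show ?case using * add.hyps assms(2) sw_closed Sc by (intro bexI[OF _ sw.add[OF *(1,2)]]) (auto simp: l_distr)
qed

lemma sw_comp:
 assumes "f:sw R S" "g:sw R S"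
 shows "EX h:sw R S. ALL x:carrier R. h x = f (g x)"
 using assms(1)
proof (induction rule: sw.induct)
 case (base a s)
 obtain g' where g': "g':sw R S" "ALL x:carrier R. g' x = a \<otimes> g x" using sw_left[OF assms(2) base(1)] by blast
 obtain g'' where "g'':sw R S" "ALL x:carrier R. g'' x = g' x \<otimes> s" using sw_right[OF g'(1) base(2)] by blast
 then show ?case using g' by auto
next
 case (add f f')
 then obtain h h' where *: "h:sw R S" "h':sw R S" "ALL x:carrier R. h x = f (g x)" "ALL x:carrier R. h' x = f' (g x)" by blast
 show ?case using * by (intro bexI[OF _ sw.add[OF *(1,2)]]) auto
qed

lemma sw_id: "EX g:sw R S. ALL x:carrier R. g x = x"
 by (rule bexI[OF _ sw.base[OF one_closed S(2)]]) auto

lemma sw_sub: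
 assumes "f:sw R S" "g:sw R S"
 shows "EX h:sw R S. ALL x:carrier R. h x = f x \<ominus> g x"
proof -
 obtain g' where g': "g':sw R S" "ALL x:carrier R. g' x = (\<ominus> \<one>) \<otimes> g x" using sw_left[OF assms(2),of "\<ominus> \<one>"] by auto
 show ?thesis
  by (rule bexI[OF _ sw.add[OF assms(1) g'(1)]]) (use g' sw_closed[OF assms(2)] in "auto simp: minus_eq l_minus")
qed

lemma sw_sum:
 assumes "finite I" "!!i. i:I==>f i:sw R S" "!!i. i:I==>a i:.R"
 shows "EX h:sw R S. ALL x:carrier R. h x = (\<Oplus>i\<in>I. a i \<otimes> f i x)"
 using assms
proof (induction I rule: finite_induct)
 case empty
 show ?case by (rule bexI[OF _ sw.base[OF zero_closed S(2)]]) auto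
next
 case (insert i I)
 then obtain h where h: "h:sw R S" "ALL x:carrier R. h x = (\<Oplus>i\<in>I. a i \<otimes> f i x)" by auto
 obtain g where g: "g:sw R S" "ALL x:carrier R. g x = a i \<otimes> f i x" using sw_left[of "f i" "a i"] insert.prems by auto
 show ?case
  by (rule bexI[OF _ sw.add[OF g(1) h(1)]]) (use g h insert sw_closed in "auto simp: Pi_iff")
qed

lemma sw_ideal:
 assumes "ideal J R" "f:sw R S" "x:J"
 shows "f x:J"
proof -
 interpret ideal J R by fact
 have "x:.R" using assms(3) by (rule a_Hcarr)
 from assms(2) show ?thesis
  by (induction rule: sw.induct) (use assms(3) in "auto simp: Sc intro: I_r_closed[OF I_l_closed]")
qed

abbreviation "C \<equiv> {z:carrier R. ALL s:S. z \<otimes> s = s \<otimes> z}"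

text \<open>Independence over the centraliser \<open>C\<close> of \<open>S\<close> acting from the
  right. The operators in \<open>sw R S\<close> are right \<open>C\<close>-linear, so this is the
  independence that they respect.\<close>

definition rindep :: "'i set=>('i=>'a)=>bool" where
 "rindep I e \<longleftrightarrow> (ALL z:I \<rightarrow> C. (\<Oplus>i\<in>I. e i \<otimes> z i) = \<zero> --> (ALL i:I. z i = \<zero>))"

lemma rindepD:
 "rindep I e==>z:I \<rightarrow> C==>(\<Oplus>i\<in>I. e i \<otimes> z i) = \<zero>==>i:I==>z i = \<zero>"
 unfolding rindep_def by blast

text \<open>The density theorem in the style of Artin and Whaples: if every nonzero element can be
  moved to \<one>, an independent family has a dual family of operators. By induction on the family,
  the point is to find an operator that kills the old members but not the new one.\<close>

theorem density:
 assumes simple: "!!x. x:.R==>x ~= \<zero>==>EX f:sw R S. f x = \<one>" and nz: "\<one> ~= \<zero>"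
  and "finite I" "e:I->.R" "rindep I e" "i0:I"
 shows "EX f:sw R S. ALL i:I. f (e i) = (if i = i0 then \<one> else \<zero>)"
 using assms(3-6)
proof (induction I arbitrary: i0 rule: finite_induct)
 case empty then show ?case by simp
next
 case (insert m I)
 have em: "e m:.R" and ei: "!!i. i:I==>e i:.R" using insert.prems by auto
 have C0: "\<zero>:C" "\<one>:C" using Sc by auto
 have Cneg: "\<ominus> z:C" if "z:C" for z using that Sc by (auto simp: l_minus r_minus)
 have ri: "rindep I e" unfolding rindep_def
 proof (intro ballI impI)
  fix z i assume z: "z:I \<rightarrow> C" "(\<Oplus>i\<in>I. e i \<otimes> z i) = \<zero>" and i: "i:I"
  let ?z = "%j. if j = m then \<zero> else z j"
  have zc: "!!i. i:I==>z i:.R" using z(1) by auto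
  have 1: "?z:insert m I \<rightarrow> C" using z(1) C0 by (auto simp: Pi_iff)
  have "(\<Oplus>j\<in>insert m I. e j \<otimes> ?z j) = e m \<otimes> ?z m \<oplus> (\<Oplus>j\<in>I. e j \<otimes> ?z j)"
   by (rule finsum_insert) (use insert.hyps em ei zc in auto)
  also have "(\<Oplus>j\<in>I. e j \<otimes> ?z j) = (\<Oplus>j\<in>I. e j \<otimes> z j)"
   by (rule fcong) (use insert.hyps ei zc in auto)
  finally have "(\<Oplus>j\<in>insert m I. e j \<otimes> ?z j) = \<zero>" using z(2) em by simp
  then have "?z i = \<zero>" by (rule rindepD[OF insert.prems(2) 1]) (simp add: i)
  then show "z i = \<zero>" using i insert.hyps by (auto split: if_splits)
 qed
 have "ALL i:I. EX f. f:sw R S & (ALL j:I. f (e j) = (if j = i then \<one> else \<zero>))"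
  using insert.IH[OF _ ri] ei by blast
 then obtain F where F: "!!i. i:I==>F i:sw R S" "!!i j. i:I==>j:I==>F i (e j) = (if j = i then \<one> else \<zero>)"
  unfolding bchoice_iff by blast
 have "EX g:sw R S. (ALL i:I. g (e i) = \<zero>) & g (e m) ~= \<zero>"
 proof (rule ccontr)
  assume "~ ?thesis"
  then have kill: "g (e m) = \<zero>" if "g:sw R S" "!!i. i:I==>g (e i) = \<zero>" for g using that by blast
  have Fm: "!!i. i:I==>F i (e m):.R" using F(1) sw_closed em by blast
  \<comment> \<open>The commutator of \<open>F i\<close> with \<open>s\<close> kills all old
    members, hence by assumption also \<open>e m\<close>; so the value at \<open>e m\<close>
    commutes with \<open>s\<close>.\<close>
  have zC: "F i (e m):C" if i: "i:I" for i
  proof -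
   have "F i (e m) \<otimes> s = s \<otimes> F i (e m)" if s: "s:S" for s
   proof -
    obtain g1 where g1: "g1:sw R S" "ALL x:carrier R. g1 x = F i x \<otimes> s" using sw_right[OF F(1)[OF i] s] by blast
    obtain g2 where g2: "g2:sw R S" "ALL x:carrier R. g2 x = s \<otimes> F i x" using sw_left[OF F(1)[OF i] Sc[OF s]] by blast
    obtain g where g: "g:sw R S" "ALL x:carrier R. g x = g1 x \<ominus> g2 x" using sw_sub[OF g1(1) g2(1)] by blast
    have "g (e m) = \<zero>"
    proof (rule kill[OF g(1)])
     fix j assume j: "j:I"
     then show "g (e j) = \<zero>" using g(2) g1(2) g2(2) ei[OF j] F(2)[OF i j] Sc[OF s] by (simp add: r_neg minus_eq split: if_splits)
    qed
    then show ?thesis using g(2) g1(2) g2(2) em Fm[OF i] Sc[OF s] by simp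
   qed
   then show ?thesis using Fm[OF i] by auto
  qed
  \<comment> \<open>The operator x \<mapsto> x - \<Sum> e_i F_i(x) kills all old members. If it
    killed \<open>e m\<close> as well, then \<open>e m\<close> would be a combination of them with
    coefficients in \<open>C\<close>, against independence.\<close>
  obtain h where h: "h:sw R S" "ALL x:carrier R. h x = (\<Oplus>i\<in>I. e i \<otimes> F i x)" using sw_sum[of I F e,OF insert.hyps(1)] F(1) ei by blast
  obtain idd where idd: "idd:sw R S" "ALL x:carrier R. idd x = x" using sw_id by blast
  obtain g where g: "g:sw R S" "ALL x:carrier R. g x = idd x \<ominus> h x" using sw_sub[OF idd(1) h(1)] by blast
  have "g (e m) = \<zero>"
  proof (rule kill[OF g(1)])
   fix j assume j: "j:I"
   have "h (e j) = (\<Oplus>i\<in>I. if i = j then e i else \<zero>)"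
    using h(2) ei[OF j] by (simp,intro fcong) (use F(2)[OF _ j] ei in auto)
   also have "... = e j" by (rule finsum_delta) (use insert.hyps j ei in auto)
   finally show "g (e j) = \<zero>" using g(2) idd(2) ei[OF j] by (simp add: minus_eq r_neg)
  qed
  then have eq: "e m \<ominus> (\<Oplus>i\<in>I. e i \<otimes> F i (e m)) = \<zero>" using g(2) idd(2) h(2) em by simp
  let ?z = "%j. if j = m then \<one> else \<ominus> F j (e m)"
  have 1: "?z:insert m I \<rightarrow> C" using zC Cneg C0 by auto
  have "(\<Oplus>j\<in>insert m I. e j \<otimes> ?z j) = e m \<otimes> ?z m \<oplus> (\<Oplus>j\<in>I. e j \<otimes> ?z j)"
   by (rule finsum_insert) (use insert.hyps em ei Fm in auto)
  also have "(\<Oplus>j\<in>I. e j \<otimes> ?z j) = (\<Oplus>j\<in>I. \<ominus> (e j \<otimes> F j (e m)))"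
   by (rule fcong) (use insert.hyps ei Fm in "auto simp: r_minus")
  also have "... = \<ominus> (\<Oplus>j\<in>I. e j \<otimes> F j (e m))"
   by (rule additive_finsum[symmetric,OF abelian_group_axioms abelian_group_axioms]) (use ei Fm in "auto simp: minus_add")
  finally have "(\<Oplus>j\<in>insert m I. e j \<otimes> ?z j) = \<zero>" using eq em by (simp add: minus_eq)
  then have "?z m = \<zero>" by (rule rindepD[OF insert.prems(2) 1]) simp
  then show False using nz by simp
 qed
 then obtain g0 where g0: "g0:sw R S" "!!i. i:I==>g0 (e i) = \<zero>" "g0 (e m) ~= \<zero>" by blast
 obtain h where h: "h:sw R S" "h (g0 (e m)) = \<one>" using simple[OF sw_closed[OF g0(1) em] g0(3)] by blast
 obtain g where g: "g:sw R S" "ALL x:carrier R. g x = h (g0 x)" using sw_comp[OF h(1) g0(1)] by blast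
 have gm: "g (e m) = \<one>" "!!i. i:I==>g (e i) = \<zero>" using g(2) h g0(2) em ei sw_zero[OF h(1)] by auto
 show ?case
 proof (cases "i0 = m")
  case True
  then show ?thesis using gm g(1) insert.hyps by (intro bexI[of _ g]) auto
 next
  case False
  then have i0: "i0:I" using insert.prems by auto
  have Fm: "F i0 (e m):.R" using sw_closed F(1) i0 em by blast
  \<comment> \<open>The dual operator for \<open>i0\<close> is corrected by a multiple of
    \<open>g\<close>, which affects only its value at \<open>e m\<close>.\<close>
  obtain g' where g': "g':sw R S" "ALL x:carrier R. g' x = F i0 (e m) \<otimes> g x" using sw_left[OF g(1) Fm] by blast
  obtain f where f: "f:sw R S" "ALL x:carrier R. f x = F i0 x \<ominus> g' x" using sw_sub[OF F(1)[OF i0] g'(1)] by blast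
  have "f (e i) = (if i = i0 then \<one> else \<zero>)" if "i:insert m I" for i
  proof (cases "i = m")
   case True
   then show ?thesis using f(2) g'(2) em gm Fm False by (simp add: minus_eq r_neg)
  next
   case F2: False
   then have "i:I" using that by auto
   then show ?thesis using f(2) g'(2) ei gm Fm F(2)[OF i0] by (simp add: minus_eq)
  qed
  then show ?thesis using f(1) by blast
 qed
qed

end

lemma (in ring) ideal_test:
 assumes "J <= carrier R" "\<zero>:J" "!!x y. x:J==>y:J==>x \<oplus> y:J"
  "!!a x. x:J==>a:.R==>a \<otimes> x:J" "!!a x. x:J==>a:.R==>x \<otimes> a:J"
 shows "ideal J R"
proof (rule idealI[OF ring_axioms])
 show "subgroup J (add_monoid R)"
 proof (rule add.subgroupI)
  fix x assume x: "x:J"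
  then have "(\<ominus> \<one>) \<otimes> x:J" by (intro assms(4)) auto
  moreover have "(\<ominus> \<one>) \<otimes> x = \<ominus> x" using x assms(1) by (auto simp: l_minus)
  ultimately show "\<ominus> x:J" by simp
 qed (use assms in auto)
qed (use assms in auto)

text \<open>The values at \<open>x\<close> of all sandwich operators form the two-sided ideal
  generated by \<open>x\<close>, which by simplicity contains the unit.\<close>

lemma simple_ring_sw:
 assumes "simple_ring R" "x:.R" "x ~= 0[R]"
 shows "EX f:sw R (carrier R). f x = 1[R]"
proof -
 interpret ring R by (rule conjunct1[OF assms(1)[unfolded simple_ring_def]])
 interpret sandwich R "carrier R" by unfold_locales auto
 let ?J = "{f x | f. f:sw R (carrier R)}"
 have "ideal ?J R"
 proof (rule ideal_test)
  show "?J <= carrier R" using sw_closed assms(2) by auto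
  have "0[R]*[R]x*[R]1[R]:?J" 
   by (intro CollectI exI[of _ "%x. 0[R]*[R]x*[R]1[R]"] conjI refl sw.base) auto
  then show "0[R]:?J" using assms(2) by simp
  fix y z assume "y:?J" "z:?J"
  then obtain f g where "f:sw R (carrier R)" "g:sw R (carrier R)" "y = f x" "z = g x" by blast
  then show "y+[R]z:?J" by (intro CollectI exI[of _ "%x. f x+[R]g x"] conjI sw.add) auto
 next
  fix a y assume y: "y:?J" and a: "a:.R"
  then obtain f where f: "f:sw R (carrier R)" "y = f x" by blast
  obtain g where "g:sw R (carrier R)" "g x = a*[R]f x" using sw_left[OF f(1) a] assms(2) by blast
  then show "a*[R]y:?J" unfolding f(2) by (intro CollectI exI[of _ g]) auto
  obtain g where "g:sw R (carrier R)" "g x = f x*[R]a" using sw_right[OF f(1) a] assms(2) by blast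
  then show "y*[R]a:?J" unfolding f(2) by (intro CollectI exI[of _ g]) auto
 qed
 then have J: "?J = {0[R]} | ?J = carrier R" using assms(1)[unfolded simple_ring_def] by blast
 obtain g where "g:sw R (carrier R)" "g x = x" using sw_id assms(2) by blast
 then have "x:?J" by (intro CollectI exI[of _ g]) auto
 then have "?J = carrier R" using J assms(3) by auto
 then have "1[R]:?J" by auto
 then obtain f where "1[R] = f x" "f:sw R (carrier R)" by (elim CollectE exE conjE)
 then show ?thesis by (intro bexI[of _ f]) auto
qed

text \<open>The coordinate functionals of \<open>e\<close>, with values in the scalars, are realised
  by two-sided multiplication. For a basis this is equivalent to central simplicity, and unlike a
  statement about ideals and centres it passes visibly to tensor products, opposites and base
  changes.\<close>

definition azumaya :: "('a, 'b, 'n) module_scheme=>'i set=>('i=>'b)=>bool" where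
 "azumaya A I e \<longleftrightarrow> 1[A] ~= 0[A] & (ALL i:I. EX f:sw A (carrier A). ALL j:I. f (e j) = (if j = i then 1[A] else 0[A]))"

context assoc_algebra
begin

sublocale sandwich A "carrier A" by unfold_locales auto

lemma sw_hom: "f:sw A (carrier A)==>f:module_hom K A A"
proof (induction rule: sw.induct)
 case (base a s)
 show ?case by (rule module_hom_comp[OF left_mult_hom[OF base(1)] right_mult_hom[OF base(2)]])
next
 case (add f g)
 note D = module_homD[OF add.IH(1)] module_homD[OF add.IH(2)]
 show ?case by (rule module_homI) (simp_all add: D smult_r_distr M.a_ac)
qed

lemma scalar_mult: "k:.K==>x:.A==>x*[A](k*.[A]1[A]) = k*.[A]x"
 "k:.K==>x:.A==>(k*.[A]1[A])*[A]x = k*.[A]x"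
 by (simp_all add: smult_mult_right smult_mult_left)

lemma scalar_central: "k:.K==>k*.[A]1[A]:ring_center A"
 by (simp add: ring_center_def scalar_mult)

lemma smult_eq_zero:
 assumes "k:.K" "x:.A" "k*.[A]x = 0[A]"
 shows "k = 0[K] | x = 0[A]"
proof (rule disjCI)
 assume x: "x ~= 0[A]"
 show "k = 0[K]"
 proof (rule ccontr)
  assume "k ~= 0[K]"
  then have "k:Units K" using assms(1) field_Units by auto
  then have i: "inv\<^bsub>K\<^esub> k:.K" "inv\<^bsub>K\<^esub> k*[K]k = 1[K]" by auto
  have "x = (inv\<^bsub>K\<^esub> k*[K]k)*.[A]x" using i(2) assms(2) by simp
  also have "... = 0[A]" using i(1) assms by (simp add: smult_assoc1)
  finally show False using x by simp
 qed
qed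

lemma csa_azumaya:
 assumes csa: "csa K A" and e: "basis_family K A I e"
 shows "azumaya A I e"
proof -
 have sr: "simple_ring A" and ce: "ring_center A = {k*.[A]1[A] | k. k:.K}" using csa by (auto simp: central_simple_algebra_def)
 have nz: "1[A] ~= 0[A]"
 proof
  assume 0: "1[A] = 0[A]"
  have "x = 0[A]" if "x:.A" for x using l_one[OF that] l_null[OF that] 0 by simp
  then have "carrier A = {0[A]}" by auto
  then show False using sr by (simp add: simple_ring_def)
 qed
 note eD = basis_familyD[OF e]
 \<comment> \<open>With the whole ring for \<open>S\<close> the centraliser is the centre, hence the
   scalars, and independence over it is ordinary linear independence.\<close>
 have "rindep I e" unfolding rindep_def
 proof (intro ballI impI)
  fix z i assume z: "z:I \<rightarrow> C" "(\<Oplus>[A]i:I. e i*[A]z i) = 0[A]" and i: "i:I"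
  have "ALL i:I. EX k. k:.K & z i = k*.[A]1[A]"
  proof
   fix i assume "i:I"
   then have "z i:ring_center A" using z(1) by (auto simp: ring_center_def)
   then show "EX k. k:.K & z i = k*.[A]1[A]" using ce by blast
  qed
  then obtain k where k: "!!i. i:I==>k i:.K" "!!i. i:I==>z i = k i*.[A]1[A]" unfolding bchoice_iff by blast
  have "lc A I k e = (\<Oplus>[A]i:I. e i*[A]z i)" unfolding lc_def
   by (rule M.fcong) (simp_all add: k eD scalar_mult)
  then have "lc A I k e = 0[A]" using z(2) by simp
  moreover have "k:I->.K" using k(1) by auto
  ultimately have "k i = 0[K]" using e i unfolding basis_family_def indep_family_def by blast
  then show "z i = 0[A]" using k(2)[OF i] by simp
 qed
 then show ?thesis unfolding azumaya_def
  using density[OF simple_ring_sw[OF sr] nz eD(1,2)] nz by blast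
qed

lemma azumaya_coord:
 assumes e: "basis_family K A I e" and f: "f:sw A (carrier A)" "!!j. j:I==>f (e j) = (if j = i then 1[A] else 0[A])"
  and i: "i:I" and x: "x:.A"
 shows "f x = coord K A I e x i*.[A]1[A]"
 by (rule module_hom_eqI[OF vs vs sw_hom[OF f(1)] _ e _ x])
  (use f(2) i in "auto intro!: module_homI simp: coord_closed[OF e] coord_add[OF e] coord_smult[OF e] smult_l_distr smult_assoc1 coord_basis[OF e] basis_familyD[OF e]")

lemma central_sw:
 assumes "f:sw A (carrier A)" "z:ring_center A" "x:.A"
 shows "f (z*[A]x) = z*[A]f x"
 using assms(1)
proof (induction rule: sw.induct)
 case (base a s)
 have z: "z:.A" "a*[A]z = z*[A]a" using assms(2) base by (auto simp: ring_center_def)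
 have "a*[A](z*[A]x) = (a*[A]z)*[A]x" by (rule m_assoc[symmetric]) (use z(1) base assms(3) in auto)
 also have "... = z*[A](a*[A]x)" unfolding z(2) using z(1) base assms(3) by (simp add: m_assoc)
 finally have "a*[A](z*[A]x) = z*[A](a*[A]x)" .
 then have "a*[A](z*[A]x)*[A]s = z*[A](a*[A]x)*[A]s" by simp
 also have "... = z*[A](a*[A]x*[A]s)" by (rule m_assoc) (use z base assms(3) in auto)
 finally show ?case .
next
 case (add f g)
 have "z:.A" using assms(2) by (simp add: ring_center_def)
 then show ?case using add sw_closed assms(3) by (simp add: r_distr)
qed

text \<open>An operator extracting a nonzero coordinate puts a nonzero scalar into any nonzero
  ideal. For a central z, an operator f extracting a coordinate that does not vanish at 1 commutes
  with multiplication by z; comparing f(z) with z f(1) makes z a scalar.\<close>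

lemma azumaya_csa:
 assumes az: "azumaya A I e" and e: "basis_family K A I e"
 shows "csa K A"
proof -
 note eD = basis_familyD[OF e]
 have nz: "1[A] ~= 0[A]" using az by (simp add: azumaya_def)
 have nzc: "EX i:I. coord K A I e x i ~= 0[K]" if x: "x:.A" "x ~= 0[A]" for x
 proof (rule ccontr)
  assume "~ ?thesis"
  then have "lc A I (coord K A I e x) e = 0[A]" by (intro lc_zero[OF eD(2)]) auto
  then show False using coord_props(2)[OF e x(1)] x(2) by simp
 qed
 have fx: "EX f:sw A (carrier A). ALL x:carrier A. f x = coord K A I e x i*.[A]1[A]" if i: "i:I" for i
 proof -
  obtain f where "f:sw A (carrier A)" "!!j. j:I==>f (e j) = (if j = i then 1[A] else 0[A])" using az i unfolding azumaya_def by blast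
  then show ?thesis using azumaya_coord[OF e _ _ i] by blast
 qed
 have "simple_ring A" unfolding simple_ring_def
 proof (intro conjI allI impI)
  show "ring A" by (rule alg_ring)
  show "carrier A ~= {0[A]}" using nz one_closed by auto
  fix J assume J: "ideal J A"
  interpret J: ideal J A by fact
  show "J = {0[A]} | J = carrier A"
  proof (cases "J = {0[A]}")
   case False
   then obtain x where x: "x:J" "x ~= 0[A]" using J.zero_closed by blast
   have xc: "x:.A" using x(1) by (rule J.a_Hcarr)
   obtain i where i: "i:I" "coord K A I e x i ~= 0[K]" using nzc[OF xc x(2)] by blast
   let ?k = "coord K A I e x i"
   have k: "?k:.K" by (rule coord_closed[OF e xc i(1)])
   then have "?k:Units K" using i(2) field_Units by auto
   then have inv: "inv\<^bsub>K\<^esub> ?k:.K" "inv\<^bsub>K\<^esub> ?k*[K]?k = 1[K]" by auto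
   obtain f where f: "f:sw A (carrier A)" "f x = ?k*.[A]1[A]" using fx[OF i(1)] xc by blast
   have "?k*.[A]1[A]:J" using sw_ideal[OF J f(1) x(1)] f(2) by simp
   then have "(inv\<^bsub>K\<^esub> ?k*.[A]1[A])*[A](?k*.[A]1[A]):J" by (rule J.I_l_closed) (simp add: inv)
   moreover have "(inv\<^bsub>K\<^esub> ?k*.[A]1[A])*[A](?k*.[A]1[A]) = 1[A]"
    using inv k by (simp add: scalar_mult smult_assoc1[symmetric] R.m_comm[OF k inv(1)])
   ultimately show ?thesis using J.one_imp_carrier by simp
  qed simp
 qed
 moreover have "ring_center A = {k*.[A]1[A] | k. k:.K}"
 proof
  show "{k*.[A]1[A] | k. k:.K} <= ring_center A" using scalar_central by auto
  show "ring_center A <= {k*.[A]1[A] | k. k:.K}"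
  proof
   fix z assume z: "z:ring_center A"
   then have zc: "z:.A" by (simp add: ring_center_def)
   obtain i where i: "i:I" "coord K A I e 1[A] i ~= 0[K]" using nzc[OF one_closed nz] by blast
   let ?k = "coord K A I e 1[A] i" and ?l = "coord K A I e z i"
   have k: "?k:.K" "?l:.K" using coord_closed[OF e _ i(1)] zc by auto
   then have "?k:Units K" using i(2) field_Units by auto
   then have inv: "inv\<^bsub>K\<^esub> ?k:.K" "inv\<^bsub>K\<^esub> ?k*[K]?k = 1[K]" by auto
   obtain f where f: "f:sw A (carrier A)" "f 1[A] = ?k*.[A]1[A]" "f z = ?l*.[A]1[A]" using fx[OF i(1)] zc by blast
   have "?l*.[A]1[A] = ?k*.[A]z"
    using central_sw[OF f(1) z one_closed] f(2,3) zc k by (simp add: scalar_mult)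
   then have "inv\<^bsub>K\<^esub> ?k*.[A](?l*.[A]1[A]) = inv\<^bsub>K\<^esub> ?k*.[A](?k*.[A]z)" by simp
   then have "(inv\<^bsub>K\<^esub> ?k*[K]?l)*.[A]1[A] = z" using inv k zc by (simp add: smult_assoc1[symmetric])
   then show "z:{k*.[A]1[A] | k. k:.K}" using inv k by (intro CollectI exI[of _ "inv\<^bsub>K\<^esub> ?k*[K]?l"]) auto
  qed
 qed
 ultimately show ?thesis unfolding central_simple_algebra_def
  using basis_family_dim(1)[OF e] assoc_algebra_axioms by blast
qed

end

section \<open>Central simple algebras under the standard constructions\<close>

context tensor
begin

lemma iota_zero_left: "b:.B==>\<iota> 0[A] b = 0[T]"
 using iota_smult_left[of "0[K]" "0[A]" b] by (simp add: iota_closed)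

lemma iota_zero_right: "a:.A==>\<iota> a 0[B] = 0[T]"
 using iota_smult_right[of "0[K]" a "0[B]"] by (simp add: iota_closed)

lemma sw_lift_left:
 assumes "f:sw A (carrier A)"
 shows "EX F:sw T (carrier T). ALL a:carrier A. ALL b:carrier B. F (\<iota> a b) = \<iota> (f a) b"
 using assms
proof (induction rule: sw.induct)
 case (base a s)
 show ?case
  by (rule bexI[OF _ sw.base[of "\<iota> a 1[B]" T "\<iota> s 1[B]"]]) (use base in "auto simp: iota_mult iota_closed")
next
 case (add f g)
 then obtain F G where *: "F:sw T (carrier T)" "G:sw T (carrier T)" "ALL a:carrier A. ALL b:carrier B. F (\<iota> a b) = \<iota> (f a) b"
  "ALL a:carrier A. ALL b:carrier B. G (\<iota> a b) = \<iota> (g a) b" by blast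
 show ?case
  by (rule bexI[OF _ sw.add[OF *(1,2)]]) (use * add.hyps A.sw_closed in "auto simp: iota_add_left")
qed

lemma sw_lift_right:
 assumes "f:sw B (carrier B)"
 shows "EX F:sw T (carrier T). ALL a:carrier A. ALL b:carrier B. F (\<iota> a b) = \<iota> a (f b)"
 using assms
proof (induction rule: sw.induct)
 case (base b s)
 show ?case
  by (rule bexI[OF _ sw.base[of "\<iota> 1[A] b" T "\<iota> 1[A] s"]]) (use base in "auto simp: iota_mult iota_closed")
next
 case (add f g)
 then obtain F G where *: "F:sw T (carrier T)" "G:sw T (carrier T)" "ALL a:carrier A. ALL b:carrier B. F (\<iota> a b) = \<iota> a (f b)"
  "ALL a:carrier A. ALL b:carrier B. G (\<iota> a b) = \<iota> a (g b)" by blast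
 show ?case
  by (rule bexI[OF _ sw.add[OF *(1,2)]]) (use * add.hyps B.sw_closed in "auto simp: iota_add_right")
qed

end

context tensor_basis
begin

lemma exists_coord_one:
 assumes "1[A] ~= 0[A]"
 obtains i where "i:I" "co 1[A] i ~= 0[K]"
proof -
 have "EX i:I. co 1[A] i ~= 0[K]"
 proof (rule ccontr)
  assume "~ ?thesis"
  then have "lc A I (co 1[A]) e = 0[A]" by (intro A.lc_zero[OF basis_familyD(2)[OF e]]) auto
  then show False using A.coord_props(2)[OF e A.one_closed] assms by simp
 qed
 then show ?thesis using that by blast
qed

text \<open>Some coordinate of the unit is nonzero, and expanding 1 \<otimes> b in the basis of
  \<open>A\<close> exhibits that multiple of \<open>b\<close>. In particular the tensor product of
  nonzero algebras is nonzero.\<close>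

lemma iota_one_inj:
 assumes nz: "1[A] ~= 0[A]" and b: "b:.B" and z: "\<iota> 1[A] b = 0[T]"
 shows "b = 0[B]"
proof -
 obtain i where i: "i:I" "co 1[A] i ~= 0[K]" using exists_coord_one[OF nz] by blast
 have "co 1[A] i*.[B]b = 0[B]"
  by (rule tensor_indep[of "%i. co 1[A] i*.[B]b", OF _ _ i(1)])
   (use iota_expand[OF A.one_closed b] z b A.coord_closed[OF e A.one_closed] in auto)
 then show ?thesis using B.smult_eq_zero[OF A.coord_closed[OF e A.one_closed i(1)] b] i(2) by blast
qed

text \<open>Sandwich operators of the two factors act separately on pure tensors, so the composite
  of the lifted dual operators is dual for the pair of indices.\<close>

lemma azumaya_tensor:
 assumes A: "azumaya A I e" and B: "azumaya B J' f" and f: "f:J'->.B"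
 shows "azumaya T (I \<times> J') (%p. \<iota> (e (fst p)) (f (snd p)))"
 unfolding azumaya_def
proof (intro conjI ballI)
 have nz: "1[A] ~= 0[A]" "1[B] ~= 0[B]" using A B by (auto simp: azumaya_def)
 then show "1[T] ~= 0[T]" using iota_one_inj[OF nz(1) B.one_closed] iota_one by auto
 fix p assume p: "p:I \<times> J'"
 obtain g where g: "g:sw A (carrier A)" "ALL i:I. g (e i) = (if i = fst p then 1[A] else 0[A])" using A p unfolding azumaya_def by auto
 obtain h where h: "h:sw B (carrier B)" "ALL j:J'. h (f j) = (if j = snd p then 1[B] else 0[B])" using B p unfolding azumaya_def by auto
 obtain G where G: "G:sw T (carrier T)" "ALL a:carrier A. ALL b:carrier B. G (\<iota> a b) = \<iota> (g a) b" using sw_lift_left[OF g(1)] by blast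
 obtain H where H: "H:sw T (carrier T)" "ALL a:carrier A. ALL b:carrier B. H (\<iota> a b) = \<iota> a (h b)" using sw_lift_right[OF h(1)] by blast
 obtain X where X: "X:sw T (carrier T)" "ALL x:carrier T. X x = G (H x)" using T.sw_comp[OF G(1) H(1)] by blast
 have "X (\<iota> (e (fst q)) (f (snd q))) = (if q = p then 1[T] else 0[T])" if q: "q:I \<times> J'" for q
 proof -
  have ef: "e (fst q):.A" "f (snd q):.B" using q basis_familyD(3)[OF e] f by auto
  have "X (\<iota> (e (fst q)) (f (snd q))) = \<iota> (g (e (fst q))) (h (f (snd q)))" using X(2) G(2) H(2) ef B.sw_closed[OF h(1)] by (simp add: iota_closed)
  then show ?thesis using g(2) h(2) q iota_one by (auto simp: prod_eq_iff iota_zero_left iota_zero_right)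
 qed
 then show "EX f':sw T (carrier T). ALL q:I \<times> J'. f' (\<iota> (e (fst q)) (f (snd q))) = (if q = p then 1[T] else 0[T])" using X(1) by blast
qed

end

lemma csaD:
 assumes "csa K A"
 shows "assoc_algebra K A" "vectorspace.fin_dim K A" "simple_ring A" "ring_center A = {k*.[A]1[A] | k. k:.K}"
 using assms by (auto simp: central_simple_algebra_def)

lemma csa_has_sc:
 assumes "csa K A"
 obtains e c where "has_sc K A {..<vdim K A} e c"
proof -
 interpret A: assoc_algebra K A by (rule csaD(1)[OF assms])
 obtain e where "basis_family K A {..<A.dim} e" using A.basis_family_exists csaD(2)[OF assms] by blast
 then show ?thesis using that has_sc_exists[OF csaD(1)[OF assms]] by blast
qed

lemma csa_tensor:
 assumes A: "csa K A" and B: "csa K B"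
 shows "csa K (tensor_algebra K A B)"
proof -
 obtain e c where sc: "has_sc K A {..<vdim K A} e c" by (rule csa_has_sc[OF A])
 obtain f d where f: "has_sc K B {..<vdim K B} f d" by (rule csa_has_sc[OF B])
 note eD = has_scD[OF sc] and fD = has_scD[OF f]
 interpret tensor_basis K A B "{..<vdim K A}" e
  by (intro tensor_basis.intro tensor.intro csaD(1)[OF A] csaD(1)[OF B] tensor_basis_axioms.intro eD(1))
 show ?thesis by (rule T.azumaya_csa[OF azumaya_tensor[OF A.csa_azumaya[OF A eD(1)] B.csa_azumaya[OF B fD(1)] fD(3)] tensor_basis_family[OF fD(1)]])
qed

lemma sw_cong: "f:sw R (carrier R)==>carrier R = carrier R'==>mult R = mult R'==>add R = add R'==>f:sw R' (carrier R')"
 by (induction rule: sw.induct) (auto intro: sw.intros)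

text \<open>Base change has the ring structure of the tensor product and differs only in its
  scalars. Sandwich operators refer to the ring structure alone, so the dual operators of
  \<open>A\<close> can be lifted and reused.\<close>

lemma csa_base_change:
 assumes A: "csa K A" and L: "field L" and h: "h:ring_hom K L"
 shows "csa L (base_change K L h A)"
proof -
 obtain e c where sc: "has_sc K A {..<vdim K A} e c" by (rule csa_has_sc[OF A])
 note eD = has_scD[OF sc]
 interpret A: assoc_algebra K A by (rule csaD(1)[OF A])
 interpret L: field L by fact
 interpret tensor_basis K A "algebra_via L h" "{..<vdim K A}" e
  by (intro tensor_basis.intro tensor.intro csaD(1)[OF A] algebra_via_alg A.field_axioms L.cring_axioms h tensor_basis_axioms.intro eD(1))
 have az: "azumaya A {..<vdim K A} e" by (rule A.csa_azumaya[OF A eD(1)])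
 let ?BC = "base_change K L h A"
 interpret BC: assoc_algebra L ?BC by (rule base_change_alg[OF csaD(1)[OF A] L h])
 have sel: "carrier T = carrier ?BC" "mult T = mult ?BC" "add T = add ?BC" "1[T] = 1[?BC]" "0[T] = 0[?BC]" by (simp_all add: base_change_def)
 have o: "1[L]:.(algebra_via L h)" "1[L] = 1[algebra_via L h]" by (simp_all add: algebra_via_def)
 have "azumaya ?BC {..<vdim K A} (%i. \<iota> (e i) 1[L])" unfolding azumaya_def
 proof (intro conjI ballI)
  have "1[A] ~= 0[A]" using az by (simp add: azumaya_def)
  then show "1[?BC] ~= 0[?BC]" using iota_one_inj[OF _ B.one_closed] iota_one L.one_not_zero unfolding sel[symmetric] by (auto simp: algebra_via_def)
  fix i assume "i:{..<vdim K A}"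
  then obtain g where g: "g:sw A (carrier A)" "ALL j:{..<vdim K A}. g (e j) = (if j = i then 1[A] else 0[A])" using az unfolding azumaya_def by auto
  obtain G where G: "G:sw T (carrier T)" "ALL a:carrier A. ALL b:carrier (algebra_via L h). G (\<iota> a b) = \<iota> (g a) b" using sw_lift_left[OF g(1)] by blast
  have "G (\<iota> (e j) 1[L]) = (if j = i then 1[?BC] else 0[?BC])" if "j:{..<vdim K A}" for j
  proof -
   have "e j:.A" using eD(3) that by auto
   then have "G (\<iota> (e j) 1[L]) = \<iota> (g (e j)) 1[L]" using G(2) o(1) by blast
   then show ?thesis using bspec[OF g(2) that] iota_one iota_zero_left[OF o(1)] unfolding sel[symmetric] o(2) by (cases "j = i") simp_all
  qed
  then show "EX f:sw ?BC (carrier ?BC). ALL j:{..<vdim K A}. f (\<iota> (e j) 1[L]) = (if j = i then 1[?BC] else 0[?BC])"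
   using sw_cong[OF G(1) sel(1-3)] by blast
 qed
 then show ?thesis by (rule BC.azumaya_csa[OF _ has_scD(1)[OF has_sc_base_change[OF csaD(1)[OF A] L h sc]]])
qed

lemma csa_opp:
 assumes A: "csa K A"
 shows "csa K (opp A)"
proof -
 interpret A: assoc_algebra K A by (rule csaD(1)[OF A])
 interpret O: assoc_algebra K "opp A" by (rule opp_alg[OF csaD(1)[OF A]])
 obtain e c where e: "has_sc K A {..<vdim K A} e c" by (rule csa_has_sc[OF A])
 have az: "azumaya A {..<vdim K A} e" by (rule A.csa_azumaya[OF A has_scD(1)[OF e]])
 have ek: "!!j. j:{..<vdim K A}==>e j:.A" using has_scD(3)[OF e] by auto
 have lift: "EX g:sw (opp A) (carrier (opp A)). ALL x:carrier A. g x = f x" if "f:sw A (carrier A)" for f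
  using that
 proof (induction rule: sw.induct)
  case (base a s)
  show ?case by (rule bexI[OF _ sw.base[of s "opp A" a]]) (use base in "auto simp: opp_sel A.m_assoc")
 next
  case (add f f')
  then obtain g g' where *: "g:sw (opp A) (carrier (opp A))" "g':sw (opp A) (carrier (opp A))" "ALL x:carrier A. g x = f x" "ALL x:carrier A. g' x = f' x" by blast
  show ?case by (rule bexI[OF _ sw.add[OF *(1,2)]]) (use * in "auto simp: opp_sel")
 qed
 have "azumaya (opp A) {..<vdim K A} e" unfolding azumaya_def opp_sel(3,4)
 proof (intro conjI ballI)
  show "1[A] ~= 0[A]" using az by (simp add: azumaya_def)
  fix i assume i: "i:{..<vdim K A}"
  obtain f where f: "f:sw A (carrier A)" "ALL j:{..<vdim K A}. f (e j) = (if j = i then 1[A] else 0[A])"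
   using az i unfolding azumaya_def by blast
  obtain g where g: "g:sw (opp A) (carrier (opp A))" "ALL x:carrier A. g x = f x" using lift[OF f(1)] by blast
  show "EX f:sw (opp A) (carrier (opp A)). ALL j:{..<vdim K A}. f (e j) = (if j = i then 1[A] else 0[A])"
   using g f(2) ek by (intro bexI[OF _ g(1)]) auto
 qed
 then show ?thesis by (rule O.azumaya_csa) (rule has_scD(1)[OF has_sc_opp[OF e]])
qed

lemma csa_self:
 assumes "field K"
 shows "csa K (algebra_via K (%k. k))"
proof -
 interpret S: assoc_algebra K "algebra_via K (%k. k)" by (rule self_alg[OF assms])
 have "azumaya (algebra_via K (%k. k)) {()} (%_. 1[K])" unfolding azumaya_def
 proof (intro conjI ballI)
  show "1[algebra_via K (%k. k)] ~= 0[algebra_via K (%k. k)]" using S.one_not_zero by (simp add: algebra_via_def)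
  fix i :: unit
  obtain g where "g:sw (algebra_via K (%k. k)) (carrier (algebra_via K (%k. k)))" "ALL x:carrier (algebra_via K (%k. k)). g x = x" using S.sw_id by blast
  then show "EX f:sw (algebra_via K (%k. k)) (carrier (algebra_via K (%k. k))). ALL j:{()}. f 1[K] =
     (if j = i then 1[algebra_via K (%k. k)] else 0[algebra_via K (%k. k)])"
   by (intro bexI[of _ g]) (auto simp: algebra_via_def)
 qed
 then show ?thesis by (rule S.azumaya_csa) (rule has_scD(1)[OF has_sc_self[OF assms]])
qed

section \<open>Full matrix algebras over the base field\<close>

abbreviation self :: "('a, 'm) ring_scheme=>('a, 'a) module" where "self K \<equiv> algebra_via K (%k. k)"

lemma mat_ring_self [simp]: "MR (algebra_via K h) n = MR K n"
 by (simp add: mat_ring_def algebra_via_def cong: if_cong)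

lemma (in field) mat_self_ring: "ring (MR R n)" by (rule mat_ring_ring)

lemma mat_self_sel:
 "carrier (MA (self K) n) = carrier (MR K n)" "mult (MA (self K) n) = mult (MR K n)"
 "one (MA (self K) n) = one (MR K n)" "zero (MA (self K) n) = zero (MR K n)"
 "finsum (MA (self K) n) = finsum (MR K n)"
 "k*.[MA (self K) n]M = (\<lambda>p\<in>sq n. k*[K]M p)"
 by (simp_all add: mat_algebra_def) (simp add: algebra_via_def)

lemma mat_self_alg: "field K==>assoc_algebra K (MA (self K) n)"
 by (rule mat_algebra_alg[OF self_alg])

lemma mat_self_lc:
 assumes K: "field K" and m: "m:P->.(MR K n)" and t: "t:P->.K" and p: "p:sq n"
 shows "lc (MA (self K) n) P t m p = (\<Oplus>[K]s:P. t s*[K]m s p)"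
proof -
 interpret field K by fact
 have c: "!!s. s:P==>t s:.K" "!!s q. s:P==>q:sq n==>m s q:.K" using t m mat_entry' by fastforce+
 have "lc (MA (self K) n) P t m p = (\<Oplus>[K]s:P. (t s*.[MA (self K) n]m s) p)"
  unfolding lc_def mat_self_sel(5)
 proof (rule mat_finsum_entry[OF p])
  fix s assume "s:P"
  then show "t s*.[MA (self K) n]m s:.(MR K n)" using c by (auto simp: mat_self_sel mat_ring_sel)
 qed
 also have "... = (\<Oplus>[K]s:P. t s*[K]m s p)"
  by (rule fcong) (use c p in "auto simp: mat_self_sel")
 finally show ?thesis .
qed

lemma mat_self_dim:
 assumes "field K"
 shows "vdim K (MA (self K) n) = n * n" "vectorspace.fin_dim K (MA (self K) n)"
proof -
 interpret M: assoc_algebra K "MA (self K) n" by (rule mat_self_alg[OF assms])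
 note b = has_scD(1)[OF has_sc_mat[OF self_alg[OF assms] has_sc_self[OF assms]]]
 show "M.dim = n * n" using M.basis_family_dim(2)[OF b] by simp
 show "M.fin_dim" by (rule M.basis_family_dim(1)[OF b])
qed

lemma csa_mat_self:
 assumes K: "field K" and n: "n >= 1"
 shows "csa K (MA (self K) n)"
proof -
 interpret K: field K by fact
 let ?M = "MA (self K) n" and ?R = "MR K n"
 interpret M: assoc_algebra K ?M by (rule mat_self_alg[OF K])
 interpret R: ring ?R by (rule K.mat_self_ring)
 let ?E = "%p. munit K n p 1[K]"
 have Ec: "!!p. ?E p:.?M" by (simp add: mat_self_sel K.munit_closed)
 have Em: "?E p*[?M]?E q = (if snd p = fst q then ?E (fst p,snd q) else 0[?M])" if "p:sq n" "q:sq n" for p q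
  using K.munit_mult[OF K.one_closed K.one_closed that] by (simp add: mat_self_sel)
 note b = has_scD(1)[OF has_sc_mat[OF self_alg[OF K] has_sc_self[OF K],of n]]
 have mE: "munit (self K) n p x = munit K n p x" for p x by (simp add: munit_def algebra_via_def cong: if_cong)
 have "azumaya ?M (sq n \<times> {()}) (%p. munit (self K) n (fst p) 1[K])" unfolding azumaya_def mE
 proof (intro conjI ballI)
  show nz: "1[?M] ~= 0[?M]"
  proof
   assume "1[?M] = 0[?M]"
   then have "1[?M] (0,0) = 0[?M] (0,0)" by simp
   then show False using n K.one_not_zero by (simp add: mat_self_sel mat_ring_sel)
  qed
  fix i assume "i:sq n \<times> {()}"
  then obtain p q where pq: "i = ((p,q),())" "p < n" "q < n" by auto
  \<comment> \<open>The operator x \<mapsto> \<Sum> E_(r,p) x E_(q,r), summed over r, returns the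
    (p,q) entry of x times the identity, which is the dual operator wanted.\<close>
  have "EX h:sw ?M (carrier ?M). ALL x:carrier ?M. h x = (\<Oplus>[?M]r:{..<n}. ?E (r,p)*[?M](1[?M]*[?M]x*[?M]?E (q,r)))"
   by (rule M.sw_sum) (auto intro!: sw.base Ec)
  then obtain h where h: "h:sw ?M (carrier ?M)" "ALL x:carrier ?M. h x = (\<Oplus>[?M]r:{..<n}. ?E (r,p)*[?M](1[?M]*[?M]x*[?M]?E (q,r)))" by blast
  have "h (?E (fst j)) = (if j = i then 1[?M] else 0[?M])" if "j:sq n \<times> {()}" for j
  proof -
   obtain p' q' where j: "j = ((p',q'),())" "p' < n" "q' < n" using \<open>j:sq n \<times> {()}\<close> by auto
   have "h (?E (fst j)) = (\<Oplus>[?M]r:{..<n}. if j = i then ?E (r,r) else 0[?M])"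
    unfolding bspec[OF h(2) Ec]
   proof (rule M.M.fcong)
    show "(%r. if j = i then ?E (r,r) else 0[?M]):{..<n}->.?M" using Ec by auto
    fix r assume "r:{..<n}"
    then have r: "(r,p):sq n" "(q,r):sq n" "(p',q'):sq n" "(p',r):sq n" using pq j by auto
    have "?E (r,p)*[?M](1[?M]*[?M]?E (fst j)*[?M]?E (q,r)) = ?E (r,p)*[?M](?E (p',q')*[?M]?E (q,r))"
     using Ec by (simp add: j)
    also have "... = (if j = i then ?E (r,r) else 0[?M])"
     using Em[OF r(3,2)] Em[OF r(1,4)] Ec[of "(r,p)"] pq j by auto
    finally show "?E (r,p)*[?M](1[?M]*[?M]?E (fst j)*[?M]?E (q,r)) = (if j = i then ?E (r,r) else 0[?M])" .
   qed
   also have "... = (if j = i then 1[?M] else 0[?M])"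
   proof (cases "j = i")
    case True
    have "(\<Oplus>[?R]r:{..<n}. ?E (r,r)) = 1[?R]"
    proof (rule mat_eqI[where R = K and n = n])
     show "(\<Oplus>[?R]r:{..<n}. ?E (r,r)):.?R" by (rule R.finsum_closed) (simp add: K.munit_closed)
     show "1[?R]:.?R" by simp
     fix a b assume ab: "a < n" "b < n"
     have "(\<Oplus>[?R]r:{..<n}. ?E (r,r)) (a,b) = (\<Oplus>[K]r:{..<n}. ?E (r,r) (a,b))"
      by (rule K.mat_finsum_entry) (use ab in "auto simp: K.munit_closed")
     also have "... = (\<Oplus>[K]r:{..<n}. if r = a then (if a = b then 1[K] else 0[K]) else 0[K])"
      by (rule K.fcong) (use ab in "auto simp: munit_def")
     also have "... = (if a = b then 1[K] else 0[K])" by (rule K.finsum_delta) (use ab in auto)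
     finally show "(\<Oplus>[?R]r:{..<n}. ?E (r,r)) (a,b) = 1[?R] (a,b)" using ab by (simp add: mat_ring_sel)
    qed
    then show ?thesis using True by (simp add: mat_self_sel)
   next
    case False
    then show ?thesis by (simp add: M.M.finsum_all_zero)
   qed
   finally show ?thesis .
  qed
  then show "EX f:sw ?M (carrier ?M). ALL j:sq n \<times> {()}. f (?E (fst j)) = (if j = i then 1[?M] else 0[?M])" using h(1) by blast
 qed
 then show ?thesis using M.azumaya_csa b by blast
qed

section \<open>Sandwich matrices\<close>

text \<open>The matrix of x \<mapsto> e_i x e_j, with the coordinates of the image of each basis
  vector in a row. In this convention matrix products compose from left to right, which reverses the
  multiplication of the left coefficients.\<close>

definition smat :: "('a, 'm) ring_scheme=>('a, 'b, 'n) module_scheme=>nat=>(nat=>'b)=>nat \<times> nat=>nat \<times> nat=>'a" where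
 "smat K A N e p = (\<lambda>q\<in>sq N. coord K A {..<N} e (e (fst p)*[A]e (fst q)*[A]e (snd p)) (snd q))"

text \<open>Linear independence of the N^2 operators x \<mapsto> e_i x e_j, or injectivity of the
  map from opp(A) \<otimes> A to the endomorphisms of A. A count of dimensions makes it as strong as
  \<open>azumaya\<close>, but as the absence of solutions of linear equations it also passes down to
  a subfield.\<close>

definition sinj :: "('a, 'm) ring_scheme=>('a, 'b, 'n) module_scheme=>nat=>(nat=>'b)=>bool" where
 "sinj K A N e \<longleftrightarrow> (ALL t:sq N->.K.
   (ALL k<N. (\<Oplus>[A]p:sq N. t p*.[A](e (fst p)*[A]e k*[A]e (snd p))) = 0[A]) --> (ALL p:sq N. t p = 0[K]))"

locale based_algebra = assoc_algebra K A for K (structure) and A (structure) +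
 fixes N :: nat and e
 assumes e: "basis_family K A {..<N} e"
begin

abbreviation "co \<equiv> coord K A {..<N} e"
abbreviation "W \<equiv> MA (self K) N"

lemma ei: "i < N==>e i:.A" using basis_familyD[OF e] by auto

sublocale W: assoc_algebra K W by (rule mat_self_alg[OF field_axioms])

lemma trip: "i < N==>k < N==>j < N==>e i*[A]e k*[A]e j:.A" by (intro m_closed ei)

lemma smat_mem: "p:sq N==>smat K A N e p:.(MR K N)"
 unfolding smat_def mat_ring_sel by (auto intro!: coord_closed[OF e] trip)

lemma smat_lc:
 assumes t: "t:sq N->.K" and kl: "k < N" "l < N"
 shows "lc W (sq N) t (smat K A N e) (k,l) = co (\<Oplus>[A]p:sq N. t p*.[A](e (fst p)*[A]e k*[A]e (snd p))) l"
proof -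
 have tk: "!!p. p:sq N==>t p:.K" using t by auto
 have tr: "!!p. p:sq N==>e (fst p)*[A]e k*[A]e (snd p):.A" using trip kl by auto
 have "co (\<Oplus>[A]p:sq N. t p*.[A](e (fst p)*[A]e k*[A]e (snd p))) l = (\<Oplus>[K]p:sq N. co (t p*.[A](e (fst p)*[A]e k*[A]e (snd p))) l)"
  by (rule additive_finsum[of A K "%x. co x l", OF M.abelian_group_axioms R.abelian_group_axioms])
   (use kl coord_closed[OF e] coord_add[OF e] tk tr in auto)
 also have "... = (\<Oplus>[K]p:sq N. t p*[K]smat K A N e p (k,l))"
 proof (rule R.fcong)
  show "(%p. t p*[K]smat K A N e p (k,l)):sq N->.K" using tk mat_entry[OF smat_mem kl] by auto
  fix p assume p: "p:sq N"
  have "co (t p*.[A](e (fst p)*[A]e k*[A]e (snd p))) l = t p*[K]co (e (fst p)*[A]e k*[A]e (snd p)) l"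
   by (rule coord_smult[OF e tr[OF p] tk[OF p]]) (use kl in auto)
  then show "co (t p*.[A](e (fst p)*[A]e k*[A]e (snd p))) l = t p*[K]smat K A N e p (k,l)" using kl by (simp add: smat_def)
 qed
 also have "... = lc W (sq N) t (smat K A N e) (k,l)"
  by (rule mat_self_lc[symmetric,OF field_axioms _ t]) (use smat_mem kl in auto)
 finally show ?thesis by simp
qed

lemma sinj_basis:
 assumes "sinj K A N e"
 shows "basis_family K W (sq N) (smat K A N e)"
proof (rule W.indep_family_basis)
 show "W.fin_dim" "card (sq N) = W.dim" using mat_self_dim[OF field_axioms] by auto
 show "indep_family K W (sq N) (smat K A N e)" unfolding indep_family_def
 proof (intro conjI ballI impI)
  show "smat K A N e:sq N->.W" using smat_mem by (auto simp: mat_self_sel)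
  fix t p assume t: "t:sq N->.K" "lc W (sq N) t (smat K A N e) = 0[W]" "p:sq N"
  have tk: "!!p. p:sq N==>t p:.K" using t(1) by auto
  have "(\<Oplus>[A]p:sq N. t p*.[A](e (fst p)*[A]e k*[A]e (snd p))) = 0[A]" if k: "k < N" for k
  proof (rule coord_eqI[OF e])
   show "(\<Oplus>[A]p:sq N. t p*.[A](e (fst p)*[A]e k*[A]e (snd p))):.A"
    by (intro M.finsum_closed Pi_I smult_closed tk) (use trip k in auto)
   fix l assume l: "l:{..<N}"
   have "co 0[A] l = 0[K]" using coord_smult[OF e M.zero_closed R.zero_closed l] coord_closed[OF e M.zero_closed l] by simp
   moreover have "lc W (sq N) t (smat K A N e) (k,l) = 0[K]" using t(2) k l by (simp add: mat_self_sel mat_ring_sel)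
   ultimately show "co (\<Oplus>[A]p:sq N. t p*.[A](e (fst p)*[A]e k*[A]e (snd p))) l = co 0[A] l"
    using smat_lc[OF t(1) k,of l] l by simp
  qed simp
  then show "t p = 0[K]" using assms t(1,3) unfolding sinj_def by blast
 qed simp
qed

lemma sandwich_sum:
 assumes t: "t:sq N->.K"
 obtains h where "h:sw A (carrier A)" "ALL x:carrier A. h x = (\<Oplus>[A]p:sq N. t p*.[A](e (fst p)*[A]x*[A]e (snd p)))"
proof -
 have tk: "!!p. p:sq N==>t p:.K" using t by auto
 have "EX h:sw A (carrier A). ALL x:carrier A. h x = (\<Oplus>[A]p:sq N. (t p*.[A]e (fst p))*[A](1[A]*[A]x*[A]e (snd p)))"
  by (rule sw_sum) (use tk ei in "auto intro!: sw.base")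
 then obtain h where h: "h:sw A (carrier A)" "ALL x:carrier A. h x = (\<Oplus>[A]p:sq N. (t p*.[A]e (fst p))*[A](1[A]*[A]x*[A]e (snd p)))" by blast
 show ?thesis
 proof (rule that[OF h(1)],rule ballI)
  fix x assume x: "x:.A"
  show "h x = (\<Oplus>[A]p:sq N. t p*.[A](e (fst p)*[A]x*[A]e (snd p)))" unfolding bspec[OF h(2) x]
   by (rule M.fcong) (use tk ei x in "auto simp: smult_mult_left m_assoc")
 qed
qed

lemma azumaya_sinj:
 assumes "azumaya A {..<N} e"
 shows "sinj K A N e"
 unfolding sinj_def
proof (intro ballI impI)
 fix t p assume t: "t:sq N->.K" and p: "p:sq N"
  and z: "ALL k<N. (\<Oplus>[A]p:sq N. t p*.[A](e (fst p)*[A]e k*[A]e (snd p))) = 0[A]"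
 have tk: "!!p. p:sq N==>t p:.K" using t by auto
 obtain h where h: "h:sw A (carrier A)" "ALL x:carrier A. h x = (\<Oplus>[A]p:sq N. t p*.[A](e (fst p)*[A]x*[A]e (snd p)))" by (rule sandwich_sum[OF t])
 have h0: "h x = 0[A]" if x: "x:.A" for x
  by (rule module_hom_eqI[OF vs vs sw_hom[OF h(1)] _ e _ x]) (use h(2) z ei in "auto intro!: module_homI")
 \<comment> \<open>The vanishing of \<Sum> t_ij e_i x e_j for every x persists when e_j is replaced
   by its image under a sandwich operator. A dual operator then leaves a linear relation among the
   e_i alone.\<close>
 have af: "(\<Oplus>[A]p:sq N. t p*.[A](e (fst p)*[A]f (e (snd p)))) = 0[A]" if "f:sw A (carrier A)" for f
  using that
 proof (induction rule: sw.induct)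
  case (base b s)
  have "(\<Oplus>[A]p:sq N. t p*.[A](e (fst p)*[A](b*[A]e (snd p)*[A]s))) = (\<Oplus>[A]p:sq N. t p*.[A](e (fst p)*[A]b*[A]e (snd p))*[A]s)"
   by (rule M.fcong) (use base tk ei in "auto simp: m_assoc smult_mult_left")
  also have "... = h b*[A]s" unfolding bspec[OF h(2) base(1)] by (rule finsum_right[symmetric]) (use base tk ei in auto)
  finally show ?case using h0[OF base(1)] base(2) by simp
 next
  case (add f g)
  have "(\<Oplus>[A]p:sq N. t p*.[A](e (fst p)*[A](f (e (snd p))+[A]g (e (snd p))))) =
   (\<Oplus>[A]p:sq N. t p*.[A](e (fst p)*[A]f (e (snd p))))+[A](\<Oplus>[A]p:sq N. t p*.[A](e (fst p)*[A]g (e (snd p))))"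
   by (rule trans[OF M.finsum_cong' M.finsum_addf]) (use tk ei sw_closed[OF add.hyps(1)] sw_closed[OF add.hyps(2)] in "auto simp: r_distr smult_r_distr")
  then show ?case using add.IH by simp
 qed
 obtain i j where ij: "p = (i,j)" "i < N" "j < N" using p by auto
 obtain f where f: "f:sw A (carrier A)" "ALL l:{..<N}. f (e l) = (if l = j then 1[A] else 0[A])" using assms ij unfolding azumaya_def by auto
 have "(\<Oplus>[A]p:sq N. t p*.[A](e (fst p)*[A]f (e (snd p)))) = (\<Oplus>[A]i:{..<N}. \<Oplus>[A]l:{..<N}. t (i,l)*.[A](e (fst (i,l))*[A]f (e (snd (i,l)))))"
  by (rule M.finsum_Times) (use tk ei sw_closed[OF f(1)] in auto)
 also have "... = lc A {..<N} (%i. t (i,j)) e" unfolding lc_def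
 proof (rule M.fcong)
  fix i assume i: "i:{..<N}"
  have "(\<Oplus>[A]l:{..<N}. t (i,l)*.[A](e (fst (i,l))*[A]f (e (snd (i,l))))) = (\<Oplus>[A]l:{..<N}. if l = j then t (i,j)*.[A]e i else 0[A])"
   by (rule M.fcong) (use f(2) tk ei i in auto)
  also have "... = t (i,j)*.[A]e i" by (rule M.finsum_delta) (use ij tk ei i in auto)
  finally show "(\<Oplus>[A]l:{..<N}. t (i,l)*.[A](e (fst (i,l))*[A]f (e (snd (i,l))))) = t (i,j)*.[A]e i" .
 qed (use tk ei ij in auto)
 finally have "lc A {..<N} (%i. t (i,j)) e = 0[A]" using af[OF f(1)] by simp
 moreover have "(%i. t (i,j)):{..<N}->.K" using tk ij by auto
 ultimately show "t p = 0[K]" using e ij unfolding basis_family_def indep_family_def by blast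
qed

lemma sinj_azumaya:
 assumes si: "sinj K A N e" and nz: "1[A] ~= 0[A]"
 shows "azumaya A {..<N} e"
 unfolding azumaya_def
proof (intro conjI ballI nz)
 fix i assume "i:{..<N}"
 then have i: "i < N" by simp
 \<comment> \<open>The matrix of the map that sends \<open>e i\<close> to the unit and the other
   basis vectors to zero. Since the sandwich matrices span, it belongs to a sandwich
   operator.\<close>
 let ?X = "\<lambda>q\<in>sq N. if fst q = i then co 1[A] (snd q) else 0[K]"
 have "?X:.W" by (auto simp: mat_self_sel mat_ring_sel intro!: coord_closed[OF e])
 then obtain t where t: "t:sq N->.K" "?X = lc W (sq N) t (smat K A N e)"
  using sinj_basis[OF si] unfolding basis_family_def span_family_def by blast
 have tk: "!!p. p:sq N==>t p:.K" using t(1) by auto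
 obtain f where f: "f:sw A (carrier A)" "ALL x:carrier A. f x = (\<Oplus>[A]p:sq N. t p*.[A](e (fst p)*[A]x*[A]e (snd p)))" by (rule sandwich_sum[OF t(1)])
 have "f (e k) = (if k = i then 1[A] else 0[A])" if "k:{..<N}" for k
 proof -
  have k: "k < N" using \<open>k:{..<N}\<close> by simp
  have "f (e k) = (\<Oplus>[A]p:sq N. t p*.[A](e (fst p)*[A]e k*[A]e (snd p)))" by (rule bspec[OF f(2) ei[OF k]])
  then have eq: "co (f (e k)) l = ?X (k,l)" if "l < N" for l
   using smat_lc[OF t(1) k that] t(2) by simp
  have z: "co 0[A] l = 0[K]" if l: "l < N" for l
   using coord_smult[OF e M.zero_closed R.zero_closed,of l] coord_closed[OF e M.zero_closed,of l] l by simp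
  show ?thesis
   by (rule coord_eqI[OF e sw_closed[OF f(1) ei[OF k]]]) (use eq z k in auto)
 qed
 then show "EX f:sw A (carrier A). ALL j:{..<N}. f (e j) = (if j = i then 1[A] else 0[A])" using f(1) by blast
qed

end

lemma (in vectorspace) coord_hom:
 assumes e: "basis_family K V I e" and h: "h:module_hom K V V" and x: "x:.V" and l: "l:I"
 shows "coord K V I e (h x) l = (\<Oplus>[K]r:I. coord K V I e x r*[K]coord K V I e (h (e r)) l)"
proof -
 note eD = basis_familyD[OF e]
 have he: "!!j. j:I==>h (e j):.V" using module_homD(1)[OF h] eD by auto
 have vs: "vectorspace K V" ..
 note cx = coord_closed[OF e x]
 have "coord K V I e (h x) l = coord K V I e (lc V I (coord K V I e x) (%j. h (e j))) l"
  using module_hom_lc[OF vs vs h eD(2) coord_Pi[OF e x]] coord_props(2)[OF e x] by simp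
 also have "... = (\<Oplus>[K]j:I. coord K V I e (coord K V I e x j*.[V]h (e j)) l)" unfolding lc_def
  by (rule additive_finsum[of V K "%y. coord K V I e y l", OF M.abelian_group_axioms R.abelian_group_axioms])
   (use coord_closed[OF e _ l] coord_add[OF e _ _ l] cx he in auto)
 also have "... = (\<Oplus>[K]r:I. coord K V I e x r*[K]coord K V I e (h (e r)) l)"
  by (rule R.fcong) (use coord_closed[OF e _ l] coord_smult[OF e _ _ l] cx he in auto)
 finally show ?thesis .
qed

lemma (in based_algebra) lc_trip:
 assumes a: "!!i. i < N==>a i:.K" and b: "!!i. i < N==>b i:.K" and z: "z:.A"
 shows "(\<Oplus>[A]s:sq N. (a (fst s)*[K]b (snd s))*.[A](e (fst s)*[A]z*[A]e (snd s))) = lc A {..<N} a e*[A]z*[A]lc A {..<N} b e"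
proof -
 have Y: "lc A {..<N} b e:.A" by (rule lc_closed) (use b ei in auto)
 have "(\<Oplus>[A]s:sq N. (a (fst s)*[K]b (snd s))*.[A](e (fst s)*[A]z*[A]e (snd s))) =
   (\<Oplus>[A]i:{..<N}. \<Oplus>[A]j:{..<N}. (a (fst (i,j))*[K]b (snd (i,j)))*.[A](e (fst (i,j))*[A]z*[A]e (snd (i,j))))"
  by (rule M.finsum_Times) (use a b z ei in auto)
 also have "... = (\<Oplus>[A]i:{..<N}. (a i*.[A]e i)*[A]z*[A]lc A {..<N} b e)"
 proof (rule M.fcong)
  show "(%i. (a i*.[A]e i)*[A]z*[A]lc A {..<N} b e):{..<N}->.A" using a z ei Y by auto
  fix i assume "i:{..<N}"
  then have i: "i < N" by simp
  have "(a i*.[A]e i)*[A]z*[A]lc A {..<N} b e = (\<Oplus>[A]j:{..<N}. (a i*.[A]e i)*[A]z*[A](b j*.[A]e j))"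
   unfolding lc_def by (rule finsum_left) (use a b z ei i in auto)
  also have "... = (\<Oplus>[A]j:{..<N}. (a (fst (i,j))*[K]b (snd (i,j)))*.[A](e (fst (i,j))*[A]z*[A]e (snd (i,j))))"
   by (rule M.fcong) (use a[OF i] b z ei[OF i] ei in "auto simp: smult_mult_left smult_mult_right smult_assoc1[symmetric] R.m_comm")
  finally show "(\<Oplus>[A]j:{..<N}. (a (fst (i,j))*[K]b (snd (i,j)))*.[A](e (fst (i,j))*[A]z*[A]e (snd (i,j)))) = (a i*.[A]e i)*[A]z*[A]lc A {..<N} b e" by simp
 qed
 also have "... = (\<Oplus>[A]i:{..<N}. (a i*.[A]e i)*[A]z)*[A]lc A {..<N} b e"
  by (rule finsum_right[symmetric,OF Y]) (use a z ei in auto)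
 also have "(\<Oplus>[A]i:{..<N}. (a i*.[A]e i)*[A]z) = lc A {..<N} a e*[A]z" unfolding lc_def
  by (rule finsum_right[symmetric,OF z]) (use a ei in auto)
 finally show ?thesis .
qed

text \<open>Exhibits opp(A) \<otimes> A as a full matrix algebra: the sandwich matrices form a
  basis, and composing x \<mapsto> e_i x e_j with x \<mapsto> e_k x e_l multiplies e_k by e_i on the
  left and e_j by e_l on the right.\<close>

lemma has_sc_smat:
 assumes A: "csa K A" and sc: "has_sc K A {..<N} e c"
 shows "has_sc K (MA (self K) N) (sq N) (smat K A N e) (kron K (%i j. c j i) c)"
proof -
 note eD = has_scD[OF sc]
 interpret A: assoc_algebra K A by (rule csaD(1)[OF A])
 interpret based_algebra K A N e by unfold_locales (rule eD(1))
 have bas: "basis_family K W (sq N) (smat K A N e)" by (rule sinj_basis[OF azumaya_sinj[OF A.csa_azumaya[OF A eD(1)]]])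
 have K: "kron K (%i j. c j i) c p q:sq N->.K"
  "smat K A N e p*[W]smat K A N e q = lc W (sq N) (kron K (%i j. c j i) c p q) (smat K A N e)"
  if pq: "p:sq N" "q:sq N" for p q
 proof -
  have l: "fst p < N" "snd p < N" "fst q < N" "snd q < N" using pq by auto
  have c1: "!!i. i < N==>c (fst q) (fst p) i:.K" "!!i. i < N==>c (snd p) (snd q) i:.K" using eD(5) l by auto
  show t: "kron K (%i j. c j i) c p q:sq N->.K" using c1 by (auto simp: kron_def)
  show "smat K A N e p*[W]smat K A N e q = lc W (sq N) (kron K (%i j. c j i) c p q) (smat K A N e)"
  proof (rule mat_eqI[where R = K and n = N])
   show "smat K A N e p*[W]smat K A N e q:.(MR K N)"
    using A.R.mat_mult_closed[OF smat_mem[OF pq(1)] smat_mem[OF pq(2)]] by (simp add: mat_self_sel)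
   show "lc W (sq N) (kron K (%i j. c j i) c p q) (smat K A N e):.(MR K N)"
    using W.lc_closed[OF basis_familyD(2)[OF bas] t] by (simp add: mat_self_sel)
   fix k r assume kr: "k < N" "r < N"
   let ?x = "e (fst p)*[A]e k*[A]e (snd p)"
   let ?h = "%y. e (fst q)*[A]y*[A]e (snd q)"
   have x: "?x:.A" by (rule trip) (use l kr in auto)
   have h: "?h:module_hom K A A" by (rule module_hom_comp[OF A.left_mult_hom A.right_mult_hom]) (use ei l in auto)
   have "(smat K A N e p*[W]smat K A N e q) (k,r) = (\<Oplus>[K]s:{..<N}. smat K A N e p (k,s)*[K]smat K A N e q (s,r))"
    unfolding mat_self_sel by (rule mat_mult_entry[OF kr])
   also have "... = (\<Oplus>[K]s:{..<N}. co ?x s*[K]co (?h (e s)) r)"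
    by (rule A.R.fcong)
     (use kr A.coord_closed[OF eD(1) x] A.coord_closed[OF eD(1) module_homD(1)[OF h]] ei in "auto simp: smat_def")
   also have "... = co (?h ?x) r" by (rule A.coord_hom[symmetric,OF eD(1) h x]) (use kr in auto)
   also have "?h ?x = (e (fst q)*[A]e (fst p))*[A]e k*[A](e (snd p)*[A]e (snd q))"
    using ei l kr by (simp add: A.m_assoc)
   also have "... = (\<Oplus>[A]s:sq N. kron K (%i j. c j i) c p q s*.[A](e (fst s)*[A]e k*[A]e (snd s)))"
    using lc_trip[of "c (fst q) (fst p)" "c (snd p) (snd q)", OF c1 ei[OF kr(1)]] eD(6)[of "fst q" "fst p"] eD(6)[of "snd p" "snd q"] l by (simp add: kron_def)
   finally show "(smat K A N e p*[W]smat K A N e q) (k,r) = lc W (sq N) (kron K (%i j. c j i) c p q) (smat K A N e) (k,r)"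
    using smat_lc[OF t kr] by simp
  qed
 qed
 show ?thesis unfolding has_sc_def by (intro conjI ballI bas K)
qed

section \<open>Restriction of scalars and descent\<close>

text \<open>Restriction of scalars turns a map that is semilinear over \<open>h\<close> into a
  linear one, so that extension from a basis and comparison on a basis apply to it.\<close>

definition res_alg :: "('a=>'l)=>('l, 'b, 'n) module_scheme=>('a, 'b) module" where
 "res_alg h A = ring_with_smult A (%k x. h k*.[A]x)"

lemma res_alg_sel: "carrier (res_alg h A) = carrier A" "mult (res_alg h A) = mult A" "one (res_alg h A) = one A"
 "zero (res_alg h A) = zero A" "add (res_alg h A) = add A" "smult (res_alg h A) = (%k x. h k*.[A]x)"
 "lc (res_alg h A) I t f = lc A I (%i. h (t i)) f"
 by (simp_all add: res_alg_def lc_def)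

lemma res_alg_alg:
 assumes K: "field K" and A: "assoc_algebra L A" and h: "h:ring_hom K L"
 shows "assoc_algebra K (res_alg h A)"
proof -
 interpret A: assoc_algebra L A by fact
 show ?thesis unfolding res_alg_def
  by (rule assoc_algebraI[OF K A.alg_ring])
   (simp_all add: ring_hom_closed[OF h] ring_hom_add[OF h] ring_hom_mult[OF h] ring_hom_one[OF h]
    A.smult_l_distr A.smult_r_distr A.smult_assoc1 A.smult_mult_left A.smult_mult_right)
qed

lemma semilinear_map:
 assumes A: "assoc_algebra K A" and sc: "has_sc K A I e c" and A': "assoc_algebra L A'" and h: "h:ring_hom K L"
  and f: "f:I->.A'" "!!i j. i:I==>j:I==>f i*[A']f j = lc A' I (%k. h (c i j k)) f"
 shows "EX j:module_hom K A (res_alg h A'). (ALL i:I. j (e i) = f i) &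
  (ALL x:carrier A. ALL y:carrier A. j (x*[A]y) = j x*[A']j y)"
proof -
 note eD = has_scD[OF sc]
 interpret A: assoc_algebra K A by fact
 interpret A': assoc_algebra L A' by fact
 let ?R = "res_alg h A'"
 interpret R: assoc_algebra K ?R by (rule res_alg_alg[OF A.field_axioms A' h])
 define j where "j = (%x. lc ?R I (coord K A I e x) f)"
 have fR: "f:I->.?R" using f(1) by (simp add: res_alg_sel)
 have j: "j:module_hom K A ?R" and je: "!!i. i:I==>j (e i) = f i" unfolding j_def using lin_ext[OF A.vs R.vs eD(1) fR] by auto
 have "j (x*[A]y) = j x*[?R]j y" if xy: "x:.A" "y:.A" for x y
 proof (rule module_hom_mult_on_basis[OF A R.assoc_algebra_axioms eD(1) j _ xy])
  fix i i' assume ii: "i:I" "i':I"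
  have "j (e i*[A]e i') = lc ?R I (c i i') (%k. j (e k))"
   unfolding eD(6)[OF ii] by (rule module_hom_lc[OF A.vs R.vs j eD(3) eD(4)[OF ii]])
  also have "... = lc ?R I (c i i') f" by (rule R.lc_cong[OF _ eD(4)[OF ii]]) (use je fR in auto)
  also have "... = f i*[?R]f i'" using f(2)[OF ii] by (simp add: res_alg_sel)
  finally show "j (e i*[A]e i') = j (e i)*[?R]j (e i')" using je ii by simp
 qed
 then show ?thesis using je by (intro bexI[OF _ j]) (simp add: res_alg_sel)
qed

text \<open>A relation over \<open>K\<close> among the operators x \<mapsto> e_i x e_j is carried by
  \<open>h\<close> to one over \<open>L\<close> among their counterparts in \<open>A'\<close>, where
  all relations are trivial; \<open>h\<close> is injective. The two algebras are linked only through
  their constants.\<close>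

lemma csa_descent:
 fixes N :: nat
 assumes A: "assoc_algebra K A" and sc: "has_sc K A {..<N} e c" and A': "csa L A'"
  and h: "h:ring_hom K L" and sc': "has_sc L A' {..<N} e' (%i j k. h (c i j k))"
 shows "csa K A"
proof -
 note eD = has_scD[OF sc] and fD = has_scD[OF sc']
 interpret A: assoc_algebra K A by fact
 interpret A': assoc_algebra L A' by (rule csaD(1)[OF A'])
 interpret BA: based_algebra K A N e by unfold_locales (rule eD(1))
 interpret BA': based_algebra L A' N e' by unfold_locales (rule fD(1))
 interpret FH: field_hom K L h by (intro field_hom.intro A.field_axioms A'.field_axioms field_hom_axioms.intro h)
 interpret R: assoc_algebra K "res_alg h A'" by (rule res_alg_alg[OF A.field_axioms csaD(1)[OF A'] h])
 have az': "azumaya A' {..<N} e'" by (rule A'.csa_azumaya[OF A' fD(1)])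
 obtain j where j: "j:module_hom K A (res_alg h A')" "ALL i:{..<N}. j (e i) = e' i"
  "ALL x:carrier A. ALL y:carrier A. j (x*[A]y) = j x*[A']j y"
  by (rule bexE[OF semilinear_map[OF A sc csaD(1)[OF A'] h fD(3),OF fD(6)]]) (assumption,assumption,elim conjE,rule that)
 note j = j(1) j(2)[rule_format] j(3)[rule_format]
 note jD = module_homD[OF j(1),unfolded res_alg_sel]
 have j0: "j 0[A] = 0[A']"
  by (rule additive_zero[OF A.M.abelian_group_axioms A'.M.abelian_group_axioms]) (use jD in auto)
 have "sinj K A N e" unfolding sinj_def
 proof (intro ballI impI)
  fix t p assume t: "t:sq N->.K" and p: "p:sq N"
   and z: "ALL k<N. (\<Oplus>[A]p:sq N. t p*.[A](e (fst p)*[A]e k*[A]e (snd p))) = 0[A]"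
  have tk: "!!p. p:sq N==>t p:.K" using t by auto
  have "(\<Oplus>[A']p:sq N. h (t p)*.[A'](e' (fst p)*[A']e' k*[A']e' (snd p))) = 0[A']" if k: "k < N" for k
  proof -
   have "j (\<Oplus>[A]p:sq N. t p*.[A](e (fst p)*[A]e k*[A]e (snd p))) = (\<Oplus>[A']p:sq N. j (t p*.[A](e (fst p)*[A]e k*[A]e (snd p))))"
    by (rule additive_finsum[OF A.M.abelian_group_axioms A'.M.abelian_group_axioms]) (use jD tk BA.trip k in auto)
   also have "... = (\<Oplus>[A']p:sq N. h (t p)*.[A'](e' (fst p)*[A']e' k*[A']e' (snd p)))"
    by (rule A'.M.fcong)
     (use jD(3) tk BA.trip BA.ei BA'.ei k j(2,3) FH.hom_closed in auto)
   finally show ?thesis using z[rule_format,OF k] j0 by simp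
  qed
  moreover have "(%p. h (t p)):sq N->.L" using tk FH.hom_closed by auto
  ultimately have "h (t p) = 0[L]" using BA'.azumaya_sinj[OF az',unfolded sinj_def,rule_format] p by blast
  then show "t p = 0[K]" by (rule FH.hom_eq_zero[OF tk[OF p]])
 qed
 moreover have "1[A] ~= 0[A]"
 proof
  assume 0: "1[A] = 0[A]"
  have "e' i = 0[A']" if i: "i < N" for i
   using A.l_one[OF BA.ei[OF i]] A.l_null[OF BA.ei[OF i]] 0 j(2)[of i] i j0 by simp
  then have "lc A' {..<N} (coord L A' {..<N} e' 1[A']) e' = 0[A']"
   unfolding lc_def by (intro A'.M.finsum_all_zero) (use A'.coord_closed[OF fD(1) A'.one_closed] in auto)
  then show False using A'.coord_props(2)[OF fD(1) A'.one_closed] az' by (simp add: azumaya_def)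
 qed
 ultimately show ?thesis by (intro A.azumaya_csa[OF BA.sinj_azumaya eD(1)])
qed

section \<open>Isomorphisms read off from structure constants\<close>

text \<open>The canonical isomorphisms of tensor products, matrix algebras and base changes amount
  to re-indexing Kronecker products, so they are obtained by matching constants instead of
  constructing maps.\<close>

lemma iso_by_bij:
 assumes A: "assoc_algebra K A" and B: "assoc_algebra K B" and e: "has_sc K A I e c" and f: "has_sc K B J f d"
  and \<pi>: "bij_betw \<pi> I J" and eq: "!!i j k. i:I==>j:I==>k:I==>d (\<pi> i) (\<pi> j) (\<pi> k) = c i j k"
 shows "algebra_iso K A B"
proof -
 have "has_sc K B I (%i. f (\<pi> i)) c"
  by (rule has_sc_cong[OF has_sc_reindex[OF B f \<pi>]]) (use eq B in "auto simp: assoc_algebra.vs")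
 then show ?thesis by (rule algebra_iso_of_has_sc[OF A B e])
qed

definition fd_alg :: "('a, 'm) ring_scheme=>('a, 'b, 'n) module_scheme=>bool" where
 "fd_alg K A \<longleftrightarrow> assoc_algebra K A & vectorspace.fin_dim K A"

lemma csa_fd: "csa K A==>fd_alg K A" by (simp add: fd_alg_def csaD)

lemma fd_alg_sc:
 assumes "fd_alg K A" obtains e c where "has_sc K A {..<vdim K A} e c"
proof -
 interpret A: assoc_algebra K A using assms by (simp add: fd_alg_def)
 obtain e where "basis_family K A {..<A.dim} e" using A.basis_family_exists assms fd_alg_def by blast
 then show ?thesis using that has_sc_exists[OF A.assoc_algebra_axioms] by blast
qed

lemma fd_algI: "assoc_algebra K A==>has_sc K A I e c==>fd_alg K A"
 unfolding fd_alg_def using vectorspace.basis_family_dim(1)[OF assoc_algebra.vs] has_scD(1) by blast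

lemma has_sc_dim: "assoc_algebra K A==>has_sc K A I e c==>vdim K A = card I"
 using vectorspace.basis_family_dim(2)[OF assoc_algebra.vs] has_scD(1) by blast

lemma fd_alg_assoc: "fd_alg K A==>assoc_algebra K A" by (simp add: fd_alg_def)

lemma tensor_cong:
 assumes A: "fd_alg K A" and B: "fd_alg K B" and A': "assoc_algebra K A'" and B': "assoc_algebra K B'"
  and i: "algebra_iso K A A'" "algebra_iso K B B'"
 shows "algebra_iso K (tensor_algebra K A B) (tensor_algebra K A' B')"
proof -
 obtain e c where e: "has_sc K A {..<vdim K A} e c" by (rule fd_alg_sc[OF A])
 obtain f d where f: "has_sc K B {..<vdim K B} f d" by (rule fd_alg_sc[OF B])
 obtain e' where e': "has_sc K A' {..<vdim K A} e' c" by (rule has_sc_iso[OF fd_alg_assoc[OF A] A' e i(1)])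
 obtain f' where f': "has_sc K B' {..<vdim K B} f' d" by (rule has_sc_iso[OF fd_alg_assoc[OF B] B' f i(2)])
 show ?thesis
  by (rule algebra_iso_of_has_sc[OF tensor_alg tensor_alg has_sc_tensor[OF _ _ e f] has_sc_tensor[OF _ _ e' f']])
   (use A B A' B' fd_alg_assoc in auto)
qed

lemma mat_cong:
 assumes A: "fd_alg K A" and A': "assoc_algebra K A'" and i: "algebra_iso K A A'"
 shows "algebra_iso K (MA A n) (MA A' n)"
proof -
 obtain e c where e: "has_sc K A {..<vdim K A} e c" by (rule fd_alg_sc[OF A])
 obtain e' where e': "has_sc K A' {..<vdim K A} e' c" by (rule has_sc_iso[OF fd_alg_assoc[OF A] A' e i])
 show ?thesis
  by (rule algebra_iso_of_has_sc[OF mat_algebra_alg mat_algebra_alg has_sc_mat[OF _ e] has_sc_mat[OF _ e']])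
   (use A A' fd_alg_assoc in auto)
qed

lemma base_change_cong:
 assumes A: "fd_alg K A" and A': "assoc_algebra K A'" and i: "algebra_iso K A A'" and L: "field L" and h: "h:ring_hom K L"
 shows "algebra_iso L (base_change K L h A) (base_change K L h A')"
proof -
 obtain e c where e: "has_sc K A {..<vdim K A} e c" by (rule fd_alg_sc[OF A])
 obtain e' where e': "has_sc K A' {..<vdim K A} e' c" by (rule has_sc_iso[OF fd_alg_assoc[OF A] A' e i])
 show ?thesis
  by (rule algebra_iso_of_has_sc[OF base_change_alg[OF _ L h] base_change_alg[OF _ L h]
     has_sc_base_change[OF _ L h e] has_sc_base_change[OF _ L h e']])
   (use A A' fd_alg_assoc in auto)
qed

lemma fd_mat:
 assumes A: "fd_alg K A" shows "fd_alg K (MA A n)"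
proof -
 obtain e c where e: "has_sc K A {..<vdim K A} e c" by (rule fd_alg_sc[OF A])
 note A = fd_alg_assoc[OF A]
 show ?thesis by (rule fd_algI[OF mat_algebra_alg[OF A] has_sc_mat[OF A e]])
qed

lemma fd_tensor:
 assumes A: "fd_alg K A" and B: "fd_alg K B" shows "fd_alg K (tensor_algebra K A B)"
proof -
 obtain e c where e: "has_sc K A {..<vdim K A} e c" by (rule fd_alg_sc[OF A])
 obtain f d where f: "has_sc K B {..<vdim K B} f d" by (rule fd_alg_sc[OF B])
 note AB = fd_alg_assoc[OF A] fd_alg_assoc[OF B]
 show ?thesis by (rule fd_algI[OF tensor_alg[OF AB] has_sc_tensor[OF AB e f]])
qed

lemma mat_dim:
 assumes "fd_alg K A" shows "vdim K (MA A n) = n * n * vdim K A"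
proof -
 obtain e c where e: "has_sc K A {..<vdim K A} e c" by (rule fd_alg_sc[OF assms])
 show ?thesis using has_sc_dim[OF mat_algebra_alg has_sc_mat[OF _ e]] fd_alg_assoc[OF assms] by (simp add: card_cartesian_product)
qed

lemma base_change_dim:
 assumes "fd_alg K A" "field L" "h:ring_hom K L" shows "vdim L (base_change K L h A) = vdim K A"
proof -
 obtain e c where e: "has_sc K A {..<vdim K A} e c" by (rule fd_alg_sc[OF assms(1)])
 show ?thesis using has_sc_dim[OF base_change_alg[OF fd_alg_assoc[OF assms(1)] assms(2,3)]
   has_sc_base_change[OF fd_alg_assoc[OF assms(1)] assms(2,3) e]] by simp
qed

text \<open>Descent along the identity of \<open>K\<close>.\<close>

lemma csa_iso:
 assumes A: "csa K A" and B: "assoc_algebra K B" and iso: "algebra_iso K A B"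
 shows "csa K B"
proof -
 obtain e c where e: "has_sc K A {..<vdim K A} e c" by (rule csa_has_sc[OF A])
 obtain f where f: "has_sc K B {..<vdim K A} f c" by (rule has_sc_iso[OF csaD(1)[OF A] B e iso])
 show ?thesis by (rule csa_descent[OF B f A,where h = "%x. x"]) (use e in "auto intro: ring_hom_memI")
qed

lemma iso_dim:
 assumes "fd_alg K A" "assoc_algebra K B" "algebra_iso K A B" shows "vdim K A = vdim K B"
proof -
 obtain e c where e: "has_sc K A {..<vdim K A} e c" by (rule fd_alg_sc[OF assms(1)])
 obtain f where f: "has_sc K B {..<vdim K A} f c" by (rule has_sc_iso[OF fd_alg_assoc[OF assms(1)] assms(2) e assms(3)])
 show ?thesis using has_sc_dim[OF assms(2) f] by simp
qed

section \<open>The Brauer group\<close>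

lemma (in ring) mu_closed: "mu R p q r:.R" by (simp add: mu_def)

lemma mat_tensor_iso:
 assumes A: "fd_alg K A" and B: "fd_alg K B"
 shows "algebra_iso K (tensor_algebra K (MA A m) B) (MA (tensor_algebra K A B) m)"
proof -
 obtain e c where e: "has_sc K A {..<vdim K A} e c" by (rule fd_alg_sc[OF A])
 obtain f d where f: "has_sc K B {..<vdim K B} f d" by (rule fd_alg_sc[OF B])
 note AB = fd_alg_assoc[OF A] fd_alg_assoc[OF B]
 interpret A: assoc_algebra K A by (rule AB)
 note c = has_scD(5)[OF e] and d = has_scD(5)[OF f]
 show ?thesis
 proof (rule iso_by_bij[OF tensor_alg[OF mat_algebra_alg[OF AB(1)] AB(2)] mat_algebra_alg[OF tensor_alg[OF AB]]
    has_sc_tensor[OF mat_algebra_alg[OF AB(1)] AB(2) has_sc_mat[OF AB(1) e] f] has_sc_mat[OF tensor_alg[OF AB] has_sc_tensor[OF AB e f]],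
    where \<pi> = "%x. (fst (fst x),(snd (fst x),snd x))"])
  show "bij_betw (%x. (fst (fst x),snd (fst x),snd x)) ((sq m \<times> {..<vdim K A}) \<times> {..<vdim K B})
    (sq m \<times> {..<vdim K A} \<times> {..<vdim K B})"
   by (rule bij_betwI[where g = "%x. ((fst x,fst (snd x)),snd (snd x))"]) auto
 qed (auto simp: kron_def A.R.m_assoc A.R.mu_closed c d)
qed

text \<open>Block decomposition: the index \<open>i * n + k\<close> is position k in block i, and
  division with remainder recovers the pair.\<close>

lemma mat_mat_iso:
 assumes A: "fd_alg K A"
 shows "algebra_iso K (MA (MA A n) m) (MA A (m * n))"
proof -
 obtain e c where e: "has_sc K A {..<vdim K A} e c" by (rule fd_alg_sc[OF A])
 note A' = fd_alg_assoc[OF A]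
 interpret A: assoc_algebra K A by (rule A')
 note c = has_scD(5)[OF e]
 have lt: "i * n + k < m * n" if "i < m" "k < n" for i k
 proof -
  have "i * n + k < Suc i * n" using that by simp
  also have "... <= m * n" using that by (intro mult_le_mono1) simp
  finally show ?thesis .
 qed
 have inj: "(i * n + k = j * n + l) = (i = j & k = l)" if "k < n" "l < n" for i j k l
 proof
  assume eq: "i * n + k = j * n + l"
  show "i = j & k = l" using arg_cong[OF eq,of "%x. x div n"] arg_cong[OF eq,of "%x. x mod n"] that by simp
 qed simp
 show ?thesis
 proof (rule iso_by_bij[OF mat_algebra_alg[OF mat_algebra_alg[OF A']] mat_algebra_alg[OF A']
    has_sc_mat[OF mat_algebra_alg[OF A'] has_sc_mat[OF A' e]] has_sc_mat[OF A' e],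
    where \<pi> = "%x. ((fst (fst x) * n + fst (fst (snd x)),snd (fst x) * n + snd (fst (snd x))),snd (snd x))"])
  show "bij_betw (%x. ((fst (fst x) * n + fst (fst (snd x)),snd (fst x) * n + snd (fst (snd x))),snd (snd x)))
    (sq m \<times> sq n \<times> {..<vdim K A}) (sq (m * n) \<times> {..<vdim K A})"
  proof (rule bij_betwI[where g = "%y. ((fst (fst y) div n,snd (fst y) div n),((fst (fst y) mod n,snd (fst y) mod n),snd y))"])
   show "(%y. ((fst (fst y) div n,snd (fst y) div n),((fst (fst y) mod n,snd (fst y) mod n),snd y)))
    :sq (m * n) \<times> {..<vdim K A} \<rightarrow> sq m \<times> sq n \<times> {..<vdim K A}"
    by (auto simp: less_mult_imp_div_less intro!: mod_less_divisor gr0I)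
  qed (use lt in auto)
 qed (auto simp: kron_def mu_def inj c)
qed

lemma tensor_comm:
 assumes A: "fd_alg K A" and B: "fd_alg K B"
 shows "algebra_iso K (tensor_algebra K A B) (tensor_algebra K B A)"
proof -
 obtain e c where e: "has_sc K A {..<vdim K A} e c" by (rule fd_alg_sc[OF A])
 obtain f d where f: "has_sc K B {..<vdim K B} f d" by (rule fd_alg_sc[OF B])
 note AB = fd_alg_assoc[OF A] fd_alg_assoc[OF B]
 interpret A: assoc_algebra K A by (rule AB)
 note c = has_scD(5)[OF e] and d = has_scD(5)[OF f]
 show ?thesis
 proof (rule iso_by_bij[OF tensor_alg[OF AB] tensor_alg[OF AB(2,1)] has_sc_tensor[OF AB e f] has_sc_tensor[OF AB(2,1) f e],where \<pi> = prod.swap])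
  show "bij_betw prod.swap ({..<vdim K A} \<times> {..<vdim K B}) ({..<vdim K B} \<times> {..<vdim K A})"
   by (rule bij_betwI[where g = prod.swap]) auto
 qed (auto simp: kron_def A.R.m_comm c d)
qed

lemma tensor_assoc:
 assumes A: "fd_alg K A" and B: "fd_alg K B" and C: "fd_alg K C"
 shows "algebra_iso K (tensor_algebra K (tensor_algebra K A B) C) (tensor_algebra K A (tensor_algebra K B C))"
proof -
 obtain e c where e: "has_sc K A {..<vdim K A} e c" by (rule fd_alg_sc[OF A])
 obtain f d where f: "has_sc K B {..<vdim K B} f d" by (rule fd_alg_sc[OF B])
 obtain g b where g: "has_sc K C {..<vdim K C} g b" by (rule fd_alg_sc[OF C])
 note AB = fd_alg_assoc[OF A] fd_alg_assoc[OF B] fd_alg_assoc[OF C]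
 interpret A: assoc_algebra K A by (rule AB)
 note c = has_scD(5)[OF e] and d = has_scD(5)[OF f] and b = has_scD(5)[OF g]
 show ?thesis
 proof (rule iso_by_bij[OF tensor_alg[OF tensor_alg[OF AB(1,2)] AB(3)] tensor_alg[OF AB(1) tensor_alg[OF AB(2,3)]]
   has_sc_tensor[OF tensor_alg[OF AB(1,2)] AB(3) has_sc_tensor[OF AB(1,2) e f] g] has_sc_tensor[OF AB(1) tensor_alg[OF AB(2,3)] e has_sc_tensor[OF AB(2,3) f g]],
   where \<pi> = "%x. (fst (fst x),(snd (fst x),snd x))"])
  show "bij_betw (%x. (fst (fst x),snd (fst x),snd x)) (({..<vdim K A} \<times> {..<vdim K B}) \<times> {..<vdim K C})
    ({..<vdim K A} \<times> {..<vdim K B} \<times> {..<vdim K C})"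
   by (rule bij_betwI[where g = "%x. ((fst x,fst (snd x)),snd (snd x))"]) auto
 qed (auto simp: kron_def A.R.m_assoc c d b)
qed

lemma tensor_self:
 assumes A: "fd_alg K A"
 shows "algebra_iso K (tensor_algebra K (self K) A) A"
proof -
 obtain e c where e: "has_sc K A {..<vdim K A} e c" by (rule fd_alg_sc[OF A])
 note A' = fd_alg_assoc[OF A]
 interpret A: assoc_algebra K A by (rule A')
 note c = has_scD(5)[OF e] and S = self_alg[OF A.field_axioms]
 show ?thesis
 proof (rule iso_by_bij[OF tensor_alg[OF S A'] A' has_sc_tensor[OF S A' has_sc_self[OF A.field_axioms] e] e,where \<pi> = snd])
  show "bij_betw snd ({()} \<times> {..<vdim K A}) {..<vdim K A}" by (rule bij_betwI[where g = "%x. ((),x)"]) auto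
 qed (auto simp: kron_def c)
qed

lemma tensor_opp:
 assumes A: "csa K A"
 shows "algebra_iso K (tensor_algebra K (opp A) A) (MA (self K) (vdim K A))"
proof -
 obtain e c where e: "has_sc K A {..<vdim K A} e c" by (rule csa_has_sc[OF A])
 note A' = csaD(1)[OF A]
 interpret A: assoc_algebra K A by (rule A')
 show ?thesis
  by (rule algebra_iso_of_has_sc[OF tensor_alg[OF opp_alg[OF A'] A'] mat_self_alg[OF A.field_axioms]
     has_sc_tensor[OF opp_alg[OF A'] A' has_sc_opp[OF e] e] has_sc_smat[OF A e]])
qed

lemma base_change_tensor:
 assumes A: "fd_alg K A" and B: "fd_alg K B" and L: "field L" "h:ring_hom K L"
 shows "algebra_iso L (base_change K L h (tensor_algebra K A B)) (tensor_algebra L (base_change K L h A) (base_change K L h B))"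
proof -
 obtain e c where e: "has_sc K A {..<vdim K A} e c" by (rule fd_alg_sc[OF A])
 obtain f d where f: "has_sc K B {..<vdim K B} f d" by (rule fd_alg_sc[OF B])
 note AB = fd_alg_assoc[OF A] fd_alg_assoc[OF B]
 note c = has_scD(5)[OF e] and d = has_scD(5)[OF f]
 note bc = base_change_alg[OF _ L] and sc = has_sc_base_change[OF _ L]
 show ?thesis
  by (rule iso_by_bij[OF bc[OF tensor_alg[OF AB]] tensor_alg[OF bc[OF AB(1)] bc[OF AB(2)]] sc[OF tensor_alg[OF AB] has_sc_tensor[OF AB e f]]
   has_sc_tensor[OF bc[OF AB(1)] bc[OF AB(2)] sc[OF AB(1) e] sc[OF AB(2) f]],where \<pi> = "%x. x"])
   (auto simp: kron_def ring_hom_mult[OF L(2)] c d bij_betw_def)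
qed

lemma base_change_mat:
 assumes A: "fd_alg K A" and L: "field L" "h:ring_hom K L"
 shows "algebra_iso L (base_change K L h (MA A n)) (MA (base_change K L h A) n)"
proof -
 obtain e c where e: "has_sc K A {..<vdim K A} e c" by (rule fd_alg_sc[OF A])
 note A' = fd_alg_assoc[OF A]
 note c = has_scD(5)[OF e]
 interpret A: assoc_algebra K A by (rule A')
 interpret FH: field_hom K L h by (intro field_hom.intro A.field_axioms L field_hom_axioms.intro)
 note bc = base_change_alg[OF _ L] and sc = has_sc_base_change[OF _ L]
 show ?thesis
  by (rule iso_by_bij[OF bc[OF mat_algebra_alg[OF A']] mat_algebra_alg[OF bc[OF A']] sc[OF mat_algebra_alg[OF A'] has_sc_mat[OF A' e]]
   has_sc_mat[OF bc[OF A'] sc[OF A' e]],where \<pi> = "%x. x"])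
   (auto simp: kron_def mu_def c bij_betw_def FH.hom_closed FH.hom_zero)
qed

lemma base_change_trans:
 assumes A: "fd_alg K A" and L: "field L" "h:ring_hom K L" and M: "field M" "g:ring_hom L M" "k:ring_hom K M"
  and k: "!!x. x:.K==>k x = g (h x)"
 shows "algebra_iso M (base_change L M g (base_change K L h A)) (base_change K M k A)"
proof -
 obtain e c where e: "has_sc K A {..<vdim K A} e c" by (rule fd_alg_sc[OF A])
 note A' = fd_alg_assoc[OF A]
 note c = has_scD(5)[OF e]
 show ?thesis
  by (rule iso_by_bij[OF base_change_alg[OF base_change_alg[OF A' L] M(1,2)] base_change_alg[OF A' M(1,3)]
    has_sc_base_change[OF base_change_alg[OF A' L] M(1,2) has_sc_base_change[OF A' L e]] has_sc_base_change[OF A' M(1,3) e],where \<pi> = "%x. x"])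
   (auto simp: k c bij_betw_def)
qed

lemma csa_mat:
 assumes A: "csa K A" and n: "n >= 1"
 shows "csa K (MA A n)"
proof -
 interpret A: assoc_algebra K A by (rule csaD(1)[OF A])
 note K = A.field_axioms
 note fA = csa_fd[OF A] and fS = csa_fd[OF csa_self[OF K]]
 have "algebra_iso K (MA (tensor_algebra K (self K) A) n) (MA A n)"
  by (rule mat_cong[OF fd_tensor[OF fS fA] csaD(1)[OF A] tensor_self[OF fA]])
 from algebra_iso_trans[OF mat_tensor_iso[OF fS fA] this]
 show ?thesis by (rule csa_iso[OF csa_tensor[OF csa_mat_self[OF K n] A] mat_algebra_alg[OF csaD(1)[OF A]]])
qed

section \<open>Brauer equivalence\<close>

lemma brauer_equivI: "m >= 1==>n >= 1==>algebra_iso K (MA A m) (MA B n)==>brauer_equiv K A B"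
 unfolding brauer_equiv_def by blast

lemma brauer_equiv_iso: "fd_alg K A==>assoc_algebra K B==>algebra_iso K A B==>brauer_equiv K A B"
 by (rule brauer_equivI[OF order_refl order_refl mat_cong])

lemma brauer_equiv_mat: "fd_alg K A==>n >= 1==>brauer_equiv K (MA A n) A"
 using mat_mat_iso[of K A n 1] by (intro brauer_equivI[of 1 n]) auto

lemma brauer_equiv_sym: "fd_alg K A==>brauer_equiv K A B==>brauer_equiv K B A"
 unfolding brauer_equiv_def using algebra_iso_sym[OF fd_alg_assoc[OF fd_mat]] by blast

lemma brauer_equiv_trans:
 assumes A: "fd_alg K A" and B: "fd_alg K B" and C: "fd_alg K C" and "brauer_equiv K A B" "brauer_equiv K B C"
 shows "brauer_equiv K A C"
proof -
 obtain m n p q where mn: "m >= 1" "n >= 1" "p >= 1" "q >= 1" and i: "algebra_iso K (MA A m) (MA B n)"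
  and j: "algebra_iso K (MA B p) (MA C q)" using assms(4,5) unfolding brauer_equiv_def by auto
 \<comment> \<open>Both equivalences are inflated until \<open>B\<close> appears in the same matrix
   size, \<open>n * p\<close>.\<close>
 have a: "algebra_iso K (MA A (p * m)) (MA B (p * n))"
  by (rule algebra_iso_trans[OF algebra_iso_sym[OF _ mat_mat_iso[OF A]] algebra_iso_trans[OF mat_cong[OF fd_mat[OF A] _ i] mat_mat_iso[OF B]]])
   (intro mat_algebra_alg fd_alg_assoc A B)+
 have b: "algebra_iso K (MA B (n * p)) (MA C (n * q))"
  by (rule algebra_iso_trans[OF algebra_iso_sym[OF _ mat_mat_iso[OF B]] algebra_iso_trans[OF mat_cong[OF fd_mat[OF B] _ j] mat_mat_iso[OF C]]])
   (intro mat_algebra_alg fd_alg_assoc B C)+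
 show ?thesis by (rule brauer_equivI[of "p * m" "n * q"]) (use mn algebra_iso_trans[OF a] b in "auto simp: mult.commute")
qed

lemma brauer_equiv_tensor_left:
 assumes A: "fd_alg K A" and B: "fd_alg K B" and C: "fd_alg K C" and AB: "brauer_equiv K A B"
 shows "brauer_equiv K (tensor_algebra K A C) (tensor_algebra K B C)"
proof -
 obtain m n where mn: "m >= 1" "n >= 1" and i: "algebra_iso K (MA A m) (MA B n)" using AB unfolding brauer_equiv_def by auto
 have j: "algebra_iso K (tensor_algebra K (MA A m) C) (tensor_algebra K (MA B n) C)"
  by (rule tensor_cong[OF fd_mat[OF A] C _ _ i algebra_iso_refl]) (intro mat_algebra_alg fd_alg_assoc B C)+
 show ?thesis
  by (rule brauer_equivI[OF mn algebra_iso_trans[OF algebra_iso_sym[OF _ mat_tensor_iso[OF A C]] algebra_iso_trans[OF j mat_tensor_iso[OF B C]]]])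
   (intro tensor_alg mat_algebra_alg fd_alg_assoc A C)
qed

lemma brauer_equiv_tensor_comm: "fd_alg K A==>fd_alg K B==>brauer_equiv K (tensor_algebra K A B) (tensor_algebra K B A)"
 by (intro brauer_equiv_iso fd_tensor tensor_alg tensor_comm fd_alg_assoc)

lemma brauer_equiv_tensor:
 assumes A: "fd_alg K A" and B: "fd_alg K B" and C: "fd_alg K C" and D: "fd_alg K D" and "brauer_equiv K A B" "brauer_equiv K C D"
 shows "brauer_equiv K (tensor_algebra K A C) (tensor_algebra K B D)"
proof -
 note t = fd_tensor and c = brauer_equiv_tensor_comm
 have "brauer_equiv K (tensor_algebra K B C) (tensor_algebra K B D)"
  by (rule brauer_equiv_trans[OF t[OF B C] t[OF C B] t[OF B D] c[OF B C]
    brauer_equiv_trans[OF t[OF C B] t[OF D B] t[OF B D] brauer_equiv_tensor_left[OF C D B assms(6)] c[OF D B]]])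
 then show ?thesis by (rule brauer_equiv_trans[OF t[OF A C] t[OF B C] t[OF B D] brauer_equiv_tensor_left[OF A B C assms(5)]])
qed

lemma brauer_equiv_base_change:
 assumes A: "fd_alg K A" and B: "fd_alg K B" and L: "field L" "h:ring_hom K L" and AB: "brauer_equiv K A B"
 shows "brauer_equiv L (base_change K L h A) (base_change K L h B)"
proof -
 obtain m n where mn: "m >= 1" "n >= 1" and i: "algebra_iso K (MA A m) (MA B n)" using AB unfolding brauer_equiv_def by auto
 note j = base_change_cong[OF fd_mat[OF A] mat_algebra_alg[OF fd_alg_assoc[OF B]] i L]
 show ?thesis
  by (rule brauer_equivI[OF mn algebra_iso_trans[OF algebra_iso_sym[OF _ base_change_mat[OF A L]] algebra_iso_trans[OF j base_change_mat[OF B L]]]])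
   (intro base_change_alg mat_algebra_alg fd_alg_assoc A L)
qed

lemma brauer_class_eq_iff:
 assumes A: "csa K A" and B: "csa K B"
 shows "brauer_class K A = brauer_class K B \<longleftrightarrow> brauer_equiv K A B"
proof
 assume eq: "brauer_class K A = brauer_class K B"
 note fA = csa_fd[OF A] and fB = csa_fd[OF B]
 obtain e c where e: "has_sc K A {..<vdim K A} e c" by (rule csa_has_sc[OF A])
 \<comment> \<open>Classes contain only algebras on functions from the natural numbers, and
   \<open>A\<close> may have elements of any type. A copy of \<open>A\<close> in the right type
   serves as the common member.\<close>
 obtain A' :: "('a,nat=>'a) module" and e' where A': "assoc_algebra K A'" "algebra_iso K A A'"
  by (rule has_sc_calg[OF csaD(1)[OF A] e])
 note cA' = csa_iso[OF A A']
 have e1: "brauer_equiv K A A'" by (rule brauer_equiv_iso[OF fA A'])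
 then have "A':brauer_class K A" using cA' brauer_equiv_sym[OF fA e1] by (simp add: brauer_class_def)
 then have "brauer_equiv K A' B" unfolding eq by (simp add: brauer_class_def)
 then show "brauer_equiv K A B" by (rule brauer_equiv_trans[OF fA csa_fd[OF cA'] fB e1])
next
 assume eq: "brauer_equiv K A B"
 note fA = csa_fd[OF A] and fB = csa_fd[OF B]
 show "brauer_class K A = brauer_class K B" unfolding brauer_class_def
  using brauer_equiv_trans[OF csa_fd fA fB _ eq] brauer_equiv_trans[OF csa_fd fB fA _ brauer_equiv_sym[OF fA eq]] by blast
qed

lemma brauer_rep:
 fixes K :: "('a, 'm) ring_scheme"
 assumes A: "csa K A"
 obtains B :: "('a,nat=>'a) module" where "csa K B" "algebra_iso K A B" "brauer_class K A = brauer_class K B"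
proof -
 obtain e c where e: "has_sc K A {..<vdim K A} e c" by (rule csa_has_sc[OF A])
 obtain B :: "('a,nat=>'a) module" and e' where B: "assoc_algebra K B" "algebra_iso K A B"
  by (rule has_sc_calg[OF csaD(1)[OF A] e])
 note cB = csa_iso[OF A B]
 show ?thesis using that[OF cB B(2)] brauer_class_eq_iff[OF A cB] brauer_equiv_iso[OF csa_fd[OF A] B] by simp
qed

lemma brauer_class_carrier: "csa K A==>brauer_class K A:.(Br K)"
 by (erule brauer_rep) (auto simp: Br_def)

lemma Br_carrierE:
 fixes K :: "('a, 'm) ring_scheme"
 assumes "\<alpha>:.(Br K)" obtains A :: "('a,nat=>'a) module" where "csa K A" "\<alpha> = brauer_class K A"
 using assms by (auto simp: Br_def)

lemma brauer_class_mem: "B:brauer_class K A \<longleftrightarrow> csa K B & brauer_equiv K B A" by (simp add: brauer_class_def)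

lemma brauer_class_nonempty:
 assumes "csa K A" obtains B where "B:brauer_class K A"
proof (rule brauer_rep[OF assms])
 fix B :: "('a,nat=>'a) module"
 assume B: "csa K B" "algebra_iso K A B"
 show thesis using that[of B] B brauer_equiv_sym[OF csa_fd[OF assms] brauer_equiv_iso[OF csa_fd[OF assms] csaD(1)[OF B(1)] B(2)]]
  by (simp add: brauer_class_mem)
qed

text \<open>The product is a union over all representatives. Tensor products respect equivalence, so
  every term of the union is the same class, and the union is taken over nonempty sets.\<close>

lemma Br_mult:
 assumes A: "csa K A" and B: "csa K B"
 shows "brauer_class K A*[Br K]brauer_class K B = brauer_class K (tensor_algebra K A B)"
proof -
 have "brauer_class K (tensor_algebra K A' B') = brauer_class K (tensor_algebra K A B)"
  if "A':brauer_class K A" "B':brauer_class K B" for A' B'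
 proof -
  from that have A': "csa K A'" "brauer_equiv K A' A" and B': "csa K B'" "brauer_equiv K B' B"
   by (auto simp: brauer_class_mem)
  show ?thesis unfolding brauer_class_eq_iff[OF csa_tensor[OF A'(1) B'(1)] csa_tensor[OF A B]]
   by (intro brauer_equiv_tensor csa_fd A' B' A B)
 qed
 moreover obtain A' B' where "A':brauer_class K A" "B':brauer_class K B" using brauer_class_nonempty[OF A] brauer_class_nonempty[OF B] by metis
 ultimately show ?thesis unfolding Br_def by simp blast
qed

lemma Br_res_class:
 assumes A: "csa K A" and L: "field L" "h:ring_hom K L"
 shows "Br_res K L h (brauer_class K A) = brauer_class L (base_change K L h A)"
proof -
 have "brauer_class L (base_change K L h A') = brauer_class L (base_change K L h A)" if "A':brauer_class K A" for A'
 proof -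
  from that have A': "csa K A'" "brauer_equiv K A' A" by (auto simp: brauer_class_mem)
  show ?thesis unfolding brauer_class_eq_iff[OF csa_base_change[OF A'(1) L] csa_base_change[OF A L]]
   by (intro brauer_equiv_base_change csa_fd A' A L)
 qed
 moreover obtain A' where "A':brauer_class K A" using brauer_class_nonempty[OF A] by metis
 ultimately show ?thesis unfolding Br_res_def by blast
qed

lemma brauer_class_iso:
 "csa K A==>csa K B==>algebra_iso K A B==>brauer_class K A = brauer_class K B"
 by (simp add: brauer_class_eq_iff brauer_equiv_iso csa_fd csaD(1))

lemma Br_one: "1[Br K] = brauer_class K (self K)" by (simp add: Br_def)

lemma csa_dim_pos:
 assumes A: "csa K A" shows "vdim K A >= 1"
proof (rule ccontr)
 assume "~ vdim K A >= 1"
 then have 0: "vdim K A = 0" by simp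
 obtain e c where e: "has_sc K A {..<vdim K A} e c" by (rule csa_has_sc[OF A])
 interpret A: assoc_algebra K A by (rule csaD(1)[OF A])
 have "x = 0[A]" if "x:.A" for x
  using A.coord_props(2)[OF has_scD(1)[OF e[unfolded 0]] that] by (simp add: lc_def)
 then show False using csaD(3)[OF A] by (auto simp: simple_ring_def)
qed

lemma Br_comm_group:
 fixes K :: "('a, 'm) ring_scheme"
 assumes K: "field K" shows "comm_group (Br K)"
proof (rule comm_groupI)
 note S = csa_self[OF K] and T = csa_tensor and Ciso = brauer_class_iso
 show "1[Br K]:.(Br K)" unfolding Br_one by (rule brauer_class_carrier[OF S])
 fix x assume "x:.(Br K)"
 then obtain A :: "('a,nat=>'a) module" where A: "csa K A" "x = brauer_class K A" by (rule Br_carrierE)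
 show "1[Br K]*[Br K]x = x" unfolding Br_one A(2) Br_mult[OF S A(1)]
  by (rule Ciso[OF T[OF S A(1)] A(1) tensor_self[OF csa_fd[OF A(1)]]])
 note N = csa_dim_pos[OF A(1)]
 \<comment> \<open>The opposite algebra is the inverse: \<open>opp A\<close> \<otimes>
   \<open>A\<close> is a matrix algebra of size \<open>vdim K A\<close>, which is positive.\<close>
 have i: "brauer_class K (tensor_algebra K (opp A) A) = brauer_class K (self K)"
  unfolding brauer_class_eq_iff[OF T[OF csa_opp[OF A(1)] A(1)] S]
  by (rule brauer_equiv_trans[OF _ _ _ brauer_equiv_iso[OF _ _ tensor_opp[OF A(1)]] brauer_equiv_mat[OF _ N]])
   (intro csa_fd csaD(1)[of K "MA (self K) (vdim K A)"] T csa_opp A csa_mat_self K N S)+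
 show "EX y:carrier (Br K). y*[Br K]x = 1[Br K]"
  by (rule bexI[OF _ brauer_class_carrier[OF csa_opp[OF A(1)]]]) (simp add: A(2) Br_mult[OF csa_opp[OF A(1)] A(1)] i Br_one)
 fix y assume "y:.(Br K)"
 then obtain B :: "('a,nat=>'a) module" where B: "csa K B" "y = brauer_class K B" by (rule Br_carrierE)
 show "x*[Br K]y:.(Br K)" unfolding A(2) B(2) Br_mult[OF A(1) B(1)] by (rule brauer_class_carrier[OF T[OF A(1) B(1)]])
 show "x*[Br K]y = y*[Br K]x" unfolding A(2) B(2) Br_mult[OF A(1) B(1)] Br_mult[OF B(1) A(1)]
  by (rule Ciso[OF T[OF A(1) B(1)] T[OF B(1) A(1)] tensor_comm]) (intro csa_fd A B)+
 fix z assume "z:.(Br K)"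
 then obtain C :: "('a,nat=>'a) module" where C: "csa K C" "z = brauer_class K C" by (rule Br_carrierE)
 show "x*[Br K]y*[Br K]z = x*[Br K](y*[Br K]z)"
  unfolding A(2) B(2) C(2) Br_mult[OF A(1) B(1)] Br_mult[OF B(1) C(1)] Br_mult[OF T[OF A(1) B(1)] C(1)] Br_mult[OF A(1) T[OF B(1) C(1)]]
  by (rule Ciso[OF T[OF T[OF A(1) B(1)] C(1)] T[OF A(1) T[OF B(1) C(1)]] tensor_assoc]) (intro csa_fd A B C)+
qed

lemma Br_res_closed: "field L==>h:ring_hom K L==>\<alpha>:.(Br K)==>Br_res K L h \<alpha>:.(Br L)"
 by (erule Br_carrierE) (simp add: Br_res_class brauer_class_carrier csa_base_change)

lemma Br_res_hom:
 fixes K :: "('a, 'm) ring_scheme"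
 assumes L: "field L" "h:ring_hom K L"
 shows "Br_res K L h:hom (Br K) (Br L)"
proof (rule homI[OF Br_res_closed[OF L]])
 fix x y assume "x:.(Br K)" "y:.(Br K)"
 then obtain A B :: "('a,nat=>'a) module" where A: "csa K A" "x = brauer_class K A"
  and B: "csa K B" "y = brauer_class K B" by (elim Br_carrierE)
 note T = csa_tensor and C = csa_base_change[OF _ L]
 show "Br_res K L h (x*[Br K]y) = Br_res K L h x*[Br L]Br_res K L h y"
  unfolding A(2) B(2) Br_mult[OF A(1) B(1)] Br_res_class[OF A(1) L] Br_res_class[OF B(1) L] Br_res_class[OF T[OF A(1) B(1)] L]
   Br_mult[OF C[OF A(1)] C[OF B(1)]]
  by (rule brauer_class_iso[OF C[OF T[OF A(1) B(1)]] T[OF C[OF A(1)] C[OF B(1)]] base_change_tensor[OF csa_fd[OF A(1)] csa_fd[OF B(1)] L]])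
qed

section \<open>Idempotents with division corner\<close>

text \<open>A nonzero idempotent whose corner eRe is a division ring; left inverses are demanded,
  and \<open>dvid_inv\<close> makes them two-sided. Division algebras are the case where
  \<open>e\<close> is the unit.\<close>

definition dvid :: "('b, 'm) ring_scheme=>'b=>bool" where
 "dvid R e \<longleftrightarrow> e:.R & e ~= 0[R] & e*[R]e = e &
   (ALL x:carrier R. e*[R]x = x --> x*[R]e = x --> x ~= 0[R] -->
    (EX y:carrier R. e*[R]y = y & y*[R]e = y & y*[R]x = e))"

context ring
begin

text \<open>Simple rings are prime: if x a y vanished for all a, then f(x) y would vanish for every
  sandwich operator f, among them one with f(x) = \<one>.\<close>

lemma simple_prime:
 assumes R: "simple_ring R" and x: "x:.R" "x ~= \<zero>" and y: "y:.R" "y ~= \<zero>"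
 shows "EX a:carrier R. x \<otimes> a \<otimes> y ~= \<zero>"
proof (rule ccontr)
 assume "~ ?thesis"
 then have z: "!!a. a:.R==>x \<otimes> a \<otimes> y = \<zero>" by blast
 interpret sandwich R "carrier R" by unfold_locales auto
 have "f x \<otimes> a \<otimes> y = \<zero>" if "f:sw R (carrier R)" "a:.R" for f a using that
 proof (induction arbitrary: a rule: sw.induct)
  case (base b s)
  then show ?case using z[of "s \<otimes> a"] x y by (simp add: m_assoc)
 next
  case (add f g)
  then show ?case using sw_closed[OF add.hyps(1) x(1)] sw_closed[OF add.hyps(2) x(1)] y by (simp add: l_distr)
 qed
 then show False using simple_ring_sw[OF R x] y one_closed by (metis l_one)
qed

lemma dvidD:
 assumes "dvid R e" shows "e:.R" "e ~= \<zero>" "e \<otimes> e = e"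
 using assms by (auto simp: dvid_def)

lemma dvid_inv:
 assumes e: "dvid R e" and x: "x:.R" "e \<otimes> x = x" "x \<otimes> e = x" "x ~= \<zero>"
 obtains y where "y:.R" "e \<otimes> y = y" "y \<otimes> e = y" "y \<otimes> x = e" "x \<otimes> y = e"
proof -
 note eD = dvidD[OF e]
 obtain y where y: "y:.R" "e \<otimes> y = y" "y \<otimes> e = y" "y \<otimes> x = e" using e x unfolding dvid_def by blast
 have "y ~= \<zero>" using y(4) x(1) eD(2) by auto
 then obtain z where z: "z:.R" "e \<otimes> z = z" "z \<otimes> e = z" "z \<otimes> y = e" using e y unfolding dvid_def by blast
 have "z = z \<otimes> (y \<otimes> x)" using z(3) y(4) by simp
 also have "... = x" using z(1,4) y(1) x(1,2) by (simp add: m_assoc[symmetric])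
 finally show ?thesis using that[OF y] z(4) by simp
qed

text \<open>This replaces the uniqueness of the simple module. Primeness gives a nonzero u = f a e
  and a nonzero u b f, which has an inverse w in the corner of f; then v = e b w satisfies u v = f.
  Both the uniqueness of division algebras and Skolem-Noether are drawn from it.\<close>

lemma dvid_equiv:
 assumes R: "simple_ring R" and e: "dvid R e" and f: "dvid R f"
 obtains u v where "u:.R" "v:.R" "f \<otimes> u = u" "u \<otimes> e = u" "e \<otimes> v = v" "v \<otimes> f = v" "u \<otimes> v = f" "v \<otimes> u = e"
proof -
 note eD = dvidD[OF e] and fD = dvidD[OF f]
 obtain a where a: "a:.R" "f \<otimes> a \<otimes> e ~= \<zero>" using simple_prime[OF R fD(1,2) eD(1,2)] by blast
 let ?u = "f \<otimes> a \<otimes> e"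
 have u: "?u:.R" using a eD fD by simp
 have ue: "f \<otimes> ?u = ?u" "?u \<otimes> e = ?u" using a eD fD by (simp_all add: m_assoc) (simp add: m_assoc[symmetric] fD)
 obtain b where b: "b:.R" "?u \<otimes> b \<otimes> f ~= \<zero>" using simple_prime[OF R u a(2) fD(1,2)] by blast
 let ?z = "?u \<otimes> b \<otimes> f"
 have zf: "f \<otimes> ?z = ?z" using ue(1) u b fD by (metis m_assoc m_closed)
 have zf': "?z \<otimes> f = ?z" using u b fD by (simp add: m_assoc)
 obtain w where w: "w:.R" "f \<otimes> w = w" "w \<otimes> f = w" "?z \<otimes> w = f"
  by (rule dvid_inv[OF f _ zf zf' b(2)]) (use u b fD in auto)
 let ?v = "e \<otimes> b \<otimes> w"
 have v: "?v:.R" using eD b w by simp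
 have ve: "e \<otimes> ?v = ?v" using eD b w by (simp add: m_assoc[symmetric])
 have vf: "?v \<otimes> f = ?v" using eD fD b w by (simp add: m_assoc)
 have uv: "?u \<otimes> ?v = f"
 proof -
  have "?u \<otimes> ?v = (?u \<otimes> e) \<otimes> (b \<otimes> w)" using u eD b w by (simp only: m_assoc m_closed)
  also have "... = ?u \<otimes> b \<otimes> (f \<otimes> w)" using ue(2) u b w by (simp add: m_assoc)
  also have "... = f" using w(4) u b w fD by (simp only: m_assoc m_closed)
  finally show ?thesis .
 qed
 \<comment> \<open>A nonzero idempotent in the division ring eRe must be \<open>e\<close>.\<close>
 let ?p = "?v \<otimes> ?u"
 have p: "?p:.R" "e \<otimes> ?p = ?p" "?p \<otimes> e = ?p" using u v ue ve eD by (auto simp: m_assoc) (metis m_assoc)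
 have "?p \<otimes> ?p = ?v \<otimes> (?u \<otimes> ?v) \<otimes> ?u" using u v by (simp only: m_assoc m_closed)
 also have "... = ?p" unfolding uv vf ..
 finally have pp: "?p \<otimes> ?p = ?p" .
 have "?p ~= \<zero>"
 proof
  assume 0: "?p = \<zero>"
  have "f = ?u \<otimes> ?v \<otimes> (?u \<otimes> ?v)" unfolding uv fD(3) ..
  also have "... = ?u \<otimes> ?p \<otimes> ?v" using u v by (simp only: m_assoc m_closed)
  finally show False using 0 u v fD by simp
 qed
 then obtain q where q: "q:.R" "q \<otimes> ?p = e" using dvid_inv[OF e p] by blast
 have "?p = q \<otimes> ?p \<otimes> ?p" using q(2) p(2) by simp
 also have "... = q \<otimes> (?p \<otimes> ?p)" by (rule m_assoc[OF q(1) p(1) p(1)])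
 also have "... = e" unfolding pp q(2) ..
 finally show ?thesis using that[OF u v ue ve vf uv] by simp
qed

text \<open>The conjugating element is P = \<Sum> b_k0 u a_0k, with inverse \<Sum> a_k0 v b_0k: the
  equivalence of the first diagonal idempotents is spread over all rows by the two systems of matrix
  units.\<close>

lemma matrix_units_conj:
 fixes n :: nat
 assumes n: "n >= 1" and a: "!!i j. i < n==>j < n==>a i j:.R" and b: "!!i j. i < n==>j < n==>b i j:.R"
  and am: "!!i j k l. i < n==>j < n==>k < n==>l < n==>a i j \<otimes> a k l = (if j = k then a i l else \<zero>)"
  and bm: "!!i j k l. i < n==>j < n==>k < n==>l < n==>b i j \<otimes> b k l = (if j = k then b i l else \<zero>)"
  and a1: "(\<Oplus>i\<in>{..<n}. a i i) = \<one>" and b1: "(\<Oplus>i\<in>{..<n}. b i i) = \<one>"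
  and uv: "u:.R" "v:.R" "b 0 0 \<otimes> u = u" "u \<otimes> a 0 0 = u" "a 0 0 \<otimes> v = v" "v \<otimes> b 0 0 = v"
   "u \<otimes> v = b 0 0" "v \<otimes> u = a 0 0"
 obtains P Q where "P:.R" "Q:.R" "P \<otimes> Q = \<one>" "Q \<otimes> P = \<one>" "!!i j. i < n==>j < n==>b i j \<otimes> P = P \<otimes> a i j"
proof -
 have 0: "0 < n" using n by simp
 \<comment> \<open>One computation for both \<open>P \<otimes> Q\<close> and
   \<open>Q \<otimes> P\<close>: the rule for the middle system of matrix units leaves only the
   summand with k = i.\<close>
 have gen: "x i 0 \<otimes> s \<otimes> y 0 i \<otimes> (\<Oplus>k\<in>{..<n}. y k 0 \<otimes> t \<otimes> z 0 k) = x i 0 \<otimes> (s \<otimes> t) \<otimes> z 0 i"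
  if xyz: "!!i j. i < n==>j < n==>x i j:.R" "!!i j. i < n==>j < n==>y i j:.R" "!!i j. i < n==>j < n==>z i j:.R"
   and ym: "!!i j k l. i < n==>j < n==>k < n==>l < n==>y i j \<otimes> y k l = (if j = k then y i l else \<zero>)"
   and st: "s:.R" "t:.R" "s \<otimes> y 0 0 = s" and i: "i < n" for x y z s t i
 proof -
  have "x i 0 \<otimes> s \<otimes> y 0 i \<otimes> (\<Oplus>k\<in>{..<n}. y k 0 \<otimes> t \<otimes> z 0 k) = (\<Oplus>k\<in>{..<n}. x i 0 \<otimes> s \<otimes> y 0 i \<otimes> (y k 0 \<otimes> t \<otimes> z 0 k))"
   by (rule finsum_left) (use xyz st i 0 in auto)
  also have "... = (\<Oplus>k\<in>{..<n}. if k = i then x i 0 \<otimes> (s \<otimes> t) \<otimes> z 0 i else \<zero>)"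
  proof (rule fcong)
   fix k assume "k:{..<n}" then have k: "k < n" by simp
   have "x i 0 \<otimes> s \<otimes> y 0 i \<otimes> (y k 0 \<otimes> t \<otimes> z 0 k) = x i 0 \<otimes> s \<otimes> (y 0 i \<otimes> y k 0) \<otimes> (t \<otimes> z 0 k)"
    using xyz st i 0 k by (simp add: m_assoc)
   also have "... = (if k = i then x i 0 \<otimes> (s \<otimes> y 0 0) \<otimes> (t \<otimes> z 0 k) else \<zero>)"
    using ym[OF 0 i k 0] xyz st(1,2) i 0 k by (auto simp: m_assoc)
   finally show "x i 0 \<otimes> s \<otimes> y 0 i \<otimes> (y k 0 \<otimes> t \<otimes> z 0 k) = (if k = i then x i 0 \<otimes> (s \<otimes> t) \<otimes> z 0 i else \<zero>)"
    using st xyz i 0 k by (simp add: m_assoc)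
  qed (use xyz st i 0 in auto)
  also have "... = x i 0 \<otimes> (s \<otimes> t) \<otimes> z 0 i" by (rule finsum_delta) (use xyz st i 0 in auto)
  finally show ?thesis .
 qed
 define P where "P = (\<Oplus>k\<in>{..<n}. b k 0 \<otimes> u \<otimes> a 0 k)"
 define Q where "Q = (\<Oplus>k\<in>{..<n}. a k 0 \<otimes> v \<otimes> b 0 k)"
 have PQi: "b i 0 \<otimes> u \<otimes> a 0 i \<otimes> Q = b i i" if i: "i < n" for i
 proof -
  have "b i 0 \<otimes> u \<otimes> a 0 i \<otimes> Q = b i 0 \<otimes> (u \<otimes> v) \<otimes> b 0 i" unfolding Q_def by (rule gen[of b a b u v i]) (fact b a am uv i)+
  then show ?thesis using bm[OF i 0 0 0] bm[OF i 0 0 i] uv(7) by simp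
 qed
 have QPi: "a i 0 \<otimes> v \<otimes> b 0 i \<otimes> P = a i i" if i: "i < n" for i
 proof -
  have "a i 0 \<otimes> v \<otimes> b 0 i \<otimes> P = a i 0 \<otimes> (v \<otimes> u) \<otimes> a 0 i" unfolding P_def by (rule gen[of a b a v u i]) (fact b a bm uv i)+
  then show ?thesis using am[OF i 0 0 0] am[OF i 0 0 i] uv(8) by simp
 qed
 have PQc: "P:.R" "Q:.R" unfolding P_def Q_def using a b uv 0 by (auto intro!: finsum_closed)
 have "P \<otimes> Q = (\<Oplus>i\<in>{..<n}. b i 0 \<otimes> u \<otimes> a 0 i \<otimes> Q)" unfolding P_def by (rule finsum_right) (use PQc a b uv 0 in auto)
 also have "... = (\<Oplus>i\<in>{..<n}. b i i)"
  by (rule fcong) (use b PQi in auto)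
 finally have PQ: "P \<otimes> Q = \<one>" using b1 by simp
 have "Q \<otimes> P = (\<Oplus>i\<in>{..<n}. a i 0 \<otimes> v \<otimes> b 0 i \<otimes> P)" unfolding Q_def by (rule finsum_right) (use PQc a b uv 0 in auto)
 also have "... = (\<Oplus>i\<in>{..<n}. a i i)"
  by (rule fcong) (use a QPi in auto)
 finally have QP: "Q \<otimes> P = \<one>" using a1 by simp
 have bP: "b i j \<otimes> P = P \<otimes> a i j" if ij: "i < n" "j < n" for i j
 proof -
  have x: "b i j \<otimes> (b k 0 \<otimes> u \<otimes> a 0 k) = (if k = j then b i 0 \<otimes> u \<otimes> a 0 j else \<zero>)" if k: "k < n" for k
  proof -
   have "b i j \<otimes> (b k 0 \<otimes> u \<otimes> a 0 k) = (b i j \<otimes> b k 0) \<otimes> u \<otimes> a 0 k" using a b uv ij k 0 by (simp add: m_assoc)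
   then show ?thesis using bm[OF ij k 0] a uv k 0 by auto
  qed
  have y: "b k 0 \<otimes> u \<otimes> a 0 k \<otimes> a i j = (if k = i then b i 0 \<otimes> u \<otimes> a 0 j else \<zero>)" if k: "k < n" for k
   using am[OF 0 k ij] a b uv ij k 0 by (auto simp: m_assoc)
  have "b i j \<otimes> P = (\<Oplus>k\<in>{..<n}. b i j \<otimes> (b k 0 \<otimes> u \<otimes> a 0 k))" unfolding P_def by (rule finsum_left) (use a b uv ij 0 in auto)
  also have "... = (\<Oplus>k\<in>{..<n}. if k = j then b i 0 \<otimes> u \<otimes> a 0 j else \<zero>)" by (rule fcong) (use x a b uv ij 0 in auto)
  also have "... = b i 0 \<otimes> u \<otimes> a 0 j" by (rule finsum_delta) (use a b uv ij 0 in auto)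
  also have "... = (\<Oplus>k\<in>{..<n}. if k = i then b i 0 \<otimes> u \<otimes> a 0 j else \<zero>)"
   by (rule finsum_delta[symmetric]) (use a b uv ij 0 in auto)
  also have "... = (\<Oplus>k\<in>{..<n}. b k 0 \<otimes> u \<otimes> a 0 k \<otimes> a i j)" by (rule fcong) (use y a b uv ij 0 in auto)
  also have "... = P \<otimes> a i j" unfolding P_def by (rule finsum_right[symmetric]) (use a b uv ij 0 in auto)
  finally show ?thesis .
 qed
 show ?thesis by (rule that[OF PQc PQ QP]) (fact bP)
qed

text \<open>A maximal system \<open>v\<^sub>i u\<^sub>j = \<delta>\<^sub>i\<^sub>j e\<close> has \<open>\<Sum> u\<^sub>i v\<^sub>i = \<one>\<close>, since otherwise it can be enlarged inside
  the complementary idempotent.\<close>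

definition usys :: "'a=>nat=>(nat=>'a)=>(nat=>'a)=>bool" where
 "usys e r u v \<longleftrightarrow> (ALL i<r. u i:.R & v i:.R & u i \<otimes> e = u i & e \<otimes> v i = v i &
   (ALL j<r. v i \<otimes> u j = (if i = j then e else \<zero>)))"

lemma usysD:
 assumes "usys e r u v" "i < r"
 shows "u i:.R" "v i:.R" "u i \<otimes> e = u i" "e \<otimes> v i = v i" "!!j. j < r==>v i \<otimes> u j = (if i = j then e else \<zero>)"
 using assms unfolding usys_def by auto

lemma usys_extend:
 assumes R: "simple_ring R" and e: "dvid R e" and s: "usys e r u v" and p: "(\<Oplus>i\<in>{..<r}. u i \<otimes> v i) ~= \<one>"
 shows "EX u v. usys e (Suc r) u v"
proof -
 note eD = dvidD[OF e] and sD = usysD[OF s]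
 let ?s = "\<Oplus>i\<in>{..<r}. u i \<otimes> v i"
 have sc: "?s:.R" by (rule finsum_closed) (use sD in auto)
 define p where "p = \<one> \<ominus> ?s"
 have pc: "p:.R" using sc by (simp add: p_def)
 have p0: "p ~= \<zero>" using p sc by (simp add: p_def)
 have vs: "v i \<otimes> ?s = v i" if i: "i < r" for i
 proof -
  have "v i \<otimes> ?s = (\<Oplus>k\<in>{..<r}. v i \<otimes> (u k \<otimes> v k))" by (rule finsum_left) (use sD i in auto)
  also have "... = (\<Oplus>k\<in>{..<r}. if k = i then v i else \<zero>)"
   by (rule fcong) (use sD(1,2) sD(4,5)[OF i] i in "auto simp: m_assoc[symmetric]")
  also have "... = v i" by (rule finsum_delta) (use sD i in auto)
  finally show ?thesis .
 qed
 have us: "?s \<otimes> u i = u i" if i: "i < r" for i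
 proof -
  have "?s \<otimes> u i = (\<Oplus>k\<in>{..<r}. u k \<otimes> v k \<otimes> u i)" by (rule finsum_right) (use sD i in auto)
  also have "... = (\<Oplus>k\<in>{..<r}. if k = i then u i else \<zero>)"
   by (rule fcong) (use sD(1,2,3) sD(5)[OF _ i] i in "auto simp: m_assoc")
  also have "... = u i" by (rule finsum_delta) (use sD i in auto)
  finally show ?thesis .
 qed
 have vp: "v i \<otimes> p = \<zero>" and pu: "p \<otimes> u i = \<zero>" if i: "i < r" for i
  using vs[OF i] us[OF i] sD(1,2)[OF i] sc by (simp_all add: p_def minus_eq r_distr l_distr r_minus l_minus r_neg)
 have "?s \<otimes> p = (\<Oplus>k\<in>{..<r}. u k \<otimes> v k \<otimes> p)" by (rule finsum_right) (use sD pc in auto)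
 also have "... = \<zero>" by (rule finsum_all_zero) (use sD vp pc in "auto simp: m_assoc")
 finally have pp: "p \<otimes> p = p" using pc sc by (subst (1) p_def) (simp add: minus_eq l_distr l_minus)
 \<comment> \<open>Construction of the new pair. Primeness gives a nonzero w = e b p and a nonzero w
   c e, whose inverse in eRe is d. Then v_r = w and u_r = p c d satisfy v_r u_r = e, and the factor
   p makes them orthogonal to the old pairs.\<close>
 obtain b where b: "b:.R" "e \<otimes> b \<otimes> p ~= \<zero>" using simple_prime[OF R eD(1,2) pc p0] by blast
 let ?w = "e \<otimes> b \<otimes> p"
 have w: "?w:.R" "e \<otimes> ?w = ?w" "?w \<otimes> p = ?w" using eD b pc pp by (auto simp: m_assoc) (simp add: m_assoc[symmetric] eD)
 obtain c where c: "c:.R" "?w \<otimes> c \<otimes> e ~= \<zero>" using simple_prime[OF R w(1) b(2) eD(1,2)] by blast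
 have wc: "e \<otimes> (?w \<otimes> c \<otimes> e) = ?w \<otimes> c \<otimes> e" using w c eD by (metis m_assoc m_closed)
 have wc': "?w \<otimes> c \<otimes> e \<otimes> e = ?w \<otimes> c \<otimes> e" using w c eD by (simp add: m_assoc)
 obtain d where d: "d:.R" "e \<otimes> d = d" "d \<otimes> e = d" "?w \<otimes> c \<otimes> e \<otimes> d = e"
  by (rule dvid_inv[OF e _ wc wc' c(2)]) (use w c eD in auto)
 let ?u = "u(r := p \<otimes> c \<otimes> d)" and ?v = "v(r := ?w)"
 have "?w \<otimes> (p \<otimes> c \<otimes> d) = (?w \<otimes> p) \<otimes> c \<otimes> d" using w(1) pc c(1) d(1) by (simp only: m_assoc m_closed)
 also have "... = ?w \<otimes> c \<otimes> (e \<otimes> d)" unfolding w(3) d(2) ..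
 also have "... = e" using d(4) w(1) c eD d(1) by (simp only: m_assoc m_closed)
 finally have 1: "?w \<otimes> (p \<otimes> c \<otimes> d) = e" .
 have 2: "?w \<otimes> u i = \<zero>" if i: "i < r" for i using pu[OF i] eD b pc sD(1)[OF i] by (simp add: m_assoc)
 have 3: "v i \<otimes> (p \<otimes> c \<otimes> d) = \<zero>" if i: "i < r" for i using vp[OF i] c d pc sD(2)[OF i] by (simp add: m_assoc[symmetric])
 have "usys e (Suc r) ?u ?v" unfolding usys_def less_Suc_eq using sD w 1 2 3 pc c d eD(1) by (auto simp: m_assoc)
 then show ?thesis by blast
qed

end

context assoc_algebra
begin

text \<open>Multiplying a relation among the \<open>u i\<close> by \<open>v j\<close> isolates its
  j-th coefficient times \<open>e\<close>, so the \<open>u i\<close> are independent and their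
  number is bounded.\<close>

lemma usys_bound:
 assumes fin: fin_dim and e: "dvid A e" and s: "usys e r u v" shows "r <= dim"
proof -
 note eD = dvidD[OF e] and sD = usysD[OF s]
 have "indep_family K A {..<r} u" unfolding indep_family_def
 proof (intro conjI ballI impI)
  fix k j assume k: "k:{..<r}->.K" "lc A {..<r} k u = 0[A]" and "j:{..<r}"
  then have j: "j < r" by simp
  have kc: "!!i. i < r==>k i:.K" using k(1) by auto
  have "v j*[A]lc A {..<r} k u = (\<Oplus>[A]i:{..<r}. v j*[A](k i*.[A]u i))" unfolding lc_def
   by (rule finsum_left) (use sD kc j in auto)
  also have "... = (\<Oplus>[A]i:{..<r}. if i = j then k j*.[A]e else 0[A])"
   by (rule M.fcong) (use sD(1,2) sD(5)[OF j] kc j eD in "auto simp: smult_mult_right")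
  also have "... = k j*.[A]e" by (rule M.finsum_delta) (use kc j eD in auto)
  finally have "k j*.[A]e = 0[A]" using k(2) sD(2)[OF j] by simp
  then show "k j = 0[K]" using smult_eq_zero[OF kc[OF j] eD(1)] eD(2) by blast
 qed (use sD in auto)
 then show ?thesis using indep_family_card[OF _ fin] by fastforce
qed

lemma usys_exists:
 assumes fin: fin_dim and R: "simple_ring A" and e: "dvid A e"
 obtains r u v where "r >= 1" "usys e r u v" "(\<Oplus>[A]i:{..<r}. u i*[A]v i) = 1[A]"
proof -
 let ?P = "%r. EX u v. usys e r u v"
 have b: "ALL r. ?P r --> r <= dim" using usys_bound[OF fin e] by blast
 have "?P 0" by (simp add: usys_def)
 then obtain u v where s: "usys e (Greatest ?P) u v" using GreatestI_nat[of ?P 0 dim] b by blast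
 have "(\<Oplus>[A]i:{..<Greatest ?P}. u i*[A]v i) = 1[A]"
 proof (rule ccontr)
  assume "~ ?thesis"
  from usys_extend[OF R e s this] have "Suc (Greatest ?P) <= Greatest ?P" using Greatest_le_nat[of ?P _ dim] b by blast
  then show False by simp
 qed
 moreover have "Greatest ?P >= 1"
 proof (rule ccontr)
  assume "~ ?thesis"
  then have "Greatest ?P = 0" by simp
  then have "1[A] = 0[A]" using calculation by simp
  then show False using dvidD[OF e] l_one l_null by metis
 qed
 ultimately show ?thesis using that s by blast
qed

text \<open>An infinite strictly descending chain of principal left ideals would give arbitrarily many
  independent elements.\<close>

lemma minimal_left_ideal:
 assumes fin: fin_dim and nz: "1[A] ~= 0[A]"
 obtains x where "x:.A" "x ~= 0[A]"
  "!!a. a:.A==>a*[A]x ~= 0[A]==>EX b:carrier A. x = b*[A](a*[A]x)"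
proof (rule ccontr)
 assume no: "~ thesis"
 note main = that
 have "EX a:carrier A. a*[A]x ~= 0[A] & (ALL b:carrier A. x ~= b*[A](a*[A]x))" if "x:.A" "x ~= 0[A]" for x
  using no main[OF that] by blast
 then obtain s where s: "!!x. x:.A==>x ~= 0[A]==>s x:.A"
  "!!x. x:.A==>x ~= 0[A]==>s x*[A]x ~= 0[A]"
  "!!x b. x:.A==>x ~= 0[A]==>b:.A==>x ~= b*[A](s x*[A]x)" by metis
 define f where "f = rec_nat 1[A] (%_ x. s x*[A]x)"
 have fS: "f (Suc n) = s (f n)*[A]f n" for n by (simp add: f_def)
 have f: "f n:.A & f n ~= 0[A]" for n
 proof (induction n)
  case 0 then show ?case using nz by (simp add: f_def)
 next
  case (Suc n) then show ?case using s(1,2) by (simp add: fS)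
 qed
 have ch: "EX a:carrier A. f (n + m) = a*[A]f n" for n m
 proof (induction m)
  case 0 then show ?case using f by (intro bexI[of _ "1[A]"]) auto
 next
  case (Suc m)
  then obtain a where "a:.A" "f (n + m) = a*[A]f n" by blast
  moreover have "s (f (n + m)):.A" using s(1) f by blast
  ultimately show ?case using f by (intro bexI[of _ "s (f (n + m))*[A]a"]) (auto simp: fS m_assoc)
 qed
 let ?N = "Suc dim"
 have "indep_family K A {..<?N} f" unfolding indep_family_def
 proof (intro conjI ballI impI)
  fix k j assume k: "k:{..<?N}->.K" "lc A {..<?N} k f = 0[A]" and j: "j:{..<?N}"
  have kc: "!!i. i < ?N==>k i:.K" using k(1) by auto
  \<comment> \<open>The first nonzero coefficient j of a relation would express f_j as a multiple of
    f_(j+1), since all later terms are such multiples; but the chain is strictly descending.\<close>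
  have "j < ?N --> k j = 0[K]"
  proof (induction j rule: less_induct)
   case (less j)
   show ?case
   proof (intro impI,rule ccontr)
    assume jN: "j < ?N" and nz: "k j ~= 0[K]"
    have kj: "k j:.K" by (rule kc[OF jN])
    let ?x = "f (Suc j)"
    have "ALL i. EX a. a:.A & (Suc j <= i --> f i = a*[A]?x)"
     using ch[of "Suc j"] by (metis le_Suc_ex one_closed)
    then obtain a where a: "!!i. a i:.A" "!!i. Suc j <= i==>f i = a i*[A]?x" by metis
    define t where "t = (%i. if Suc j <= i then k i*.[A]a i else 0[A])"
    have t: "i < ?N==>t i:.A" for i using a(1) kc by (simp add: t_def)
    let ?T = "\<Oplus>[A]i:{..<?N}. t i"
    have T: "?T:.A" by (rule M.finsum_closed) (use t in auto)
    have "lc A {..<?N} k f = (\<Oplus>[A]i:{..<?N}. (if i = j then k j*.[A]f j else 0[A])+[A]t i*[A]?x)" unfolding lc_def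
    proof (rule M.fcong)
     fix i assume "i:{..<?N}" then have i: "i < ?N" by simp
     consider "i < j" | "i = j" | "Suc j <= i" by linarith
     then show "k i*.[A]f i = (if i = j then k j*.[A]f j else 0[A])+[A]t i*[A]?x"
     proof cases
      case 1 then show ?thesis using less.IH i f by (simp add: t_def)
     next
      case 2 then show ?thesis using f kj by (simp add: t_def)
     next
      case 3 then show ?thesis using a(1)[of i] kc[OF i] f j by (auto simp: t_def smult_mult_left a(2)[OF 3])
     qed
    qed (use f t kj in auto)
    also have "... = (\<Oplus>[A]i:{..<?N}. if i = j then k j*.[A]f j else 0[A])+[A](\<Oplus>[A]i:{..<?N}. t i*[A]?x)"
     by (rule M.finsum_addf) (use f t kj in auto)
    also have "(\<Oplus>[A]i:{..<?N}. if i = j then k j*.[A]f j else 0[A]) = k j*.[A]f j"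
     by (rule M.finsum_delta) (use f kj jN in auto)
    also have "(\<Oplus>[A]i:{..<?N}. t i*[A]?x) = ?T*[A]?x" by (rule finsum_right[symmetric]) (use f t in auto)
    finally have 0: "k j*.[A]f j+[A]?T*[A]?x = 0[A]" using k(2) by simp
    have eq: "k j*.[A]f j = \<ominus>\<^bsub>A\<^esub> (?T*[A]?x)" by (rule M.minus_equality[symmetric,OF _ _ _]) (use 0 f T kj in "auto simp: M.a_comm")
    have "k j:Units K" using nz kj field_Units by auto
    then have iv: "inv\<^bsub>K\<^esub> k j:.K" "inv\<^bsub>K\<^esub> k j*[K]k j = 1[K]" by auto
    have "f j = inv\<^bsub>K\<^esub> k j*.[A](k j*.[A]f j)" using iv kj f by (simp add: smult_assoc1[symmetric])
    also have "... = (inv\<^bsub>K\<^esub> k j*.[A](\<ominus>\<^bsub>A\<^esub> ?T))*[A]?x" unfolding eq using iv T f by (simp add: smult_mult_left l_minus)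
    finally show False using s(3)[of "f j" "inv\<^bsub>K\<^esub> k j*.[A](\<ominus>\<^bsub>A\<^esub> ?T)"] f iv T by (simp add: fS)
   qed
  qed
  then show "k j = 0[K]" using j by simp
 qed (use f in auto)
 then show False using indep_family_card[OF _ fin] by fastforce
qed

text \<open>Brauer's lemma. Primeness gives x a x \<noteq> 0; with z = a x, minimality of the left
  ideal A x makes right multiplication by z injective on it. Writing x = b (x a x), the element e =
  a b x of A x fixes z from the left, and injectivity forces it to be idempotent.\<close>

lemma dvid_exists:
 assumes fin: fin_dim and R: "simple_ring A"
 obtains e where "dvid A e"
proof -
 have nz: "1[A] ~= 0[A]"
 proof
  assume 0: "1[A] = 0[A]"
  have "x = 0[A]" if "x:.A" for x using l_one[OF that] l_null[OF that] 0 by simp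
  then show False using R by (auto simp: simple_ring_def)
 qed
 obtain x where x: "x:.A" "x ~= 0[A]"
  and min: "!!a. a:.A==>a*[A]x ~= 0[A]==>EX b:carrier A. x = b*[A](a*[A]x)"
  by (rule minimal_left_ideal[OF fin nz]) blast
 obtain a where a: "a:.A" "x*[A]a*[A]x ~= 0[A]" using simple_prime[OF R x x] by blast
 let ?z = "a*[A]x"
 have z: "?z:.A" "x*[A]?z ~= 0[A]" using a x by (auto simp: m_assoc)
 have inj: "c*[A]x = 0[A]" if c: "c:.A" "c*[A]x*[A]?z = 0[A]" for c
 proof (rule ccontr)
  assume "c*[A]x ~= 0[A]"
  then obtain b where b: "b:.A" "x = b*[A](c*[A]x)" using min[OF c(1)] by blast
  have "x*[A]?z = b*[A](c*[A]x)*[A]?z" using b(2) by simp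
  also have "... = 0[A]" using b(1) c x z by (simp add: m_assoc)
  finally show False using z(2) by simp
 qed
 have "(x*[A]a)*[A]x ~= 0[A]" by (rule a(2))
 then obtain b where b: "b:.A" "x = b*[A](x*[A]a*[A]x)" using min[of "x*[A]a"] a x by auto
 let ?g = "a*[A]b"
 let ?e = "?g*[A]x"
 have e: "?e:.A" using a b x by simp
 have "?e*[A]?z = a*[A](b*[A](x*[A]a*[A]x))" using a b(1) x by (simp add: m_assoc)
 then have ez: "?e*[A]?z = ?z" using b(2) by simp
 \<comment> \<open>Since e = g x, this says e e = e. It can be tested after multiplication by z,
   where e z = z applies.\<close>
 have "(?e*[A]?g \<ominus>\<^bsub>A\<^esub> ?g)*[A]x = 0[A]"
 proof (rule inj)
  have "(?e*[A]?g \<ominus>\<^bsub>A\<^esub> ?g)*[A]x*[A]?z = ?e*[A](?e*[A]?z) \<ominus>\<^bsub>A\<^esub> ?e*[A]?z"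
   using a b(1) x e z by (simp add: minus_eq l_distr l_minus m_assoc)
  then show "(?e*[A]?g \<ominus>\<^bsub>A\<^esub> ?g)*[A]x*[A]?z = 0[A]" using ez z by simp
 qed (use a b e in auto)
 then have "?e*[A]?e \<ominus>\<^bsub>A\<^esub> ?e = 0[A]" using a b(1) x e by (simp add: minus_eq l_distr l_minus m_assoc)
 then have ee: "?e*[A]?e = ?e" using e by simp
 have e0: "?e ~= 0[A]" using ez z x(1) l_null r_null by metis
 have "dvid A ?e" unfolding dvid_def
 proof (intro conjI ballI impI e e0 ee)
  fix y assume y: "y:.A" "?e*[A]y = y" "y*[A]?e = y" "y ~= 0[A]"
  have yx: "(y*[A]?g)*[A]x = y" using y(1,3) a b(1) x by (simp add: m_assoc)
  then obtain c where c: "c:.A" "x = c*[A]y" using min[of "y*[A]?g"] y a b by auto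
  \<comment> \<open>Minimality writes x = c y, hence g c y = g x = e; cutting g c down to the corner
    gives the left inverse of y there.\<close>
  let ?h = "?e*[A](?g*[A]c)*[A]?e"
  have gc: "?g:.A" "?g*[A]c:.A" using a b c by auto
  have "?h*[A]y = ?e*[A](?g*[A]c)*[A](?e*[A]y)" using gc e y(1) by (simp only: m_assoc m_closed)
  also have "... = ?e*[A](?g*[A](c*[A]y))" unfolding y(2) using gc e y(1) c(1) by (simp only: m_assoc m_closed)
  also have "... = ?e" unfolding c(2)[symmetric] by (rule ee)
  finally have hy: "?h*[A]y = ?e" .
  have "?e*[A]?h = (?e*[A]?e)*[A](?g*[A]c)*[A]?e" using gc(2) e by (simp only: m_assoc m_closed)
  then have h1: "?e*[A]?h = ?h" unfolding ee .
  have "?h*[A]?e = ?e*[A](?g*[A]c)*[A](?e*[A]?e)" using gc(2) e by (simp only: m_assoc m_closed)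
  then have h2: "?h*[A]?e = ?h" unfolding ee .
  show "EX h:carrier A. ?e*[A]h = h & h*[A]?e = h & h*[A]y = ?e"
   by (rule bexI[of _ ?h]) (use h1 h2 hy gc e in auto)
 qed
 then show ?thesis using that by blast
qed

end

text \<open>An embedding of \<open>D\<close> onto the corner eAe, with unit \<open>e\<close> instead
  of the unit of \<open>A\<close>. Keeping the embedding explicit lets \<open>D\<close> live in any
  type and lets corners be carried along equivalences of idempotents and isomorphisms of
  \<open>A\<close>.\<close>

definition corner_map :: "('a, 'm) ring_scheme=>('a, 'd, 'n) module_scheme=>('a, 'b, 'p) module_scheme=>'b=>('d=>'b)=>bool" where
 "corner_map K D A e \<psi> \<longleftrightarrow> \<psi>:module_hom K D A & (ALL x:carrier D. ALL y:carrier D. \<psi> (x*[D]y) = \<psi> x*[A]\<psi> y) &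
   \<psi> 1[D] = e & bij_betw \<psi> (carrier D) {x:carrier A. e*[A]x = x & x*[A]e = x}"

lemma corner_mapD:
 assumes "corner_map K D A e \<psi>"
 shows "\<psi>:module_hom K D A" "!!x y. x:.D==>y:.D==>\<psi> (x*[D]y) = \<psi> x*[A]\<psi> y" "\<psi> 1[D] = e"
  "inj_on \<psi> (carrier D)" "!!x. x:.D==>e*[A]\<psi> x = \<psi> x" "!!x. x:.D==>\<psi> x*[A]e = \<psi> x"
  "!!y. y:.A==>e*[A]y = y==>y*[A]e = y==>EX x:carrier D. y = \<psi> x"
 using assms unfolding corner_map_def bij_betw_def by (auto simp: set_eq_iff)

lemma corner_mapI:
 assumes "\<psi>:module_hom K D A" "!!x y. x:.D==>y:.D==>\<psi> (x*[D]y) = \<psi> x*[A]\<psi> y" "\<psi> 1[D] = e"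
  "inj_on \<psi> (carrier D)" "!!x. x:.D==>e*[A]\<psi> x = \<psi> x" "!!x. x:.D==>\<psi> x*[A]e = \<psi> x"
  "!!y. y:.A==>e*[A]y = y==>y*[A]e = y==>EX x:carrier D. y = \<psi> x"
 shows "corner_map K D A e \<psi>"
 unfolding corner_map_def bij_betw_def using assms module_homD(1)[OF assms(1)] by (auto simp: image_iff)

lemma corner_map_unique:
 assumes D: "assoc_algebra K D" and D': "assoc_algebra K D'" and p: "corner_map K D A e \<psi>" and q: "corner_map K D' A e \<psi>'"
 shows "algebra_iso K D D'"
proof -
 note pD = corner_mapD[OF p] and qD = corner_mapD[OF q]
 note pm = module_homD[OF pD(1)] and qm = module_homD[OF qD(1)]
 interpret D: assoc_algebra K D by fact
 interpret D': assoc_algebra K D' by fact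
 have "ALL x:carrier D. EX y. y:.D' & \<psi>' y = \<psi> x" using qD(7)[OF pm(1) pD(5,6)] by metis
 then obtain g where g: "!!x. x:.D==>g x:.D'" "!!x. x:.D==>\<psi>' (g x) = \<psi> x" unfolding bchoice_iff by blast
 have "g:ring_iso D D'" unfolding ring_iso_def
 proof (intro CollectI conjI ring_hom_memI)
  fix x y assume xy: "x:.D" "y:.D"
  show "g (x*[D]y) = g x*[D']g y" by (rule inj_onD[OF qD(4)]) (use xy g pD(2) qD(2) in auto)
  show "g (x+[D]y) = g x+[D']g y" by (rule inj_onD[OF qD(4)]) (use xy g pm(2) qm(2) in auto)
 next
  show "g 1[D] = 1[D']" by (rule inj_onD[OF qD(4)]) (use g pD(3) qD(3) in auto)
  show "bij_betw g (carrier D) (carrier D')"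
  proof (rule bij_betw_imageI)
   show "inj_on g (carrier D)" using g(2) pD(4) by (metis inj_on_def)
   show "g ` carrier D = carrier D'"
   proof
    show "g ` carrier D <= carrier D'" using g(1) by auto
    show "carrier D' <= g ` carrier D"
    proof
     fix y assume y: "y:.D'"
     obtain x where x: "x:.D" "\<psi>' y = \<psi> x" using pD(7)[OF qm(1)[OF y] qD(5)[OF y] qD(6)[OF y]] by blast
     have "y = g x" by (rule inj_onD[OF qD(4)]) (use x y g in auto)
     then show "y:g ` carrier D" using x(1) by blast
    qed
   qed
  qed
 qed (use g in auto)
 moreover have "g (k*.[D]x) = k*.[D']g x" if "k:.K" "x:.D" for k x
  by (rule inj_onD[OF qD(4)]) (use that g pm(3) qm(3) in auto)
 ultimately show ?thesis unfolding algebra_iso_def by blast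
qed

text \<open>The map x \<mapsto> u x v carries the corner of \<open>e\<close> onto that of
  \<open>f\<close>, with inverse y \<mapsto> v y u. It is multiplicative because v u = e is absorbed
  between two elements of the corner.\<close>

lemma corner_map_conj:
 assumes A: "assoc_algebra K A" and p: "corner_map K D A e \<psi>" and e: "e:.A" "f:.A" "f*[A]f = f"
  and uv: "u:.A" "v:.A" "f*[A]u = u" "u*[A]e = u" "e*[A]v = v" "v*[A]f = v" "u*[A]v = f" "v*[A]u = e"
 shows "corner_map K D A f (%x. u*[A]\<psi> x*[A]v)"
proof -
 interpret A: assoc_algebra K A by fact
 note pD = corner_mapD[OF p]
 note pm = module_homD[OF pD(1)]
 have bk: "v*[A](u*[A]\<psi> x*[A]v)*[A]u = \<psi> x" if x: "x:.D" for x
 proof -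
  have "v*[A](u*[A]\<psi> x*[A]v)*[A]u = (v*[A]u)*[A]\<psi> x*[A](v*[A]u)" using uv(1,2) pm(1)[OF x] by (simp add: A.m_assoc)
  then show ?thesis unfolding uv(8) pD(5)[OF x] pD(6)[OF x] .
 qed
 show ?thesis
 proof (rule corner_mapI)
  show "(%x. u*[A]\<psi> x*[A]v):module_hom K D A"
   by (rule module_homI) (use uv(1,2) pm in "auto simp: A.r_distr A.l_distr A.smult_mult_left A.smult_mult_right")
  show "inj_on (%x. u*[A]\<psi> x*[A]v) (carrier D)" using bk pD(4) unfolding inj_on_def by metis
  show "u*[A]\<psi> 1[D]*[A]v = f" unfolding pD(3) uv(4,7) ..
  fix x assume x: "x:.D"
  note px = pm(1)[OF x]
  show "f*[A](u*[A]\<psi> x*[A]v) = u*[A]\<psi> x*[A]v" using uv(1-3) px e by (simp add: A.m_assoc[symmetric])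
  show "u*[A]\<psi> x*[A]v*[A]f = u*[A]\<psi> x*[A]v" using uv(1,2,6) px e by (simp add: A.m_assoc)
  fix y assume y: "y:.D"
  note py = pm(1)[OF y]
  have "u*[A]\<psi> x*[A]v*[A](u*[A]\<psi> y*[A]v) = u*[A](\<psi> x*[A](v*[A]u)*[A]\<psi> y)*[A]v"
   using uv(1,2) px py by (simp add: A.m_assoc)
  then show "u*[A]\<psi> (x*[D]y)*[A]v = u*[A]\<psi> x*[A]v*[A](u*[A]\<psi> y*[A]v)"
   unfolding uv(8) pD(6)[OF x] pD(2)[OF x y] by simp
 next
  fix y assume y: "y:.A" "f*[A]y = y" "y*[A]f = y"
  let ?y = "v*[A]y*[A]u"
  have "e*[A]?y = ?y" "?y*[A]e = ?y" using uv y e by (simp_all add: A.m_assoc) (metis A.m_assoc A.m_closed)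
  then obtain x where x: "x:.D" "?y = \<psi> x" using pD(7)[of ?y] uv(1,2) y(1) by auto
  have "u*[A]?y*[A]v = (u*[A]v)*[A]y*[A](u*[A]v)" using uv(1,2) y(1) by (simp add: A.m_assoc)
  then have "u*[A]?y*[A]v = y" unfolding uv(7) y(2,3) .
  then show "EX x:carrier D. y = u*[A]\<psi> x*[A]v" using x by metis
 qed
qed

lemma corner_map_comp:
 assumes p: "corner_map K D A e \<psi>" and e: "e:.A" and A: "assoc_algebra K A" and h: "h:ring_iso A B" "h:module_hom K A B"
 shows "corner_map K D B (h e) (%x. h (\<psi> x))"
proof -
 interpret A: assoc_algebra K A by fact
 note pD = corner_mapD[OF p]
 note pm = module_homD[OF pD(1)] and hm = module_homD[OF h(2)]
 have hmul: "!!x y. x:.A==>y:.A==>h (x*[A]y) = h x*[B]h y" and hb: "inj_on h (carrier A)" "h ` carrier A = carrier B"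
  using h(1) by (auto simp: ring_iso_def ring_hom_def bij_betw_def)
 show ?thesis
 proof (rule corner_mapI)
  show "(%x. h (\<psi> x)):module_hom K D B" by (rule module_homI) (use pm hm in auto)
  show "inj_on (%x. h (\<psi> x)) (carrier D)" using pD(4) hb(1) pm(1) unfolding inj_on_def by metis
 next
  fix y assume y: "y:.B" "h e*[B]y = y" "y*[B]h e = y"
  then obtain z where z: "z:.A" "y = h z" using hb(2) by auto
  have "e*[A]z = z" "z*[A]e = z" by (rule inj_onD[OF hb(1)]; use z y e hmul in auto)+
  then show "EX x:carrier D. y = h (\<psi> x)" using pD(7)[of z] z by auto
 qed (use pD(2,3,5,6) pm(1) e in "auto simp: hmul[symmetric]")
qed

lemma dvid_corner_map:
 assumes D: "assoc_algebra K D" and A: "assoc_algebra K A" and p: "corner_map K D A e \<psi>"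
 shows "dvid D 1[D] \<longleftrightarrow> dvid A e"
proof -
 interpret D: assoc_algebra K D by fact
 interpret A: assoc_algebra K A by fact
 note pD = corner_mapD[OF p]
 note pm = module_homD[OF pD(1)]
 have p0: "\<psi> 0[D] = 0[A]" by (rule additive_zero[OF D.M.abelian_group_axioms A.M.abelian_group_axioms]) (use pm in auto)
 have inj: "\<psi> x = \<psi> y \<longleftrightarrow> x = y" if "x:.D" "y:.D" for x y using pD(4) that by (auto dest: inj_onD)
 have ec: "e:.A" "e*[A]e = e" using pm(1)[OF D.one_closed] pD(5)[OF D.one_closed] pD(3) by auto
 have e0: "(1[D] ~= 0[D]) = (e ~= 0[A])" using inj[OF D.one_closed D.zero_closed] p0 pD(3) by simp
 have "(ALL x:carrier D. x ~= 0[D] --> (EX y:carrier D. y*[D]x = 1[D])) = (ALL x:carrier A. e*[A]x = x --> x*[A]e = x --> x ~= 0[A] -->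
    (EX y:carrier A. e*[A]y = y & y*[A]e = y & y*[A]x = e))" (is "?l = ?r")
 proof
  assume l: ?l
  show ?r
  proof (intro ballI impI)
   fix x assume x: "x:.A" "e*[A]x = x" "x*[A]e = x" "x ~= 0[A]"
   obtain z where z: "z:.D" "x = \<psi> z" using pD(7)[OF x(1-3)] by blast
   have "z ~= 0[D]" using x(4) z(2) p0 by auto
   then obtain y where y: "y:.D" "y*[D]z = 1[D]" using l z(1) by blast
   show "EX y:carrier A. e*[A]y = y & y*[A]e = y & y*[A]x = e"
    by (rule bexI[of _ "\<psi> y"]) (use y z pm(1) pD(3,5,6) pD(2)[of y z,symmetric] in auto)
  qed
 next
  assume r: ?r
  show ?l
  proof (intro ballI impI)
   fix x assume x: "x:.D" "x ~= 0[D]"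
   have "\<psi> x ~= 0[A]" using inj[OF x(1) D.zero_closed] p0 x(2) by simp
   then obtain y where y: "y:.A" "e*[A]y = y" "y*[A]e = y" "y*[A]\<psi> x = e" using r pm(1)[OF x(1)] pD(5,6)[OF x(1)] by blast
   obtain z where z: "z:.D" "y = \<psi> z" using pD(7)[OF y(1-3)] by blast
   have "\<psi> (z*[D]x) = \<psi> 1[D]" using y(4) z pD(2)[OF z(1) x(1)] pD(3) by simp
   then show "EX y:carrier D. y*[D]x = 1[D]" using inj[of "z*[D]x" "1[D]"] z x by auto
  qed
 qed
 then show ?thesis unfolding dvid_def using ec e0 by auto
qed

lemma division_iff:
 assumes D: "assoc_algebra K D" shows "division_algebra K D \<longleftrightarrow> dvid D 1[D]"
proof -
 interpret D: assoc_algebra K D by fact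
 show ?thesis
 proof
  assume d: "division_algebra K D"
  then have U: "Units D = carrier D - {0[D]}" by (simp add: division_algebra_def)
  have "1[D] ~= 0[D]" using U D.Units_one_closed by auto
  moreover have "EX y:carrier D. y*[D]x = 1[D]" if "x:.D" "x ~= 0[D]" for x
   using D.Units_l_inv_ex[of x] U that by auto
  ultimately show "dvid D 1[D]" unfolding dvid_def by auto
 next
  assume d: "dvid D 1[D]"
  have "x:Units D" if x: "x:.D" "x ~= 0[D]" for x
  proof -
   obtain y where "y:.D" "y*[D]x = 1[D]" "x*[D]y = 1[D]" by (rule D.dvid_inv[OF d x(1) _ _ x(2)]) (use x in auto)
   then show ?thesis using x(1) unfolding Units_def by blast
  qed
  moreover have "0[D] \<notin> Units D" using D.dvidD(2)[OF d] D.Units_r_inv_ex[of "0[D]"] by auto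
  ultimately show "division_algebra K D" unfolding division_algebra_def using D by auto
 qed
qed

lemma corner_map_munit:
 assumes D: "assoc_algebra K D" and n: "n >= 1"
 shows "corner_map K D (MA D n) (munit D n (0,0) 1[D]) (munit D n (0,0))"
proof -
 interpret D: assoc_algebra K D by fact
 have p: "(0,0):sq n" using n by simp
 note mult = D.munit_mult[OF _ _ p p,unfolded fst_conv snd_conv,simplified]
 show ?thesis
 proof (rule corner_mapI)
  show "munit D n (0,0):module_hom K D (MA D n)"
   by (rule module_homI) (auto simp: mat_algebra_sel mat_ring_sel munit_def)
  show "inj_on (munit D n (0,0)) (carrier D)"
   by (rule inj_on_inverseI[where g = "%M. M (0,0)"]) (use n in "simp add: munit_def")
 next
  fix y assume y: "y:.(MA D n)" "munit D n (0,0) 1[D]*[MA D n]y = y" "y*[MA D n]munit D n (0,0) 1[D] = y"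
  have ym: "y:.(MR D n)" using y(1) by (simp add: mat_algebra_sel)
  note ye = mat_entry[OF ym]
  have z: "y (i,j) = 0[D]" if ij: "i < n" "j < n" "i ~= 0 | j ~= 0" for i j
  proof (cases "i = 0")
   case False
   have "y (i,j) = (\<Oplus>[D]k:{..<n}. munit D n (0,0) 1[D] (i,k)*[D]y (k,j))"
    using y(2) mat_mult_entry[OF ij(1,2),of D "munit D n (0,0) 1[D]" y] by (simp add: mat_algebra_sel)
   also have "... = 0[D]" by (rule D.M.finsum_all_zero) (use False ij ye in "auto simp: munit_def")
   finally show ?thesis .
  next
   case True
   then have j0: "j ~= 0" using ij by simp
   have "y (i,j) = (\<Oplus>[D]k:{..<n}. y (i,k)*[D]munit D n (0,0) 1[D] (k,j))"
    using y(3) mat_mult_entry[OF ij(1,2),of D y "munit D n (0,0) 1[D]"] by (simp add: mat_algebra_sel)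
   also have "... = 0[D]" by (rule D.M.finsum_all_zero) (use j0 ij ye in "auto simp: munit_def")
   finally show ?thesis .
  qed
  have y0: "y (0,0):.D" using ye n by simp
  have "y = munit D n (0,0) (y (0,0))"
   by (rule mat_eqI[OF ym D.munit_closed[OF y0]]) (use z in "auto simp: munit_def")
  then show "EX x:carrier D. y = munit D n (0,0) x" using y0 by blast
 qed (auto simp: mat_algebra_sel mult)
qed

text \<open>Inside one matrix algebra over \<open>D'\<close> both division algebras appear as
  corners of idempotents. These are equivalent by simplicity, so their corners are
  isomorphic.\<close>

lemma division_unique:
 assumes D: "csa K D" "division_algebra K D" and D': "csa K D'" "division_algebra K D'"
  and eq: "brauer_equiv K D D'"
 shows "algebra_iso K D D'"
proof -
 obtain m n where mn: "m >= 1" "n >= 1" "algebra_iso K (MA D m) (MA D' n)" using eq unfolding brauer_equiv_def by auto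
 then obtain h where h: "h:ring_iso (MA D m) (MA D' n)" "h:module_hom K (MA D m) (MA D' n)"
  unfolding algebra_iso_iff by blast
 note aD = csaD(1)[OF D(1)] and aD' = csaD(1)[OF D'(1)]
 interpret M: assoc_algebra K "MA D' n" by (rule mat_algebra_alg[OF aD'])
 interpret D: assoc_algebra K D by (rule aD)
 let ?e = "munit D m (0,0) 1[D]" and ?f = "munit D' n (0,0) 1[D']"
 have ec: "?e:.(MA D m)" using D.munit_closed by (simp add: mat_algebra_sel)
 note c = corner_map_comp[OF corner_map_munit[OF aD mn(1)] ec mat_algebra_alg[OF aD] h]
 note c' = corner_map_munit[OF aD' mn(2)]
 have dv: "dvid (MA D' n) (h ?e)" "dvid (MA D' n) ?f"
  using dvid_corner_map[OF aD M.assoc_algebra_axioms c] dvid_corner_map[OF aD' M.assoc_algebra_axioms c'] D(2) D'(2)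
   division_iff[OF aD] division_iff[OF aD'] by auto
 obtain u v where uv: "u:.(MA D' n)" "v:.(MA D' n)" "?f*[MA D' n]u = u" "u*[MA D' n]h ?e = u"
  "h ?e*[MA D' n]v = v" "v*[MA D' n]?f = v" "u*[MA D' n]v = ?f" "v*[MA D' n]u = h ?e"
  by (rule M.dvid_equiv[OF csaD(3)[OF csa_mat[OF D'(1) mn(2)]] dv])
 show ?thesis
  by (rule corner_map_unique[OF aD aD' corner_map_conj[OF M.assoc_algebra_axioms c M.dvidD(1)[OF dv(1)] M.dvidD(1)[OF dv(2)] M.dvidD(3)[OF dv(2)] uv] c'])
qed

section \<open>Wedderburn's theorem\<close>

definition corner :: "('a, 'b, 'n) module_scheme=>'b=>('a, 'b) module" where
 "corner A e = ring_with_smult \<lparr>carrier = {x:carrier A. e*[A]x = x & x*[A]e = x}, mult = mult A,one = e,zero = zero A,add = add A\<rparr> (smult A)"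

context assoc_algebra
begin

lemma corner_ring:
 assumes e: "e:.A" "e*[A]e = e"
 shows "ring \<lparr>carrier = {x:carrier A. e*[A]x = x & x*[A]e = x}, mult = mult A,one = e,zero = zero A,add = add A\<rparr>"
proof (rule ringI)
 show "abelian_group \<lparr>carrier = {x:carrier A. e*[A]x = x & x*[A]e = x}, mult = mult A,one = e,zero = zero A,add = add A\<rparr>"
 proof (rule abelian_groupI,goal_cases)
  case (6 x)
  then show ?case using e by (intro bexI[of _ "\<ominus>\<^bsub>A\<^esub> x"]) (auto simp: M.l_neg r_minus l_minus)
 qed (use e in "auto simp: r_distr l_distr M.a_ac")
 show "Group.monoid \<lparr>carrier = {x:carrier A. e*[A]x = x & x*[A]e = x}, mult = mult A,one = e,zero = zero A,add = add A\<rparr>"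
 proof (rule monoidI,goal_cases)
  case (1 x y)
  then show ?case using e by (auto simp: m_assoc) (simp add: m_assoc[symmetric])
 qed (use e in "auto simp: m_assoc")
qed (auto simp: l_distr r_distr)

lemma corner_alg:
 assumes e: "e:.A" "e*[A]e = e"
 shows "assoc_algebra K (corner A e)"
 unfolding corner_def
 by (rule assoc_algebraI[OF field_axioms corner_ring[OF e]])
  (use e in "auto simp: smult_mult_left smult_mult_right smult_l_distr smult_r_distr smult_assoc1")

lemma corner_sel: "carrier (corner A e) = {x:carrier A. e*[A]x = x & x*[A]e = x}" "mult (corner A e) = mult A"
 "one (corner A e) = e" "zero (corner A e) = zero A" "add (corner A e) = add A" "smult (corner A e) = smult A"
 by (simp_all add: corner_def)

lemma corner_map_id: "e:.A==>e*[A]e = e==>corner_map K (corner A e) A e (%x. x)"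
 by (rule corner_mapI) (auto simp: corner_sel intro!: module_homI)

lemma corner_fin_dim:
 assumes e: "e:.A" "e*[A]e = e" and fin: fin_dim
 shows "vectorspace.fin_dim K (corner A e)"
proof -
 interpret C: assoc_algebra K "corner A e" by (rule corner_alg[OF e])
 have ee: "e*[A](e*[A]x*[A]e) = e*[A]x*[A]e" "e*[A]x*[A]e*[A]e = e*[A]x*[A]e"
  if "x:.A" for x using that e by (simp_all add: m_assoc) (simp add: m_assoc[symmetric])
 have h: "(%x. e*[A]x*[A]e):module_hom K A (corner A e)"
  by (rule module_homI) (use e ee in "auto simp: corner_sel l_distr r_distr smult_mult_left smult_mult_right")
 interpret linear_map K A "corner A e" "%x. e*[A]x*[A]e"
  by (intro linear_map.intro vs C.vs mod_hom.intro module_axioms C.module_axioms mod_hom_axioms.intro h)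
 have "(%x. e*[A]x*[A]e) ` carrier A = carrier (corner A e)"
 proof
  show "(%x. e*[A]x*[A]e) ` carrier A <= carrier (corner A e)" using module_homD(1)[OF h] by auto
  show "carrier (corner A e) <= (%x. e*[A]x*[A]e) ` carrier A"
  proof
   fix x assume "x:.(corner A e)"
   then have "x:.A" "x = e*[A]x*[A]e" by (auto simp: corner_sel)
   then show "x:(%x. e*[A]x*[A]e) ` carrier A" by blast
  qed
 qed
 then show ?thesis by (rule surj_fin_dim[OF fin])
qed

text \<open>For z central in the corner, z x e = e x z for all x, and this persists when the leading
  z and e are replaced by g(z) and g(e) for a sandwich operator g. If g extracts a coordinate that
  is nonzero at e, it reads k e = l z with l \<noteq> 0.\<close>

lemma corner_center:
 assumes csa: "csa K A" and e: "e:.A" "e ~= 0[A]" "e*[A]e = e" and z: "z:ring_center (corner A e)"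
 shows "EX k:carrier K. z = k*.[A]e"
proof -
 have zc: "z:.A" "e*[A]z = z" "z*[A]e = z" using z by (auto simp: ring_center_def corner_sel)
 have com: "z*[A]x*[A]e = e*[A]x*[A]z" if x: "x:.A" for x
 proof -
  have "e*[A]x*[A]e:.(corner A e)" using e x by (auto simp: corner_sel m_assoc) (simp add: m_assoc[symmetric] e)
  then have "z*[A](e*[A]x*[A]e) = (e*[A]x*[A]e)*[A]z" using z by (auto simp: ring_center_def corner_sel)
  moreover have "z*[A](e*[A]x*[A]e) = (z*[A]e)*[A]x*[A]e" using e zc(1) x by (simp only: m_assoc m_closed)
  moreover have "(e*[A]x*[A]e)*[A]z = e*[A]x*[A](e*[A]z)" using e zc(1) x by (simp only: m_assoc m_closed)
  ultimately show ?thesis unfolding zc(2,3) by simp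
 qed
 have sw: "g z*[A]x*[A]e = g e*[A]x*[A]z" if "g:sw A (carrier A)" "x:.A" for g x using that
 proof (induction arbitrary: x rule: sw.induct)
  case (base a s)
  then show ?case using com[of "s*[A]x"] zc(1) e(1) by (simp add: m_assoc)
 next
  case (add f g)
  then show ?case using sw_closed[OF add.hyps(1)] sw_closed[OF add.hyps(2)] zc(1) e(1) by (simp add: l_distr)
 qed
 obtain b where b: "basis_family K A {..<dim} b" using basis_family_exists csaD(2)[OF csa] by blast
 have "EX i<dim. coord K A {..<dim} b e i ~= 0[K]"
 proof (rule ccontr)
  assume "~ ?thesis"
  then have "lc A {..<dim} (coord K A {..<dim} b e) b = 0[A]" by (intro lc_zero[OF basis_familyD(2)[OF b]]) auto
  then show False using coord_props(2)[OF b e(1)] e(2) by simp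
 qed
 then obtain i where i: "i < dim" "coord K A {..<dim} b e i ~= 0[K]" by blast
 then have i': "i:{..<dim}" by simp
 let ?l = "coord K A {..<dim} b e i" and ?k = "coord K A {..<dim} b z i"
 have lk: "?l:.K" "?k:.K" using coord_closed[OF b _ i'] e zc by auto
 obtain g where g: "g:sw A (carrier A)" "ALL j:{..<dim}. g (b j) = (if j = i then 1[A] else 0[A])"
  using csa_azumaya[OF csa b] i' unfolding azumaya_def by blast
 have gc: "g x = coord K A {..<dim} b x i*.[A]1[A]" if "x:.A" for x
  by (rule azumaya_coord[OF b g(1) _ i' that]) (use g(2) in auto)
 have "?k*.[A]e = ?l*.[A]z" using sw[OF g(1) one_closed] lk zc(1) e(1) by (simp add: gc[OF zc(1)] gc[OF e(1)] smult_mult_left)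
 moreover have "?l:Units K" using i lk field_Units by auto
 then have iv: "inv\<^bsub>K\<^esub> ?l:.K" "inv\<^bsub>K\<^esub> ?l*[K]?l = 1[K]" by auto
 have "z = inv\<^bsub>K\<^esub> ?l*.[A](?l*.[A]z)" using iv lk zc(1) by (simp add: smult_assoc1[symmetric])
 ultimately have "z = (inv\<^bsub>K\<^esub> ?l*[K]?k)*.[A]e" using iv lk e(1) by (simp add: smult_assoc1)
 then show ?thesis using iv lk by blast
qed

lemma corner_csa:
 assumes csa: "csa K A" and d: "dvid A e"
 shows "csa K (corner A e)" "division_algebra K (corner A e)"
proof -
 note e = dvidD[OF d]
 interpret C: assoc_algebra K "corner A e" by (rule corner_alg[OF e(1,3)])
 show div: "division_algebra K (corner A e)"
  using division_iff[OF C.assoc_algebra_axioms] dvid_corner_map[OF C.assoc_algebra_axioms assoc_algebra_axioms corner_map_id[OF e(1,3)]] d by simp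
 then have U: "Units (corner A e) = carrier (corner A e) - {0[corner A e]}" by (simp add: division_algebra_def)
 have "simple_ring (corner A e)" unfolding simple_ring_def
 proof (intro conjI allI impI)
  show "ring (corner A e)" by (rule C.alg_ring)
  show "carrier (corner A e) ~= {0[corner A e]}" using C.one_closed e(2) by (auto simp: corner_sel)
  fix J assume J: "ideal J (corner A e)"
  interpret J: ideal J "corner A e" by fact
  show "J = {0[corner A e]} | J = carrier (corner A e)"
  proof (cases "J = {0[corner A e]}")
   case False
   then obtain x where x: "x:J" "x ~= 0[corner A e]" using J.zero_closed by blast
   then have xU: "x:Units (corner A e)" using U J.a_Hcarr by auto
   have "inv\<^bsub>corner A e\<^esub> x*[corner A e]x:J" by (rule J.I_l_closed[OF x(1)]) (use xU in simp)
   then show ?thesis using J.one_imp_carrier xU by simp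
  qed simp
 qed
 moreover have "ring_center (corner A e) = {k*.[corner A e]1[corner A e] | k. k:.K}"
 proof
  show "ring_center (corner A e) <= {k*.[corner A e]1[corner A e] | k. k:.K}"
   using corner_center[OF csa e] by (auto simp: corner_sel)
  show "{k*.[corner A e]1[corner A e] | k. k:.K} <= ring_center (corner A e)" using C.scalar_central by auto
 qed
 ultimately show "csa K (corner A e)" unfolding central_simple_algebra_def
  using corner_fin_dim[OF e(1,3) csaD(2)[OF csa]] C.assoc_algebra_axioms by blast
qed

text \<open>A Peirce decomposition: x is recorded by the matrix with entries v_i x u_j in the
  corner, and \<Sum> u_k X_kl v_l recovers an element from a matrix X. Both directions rest on
  \<Sum> u_i v_i = 1 and v_i u_j = \<delta>_ij e.\<close>

lemma corner_mat_iso: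
 assumes e: "e:.A" "e*[A]e = e" and s: "usys e r u v" and s1: "(\<Oplus>[A]i:{..<r}. u i*[A]v i) = 1[A]"
 shows "algebra_iso K A (MA (corner A e) r)"
proof -
 note sD = usysD[OF s]
 interpret C: assoc_algebra K "corner A e" by (rule corner_alg[OF e])
 define h where "h = (%x. \<lambda>p\<in>sq r. v (fst p)*[A]x*[A]u (snd p))"
 have ent: "v i*[A]x*[A]u j:.(corner A e)" if x: "x:.A" and ij: "i < r" "j < r" for x i j
 proof -
  have "e*[A](v i*[A]x*[A]u j) = e*[A]v i*[A]x*[A]u j" using e sD(1,2) ij x by (simp add: m_assoc)
  moreover have "v i*[A]x*[A]u j*[A]e = v i*[A]x*[A](u j*[A]e)" using e sD(1,2) ij x by (simp add: m_assoc)
  ultimately show ?thesis using sD ij x by (simp add: corner_sel)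
 qed
 have fs: "finsum (corner A e) X S = finsum A X S" if X: "X:S->.(corner A e)" for X :: "nat=>_" and S
  using additive_finsum[OF C.M.abelian_group_axioms M.abelian_group_axioms,of "%x. x" S X] X by (auto simp: corner_sel)
 have hc: "h x:.(MR (corner A e) r)" if "x:.A" for x using ent[OF that] by (auto simp: h_def mat_ring_sel)
 have split: "x = (\<Oplus>[A]i:{..<r}. u i*[A](v i*[A]x))" if x: "x:.A" for x
 proof -
  have "(\<Oplus>[A]i:{..<r}. u i*[A]v i)*[A]x = (\<Oplus>[A]i:{..<r}. u i*[A]v i*[A]x)" by (rule finsum_right) (use sD x in auto)
  also have "... = (\<Oplus>[A]i:{..<r}. u i*[A](v i*[A]x))" by (rule M.fcong) (use sD x in "auto simp: m_assoc")
  finally show ?thesis using s1 x by simp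
 qed
 have split': "x = (\<Oplus>[A]i:{..<r}. x*[A]u i*[A]v i)" if x: "x:.A" for x
 proof -
  have "x*[A](\<Oplus>[A]i:{..<r}. u i*[A]v i) = (\<Oplus>[A]i:{..<r}. x*[A](u i*[A]v i))" by (rule finsum_left) (use sD x in auto)
  also have "... = (\<Oplus>[A]i:{..<r}. x*[A]u i*[A]v i)" by (rule M.fcong) (use sD x in "auto simp: m_assoc")
  finally show ?thesis using s1 x by simp
 qed
 have "h:ring_iso A (MA (corner A e) r)" unfolding ring_iso_def
 proof (intro CollectI conjI ring_hom_memI)
  fix x y assume x: "x:.A" and y: "y:.A"
  show "h (x*[A]y) = h x*[MA (corner A e) r]h y"
  proof (rule mat_eqI[where R = "corner A e" and n = r])
   show "h (x*[A]y):.(MR (corner A e) r)" using hc x y by simp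
   show "h x*[MA (corner A e) r]h y:.(MR (corner A e) r)"
    using C.mat_mult_closed[OF hc[OF x] hc[OF y]] by (simp add: mat_algebra_sel)
   fix i j assume ij: "i < r" "j < r"
   have "(h x*[MA (corner A e) r]h y) (i,j) = (\<Oplus>[corner A e]k:{..<r}. h x (i,k)*[corner A e]h y (k,j))"
    unfolding mat_algebra_sel by (rule mat_mult_entry[OF ij])
   also have "... = (\<Oplus>[A]k:{..<r}. h x (i,k)*[corner A e]h y (k,j))"
    by (rule fs) (use mat_entry[OF hc[OF x]] mat_entry[OF hc[OF y]] ij in auto)
   also have "... = (\<Oplus>[A]k:{..<r}. v i*[A]x*[A](u k*[A](v k*[A](y*[A]u j))))"
    by (rule M.fcong) (use ij x y sD(1,2) in "auto simp: h_def corner_sel m_assoc")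
   also have "... = v i*[A]x*[A](\<Oplus>[A]k:{..<r}. u k*[A](v k*[A](y*[A]u j)))"
    by (rule finsum_left[symmetric]) (use ij x y sD(1,2) in auto)
   also have "... = v i*[A]x*[A](y*[A]u j)" using split[of "y*[A]u j"] y sD(1)[OF ij(2)] by simp
   finally show "h (x*[A]y) (i,j) = (h x*[MA (corner A e) r]h y) (i,j)"
    using ij x y sD(1,2) by (simp add: h_def m_assoc)
  qed
  show "h (x+[A]y) = h x+[MA (corner A e) r]h y"
   unfolding mat_algebra_sel mat_ring_sel(4) h_def by (rule restrict_ext) (use x y sD(1,2) in "auto simp: corner_sel r_distr l_distr")
 next
  show "h 1[A] = 1[MA (corner A e) r]"
   unfolding mat_algebra_sel mat_ring_sel(3) h_def by (rule restrict_ext) (use sD in "auto simp: corner_sel")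
  show "bij_betw h (carrier A) (carrier (MA (corner A e) r))"
  proof (rule bij_betw_imageI)
   show "inj_on h (carrier A)"
   proof (rule inj_onI)
    fix x y assume x: "x:.A" and y: "y:.A" and eq: "h x = h y"
    have ij: "v i*[A]x*[A]u j = v i*[A]y*[A]u j" if "i < r" "j < r" for i j using fun_cong[OF eq,of "(i,j)"] that by (simp add: h_def)
    have vi: "v i*[A]x = v i*[A]y" if i: "i < r" for i
    proof -
     have "v i*[A]x = (\<Oplus>[A]j:{..<r}. v i*[A]x*[A]u j*[A]v j)" by (rule split') (use x i sD in auto)
     also have "... = (\<Oplus>[A]j:{..<r}. v i*[A]y*[A]u j*[A]v j)" by (rule M.fcong) (use ij[OF i] y i sD in auto)
     also have "... = v i*[A]y" by (rule split'[symmetric]) (use y i sD in auto)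
     finally show ?thesis .
    qed
    have "x = (\<Oplus>[A]i:{..<r}. u i*[A](v i*[A]x))" by (rule split[OF x])
    also have "... = (\<Oplus>[A]i:{..<r}. u i*[A](v i*[A]y))" by (rule M.fcong) (use vi y sD in auto)
    also have "... = y" by (rule split[symmetric,OF y])
    finally show "x = y" .
   qed
   show "h ` carrier A = carrier (MA (corner A e) r)"
   proof
    show "h ` carrier A <= carrier (MA (corner A e) r)" using hc by (auto simp: mat_algebra_sel)
    show "carrier (MA (corner A e) r) <= h ` carrier A"
    proof
     fix X assume "X:.(MA (corner A e) r)"
     then have X: "X:.(MR (corner A e) r)" by (simp add: mat_algebra_sel)
     have Xc: "X (i,j):.A" "e*[A]X (i,j) = X (i,j)" "X (i,j)*[A]e = X (i,j)" if "i < r" "j < r" for i j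
      using mat_entry[OF X that] by (auto simp: corner_sel)
     define x where "x = (\<Oplus>[A]k:{..<r}. u k*[A](\<Oplus>[A]l:{..<r}. X (k,l)*[A]v l))"
     have inn: "(\<Oplus>[A]l:{..<r}. X (k,l)*[A]v l):.A" if "k < r" for k by (rule M.finsum_closed) (use that Xc sD in auto)
     have x: "x:.A" unfolding x_def by (rule M.finsum_closed) (use inn sD in auto)
     have "v i*[A]x*[A]u j = X (i,j)" if ij: "i < r" "j < r" for i j
     proof -
      let ?S = "%k. \<Oplus>[A]l:{..<r}. X (k,l)*[A]v l"
      have "v i*[A]x = (\<Oplus>[A]k:{..<r}. v i*[A](u k*[A]?S k))" unfolding x_def by (rule finsum_left) (use inn sD ij in auto)
      also have "... = (\<Oplus>[A]k:{..<r}. if k = i then e*[A]?S i else 0[A])"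
       by (rule M.fcong) (use inn sD(1,2) sD(5)[OF ij(1)] ij e in "auto simp: m_assoc[symmetric]")
      also have "... = e*[A]?S i" by (rule M.finsum_delta) (use inn ij e in auto)
      finally have "v i*[A]x*[A]u j = e*[A](?S i*[A]u j)" using e inn[OF ij(1)] sD(1)[OF ij(2)] by (simp add: m_assoc)
      also have "?S i*[A]u j = (\<Oplus>[A]l:{..<r}. X (i,l)*[A]v l*[A]u j)" by (rule finsum_right) (use Xc sD ij in auto)
      also have "... = (\<Oplus>[A]l:{..<r}. if l = j then X (i,j) else 0[A])"
       by (rule M.fcong) (use Xc sD(1,2) sD(5)[OF _ ij(2)] ij e in "auto simp: m_assoc")
      also have "... = X (i,j)" by (rule M.finsum_delta) (use Xc ij in auto)
      finally show ?thesis using Xc ij by simp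
     qed
     then have "h x = X" by (intro mat_eqI[OF hc[OF x] X]) (simp add: h_def)
     then show "X:h ` carrier A" using x by blast
    qed
   qed
  qed
 qed (use hc in "auto simp: mat_algebra_sel")
 moreover have "h (k*.[A]x) = k*.[MA (corner A e) r]h x" if "k:.K" "x:.A" for k x
  unfolding mat_algebra_sel h_def by (rule restrict_ext) (use that sD in "auto simp: corner_sel smult_mult_left smult_mult_right")
 ultimately show ?thesis unfolding algebra_iso_def by blast
qed

end

lemma division_iso:
 assumes D: "assoc_algebra K D" and D': "assoc_algebra K D'" and i: "algebra_iso K D D'" and d: "division_algebra K D"
 shows "division_algebra K D'"
proof -
 interpret D: assoc_algebra K D by fact
 obtain h where h: "h:ring_iso D D'" "h:module_hom K D D'" using i unfolding algebra_iso_iff by blast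
 have "corner_map K D D 1[D] (%x. x)" by (rule corner_mapI) (auto intro!: module_homI)
 from corner_map_comp[OF this D.one_closed D h] have c: "corner_map K D D' 1[D'] h" using h(1) by (simp add: ring_iso_def ring_hom_def)
 show ?thesis using dvid_corner_map[OF D D' c] d division_iff[OF D] division_iff[OF D'] by simp
qed

theorem wedderburn:
 fixes K :: "('a, 'm) ring_scheme"
 assumes A: "csa K A"
 obtains D :: "('a,nat=>'a) module" and r where "r >= 1" "csa K D" "division_algebra K D" "algebra_iso K A (MA D r)"
proof -
 interpret A: assoc_algebra K A by (rule csaD(1)[OF A])
 obtain e where d: "dvid A e" by (rule A.dvid_exists[OF csaD(2,3)[OF A]])
 note e = A.dvidD[OF d]
 obtain r u v where r: "r >= 1" and s: "A.usys e r u v" "(\<Oplus>[A]i:{..<r}. u i*[A]v i) = 1[A]" by (rule A.usys_exists[OF csaD(2,3)[OF A] d])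
 note C = A.corner_csa[OF A d]
 obtain D :: "('a,nat=>'a) module" where D: "csa K D" "algebra_iso K (corner A e) D" by (rule brauer_rep[OF C(1)])
 show ?thesis
  by (rule that[OF r D(1) division_iso[OF csaD(1)[OF C(1)] csaD(1)[OF D(1)] D(2) C(2)]
   algebra_iso_trans[OF A.corner_mat_iso[OF e(1,3) s] mat_cong[OF csa_fd[OF C(1)] csaD(1)[OF D(1)] D(2)]]])
qed

section \<open>The dimension of a central division algebra is a square\<close>

text \<open>A division ring with a subset equal to its own centraliser. This equation carries the
  maximality; closure of \<open>S\<close> under the field operations follows from it.\<close>

locale maximal_subfield = sandwich R S for R (structure) and S +
 assumes C: "C = S" and nz: "\<one> ~= \<zero>" and inv: "!!x. x:.R==>x ~= \<zero>==>EX y:carrier R. y \<otimes> x = \<one> & x \<otimes> y = \<one>"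
begin

lemma Sc: "s:S==>s:.R" using S(1) by auto

lemma S_comm: "s:S==>t:S==>s \<otimes> t = t \<otimes> s" using C by auto

lemma S_mem: "z:.R==>(!!s. s:S==>z \<otimes> s = s \<otimes> z)==>z:S" using C by auto

lemma S_zero: "\<zero>:S" by (rule S_mem) (simp_all add: Sc)

lemma S_add: assumes "s:S" "t:S" shows "s \<oplus> t:S"
 by (rule S_mem) (use assms Sc S_comm in "auto simp: l_distr r_distr")

lemma S_minus: assumes "s:S" shows "\<ominus> s:S"
 by (rule S_mem) (use assms Sc S_comm in "auto simp: l_minus r_minus")

lemma S_inv:
 assumes s: "s:S" "s ~= \<zero>" obtains y where "y:S" "s \<otimes> y = \<one>" "y \<otimes> s = \<one>"
proof -
 obtain y where y: "y:.R" "y \<otimes> s = \<one>" "s \<otimes> y = \<one>" using inv[OF Sc[OF s(1)] s(2)] by blast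
 have "y:S"
 proof (rule S_mem[OF y(1)])
  fix t assume t: "t:S"
  note c = Sc[OF t] Sc[OF s(1)] y(1)
  have "y \<otimes> t = y \<otimes> (t \<otimes> s) \<otimes> y" using c y(3) by (simp add: m_assoc)
  also have "... = y \<otimes> (s \<otimes> t) \<otimes> y" using S_comm[OF s(1) t] by simp
  also have "... = (y \<otimes> s) \<otimes> t \<otimes> y" using c by (simp add: m_assoc)
  finally show "y \<otimes> t = t \<otimes> y" using y(2) c by simp
 qed
 then show ?thesis using that y by blast
qed

abbreviation "L \<equiv> R\<lparr>carrier := S\<rparr>"

lemma L_field: "field L"
proof -
 have "cring L"
 proof (rule cringI)
  show "abelian_group L"
  proof (rule abelian_groupI,goal_cases)
   case (6 x) then show ?case using S_minus by (intro bexI[of _ "\<ominus> x"]) (auto simp: l_neg Sc)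
  qed (auto simp: S_add S_zero Sc a_ac)
  show "comm_monoid L" by (rule comm_monoidI) (auto simp: S Sc m_assoc intro: S_comm)
 qed (auto simp: Sc l_distr)
 then show ?thesis
 proof (rule cring.cring_fieldI2)
  show "0[L] ~= 1[L]" using nz by simp
  fix a assume "a:.L" "a ~= 0[L]"
  then have a: "a:S" "a ~= \<zero>" by auto
  obtain y where "y:S" "a \<otimes> y = \<one>" "y \<otimes> a = \<one>" by (rule S_inv[OF a])
  then show "EX b:carrier L. a*[L]b = 1[L]" by auto
 qed
qed

lemma L_finsum:
 assumes "!!i. i:I==>X i:S" shows "finsum L X I = finsum R X I"
proof -
 interpret L: field L by (rule L_field)
 show ?thesis using additive_finsum[OF L.abelian_group_axioms abelian_group_axioms,of "%x. x" I X] assms by (simp add: Sc Pi_def)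
qed

lemma S_finsum: "(!!i. i:I==>X i:S)==>finsum R X I:S"
proof -
 interpret L: field L by (rule L_field)
 assume X: "!!i. i:I==>X i:S"
 then show ?thesis using L.finsum_closed[of X I] L_finsum[of I X] by auto
qed

lemma rindep_unique:
 assumes d: "rindep I d" "d:I->.R" and z: "z:I \<rightarrow> S" "w:I \<rightarrow> S" and eq: "(\<Oplus>i\<in>I. d i \<otimes> z i) = (\<Oplus>i\<in>I. d i \<otimes> w i)" and i: "i:I"
 shows "z i = w i"
proof -
 have dc: "!!i. i:I==>d i:.R" and zc: "!!i. i:I==>z i:S & z i:.R" "!!i. i:I==>w i:S & w i:.R" using d z Sc by auto
 have "(\<Oplus>i\<in>I. d i \<otimes> (z i \<oplus> \<ominus> w i)) = (\<Oplus>i\<in>I. d i \<otimes> z i \<oplus> (\<ominus> \<one>) \<otimes> (d i \<otimes> w i))"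
  by (rule fcong) (use dc zc in "auto simp: r_distr r_minus l_minus")
 also have "... = (\<Oplus>i\<in>I. d i \<otimes> z i) \<oplus> (\<Oplus>i\<in>I. (\<ominus> \<one>) \<otimes> (d i \<otimes> w i))" by (rule finsum_addf) (use dc zc in auto)
 also have "(\<Oplus>i\<in>I. (\<ominus> \<one>) \<otimes> (d i \<otimes> w i)) = (\<ominus> \<one>) \<otimes> (\<Oplus>i\<in>I. d i \<otimes> w i)" by (rule finsum_left[symmetric]) (use dc zc in auto)
 finally have "(\<Oplus>i\<in>I. d i \<otimes> (z i \<oplus> \<ominus> w i)) = \<zero>" unfolding eq using dc zc by (simp add: l_minus r_neg finsum_closed Pi_def)
 moreover have "(%i. z i \<oplus> \<ominus> w i):I \<rightarrow> C" unfolding C using zc S_add S_minus by auto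
 ultimately have "z i \<oplus> \<ominus> w i = \<zero>" using rindepD[OF d(1) _ _ i] by blast
 then show ?thesis using zc[OF i] by (simp add: minus_eq[symmetric])
qed

text \<open>A family of greatest length among the independent ones spans, because enlarging it by x
  yields a relation in which the coefficient of x is nonzero and hence invertible in
  \<open>S\<close>.\<close>

lemma right_basis:
 assumes bound: "!!m d. d:{..<m}->.R==>rindep {..<m} d==>m <= (N::nat)"
 obtains m d where "d:{..<m::nat}->.R" "rindep {..<m} d" "!!x. x:.R==>EX z:{..<m} \<rightarrow> S. x = (\<Oplus>i\<in>{..<m}. d i \<otimes> z i)"
proof -
 let ?P = "%m::nat. EX d. d:{..<m}->.R & rindep {..<m} d"
 let ?m = "Greatest ?P"
 have b: "ALL m. ?P m --> m <= N" using bound by blast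
 have "?P 0" by (intro exI[of _ "%_. \<zero>"]) (simp add: rindep_def)
 then obtain d where d: "d:{..<?m}->.R" "rindep {..<?m} d" using GreatestI_nat[of ?P 0 N] b by blast
 have dc: "!!i. i < ?m==>d i:.R" using d(1) by auto
 have sp: "EX z:{..<?m} \<rightarrow> S. x = (\<Oplus>i\<in>{..<?m}. d i \<otimes> z i)" if x: "x:.R" for x
 proof -
  let ?d = "d(?m := x)"
  have "~ ?P (Suc ?m)" using Greatest_le_nat[of ?P "Suc ?m" N] b by auto
  moreover have "?d:{..<Suc ?m}->.R" using dc x by (auto simp: less_Suc_eq)
  ultimately have "~ rindep {..<Suc ?m} ?d" by blast
  then obtain z i where z: "z:{..<Suc ?m} \<rightarrow> C" "(\<Oplus>i\<in>{..<Suc ?m}. ?d i \<otimes> z i) = \<zero>" and i: "i < Suc ?m" "z i ~= \<zero>" unfolding rindep_def by auto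
  have zS: "!!i. i < Suc ?m==>z i:S" using z(1) unfolding C by auto
  note zc = Sc[OF zS]
  let ?s = "\<Oplus>i\<in>{..<?m}. d i \<otimes> z i"
  have "(\<Oplus>i\<in>{..<Suc ?m}. ?d i \<otimes> z i) = ?d ?m \<otimes> z ?m \<oplus> (\<Oplus>i\<in>{..<?m}. ?d i \<otimes> z i)"
   unfolding lessThan_Suc by (rule finsum_insert) (use dc zc x in auto)
  also have "(\<Oplus>i\<in>{..<?m}. ?d i \<otimes> z i) = ?s" by (rule fcong) (use dc zc in auto)
  finally have s: "x \<otimes> z ?m \<oplus> ?s = \<zero>" using z(2) by simp
  have sc: "?s:.R" by (rule finsum_closed) (use dc zc in auto)
  have zm: "z ?m ~= \<zero>"
  proof
   assume 0: "z ?m = \<zero>"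
   then have "?s = \<zero>" using s x sc by simp
   moreover have "z:{..<?m} \<rightarrow> C" unfolding C using zS by auto
   ultimately have "!!j. j < ?m==>z j = \<zero>" using rindepD[OF d(2)] by blast
   then show False using i 0 by (cases "i = ?m") auto
  qed
  obtain y where y: "y:S" "z ?m \<otimes> y = \<one>" "y \<otimes> z ?m = \<one>" by (rule S_inv[OF zS[OF lessI] zm])
  note yc = Sc[OF y(1)]
  have "x \<otimes> z ?m = \<ominus> ?s" by (rule minus_equality[symmetric]) (use s x zc[of ?m] sc in "auto simp: a_comm")
  then have "x \<otimes> z ?m \<otimes> y = ?s \<otimes> (\<ominus> y)" using sc yc by (simp add: l_minus r_minus)
  then have "x = ?s \<otimes> (\<ominus> y)" using y(2) x zc[of ?m] yc by (simp add: m_assoc)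
  also have "... = (\<Oplus>i\<in>{..<?m}. d i \<otimes> z i \<otimes> (\<ominus> y))" by (rule finsum_right) (use dc zc yc in auto)
  also have "... = (\<Oplus>i\<in>{..<?m}. d i \<otimes> (z i \<otimes> (\<ominus> y)))" by (rule fcong) (use dc zc yc in "auto simp: m_assoc")
  finally show ?thesis using zS S(3) S_minus[OF y(1)] by (intro bexI[of _ "%i. z i \<otimes> (\<ominus> y)"]) auto
 qed
 show ?thesis by (rule that[OF d]) (fact sp)
qed

end

lemma maximal_subfield_exists:
 assumes D: "assoc_algebra K D" "division_algebra K D"
 obtains L where "maximal_subfield D L"
proof -
 interpret D: assoc_algebra K D by fact
 \<comment> \<open>Zorn's lemma is applied to sets of commuting elements rather than to subfields:
   chain unions are immediate, and anything commuting with a maximal such set already belongs to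
   it.\<close>
 let ?A = "{T. T <= carrier D & (ALL x:T. ALL y:T. x*[D]y = y*[D]x)}"
 have "EX M:?A. ALL X:?A. M <= X --> X = M"
 proof (rule subset_Zorn')
  fix \<C> assume c: "subset.chain ?A \<C>"
  have "x*[D]y = y*[D]x" if "X:\<C>" "Y:\<C>" "x:X" "y:Y" for X Y x y
  proof -
   have "X:?A" "Y:?A" "X <= Y | Y <= X" using subset_chain_def[of ?A \<C>] c that(1,2) by auto
   then show ?thesis using that(3,4) by blast
  qed
  then show "\<Union>\<C>:?A" using subset_chain_def[of ?A \<C>] c by auto
 qed
 then obtain L where L: "L:?A" "ALL X:?A. L <= X --> X = L" by (rule bexE)
 have mem: "z:L" if z: "z:.D" "!!s. s:L==>z*[D]s = s*[D]z" for z
  using bspec[OF L(2),of "insert z L"] L(1) z by auto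
 have "dvid D 1[D]" using division_iff[OF D(1)] D(2) by simp
 have 2: "s*[D]t:L" if st: "s:L" "t:L" for s t
 proof (rule mem)
  show "s*[D]t:.D" using L(1) st by auto
  fix r assume r: "r:L"
  have c: "s:.D" "t:.D" "r:.D" using L(1) st r by auto
  have "s*[D]t*[D]r = s*[D](r*[D]t)" using L(1) st r c by (auto simp: D.m_assoc)
  also have "... = r*[D]s*[D]t" using L(1) st r c by (auto simp: D.m_assoc[symmetric])
  finally show "s*[D]t*[D]r = r*[D](s*[D]t)" using c by (simp add: D.m_assoc)
 qed
 have "maximal_subfield D L"
 proof unfold_locales
  show "L <= carrier D" using L by auto
  show "1[D]:L" using L(1) by (intro mem) auto
  show "{z:carrier D. ALL s:L. z*[D]s = s*[D]z} = L" using L(1) mem by auto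
  show "1[D] ~= 0[D]" by (rule D.dvidD(2)) fact
  show "EX y:carrier D. y*[D]x = 1[D] & x*[D]y = 1[D]" if "x:.D" "x ~= 0[D]" for x
   by (rule D.dvid_inv[OF \<open>dvid D 1[D]\<close> that(1) _ _ that(2)]) (use that in auto)
 qed (fact 2)
 then show ?thesis by (rule that)
qed

text \<open>For a maximal subfield \<open>L\<close> the operators \<open>x \<mapsto> a x l\<close> identify \<open>D \<otimes> L\<close> with the \<open>L\<close>-linear
  endomorphisms of \<open>D\<close>: they are independent because \<open>D\<close> is central simple, and exhaust by density.\<close>

lemma division_dim_square:
 fixes D (structure)
 assumes csa: "csa K D" and div: "division_algebra K D"
 shows "EX d. vdim K D = d * d"
proof -
 interpret D: assoc_algebra K D by (rule csaD(1)[OF csa])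
 obtain S where "maximal_subfield D S" by (rule maximal_subfield_exists[OF csaD(1)[OF csa] div])
 then interpret S: maximal_subfield D S .
 let ?N = "D.dim"
 obtain e where e: "basis_family K D {..<?N} e" using D.basis_family_exists csaD(2)[OF csa] by blast
 have ec: "!!i. i < ?N==>e i:.D" using basis_familyD(3)[OF e] by simp
 have kS: "k \<odot> s:S" if "k:.K" "s:S" for k s
  by (rule S.S_mem) (use that S.Sc S.S_comm in "auto simp: D.smult_mult_left D.smult_mult_right")
 \<comment> \<open>Multiples of the unit by elements of \<open>K\<close> lie in \<open>S\<close>, so
   independence over \<open>S\<close> implies independence over \<open>K\<close>; this bounds the
   length by the dimension of \<open>D\<close>.\<close>
 obtain m d where d: "d:{..<m::nat}->.D" "S.rindep {..<m} d" and sp: "!!x. x:.D==>EX z:{..<m} \<rightarrow> S. x = (\<Oplus>i\<in>{..<m}. d i \<otimes> z i)"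
 proof (rule S.right_basis[of ?N])
  fix m :: nat and d assume d: "d:{..<m}->.D" "S.rindep {..<m} d"
  have dc: "!!i. i < m==>d i:.D" using d(1) by auto
  have "indep_family K D {..<m} d" unfolding indep_family_def
  proof (intro conjI ballI impI d(1) finite_lessThan)
   fix k i assume k: "k:{..<m}->.K" "lc D {..<m} k d = \<zero>" and i: "i:{..<m}"
   have kc: "!!i. i < m==>k i:.K" using k(1) by auto
   have "(\<Oplus>i\<in>{..<m}. d i \<otimes> (k i \<odot> \<one>)) = lc D {..<m} k d" unfolding lc_def
    by (rule D.M.fcong) (use kc dc in "auto simp: D.scalar_mult")
   moreover have "(%i. k i \<odot> \<one>):{..<m} \<rightarrow> {z:carrier D. ALL s:S. z \<otimes> s = s \<otimes> z}" unfolding S.C using kc kS S.S(2) by auto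
   ultimately have "k i \<odot> \<one> = \<zero>" using S.rindepD[OF d(2) _ _ i] k(2) by simp
   then show "k i = 0[K]" using D.smult_eq_zero[of "k i" \<one>] kc i S.nz by auto
  qed
  then show "m <= ?N" using D.indep_family_card[OF _ csaD(2)[OF csa]] by fastforce
 qed blast
 have dc: "!!i. i < m==>d i:.D" using d(1) by auto
 have "ALL i k. EX z. i < ?N --> k < m --> z:{..<m} \<rightarrow> S & e i \<otimes> d k = (\<Oplus>l\<in>{..<m}. d l \<otimes> z l)" using sp[OF D.m_closed[OF ec dc]] by blast
 then obtain \<rho> where \<rho>: "!!i k. i < ?N==>k < m==>\<rho> i k:{..<m} \<rightarrow> S" "!!i k. i < ?N==>k < m==>e i \<otimes> d k = (\<Oplus>l\<in>{..<m}. d l \<otimes> \<rho> i k l)" by metis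
 have \<rho>S: "!!i k l. i < ?N==>k < m==>l < m==>\<rho> i k l:S" using \<rho>(1) by blast
 note \<rho>c = S.Sc[OF \<rho>S]
 \<comment> \<open>The matrix of left multiplication by \<open>e i\<close> on \<open>D\<close> as a
   right vector space over \<open>S\<close>: column k holds the coefficients of
   \<open>e i \<otimes> d k\<close>.\<close>
 define T where "T = (%i. \<lambda>p\<in>sq m. \<rho> i (snd p) (fst p))"
 let ?W = "MA (self S.L) m"
 interpret L: field S.L by (rule S.L_field)
 interpret W: assoc_algebra S.L ?W by (rule mat_self_alg[OF S.L_field])
 have T: "T:{..<?N}->.(MR S.L m)" unfolding T_def mat_ring_sel(1) by (intro Pi_I restrict_PiE_iff[THEN iffD2] ballI) (use \<rho>S in auto)
 \<comment> \<open>Entry (l,k) of the combination of the \<open>T i\<close> with coefficients t_i is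
   the coefficient of d_l in \<Sum> e_i d_k t_i. Such combinations are thus the matrices of the
   operators x \<mapsto> \<Sum> e_i x t_i.\<close>
 have key: "(\<Oplus>i\<in>{..<?N}. e i \<otimes> d k \<otimes> t i) = (\<Oplus>l\<in>{..<m}. d l \<otimes> lc ?W {..<?N} t T (l,k))"
  and lcS: "!!l. l < m==>lc ?W {..<?N} t T (l,k):S"
  if t: "!!i. i < ?N==>t i:S" and k: "k < m" for t k
 proof -
  note tc = S.Sc[OF t]
  have lcT: "lc ?W {..<?N} t T (l,k) = (\<Oplus>i\<in>{..<?N}. \<rho> i k l \<otimes> t i)" if l: "l < m" for l
  proof -
   have "lc ?W {..<?N} t T (l,k) = (\<Oplus>[S.L]i:{..<?N}. t i*[S.L]T i (l,k))" by (rule mat_self_lc[OF S.L_field T]) (use t k l in auto)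
   also have "... = (\<Oplus>i\<in>{..<?N}. t i*[S.L]T i (l,k))" by (rule S.L_finsum) (use t \<rho>S k l S.S(3) in "auto simp: T_def")
   also have "... = (\<Oplus>i\<in>{..<?N}. \<rho> i k l \<otimes> t i)" by (rule D.M.fcong) (use t tc \<rho>S \<rho>c k l S.S_comm in "auto simp: T_def")
   finally show ?thesis .
  qed
  show "lc ?W {..<?N} t T (l,k):S" if l: "l < m" for l
   unfolding lcT[OF l] by (rule S.S_finsum) (use t \<rho>S k l S.S(3) in auto)
  have "(\<Oplus>i\<in>{..<?N}. e i \<otimes> d k \<otimes> t i) = (\<Oplus>i\<in>{..<?N}. \<Oplus>l\<in>{..<m}. d l \<otimes> (\<rho> i k l \<otimes> t i))"
  proof (rule D.M.fcong)
   fix i assume "i:{..<?N}" then have i: "i < ?N" by simp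
   have "e i \<otimes> d k \<otimes> t i = (\<Oplus>l\<in>{..<m}. d l \<otimes> \<rho> i k l \<otimes> t i)" unfolding \<rho>(2)[OF i k] by (rule D.finsum_right) (use dc \<rho>c tc i k in auto)
   also have "... = (\<Oplus>l\<in>{..<m}. d l \<otimes> (\<rho> i k l \<otimes> t i))" by (rule D.M.fcong) (use dc \<rho>c tc i k in "auto simp: D.m_assoc")
   finally show "e i \<otimes> d k \<otimes> t i = (\<Oplus>l\<in>{..<m}. d l \<otimes> (\<rho> i k l \<otimes> t i))" .
  qed (use dc \<rho>c tc k in "auto intro!: D.M.finsum_closed")
  also have "... = (\<Oplus>l\<in>{..<m}. \<Oplus>i\<in>{..<?N}. d l \<otimes> (\<rho> i k l \<otimes> t i))" by (rule D.M.finsum_swap) (use dc \<rho>c tc k in auto)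
  also have "... = (\<Oplus>l\<in>{..<m}. d l \<otimes> (\<Oplus>i\<in>{..<?N}. \<rho> i k l \<otimes> t i))"
   by (intro D.M.fcong D.finsum_left[symmetric]) (use dc \<rho>c tc k in "auto intro!: D.M.finsum_closed")
  also have "... = (\<Oplus>l\<in>{..<m}. d l \<otimes> lc ?W {..<?N} t T (l,k))"
   by (rule D.M.fcong) (use dc \<rho>c tc k lcT in "auto intro!: D.M.finsum_closed")
  finally show "(\<Oplus>i\<in>{..<?N}. e i \<otimes> d k \<otimes> t i) = (\<Oplus>l\<in>{..<m}. d l \<otimes> lc ?W {..<?N} t T (l,k))" .
 qed
 have "indep_family S.L ?W {..<?N} T" unfolding indep_family_def
 proof (intro conjI ballI impI finite_lessThan)
  show "T:{..<?N}->.?W" using T by (simp add: mat_self_sel)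
  fix t j assume "t:{..<?N}->.S.L" and z: "lc ?W {..<?N} t T = 0[?W]" and "j:{..<?N}"
  then have t: "!!i. i < ?N==>t i:S" and j: "j < ?N" by auto
  note tc = S.Sc[OF t]
  have 0: "(\<Oplus>i\<in>{..<?N}. e i \<otimes> d k \<otimes> t i) = \<zero>" if k: "k < m" for k
  proof -
   have "(\<Oplus>i\<in>{..<?N}. e i \<otimes> d k \<otimes> t i) = (\<Oplus>l\<in>{..<m}. d l \<otimes> lc ?W {..<?N} t T (l,k))" by (rule key[OF t k])
   also have "... = \<zero>" unfolding z mat_self_sel mat_ring_sel by (rule D.M.finsum_all_zero) (use dc k in auto)
   finally show ?thesis .
  qed
  have 1: "(\<Oplus>i\<in>{..<?N}. e i \<otimes> x \<otimes> t i) = \<zero>" if x: "x:.D" for x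
  proof -
   obtain z where "z:{..<m} \<rightarrow> S" and xz: "x = (\<Oplus>k\<in>{..<m}. d k \<otimes> z k)" using sp[OF x] by blast
   then have zS: "!!k. k < m==>z k:S" by auto
   note zc = S.Sc[OF zS]
   have "(\<Oplus>i\<in>{..<?N}. e i \<otimes> x \<otimes> t i) = (\<Oplus>i\<in>{..<?N}. \<Oplus>k\<in>{..<m}. e i \<otimes> d k \<otimes> t i \<otimes> z k)"
   proof (rule D.M.fcong)
    fix i assume "i:{..<?N}" then have i: "i < ?N" by simp
    have "e i \<otimes> x = (\<Oplus>k\<in>{..<m}. e i \<otimes> (d k \<otimes> z k))" unfolding xz by (rule D.finsum_left) (use ec dc zc i in auto)
    then have "e i \<otimes> x \<otimes> t i = (\<Oplus>k\<in>{..<m}. e i \<otimes> (d k \<otimes> z k)) \<otimes> t i" by simp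
    also have "... = (\<Oplus>k\<in>{..<m}. e i \<otimes> (d k \<otimes> z k) \<otimes> t i)" by (rule D.finsum_right) (use ec dc zc tc i in auto)
    also have "... = (\<Oplus>k\<in>{..<m}. e i \<otimes> d k \<otimes> t i \<otimes> z k)"
     by (rule D.M.fcong) (use ec[OF i] dc zc tc[OF i] S.S_comm[OF t[OF i] zS] in "auto simp: D.m_assoc")
    finally show "e i \<otimes> x \<otimes> t i = (\<Oplus>k\<in>{..<m}. e i \<otimes> d k \<otimes> t i \<otimes> z k)" .
   qed (use ec dc zc tc in "auto intro!: D.M.finsum_closed")
   also have "... = (\<Oplus>k\<in>{..<m}. \<Oplus>i\<in>{..<?N}. e i \<otimes> d k \<otimes> t i \<otimes> z k)" by (rule D.M.finsum_swap) (use ec dc zc tc in auto)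
   also have "... = (\<Oplus>k\<in>{..<m}. (\<Oplus>i\<in>{..<?N}. e i \<otimes> d k \<otimes> t i) \<otimes> z k)"
    by (intro D.M.fcong D.finsum_right[symmetric]) (use ec dc zc tc in "auto intro!: D.M.finsum_closed")
   also have "... = \<zero>" by (rule D.M.finsum_all_zero) (use 0 zc in auto)
   finally show ?thesis .
  qed
  \<comment> \<open>The vanishing of \<Sum> e_i x t_i for all x persists with e_i replaced by
    g(e_i). The dual operators of the central simple algebra \<open>D\<close> then isolate each
    t_j.\<close>
  have 2: "(\<Oplus>i\<in>{..<?N}. g (e i) \<otimes> x \<otimes> t i) = \<zero>" if "g:sw D (carrier D)" "x:.D" for g x using that
  proof (induction arbitrary: x rule: sw.induct)
   case (base a s)
   have "(\<Oplus>i\<in>{..<?N}. a \<otimes> e i \<otimes> s \<otimes> x \<otimes> t i) = (\<Oplus>i\<in>{..<?N}. a \<otimes> (e i \<otimes> (s \<otimes> x) \<otimes> t i))"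
    by (rule D.M.fcong) (use base ec tc in "auto simp: D.m_assoc")
   also have "... = a \<otimes> (\<Oplus>i\<in>{..<?N}. e i \<otimes> (s \<otimes> x) \<otimes> t i)" by (rule D.finsum_left[symmetric]) (use base ec tc in auto)
   finally show ?case using 1[of "s \<otimes> x"] base by simp
  next
   case (add f g)
   note fc = D.sw_closed[OF add.hyps(1)] and gc = D.sw_closed[OF add.hyps(2)]
   have "(\<Oplus>i\<in>{..<?N}. (f (e i) \<oplus> g (e i)) \<otimes> x \<otimes> t i) = (\<Oplus>i\<in>{..<?N}. f (e i) \<otimes> x \<otimes> t i \<oplus> g (e i) \<otimes> x \<otimes> t i)"
    by (rule D.M.fcong) (use add.prems ec tc fc gc in "auto simp: D.l_distr")
   also have "... = (\<Oplus>i\<in>{..<?N}. f (e i) \<otimes> x \<otimes> t i) \<oplus> (\<Oplus>i\<in>{..<?N}. g (e i) \<otimes> x \<otimes> t i)"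
    by (rule D.M.finsum_addf) (use add.prems ec tc fc gc in auto)
   finally show ?case using add.IH(1)[OF add.prems] add.IH(2)[OF add.prems] by simp
  qed
  obtain g where g: "g:sw D (carrier D)" "ALL i:{..<?N}. g (e i) = (if i = j then \<one> else \<zero>)"
   using D.csa_azumaya[OF csa e] j unfolding azumaya_def by blast
  have "(\<Oplus>i\<in>{..<?N}. g (e i) \<otimes> \<one> \<otimes> t i) = (\<Oplus>i\<in>{..<?N}. if i = j then t j else \<zero>)"
   by (rule D.M.fcong) (use g(2) tc j in auto)
  also have "... = t j" by (rule D.M.finsum_delta) (use tc j in auto)
  finally show "t j = 0[S.L]" using 2[OF g(1) D.one_closed] by simp
 qed
 moreover have "span_family S.L ?W {..<?N} T" unfolding span_family_def
 proof (intro conjI ballI finite_lessThan)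
  show "T:{..<?N}->.?W" using T by (simp add: mat_self_sel)
  fix X assume "X:.?W"
  then have X: "X:.(MR S.L m)" by (simp add: mat_self_sel)
  have XS: "!!l k. l < m==>k < m==>X (l,k):S" using mat_entry[OF X] by simp
  note Xc = S.Sc[OF XS]
  \<comment> \<open>Density over \<open>S\<close>: in a division ring every nonzero element is moved
    to the unit by a left multiplication alone.\<close>
  have "ALL k:{..<m}. EX f. f:sw D S & (ALL i:{..<m}. f (d i) = (if i = k then \<one> else \<zero>))"
  proof
   fix k assume k: "k:{..<m}"
   have "EX f:sw D S. ALL i:{..<m}. f (d i) = (if i = k then \<one> else \<zero>)"
   proof (rule S.density[OF _ S.nz finite_lessThan d k])
    fix x assume "x:.D" "x ~= \<zero>"
    then obtain y where "y:.D" "y \<otimes> x = \<one>" using S.inv by blast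
    then show "EX f:sw D S. f x = \<one>" by (intro bexI[OF _ sw.base[OF \<open>y:.D\<close> S.S(2)]]) simp
   qed
   then show "EX f. f:sw D S & (ALL i:{..<m}. f (d i) = (if i = k then \<one> else \<zero>))" by blast
  qed
  then obtain F where F: "!!k. k:{..<m}==>F k:sw D S" "!!k i. k < m==>i < m==>F k (d i) = (if i = k then \<one> else \<zero>)" unfolding bchoice_iff by auto
  define y where "y = (%k. \<Oplus>l\<in>{..<m}. d l \<otimes> X (l,k))"
  have yc: "k < m==>y k:.D" for k unfolding y_def by (rule D.M.finsum_closed) (use dc Xc in auto)
  obtain f where f: "f:sw D S" "ALL x:carrier D. f x = (\<Oplus>k\<in>{..<m}. y k \<otimes> F k x)" using S.sw_sum[of "{..<m}" F y] F(1) yc by auto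
  have fd: "f (d k) = y k" if k: "k < m" for k
  proof -
   have "f (d k) = (\<Oplus>i\<in>{..<m}. y i \<otimes> F i (d k))" using f(2) dc[OF k] by blast
   also have "... = (\<Oplus>i\<in>{..<m}. if i = k then y k else \<zero>)" by (rule D.M.fcong) (use yc F(2)[OF _ k] k in auto)
   also have "... = y k" by (rule D.M.finsum_delta) (use yc k in auto)
   finally show ?thesis .
  qed
  \<comment> \<open>Left coefficients are expanded in the basis \<open>e\<close> over
    \<open>K\<close> and the scalars are moved to the right, where they stay inside
    \<open>S\<close>.\<close>
  have "EX t. (ALL i<?N. t i:S) & (ALL x:carrier D. f x = (\<Oplus>i\<in>{..<?N}. e i \<otimes> x \<otimes> t i))" using f(1)
  proof (induction rule: sw.induct)
   case (base a s)
   let ?a = "coord K D {..<?N} e a"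
   have ac: "!!i. i < ?N==>?a i:.K" using D.coord_closed[OF e base(1)] by simp
   note sc = S.Sc[OF base(2)]
   have "a \<otimes> x \<otimes> s = (\<Oplus>i\<in>{..<?N}. e i \<otimes> x \<otimes> (?a i \<odot> s))" if x: "x:.D" for x
   proof -
    have "a \<otimes> (x \<otimes> s) = lc D {..<?N} ?a e \<otimes> (x \<otimes> s)" using D.coord_props(2)[OF e base(1)] by simp
    also have "... = (\<Oplus>i\<in>{..<?N}. (?a i \<odot> e i) \<otimes> (x \<otimes> s))" unfolding lc_def by (rule D.finsum_right) (use x sc ac ec in auto)
    also have "... = (\<Oplus>i\<in>{..<?N}. e i \<otimes> x \<otimes> (?a i \<odot> s))"
     by (rule D.M.fcong) (use x sc ac ec in "auto simp: D.smult_mult_left D.smult_mult_right D.m_assoc")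
    finally show ?thesis using base x sc by (simp add: D.m_assoc)
   qed
   then show ?case using ac kS base(2) by (intro exI[of _ "%i. ?a i \<odot> s"]) auto
  next
   case (add f g)
   obtain t where t: "ALL i<?N. t i:S" "ALL x:carrier D. f x = (\<Oplus>i\<in>{..<?N}. e i \<otimes> x \<otimes> t i)" using add.IH(1) by blast
   obtain u where u: "ALL i<?N. u i:S" "ALL x:carrier D. g x = (\<Oplus>i\<in>{..<?N}. e i \<otimes> x \<otimes> u i)" using add.IH(2) by blast
   have "f x \<oplus> g x = (\<Oplus>i\<in>{..<?N}. e i \<otimes> x \<otimes> (t i \<oplus> u i))" if x: "x:.D" for x
   proof -
    have "(\<Oplus>i\<in>{..<?N}. e i \<otimes> x \<otimes> (t i \<oplus> u i)) = (\<Oplus>i\<in>{..<?N}. e i \<otimes> x \<otimes> t i \<oplus> e i \<otimes> x \<otimes> u i)"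
     by (rule D.M.fcong) (use x ec t(1) u(1) S.Sc in "auto simp: D.r_distr")
    also have "... = (\<Oplus>i\<in>{..<?N}. e i \<otimes> x \<otimes> t i) \<oplus> (\<Oplus>i\<in>{..<?N}. e i \<otimes> x \<otimes> u i)"
     by (rule D.M.finsum_addf) (use x ec t(1) u(1) S.Sc in auto)
    finally show ?thesis using t(2) u(2) x by simp
   qed
   then show ?case using t(1) u(1) S.S_add by (intro exI[of _ "%i. t i \<oplus> u i"]) auto
  qed
  then obtain t where t: "!!i. i < ?N==>t i:S" "!!x. x:.D==>f x = (\<Oplus>i\<in>{..<?N}. e i \<otimes> x \<otimes> t i)" by blast
  have tL: "t:{..<?N}->.S.L" using t(1) by auto
  have "X = lc ?W {..<?N} t T"
  proof (rule mat_eqI[OF X])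
   show "lc ?W {..<?N} t T:.(MR S.L m)" using W.lc_closed[of T "{..<?N}" t] T tL by (simp add: mat_self_sel)
   fix l k assume lk: "l < m" "k < m"
   have "(\<Oplus>l\<in>{..<m}. d l \<otimes> X (l,k)) = (\<Oplus>l\<in>{..<m}. d l \<otimes> lc ?W {..<?N} t T (l,k))"
    by (rule trans[OF _ key[OF t(1) lk(2)]]) (use fd[OF lk(2)] t(2)[OF dc[OF lk(2)]] in "simp_all add: y_def")
   then show "X (l,k) = lc ?W {..<?N} t T (l,k)"
    by (rule S.rindep_unique[OF d(2,1),rotated 2]) (use XS lcS[of t k] t(1) lk in auto)
  qed
  then show "EX t:{..<?N}->.S.L. X = lc ?W {..<?N} t T" using tL by blast
 qed
 ultimately have "basis_family S.L ?W {..<?N} T" by (simp add: basis_family_def)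
 \<comment> \<open>The \<open>T i\<close> form a basis of the m by m matrices over \<open>S\<close>,
   so the dimension of \<open>D\<close> is m^2.\<close>
 from W.basis_family_dim(2)[OF this] show ?thesis unfolding mat_self_dim(1)[OF S.L_field] by (intro exI[of _ m]) simp
qed

section \<open>Index and degree\<close>

lemma csa_degree_eq: "vdim K D = d * d==>csa_degree K D = d"
 unfolding csa_degree_def by (rule the_equality) (auto simp: power2_eq_square[symmetric])

text \<open>The definite description in \<open>ind\<close> is resolved by two facts: the dimension
  of a central division algebra is a square, and the division algebras of one class are
  isomorphic.\<close>

lemma ind_class:
 fixes K :: "('a, 'm) ring_scheme" and D :: "('a,nat=>'a) module"
 assumes A: "csa K A" and r: "r >= 1" and D: "csa K D" "division_algebra K D" and i: "algebra_iso K A (MA D r)"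
 shows "vdim K D = ind K (brauer_class K A) * ind K (brauer_class K A)"
proof -
 obtain d where d: "vdim K D = d * d" using division_dim_square[OF D] by blast
 note fA = csa_fd[OF A] and fD = csa_fd[OF D(1)]
 have "brauer_equiv K A D"
  by (rule brauer_equiv_trans[OF fA fd_mat[OF fD] fD brauer_equiv_iso[OF fA mat_algebra_alg[OF csaD(1)[OF D(1)]] i] brauer_equiv_mat[OF fD r]])
 then have eq: "brauer_equiv K D A" by (rule brauer_equiv_sym[OF fA])
 have "ind K (brauer_class K A) = d" unfolding ind_def
 proof (rule the_equality)
  show "EX D:brauer_class K A. division_algebra K D & csa_degree K D = d"
   by (rule bexI[of _ D]) (use D eq csa_degree_eq[OF d] in "auto simp: brauer_class_mem")
  fix d' assume "EX D:brauer_class K A. division_algebra K D & csa_degree K D = d'"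
  then obtain E :: "('a,nat=>'a) module" where E: "csa K E" "brauer_equiv K E A" "division_algebra K E" "csa_degree K E = d'" by (auto simp: brauer_class_mem)
  have "algebra_iso K D E"
   by (rule division_unique[OF D E(1,3) brauer_equiv_trans[OF fD fA csa_fd[OF E(1)] eq brauer_equiv_sym[OF csa_fd[OF E(1)] E(2)]]])
  then have "vdim K E = d * d" using iso_dim[OF fD csaD(1)[OF E(1)]] d by simp
  then show "d' = d" using csa_degree_eq E(4) by blast
 qed
 then show ?thesis using d by simp
qed

lemma wedderburn_ind:
 fixes K :: "('a, 'm) ring_scheme"
 assumes A: "csa K A"
 obtains D :: "('a,nat=>'a) module" and r where "r >= 1" "csa K D" "division_algebra K D" "algebra_iso K A (MA D r)"
  "vdim K D = ind K (brauer_class K A) * ind K (brauer_class K A)"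
  "vdim K A = (r * ind K (brauer_class K A)) * (r * ind K (brauer_class K A))" "ind K (brauer_class K A) >= 1"
proof -
 obtain D :: "('a,nat=>'a) module" and r where D: "r >= 1" "csa K D" "division_algebra K D" "algebra_iso K A (MA D r)"
  by (rule wedderburn[OF A])
 note d = ind_class[OF A D]
 have "vdim K A = r * r * vdim K D"
  unfolding iso_dim[OF csa_fd[OF A] mat_algebra_alg[OF csaD(1)[OF D(2)]] D(4)] by (rule mat_dim[OF csa_fd[OF D(2)]])
 moreover have "ind K (brauer_class K A) ~= 0" using csa_dim_pos[OF D(2)] d by auto
 ultimately show ?thesis using that[OF D d] d by simp
qed

text \<open>Equal classes give the same division algebra, and equal dimensions the same matrix size
  over it. Agreement of Brauer classes over a factor of F_0 becomes an isomorphism of algebras in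
  this way.\<close>

lemma csa_iso_of_equiv:
 fixes K :: "('a, 'm) ring_scheme"
 assumes A: "csa K A" and B: "csa K B" and eq: "brauer_equiv K A B" and dim: "vdim K A = vdim K B"
 shows "algebra_iso K A B"
proof -
 have cl: "brauer_class K A = brauer_class K B" using brauer_class_eq_iff[OF A B] eq by simp
 let ?i = "ind K (brauer_class K A)"
 obtain D :: "('a,nat=>'a) module" and r where D: "r >= 1" "csa K D" "division_algebra K D" "algebra_iso K A (MA D r)"
  "vdim K D = ?i * ?i" "vdim K A = (r * ?i) * (r * ?i)" "?i >= 1" by (rule wedderburn_ind[OF A])
 obtain E :: "('a,nat=>'a) module" and s where E: "s >= 1" "csa K E" "division_algebra K E" "algebra_iso K B (MA E s)"
  "vdim K E = ?i * ?i" "vdim K B = (s * ?i) * (s * ?i)" "?i >= 1" unfolding cl by (rule wedderburn_ind[OF B])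
 have "(r * ?i)^2 = (s * ?i)^2" unfolding power2_eq_square D(6)[symmetric] E(6)[symmetric] by (rule dim)
 then have rs: "r = s" using D(7) by (simp add: power2_eq_iff_nonneg)
 note f = csa_fd[OF A] csa_fd[OF B] csa_fd[OF D(2)] csa_fd[OF E(2)]
 have 1: "brauer_equiv K A D" by (rule brauer_equiv_trans[OF f(1) fd_mat[OF f(3)] f(3) brauer_equiv_iso[OF f(1) mat_algebra_alg[OF csaD(1)[OF D(2)]] D(4)] brauer_equiv_mat[OF f(3) D(1)]])
 have 2: "brauer_equiv K B E" by (rule brauer_equiv_trans[OF f(2) fd_mat[OF f(4)] f(4) brauer_equiv_iso[OF f(2) mat_algebra_alg[OF csaD(1)[OF E(2)]] E(4)] brauer_equiv_mat[OF f(4) E(1)]])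
 have "algebra_iso K D E"
  by (rule division_unique[OF D(2,3) E(2,3) brauer_equiv_trans[OF f(3,1,4) brauer_equiv_sym[OF f(1) 1] brauer_equiv_trans[OF f(1,2,4) eq 2]]])
 from mat_cong[OF f(3) csaD(1)[OF E(2)] this,of s]
 show ?thesis using algebra_iso_trans[OF D(4)[unfolded rs] algebra_iso_trans[OF _ algebra_iso_sym[OF csaD(1)[OF B] E(4)]]] by blast
qed

text \<open>The witness consists of the matrices of size l / ind(\<alpha>) over the division algebra
  of the class.\<close>

lemma csa_of_degree:
 fixes K :: "('a, 'm) ring_scheme"
 assumes \<alpha>: "\<alpha>:.(Br K)" and l: "ind K \<alpha> dvd l" "l >= 1"
 obtains A :: "('a,nat=>'a) module" where "csa K A" "brauer_class K A = \<alpha>" "vdim K A = l * l"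
proof -
 obtain B :: "('a,nat=>'a) module" where B: "csa K B" "\<alpha> = brauer_class K B" by (rule Br_carrierE[OF \<alpha>])
 obtain D :: "('a,nat=>'a) module" and r where D: "r >= 1" "csa K D" "division_algebra K D" "algebra_iso K B (MA D r)"
  "vdim K D = ind K \<alpha> * ind K \<alpha>" "vdim K B = (r * ind K \<alpha>) * (r * ind K \<alpha>)" "ind K \<alpha> >= 1" unfolding B(2) by (rule wedderburn_ind[OF B(1)])
 obtain q where q: "l = ind K \<alpha> * q" using l(1) by blast
 then have q1: "q >= 1" using l(2) by (cases q) auto
 note M = csa_mat[OF D(2) q1] and f = csa_fd[OF D(2)] csa_fd[OF B(1)]
 obtain A :: "('a,nat=>'a) module" where A: "csa K A" "algebra_iso K (MA D q) A" "brauer_class K (MA D q) = brauer_class K A" by (rule brauer_rep[OF M])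
 have "brauer_class K (MA D q) = brauer_class K D" using brauer_class_eq_iff[OF M D(2)] brauer_equiv_mat[OF f(1) q1] by simp
 also have "... = brauer_class K (MA D r)" using brauer_class_eq_iff[OF csa_mat[OF D(2,1)] D(2)] brauer_equiv_mat[OF f(1) D(1)] by simp
 also have "... = \<alpha>" unfolding B(2) by (rule brauer_class_iso[OF B(1) csa_mat[OF D(2,1)] D(4),symmetric])
 finally have "brauer_class K A = \<alpha>" using A(3) by simp
 moreover have "vdim K A = l * l"
  unfolding iso_dim[OF csa_fd[OF M] csaD(1)[OF A(1)] A(2),symmetric] mat_dim[OF f(1)] D(5) q by (simp add: mult_ac)
 ultimately show ?thesis using that A(1) by blast
qed

section \<open>Homomorphisms to matrix algebras\<close>

text \<open>The relations make \<open>Y\<close> the image of a basis under a multiplicative linear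
  map. Simplicity of \<open>A\<close> makes this map injective once one \<open>Y i\<close> is
  nonzero, and equality of dimensions makes \<open>Y\<close> a basis.\<close>

lemma csa_hom_basis:
 fixes N :: nat
 assumes A: "csa K A" and sc: "has_sc K A {..<N} e c" and B: "fd_alg K B" and dim: "vdim K B = N"
  and Y: "Y:{..<N}->.B" "!!i j. i < N==>j < N==>Y i*[B]Y j = lc B {..<N} (c i j) Y" and nz: "EX i<N. Y i ~= 0[B]"
 shows "has_sc K B {..<N} Y c"
proof -
 note eD = has_scD[OF sc]
 interpret A: assoc_algebra K A by (rule csaD(1)[OF A])
 interpret B: assoc_algebra K B by (rule fd_alg_assoc[OF B])
 define h where "h = (%x. lc B {..<N} (coord K A {..<N} e x) Y)"
 have h: "h:module_hom K A B" and he: "!!i. i:{..<N}==>h (e i) = Y i" unfolding h_def using lin_ext[OF A.vs B.vs eD(1) Y(1)] by auto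
 note hm = module_homD[OF h]
 have hmul: "h (x*[A]y) = h x*[B]h y" if "x:.A" "y:.A" for x y
 proof (rule module_hom_mult_on_basis[OF A.assoc_algebra_axioms B.assoc_algebra_axioms eD(1) h _ that])
  fix i j assume ij: "i:{..<N}" "j:{..<N}"
  have "h (e i*[A]e j) = lc B {..<N} (c i j) (%k. h (e k))" unfolding eD(6)[OF ij] by (rule module_hom_lc[OF A.vs B.vs h eD(3) eD(4)[OF ij]])
  also have "... = lc B {..<N} (c i j) Y" by (rule B.lc_cong[OF _ eD(4)[OF ij]]) (use he Y(1) in auto)
  finally show "h (e i*[A]e j) = h (e i)*[B]h (e j)" using Y(2) ij he by simp
 qed
 have h0: "h 0[A] = 0[B]" by (rule additive_zero[OF A.M.abelian_group_axioms B.M.abelian_group_axioms]) (use hm in auto)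
 have ker: "x = 0[A]" if x: "x:.A" "h x = 0[B]" for x
 proof (rule ccontr)
  assume "x ~= 0[A]"
  then obtain f where f: "f:sw A (carrier A)" "f x = 1[A]" using simple_ring_sw[OF csaD(3)[OF A] x(1)] by blast
  from f(1) have "h (f x) = 0[B]"
  proof (induction rule: sw.induct)
   case (base a s) then show ?case using x hm(1) by (simp add: hmul)
  next
   case (add f g) then show ?case using A.sw_closed[OF add.hyps(1) x(1)] A.sw_closed[OF add.hyps(2) x(1)] by (simp add: hm(2))
  qed
  then have h1: "h 1[A] = 0[B]" using f(2) by simp
  obtain i where i: "i < N" "Y i ~= 0[B]" using nz by blast
  have ei: "e i:.A" using eD(3) i by auto
  have "Y i = h (1[A]*[A]e i)" using he i(1) ei by simp
  also have "... = 0[B]" unfolding hmul[OF A.one_closed ei] h1 using hm(1)[OF ei] by simp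
  finally show False using i(2) by simp
 qed
 have "indep_family K B {..<N} Y" unfolding indep_family_def
 proof (intro conjI ballI impI finite_lessThan Y(1))
  fix k i assume k: "k:{..<N}->.K" "lc B {..<N} k Y = 0[B]" and i: "i:{..<N}"
  have "h (lc A {..<N} k e) = lc B {..<N} k (%i. h (e i))" by (rule module_hom_lc[OF A.vs B.vs h eD(3) k(1)])
  also have "... = lc B {..<N} k Y" by (rule B.lc_cong[OF _ k(1)]) (use he Y(1) in auto)
  finally have "lc A {..<N} k e = 0[A]" using ker[OF A.lc_closed[OF eD(3) k(1)]] k(2) by simp
  then show "k i = 0[K]" using eD(1) k(1) i unfolding basis_family_def indep_family_def by blast
 qed
 then have bas: "basis_family K B {..<N} Y" by (rule B.indep_family_basis) (use B dim in "auto simp: fd_alg_def")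
 show ?thesis unfolding has_sc_def using bas eD(4) Y(2) by simp
qed

lemma self_division: "field K==>division_algebra K (self K)"
 using field.field_Units[of K] self_alg[of K] by (simp add: division_algebra_def algebra_via_def Units_def)

text \<open>An automorphism carries the matrix units to a second system of matrix units. The first
  diagonal idempotents of both have division corners, hence are equivalent, so the systems are
  conjugate; linearity extends this to all matrices.\<close>

lemma skolem_noether_mat:
 assumes K: "field K" and n: "n >= 1" and h: "h:ring_iso (MA (self K) n) (MA (self K) n)" "h:module_hom K (MA (self K) n) (MA (self K) n)"
 obtains P where "P:GL n K" "!!x. x:.(MR K n)==>h x*[MR K n]P = P*[MR K n]x"
proof -
 let ?M = "MA (self K) n"
 note S = self_alg[OF K]
 interpret K: field K by fact
 interpret S: assoc_algebra K "self K" by (rule S)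
 interpret M: assoc_algebra K ?M by (rule mat_self_alg[OF K])
 define a where "a = (%i j. munit (self K) n (i,j) 1[K])"
 have o: "1[self K] = 1[K]" "1[K]:.(self K)" "1[K]*[self K]1[K] = 1[K]" by (auto simp: algebra_via_def)
 have a: "a i j:.?M" for i j unfolding a_def mat_algebra_sel by (rule S.munit_closed[OF o(2)])
 have am: "a i j*[?M]a k l = (if j = k then a i l else 0[?M])" if "i < n" "j < n" "k < n" "l < n" for i j k l
  unfolding a_def mat_algebra_sel using S.munit_mult[OF o(2,2),of "(i,j)" n "(k,l)"] that o(3) by simp
 have a1: "(\<Oplus>[?M]i:{..<n}. a i i) = 1[?M]"
 proof (rule mat_eqI[where R = "self K" and n = n])
  show "(\<Oplus>[?M]i:{..<n}. a i i):.(MR (self K) n)" using M.finsum_closed[of "%i. a i i" "{..<n}"] a by (simp add: mat_algebra_sel)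
  show "1[?M]:.(MR (self K) n)" using M.one_closed by (simp only: mat_algebra_sel)
  fix i j assume ij: "i < n" "j < n"
  have "(\<Oplus>[?M]s:{..<n}. a s s) (i,j) = (\<Oplus>[self K]s:{..<n}. a s s (i,j))"
   unfolding mat_algebra_sel by (rule S.mat_finsum_entry) (use ij a in "auto simp: mat_algebra_sel")
  also have "... = (\<Oplus>[self K]s:{..<n}. if s = i then 1[?M] (i,j) else 0[self K])"
   by (rule S.M.fcong) (use ij o in "auto simp: a_def munit_def mat_algebra_sel mat_ring_sel algebra_via_def")
  also have "... = 1[?M] (i,j)" by (rule S.M.finsum_delta) (use ij o in "auto simp: mat_algebra_sel mat_ring_sel algebra_via_def")
  finally show "(\<Oplus>[?M]i:{..<n}. a i i) (i,j) = 1[?M] (i,j)" .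
 qed
 note hm = module_homD[OF h(2)]
 have hmul: "!!x y. x:.?M==>y:.?M==>h (x*[?M]y) = h x*[?M]h y" and h1: "h 1[?M] = 1[?M]"
  using h(1) by (auto simp: ring_iso_def ring_hom_def)
 have h0: "h 0[?M] = 0[?M]" by (rule additive_zero[OF M.M.abelian_group_axioms M.M.abelian_group_axioms]) (use hm in auto)
 have hs: "h (\<Oplus>[?M]i:{..<n}. a i i) = (\<Oplus>[?M]i:{..<n}. h (a i i))"
  by (rule additive_finsum[OF M.M.abelian_group_axioms M.M.abelian_group_axioms]) (use hm a in auto)
 have cm: "corner_map K (self K) ?M (a 0 0) (munit (self K) n (0,0))" unfolding a_def using corner_map_munit[OF S n] o(1) by simp
 note cm' = corner_map_comp[OF cm a M.assoc_algebra_axioms h]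
 have dv: "dvid ?M (a 0 0)" "dvid ?M (h (a 0 0))"
  using dvid_corner_map[OF S M.assoc_algebra_axioms cm] dvid_corner_map[OF S M.assoc_algebra_axioms cm'] division_iff[OF S] self_division[OF K] by auto
 have simple: "simple_ring ?M" by (rule csaD(3)[OF csa_mat_self[OF K n]])
 obtain u v where uv: "u:.?M" "v:.?M" "h (a 0 0)*[?M]u = u" "u*[?M]a 0 0 = u" "a 0 0*[?M]v = v"
  "v*[?M]h (a 0 0) = v" "u*[?M]v = h (a 0 0)" "v*[?M]u = a 0 0" by (rule M.dvid_equiv[OF simple dv])
 have bm: "h (a i j)*[?M]h (a k l) = (if j = k then h (a i l) else 0[?M])" if "i < n" "j < n" "k < n" "l < n" for i j k l
  using am[OF that] hmul[OF a a,of i j k l] h0 by auto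
 have b1: "(\<Oplus>[?M]i:{..<n}. h (a i i)) = 1[?M]" using hs a1 h1 by simp
 have "EX P Q. P:.?M & Q:.?M & P*[?M]Q = 1[?M] & Q*[?M]P = 1[?M] & (ALL i<n. ALL j<n. h (a i j)*[?M]P = P*[?M]a i j)"
  by (rule M.matrix_units_conj[where a = a and b = "%i j. h (a i j)" and n = n and u = u and v = v,OF n])
   (use a hm(1)[OF a] am bm a1 b1 uv in "simp_all,blast?")
 then obtain P Q where PQ: "P:.?M" "Q:.?M" "P*[?M]Q = 1[?M]" "Q*[?M]P = 1[?M]" "ALL i<n. ALL j<n. h (a i j)*[?M]P = P*[?M]a i j" by blast
 have "h x*[?M]P = P*[?M]x" if x: "x:.?M" for x
  by (rule module_hom_eqI[OF M.vs M.vs module_hom_comp[OF h(2) M.right_mult_hom[OF PQ(1)]] M.left_mult_hom[OF PQ(1)] has_scD(1)[OF has_sc_mat[OF S has_sc_self[OF K],of n]] _ x])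
   (use PQ(5) in "auto simp: a_def")
 moreover have "P:GL n K" unfolding GL_def Units_def using PQ(1-4) by (auto simp: mat_self_sel)
 ultimately show ?thesis using that[of P] by (simp add: mat_self_sel)
qed

section \<open>Changing bases\<close>

lemma (in vectorspace) lc_lc:
 assumes "finite I" "finite J" and f: "f:J->.V" and t: "t:I->.K" and M: "!!i j. i:I==>j:J==>M i j:.K"
 shows "lc V I t (%i. lc V J (M i) f) = lc V J (%j. \<Oplus>[K]i:I. t i*[K]M i j) f"
proof -
 have tk: "!!i. i:I==>t i:.K" using t by auto
 have "lc V I t (%i. lc V J (M i) f) = (\<Oplus>[V]i:I. lc V J (%j. t i*[K]M i j) f)" unfolding lc_def[of V I]
  by (rule M.fcong) (use M tk f in "auto intro!: lc_closed lc_smult")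
 also have "... = lc V J (%j. \<Oplus>[K]i:I. t i*[K]M i j) f" by (rule lc_finsum) (use assms tk in auto)
 finally show ?thesis .
qed

text \<open>The rows of \<open>g\<close> hold the coordinates of the new vectors. Matrices then act
  on families from the left, so from q = (g_1 g_2) f it follows that g_1^(-1) q = g_2 f, the form in
  which a factorisation is used.\<close>

definition chb :: "('a, 'b, 'n) module_scheme=>nat=>(nat \<times> nat=>'a)=>(nat=>'b)=>nat=>'b" where
 "chb V N g f i = lc V {..<N} (%j. g (i,j)) f"

context vectorspace
begin

lemma chb_closed: "g:.(MR K N)==>f:{..<N}->.V==>i < N==>chb V N g f i:.V"
 unfolding chb_def by (rule lc_closed) (auto intro: mat_entry)

lemma chb_chb:
 assumes g: "g:.(MR K N)" and h: "h:.(MR K N)" and f: "f:{..<N}->.V" and i: "i < N"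
 shows "chb V N g (chb V N h f) i = chb V N (g*[MR K N]h) f i"
proof -
 have "chb V N g (chb V N h f) i = lc V {..<N} (%j. \<Oplus>[K]k:{..<N}. g (i,k)*[K]h (k,j)) f"
  unfolding chb_def[of V N g] using mat_entry[OF g i] mat_entry[OF h] f by (subst lc_lc[symmetric]) (auto simp: chb_def[abs_def])
 also have "... = chb V N (g*[MR K N]h) f i" unfolding chb_def
  by (rule lc_cong) (use f i mat_entry[OF g i] mat_entry[OF h] in "auto simp: mat_mult_entry[OF i] intro!: R.finsum_closed")
 finally show ?thesis .
qed

lemma chb_one:
 assumes f: "f:{..<N}->.V" and i: "i < N" shows "chb V N 1[MR K N] f i = f i"
proof -
 have "chb V N 1[MR K N] f i = lc V {..<N} (%j. if j = i then 1[K] else 0[K]) f" unfolding chb_def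
  by (rule lc_cong[OF f]) (use i in "auto simp: mat_ring_sel")
 then show ?thesis using lc_delta[of "{..<N}" f i] f i by simp
qed

lemma chb_basis:
 assumes f: "basis_family K V {..<N} f" and g: "g:GL N K"
 shows "basis_family K V {..<N} (chb V N g f)"
proof -
 note fD = basis_familyD(2)[OF f]
 obtain h where h: "h:.(MR K N)" "h*[MR K N]g = 1[MR K N]" and gc: "g:.(MR K N)"
  using g unfolding GL_def Units_def by auto
 have cl: "chb V N g f:{..<N}->.V" using chb_closed[OF gc fD] by auto
 have "span_family K V {..<N} (chb V N g f)" unfolding span_family_def
 proof (intro conjI ballI cl finite_lessThan)
  fix x assume x: "x:.V"
  let ?x = "coord K V {..<N} f x"
  have xk: "!!i. i < N==>?x i:.K" using coord_closed[OF f x] by auto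
  have he: "!!i j. i < N==>j < N==>h (i,j):.K" by (rule mat_entry[OF h(1)])
  have "x = lc V {..<N} ?x (%i. lc V {..<N} (%j. h (i,j)) (chb V N g f))"
   by (rule trans[OF coord_props(2)[OF f x,symmetric] lc_cong[OF fD coord_Pi[OF f x]]])
    (use chb_chb[OF h(1) gc fD] chb_one[OF fD] h(2) in "auto simp: chb_def[of V N h]")
  also have "... = lc V {..<N} (%j. \<Oplus>[K]i:{..<N}. ?x i*[K]h (i,j)) (chb V N g f)"
   by (rule lc_lc) (use cl xk he in auto)
  finally show "EX t:{..<N}->.K. x = lc V {..<N} t (chb V N g f)"
   by (rule bexI[of _ "%j. \<Oplus>[K]i:{..<N}. ?x i*[K]h (i,j)"]) (use xk he in "auto intro!: R.finsum_closed")
 qed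
 then show ?thesis by (rule span_family_basis) (use basis_family_dim(2)[OF f] in simp)
qed

lemma basis_matrix:
 assumes f: "basis_family K V {..<N} f" and q: "basis_family K V {..<N} q"
 obtains g where "g:GL N K" "!!i. i < N==>q i = chb V N g f i"
proof -
 note fD = basis_familyD(2)[OF f] and qD = basis_familyD(2)[OF q]
 define m where "m = (%a b. \<lambda>p\<in>sq N. coord K V {..<N} a (b (fst p)) (snd p))"
 have mc: "m a b:.(MR K N)" and mb: "!!i. i < N==>b i = chb V N (m a b) a i"
  if a: "basis_family K V {..<N} a" and b: "basis_family K V {..<N} b" for a b
 proof -
  show "m a b:.(MR K N)" unfolding m_def mat_ring_sel(1)
   by (intro restrict_PiE_iff[THEN iffD2] ballI coord_closed[OF a]) (use basis_familyD(3)[OF b] in auto)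
  fix i assume i: "i < N"
  have bi: "b i:.V" using basis_familyD(3)[OF b] i by simp
  show "b i = chb V N (m a b) a i" unfolding chb_def
   by (rule trans[OF coord_props(2)[OF a bi,symmetric] lc_cong[OF basis_familyD(2)[OF a] coord_Pi[OF a bi]]]) (use i in "auto simp: m_def")
 qed
 \<comment> \<open>Stated for two arbitrary bases, so that exchanging them gives the inverse on the
   other side.\<close>
 have one: "m a b*[MR K N]m b a = 1[MR K N]" if a: "basis_family K V {..<N} a" and b: "basis_family K V {..<N} b" for a b
 proof (rule mat_eqI[OF R.mat_mult_closed[OF mc[OF a b] mc[OF b a]] R.mat_one_closed])
  fix i j assume ij: "i < N" "j < N"
  note mm = R.mat_mult_closed[OF mc[OF a b] mc[OF b a]] and bD = basis_familyD(2)[OF b]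
  have "chb V N (m a b*[MR K N]m b a) b i = chb V N (m a b) (chb V N (m b a) b) i"
   by (rule chb_chb[symmetric,OF mc[OF a b] mc[OF b a] bD ij(1)])
  also have "... = chb V N (m a b) a i" unfolding chb_def[of V N "m a b"]
   by (rule lc_cong) (use mb[OF b a] chb_closed[OF mc[OF b a] bD] mat_entry[OF mc[OF a b] ij(1)] in auto)
  also have "... = chb V N 1[MR K N] b i" unfolding chb_one[OF bD ij(1)] by (rule mb[OF a b ij(1),symmetric])
  finally have eq: "lc V {..<N} (%j. (m a b*[MR K N]m b a) (i,j)) b = lc V {..<N} (%j. 1[MR K N] (i,j)) b" by (simp add: chb_def)
  have ind: "indep_family K V {..<N} b" using b by (simp add: basis_family_def)
  show "(m a b*[MR K N]m b a) (i,j) = 1[MR K N] (i,j)"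
   by (rule indep_family_unique[OF ind _ _ eq]) (use mat_entry[OF mm ij(1)] mat_entry[OF R.mat_one_closed ij(1)] ij in auto)
 qed
 have "m f q:GL N K" unfolding GL_def Units_def using mc one f q by (intro CollectI conjI bexI[of _ "m q f"]) auto
 then show ?thesis using that[of "m f q"] mb[OF f q] by blast
qed

end

section \<open>Patching central simple algebras\<close>

lemma map_entries_closed: "h:ring_hom R S==>M:.(MR R n)==>mape n h M:.(MR S n)"
 unfolding map_entries_def mat_ring_sel(1)[of S] by (intro restrict_PiE_iff[THEN iffD2] ballI) (erule ring_hom_closed,rule mat_entry')

lemma map_entries_entry: "i < n==>j < n==>mape n h M (i,j) = h (M (i,j))"
 by (simp add: map_entries_def)

lemma map_entries_mult:
 assumes R: "ring R" "ring S" and h: "h:ring_hom R S" and M: "M:.(MR R n)" "N:.(MR R n)"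
 shows "mape n h (M*[MR R n]N) = mape n h M*[MR S n]mape n h N"
proof (rule mat_eqI)
 interpret R: ring R by (rule R)
 interpret S: ring S by (rule R)
 note c = map_entries_closed[OF h]
 show "mape n h (M*[MR R n]N):.(MR S n)" by (rule c[OF R.mat_mult_closed[OF M]])
 show "mape n h M*[MR S n]mape n h N:.(MR S n)" by (rule S.mat_mult_closed[OF c[OF M(1)] c[OF M(2)]])
 fix i j assume ij: "i < n" "j < n"
 have "h (\<Oplus>[R]k:{..<n}. M (i,k)*[R]N (k,j)) = (\<Oplus>[S]k:{..<n}. h (M (i,k)*[R]N (k,j)))"
  by (rule ring_hom_finsum[OF R h]) (use ij mat_entry[OF M(1)] mat_entry[OF M(2)] in auto)
 also have "... = (\<Oplus>[S]k:{..<n}. mape n h M (i,k)*[S]mape n h N (k,j))"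
  by (rule S.fcong) (use ij mat_entry[OF M(1)] mat_entry[OF M(2)] ring_hom_mult[OF h] ring_hom_closed[OF h] in "auto simp: map_entries_entry")
 finally show "mape n h (M*[MR R n]N) (i,j) = (mape n h M*[MR S n]mape n h N) (i,j)"
  by (simp add: map_entries_entry[OF ij] mat_mult_entry[OF ij])
qed

lemma map_entries_one:
 assumes R: "ring R" "ring S" and h: "h:ring_hom R S" shows "mape n h 1[MR R n] = 1[MR S n]"
 unfolding map_entries_def mat_ring_sel(3) by (rule restrict_ext) (auto simp: ring_hom_one[OF h] ring_hom_zero_ring[OF R h])

lemma GL_map:
 assumes R: "ring R" "ring S" and h: "h:ring_hom R S" and g: "g:GL n R"
 shows "mape n h g:GL n S"
proof -
 obtain k where k: "g:.(MR R n)" "k:.(MR R n)" "k*[MR R n]g = 1[MR R n]" "g*[MR R n]k = 1[MR R n]"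
  using g unfolding GL_def Units_def by blast
 show ?thesis unfolding GL_def Units_def
  using k map_entries_closed[OF h] map_entries_mult[OF R h k(1,2)] map_entries_mult[OF R h k(2,1)] map_entries_one[OF R h]
  by (intro CollectI conjI bexI[of _ "mape n h k"]) auto
qed

lemma map_entries_lc:
 assumes K: "field K" "field L" and h: "h:ring_hom K L" and X: "X:I->.(MR K n)" and t: "t:I->.K"
 shows "mape n h (lc (MA (self K) n) I t X) = lc (MA (self L) n) I (%i. h (t i)) (%i. mape n h (X i))"
proof (rule mat_eqI)
 interpret K: field K by (rule K)
 interpret L: field L by (rule K)
 interpret M: assoc_algebra K "MA (self K) n" by (rule mat_self_alg[OF K(1)])
 interpret N: assoc_algebra L "MA (self L) n" by (rule mat_self_alg[OF K(2)])
 have tk: "!!i. i:I==>t i:.K" and Xm: "!!i. i:I==>X i:.(MR K n)" using t X by auto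
 have X': "(%i. mape n h (X i)):I->.(MR L n)" and t': "(%i. h (t i)):I->.L"
  using Xm tk map_entries_closed[OF h] ring_hom_closed[OF h] by auto
 show "mape n h (lc (MA (self K) n) I t X):.(MR L n)"
  using map_entries_closed[OF h] M.lc_closed[of X I t] X t by (simp add: mat_self_sel)
 show "lc (MA (self L) n) I (%i. h (t i)) (%i. mape n h (X i)):.(MR L n)"
  using N.lc_closed[OF X'[folded mat_self_sel(1)] t'] by (simp add: mat_self_sel)
 fix i j assume ij: "i < n" "j < n"
 then have p: "(i,j):sq n" by simp
 have "h (\<Oplus>[K]s:I. t s*[K]X s (i,j)) = (\<Oplus>[L]s:I. h (t s*[K]X s (i,j)))"
  by (rule ring_hom_finsum[OF K.ring_axioms L.ring_axioms h]) (use tk mat_entry'[OF Xm p] in auto)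
 also have "... = (\<Oplus>[L]s:I. h (t s)*[L]mape n h (X s) (i,j))"
  by (rule L.fcong) (use tk mat_entry'[OF Xm p] ij ring_hom_mult[OF h] ring_hom_closed[OF h] in "auto simp: map_entries_entry")
 finally show "mape n h (lc (MA (self K) n) I t X) (i,j) = lc (MA (self L) n) I (%i. h (t i)) (%i. mape n h (X i)) (i,j)"
  by (simp add: map_entries_entry[OF ij] mat_self_lc[OF K(1) X t p] mat_self_lc[OF K(2) X' t' p])
qed

lemma map_entries_inj:
 assumes K: "field K" "field L" and h: "h:ring_hom K L" and M: "M:.(MR K n)" "N:.(MR K n)" and eq: "mape n h M = mape n h N"
 shows "M = N"
proof (rule mat_eqI[OF M])
 interpret field_hom K L h by (intro field_hom.intro K field_hom_axioms.intro h)
 fix i j assume ij: "i < n" "j < n"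
 then have "h (M (i,j)) = h (N (i,j))" using fun_cong[OF eq,of "(i,j)"] by (simp add: map_entries_entry)
 then show "M (i,j) = N (i,j)" using hom_inj mat_entry[OF M(1) ij] mat_entry[OF M(2) ij] by (auto dest: inj_onD)
qed

lemma semilinear_coord:
 assumes A: "assoc_algebra K A" and B: "assoc_algebra L B" and h: "h:ring_hom K L" and j: "j:module_hom K A (res_alg h B)"
  and e: "basis_family K A I e" and p: "basis_family L B I p" and je: "!!i. i:I==>j (e i) = p i" and x: "x:.A" and k: "k:I"
 shows "h (coord K A I e x k) = coord L B I p (j x) k"
proof -
 interpret A: assoc_algebra K A by fact
 interpret B: assoc_algebra L B by fact
 interpret R: assoc_algebra K "res_alg h B" by (rule res_alg_alg[OF A.field_axioms B h])
 have cx: "!!i. i:I==>coord K A I e x i:.K" using A.coord_closed[OF e x] by auto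
 have "j x = j (lc A I (coord K A I e x) e)" using A.coord_props(2)[OF e x] by simp
 also have "... = lc B I (%i. h (coord K A I e x i)) (%i. j (e i))"
  using module_hom_lc[OF A.vs R.vs j basis_familyD(2)[OF e] A.coord_Pi[OF e x]] by (simp add: res_alg_sel)
 also have "... = lc B I (%i. h (coord K A I e x i)) p"
  by (rule B.lc_cong) (use je basis_familyD(3)[OF p] cx ring_hom_closed[OF h] in auto)
 finally show ?thesis using B.coord_lc[OF p _ k,of "%i. h (coord K A I e x i)"] cx ring_hom_closed[OF h] by auto
qed

text \<open>A semilinear multiplicative map is not unital by definition. Here its image contains a
  basis of \<open>B\<close> on which the image of the unit acts as a left identity, so it is the
  unit of \<open>B\<close>.\<close>

lemma semilinear_one:
 assumes B: "assoc_algebra L B" and A: "ring A" and q: "basis_family L B I q" and e: "!!i. i:I==>e i:.A" and je: "!!i. i:I==>j (e i) = q i"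
  and jm: "ALL x:carrier A. ALL y:carrier A. j (x*[A]y) = j x*[B]j y" and j1: "j 1[A]:.B"
 shows "j 1[A] = 1[B]"
proof -
 interpret A: ring A by fact
 interpret B: assoc_algebra L B by fact
 have "j 1[A]*[B]1[B] = 1[B]"
 proof (rule module_hom_eqI[OF B.vs B.vs B.left_mult_hom[OF j1] _ q])
  show "(%x. x):module_hom L B B" by (rule module_homI) auto
  fix i assume i: "i:I"
  show "j 1[A]*[B]q i = q i" using jm[rule_format,OF A.one_closed e[OF i]] je[OF i] e[OF i] by simp
 qed simp
 then show ?thesis using j1 by simp
qed

text \<open>Over \<open>K0\<close> the two algebras become one algebra with two bases, and
  \<open>g\<close> is the matrix between them. A factorisation of \<open>g\<close> moves the bases
  over \<open>K1\<close> and \<open>K2\<close> to a common image, whence common constants and unit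
  coordinates. The factors are quantified after \<open>g\<close> because they must later be chosen
  for all factors of F_0 at once.\<close>

lemma glue_local:
 fixes N :: nat
 assumes K1: "field K1" and K2: "field K2" and K0: "field K0" and b1: "b1:ring_hom K1 K0" and b2: "b2:ring_hom K2 K0"
  and A1: "assoc_algebra K1 A1" and sc1: "has_sc K1 A1 {..<N} e1 c1" and A2: "assoc_algebra K2 A2" and sc2: "has_sc K2 A2 {..<N} e2 c2"
  and iso: "algebra_iso K0 (base_change K1 K0 b1 A1) (base_change K2 K0 b2 A2)"
 shows "EX g:GL N K0. ALL g1:GL N K1. ALL g2:GL N K2. g = mape N b1 g1*[MR K0 N]mape N b2 g2 -->
  (let f1 = chb A1 N (inv\<^bsub>MR K1 N\<^esub> g1) e1; f2 = chb A2 N g2 e2 in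
   (ALL i<N. ALL j<N. ALL k<N. b1 (coord K1 A1 {..<N} f1 (f1 i*[A1]f1 j) k) = b2 (coord K2 A2 {..<N} f2 (f2 i*[A2]f2 j) k)) &
   (ALL k<N. b1 (coord K1 A1 {..<N} f1 1[A1] k) = b2 (coord K2 A2 {..<N} f2 1[A2] k)))"
proof -
 interpret A1: assoc_algebra K1 A1 by fact
 interpret A2: assoc_algebra K2 A2 by fact
 interpret K0: field K0 by fact
 let ?B = "base_change K2 K0 b2 A2"
 have B: "assoc_algebra K0 ?B" by (rule base_change_alg[OF A2 K0 b2])
 interpret B: assoc_algebra K0 ?B by (rule B)
 define f2 where "f2 = (%i. pure_tensor K2 A2 (algebra_via K0 b2) (e2 i) 1[K0])"
 have f2: "has_sc K0 ?B {..<N} f2 (%i j k. b2 (c2 i j k))" unfolding f2_def by (rule has_sc_base_change[OF A2 K0 b2 sc2])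
 obtain q where q: "has_sc K0 ?B {..<N} q (%i j k. b1 (c1 i j k))" by (rule has_sc_iso[OF base_change_alg[OF A1 K0 b1] B has_sc_base_change[OF A1 K0 b1 sc1] iso])
 note e1D = has_scD[OF sc1] and e2D = has_scD[OF sc2] and f2D = has_scD[OF f2] and qD = has_scD[OF q]
 obtain g where g: "g:GL N K0" "!!i. i < N==>q i = chb ?B N g f2 i" by (rule B.basis_matrix[OF f2D(1) qD(1)]) blast
 have "EX j:module_hom K1 A1 (res_alg b1 ?B). (ALL i:{..<N}. j (e1 i) = q i) & (ALL x:carrier A1. ALL y:carrier A1. j (x*[A1]y) = j x*[?B]j y)"
  by (rule semilinear_map[OF A1 sc1 B b1 qD(3)]) (rule qD(6))
 then obtain j1 where j1: "j1:module_hom K1 A1 (res_alg b1 ?B)" "ALL i:{..<N}. j1 (e1 i) = q i" "ALL x:carrier A1. ALL y:carrier A1. j1 (x*[A1]y) = j1 x*[?B]j1 y" by auto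
 have "EX j:module_hom K2 A2 (res_alg b2 ?B). (ALL i:{..<N}. j (e2 i) = f2 i) & (ALL x:carrier A2. ALL y:carrier A2. j (x*[A2]y) = j x*[?B]j y)"
  by (rule semilinear_map[OF A2 sc2 B b2 f2D(3)]) (rule f2D(6))
 then obtain j2 where j2: "j2:module_hom K2 A2 (res_alg b2 ?B)" "ALL i:{..<N}. j2 (e2 i) = f2 i" "ALL x:carrier A2. ALL y:carrier A2. j2 (x*[A2]y) = j2 x*[?B]j2 y" by auto
 note j1c = module_homD(1)[OF j1(1),unfolded res_alg_sel] and j2c = module_homD(1)[OF j2(1),unfolded res_alg_sel]
 have one1: "j1 1[A1] = 1[?B]" by (rule semilinear_one[where e = e1,OF B A1.alg_ring qD(1) _ _ j1(3)]) (use e1D(3) j1(2) j1c in auto)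
 have one2: "j2 1[A2] = 1[?B]" by (rule semilinear_one[where e = e2,OF B A2.alg_ring f2D(1) _ _ j2(3)]) (use e2D(3) j2(2) j2c in auto)
 have chb_semi: "j (chb A N m e i) = chb ?B N (mape N h m) f i"
  if j: "assoc_algebra K A" "h:ring_hom K K0" "j:module_hom K A (res_alg h ?B)" "ALL i:{..<N}. j (e i) = f i" and e: "e:{..<N}->.A" and f: "f:{..<N}->.?B"
   and m: "m:.(MR K N)" and i: "i < N" for K A h j m e f i
 proof -
  interpret A: assoc_algebra K A by (rule j)
  interpret R: assoc_algebra K "res_alg h ?B" by (rule res_alg_alg[OF A.field_axioms B j(2)])
  have "j (chb A N m e i) = lc ?B {..<N} (%k. h (m (i,k))) (%k. j (e k))" unfolding chb_def
   using module_hom_lc[OF A.vs R.vs j(3) e,of "%k. m (i,k)"] mat_entry[OF m i] by (auto simp: res_alg_sel)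
  also have "... = chb ?B N (mape N h m) f i" unfolding chb_def
   by (rule B.lc_cong) (use j(4) f i mat_entry[OF m i] ring_hom_closed[OF j(2)] in "auto simp: map_entries_entry")
  finally show ?thesis .
 qed
 show ?thesis
 proof (rule bexI[OF _ g(1)],intro ballI impI)
  fix g1 g2 assume g1: "g1:GL N K1" and g2: "g2:GL N K2" and eq: "g = mape N b1 g1*[MR K0 N]mape N b2 g2"
  interpret M1: ring "MR K1 N" by (rule A1.R.mat_ring_ring)
  interpret M0: ring "MR K0 N" by (rule K0.mat_ring_ring)
  let ?i = "inv\<^bsub>MR K1 N\<^esub> g1"
  have U: "g1:Units (MR K1 N)" using g1 by (simp add: GL_def)
  have g1c: "g1:.(MR K1 N)" "?i:.(MR K1 N)" "?i:GL N K1" "?i*[MR K1 N]g1 = 1[MR K1 N]" using U by (auto simp: GL_def)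
  have g2c: "g2:.(MR K2 N)" using g2 by (auto simp: GL_def Units_def)
  note R = A1.R.ring_axioms A2.R.ring_axioms K0.ring_axioms
  note mc1 = map_entries_closed[OF b1] and mc2 = map_entries_closed[OF b2]
  have "mape N b1 ?i*[MR K0 N]g = (mape N b1 ?i*[MR K0 N]mape N b1 g1)*[MR K0 N]mape N b2 g2"
   unfolding eq by (rule M0.m_assoc[symmetric]) (use mc1 mc2 g1c g2c in auto)
  also have "mape N b1 ?i*[MR K0 N]mape N b1 g1 = 1[MR K0 N]"
   using map_entries_mult[OF R(1,3) b1 g1c(2,1)] map_entries_one[OF R(1,3) b1] g1c(4) by simp
  finally have ig: "mape N b1 ?i*[MR K0 N]g = mape N b2 g2" using mc2[OF g2c] by simp
  \<comment> \<open>The common image over \<open>K0\<close> of the modified basis of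
    \<open>A1\<close> and the modified basis of \<open>A2\<close>.\<close>
  define p where "p = chb ?B N (mape N b2 g2) f2"
  have pb: "basis_family K0 ?B {..<N} p" unfolding p_def by (rule B.chb_basis[OF f2D(1) GL_map[OF R(2,3) b2 g2]])
  let ?f1 = "chb A1 N ?i e1" and ?f2 = "chb A2 N g2 e2"
  have f1b: "basis_family K1 A1 {..<N} ?f1" by (rule A1.chb_basis[OF e1D(1) g1c(3)])
  have f2b: "basis_family K2 A2 {..<N} ?f2" by (rule A2.chb_basis[OF e2D(1) g2])
  have gc: "g:.(MR K0 N)" using g(1) by (auto simp: GL_def Units_def)
  have jf1: "j1 (?f1 i) = p i" if "i:{..<N}" for i
  proof -
   have i: "i < N" using that by simp
   have "j1 (?f1 i) = chb ?B N (mape N b1 ?i) q i" by (rule chb_semi[OF A1 b1 j1(1,2) e1D(3) qD(3) g1c(2) i])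
   also have "... = chb ?B N (mape N b1 ?i) (chb ?B N g f2) i" unfolding chb_def[of ?B N "mape N b1 ?i"]
    by (rule B.lc_cong) (use g(2) qD(3) mat_entry[OF mc1[OF g1c(2)] i] in auto)
   also have "... = p i" unfolding p_def ig[symmetric] by (rule B.chb_chb[OF mc1[OF g1c(2)] gc f2D(3) i])
   finally show ?thesis .
  qed
  have jf2: "j2 (?f2 i) = p i" if "i:{..<N}" for i unfolding p_def by (rule chb_semi[OF A2 b2 j2(1,2) e2D(3) f2D(3) g2c]) (use that in simp)
  note co1 = semilinear_coord[OF A1 B b1 j1(1) f1b pb jf1] and co2 = semilinear_coord[OF A2 B b2 j2(1) f2b pb jf2]
  note fc1 = basis_familyD(3)[OF f1b] and fc2 = basis_familyD(3)[OF f2b]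
  show "let f1 = ?f1; f2 = ?f2 in
   (ALL i<N. ALL j<N. ALL k<N. b1 (coord K1 A1 {..<N} f1 (f1 i*[A1]f1 j) k) = b2 (coord K2 A2 {..<N} f2 (f2 i*[A2]f2 j) k)) &
   (ALL k<N. b1 (coord K1 A1 {..<N} f1 1[A1] k) = b2 (coord K2 A2 {..<N} f2 1[A2] k))"
   unfolding Let_def
  proof (intro conjI allI impI)
   fix k assume "k < N" then have k: "k:{..<N}" by simp
   show "b1 (coord K1 A1 {..<N} ?f1 1[A1] k) = b2 (coord K2 A2 {..<N} ?f2 1[A2] k)"
    unfolding co1[OF _ A1.one_closed k,simplified] co2[OF _ A2.one_closed k,simplified] one1 one2 ..
   fix i j assume "i < N" "j < N" then have ij: "i:{..<N}" "j:{..<N}" by auto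
   have "j1 (?f1 i*[A1]?f1 j) = p i*[?B]p j" using j1(3) fc1 ij jf1 by simp
   moreover have "j2 (?f2 i*[A2]?f2 j) = p i*[?B]p j" using j2(3) fc2 ij jf2 by simp
   ultimately show "b1 (coord K1 A1 {..<N} ?f1 (?f1 i*[A1]?f1 j) k) = b2 (coord K2 A2 {..<N} ?f2 (?f2 i*[A2]?f2 j) k)"
    using co1[OF _ A1.m_closed[OF fc1[OF ij(1)] fc1[OF ij(2)]] k] co2[OF _ A2.m_closed[OF fc2[OF ij(1)] fc2[OF ij(2)]] k] by simp
  qed
 qed
qed

text \<open>The diamond written factor by factor. A factor w of F_0 lies over the factors
  \<open>s1 w\<close> of F_1 and \<open>s2 w\<close> of F_2, with induced field homomorphisms
  \<open>b1 w\<close> and \<open>b2 w\<close>. The assumption \<open>meet\<close> expresses F = F_1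
  \<inter> F_2, and \<open>fact\<close> factors a family of matrices simultaneously at all
  w.\<close>

locale patching =
 fixes F :: "'a ring" and V1 :: "'i set" and K1 :: "'i=>'b ring" and V2 :: "'j set" and K2 :: "'j=>'c ring" and V0 :: "'k set" and K0 :: "'k=>'d ring"
  and a1 a2 s1 s2 b1 b2
 assumes F: "field F" and K1: "!!v. v:V1==>field (K1 v)" and K2: "!!v. v:V2==>field (K2 v)" and K0: "!!v. v:V0==>field (K0 v)"
  and a1: "!!v. v:V1==>a1 v:ring_hom F (K1 v)" and a2: "!!v. v:V2==>a2 v:ring_hom F (K2 v)"
  and s1: "!!w. w:V0==>s1 w:V1" and s2: "!!w. w:V0==>s2 w:V2"
  and b1: "!!w. w:V0==>b1 w:ring_hom (K1 (s1 w)) (K0 w)" and b2: "!!w. w:V0==>b2 w:ring_hom (K2 (s2 w)) (K0 w)"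
  and comm: "!!w x. w:V0==>x:.F==>b1 w (a1 (s1 w) x) = b2 w (a2 (s2 w) x)"
  and meet: "!!x1 x2. (!!v. v:V1==>x1 v:.(K1 v))==>(!!v. v:V2==>x2 v:.(K2 v)) ==>
   (!!w. w:V0==>b1 w (x1 (s1 w)) = b2 w (x2 (s2 w)))==>EX x:carrier F. (ALL v:V1. a1 v x = x1 v) & (ALL v:V2. a2 v x = x2 v)"
  and fact: "!!n g. n >= 1==>(!!w. w:V0==>g w:GL n (K0 w))==>EX g1 g2. (ALL v:V1. g1 v:GL n (K1 v)) & (ALL v:V2. g2 v:GL n (K2 v)) &
   (ALL w:V0. g w = mape n (b1 w) (g1 (s1 w))*[MR (K0 w) n]mape n (b2 w) (g2 (s2 w)))"
  and V1: "V1 ~= {}" and V2: "V2 ~= {}"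
begin

lemma glue:
 fixes A1 :: "'i=>('b, 'p) module" and A2 :: "'j=>('c, 'q) module"
 assumes N: "N >= 1" and A1: "!!v. v:V1==>csa (K1 v) (A1 v)" "!!v. v:V1==>vdim (K1 v) (A1 v) = N"
  and A2: "!!v. v:V2==>csa (K2 v) (A2 v)" "!!v. v:V2==>vdim (K2 v) (A2 v) = N"
  and iso: "!!w. w:V0==>algebra_iso (K0 w) (base_change (K1 (s1 w)) (K0 w) (b1 w) (A1 (s1 w))) (base_change (K2 (s2 w)) (K0 w) (b2 w) (A2 (s2 w)))"
 obtains A :: "('a,nat=>'a) module" where "csa F A" "vdim F A = N"
  "!!v. v:V1==>algebra_iso (K1 v) (base_change F (K1 v) (a1 v) A) (A1 v)" "!!v. v:V2==>algebra_iso (K2 v) (base_change F (K2 v) (a2 v) A) (A2 v)"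
proof -
 have "ALL v:V1. EX e c. has_sc (K1 v) (A1 v) {..<N} e c" using A1 csa_has_sc by metis
 then obtain e1 c1 where sc1: "!!v. v:V1==>has_sc (K1 v) (A1 v) {..<N} (e1 v) (c1 v)" by metis
 have "ALL v:V2. EX e c. has_sc (K2 v) (A2 v) {..<N} e c" using A2 csa_has_sc by metis
 then obtain e2 c2 where sc2: "!!v. v:V2==>has_sc (K2 v) (A2 v) {..<N} (e2 v) (c2 v)" by metis
 let ?P = "%w g. ALL g1:GL N (K1 (s1 w)). ALL g2:GL N (K2 (s2 w)). g = mape N (b1 w) g1*[MR (K0 w) N]mape N (b2 w) g2 -->
  (let f1 = chb (A1 (s1 w)) N (inv\<^bsub>MR (K1 (s1 w)) N\<^esub> g1) (e1 (s1 w)); f2 = chb (A2 (s2 w)) N g2 (e2 (s2 w)) in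
   (ALL i<N. ALL j<N. ALL k<N. b1 w (coord (K1 (s1 w)) (A1 (s1 w)) {..<N} f1 (f1 i*[A1 (s1 w)]f1 j) k) = b2 w (coord (K2 (s2 w)) (A2 (s2 w)) {..<N} f2 (f2 i*[A2 (s2 w)]f2 j) k)) &
   (ALL k<N. b1 w (coord (K1 (s1 w)) (A1 (s1 w)) {..<N} f1 1[A1 (s1 w)] k) = b2 w (coord (K2 (s2 w)) (A2 (s2 w)) {..<N} f2 1[A2 (s2 w)] k)))"
 have "ALL w:V0. EX g. g:GL N (K0 w) & ?P w g"
 proof
  fix w assume w: "w:V0"
  have "EX g:GL N (K0 w). ?P w g"
   by (rule glue_local[OF K1[OF s1[OF w]] K2[OF s2[OF w]] K0[OF w] b1[OF w] b2[OF w] csaD(1)[OF A1(1)[OF s1[OF w]]] sc1[OF s1[OF w]]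
     csaD(1)[OF A2(1)[OF s2[OF w]]] sc2[OF s2[OF w]] iso[OF w]])
  then show "EX g. g:GL N (K0 w) & ?P w g" by (rule bexE) (intro exI conjI)
 qed
 from bchoice[OF this] obtain g where g: "ALL w:V0. g w:GL N (K0 w) & ?P w (g w)" by (rule exE)
 obtain g1 g2 where g1: "!!v. v:V1==>g1 v:GL N (K1 v)" and g2: "!!v. v:V2==>g2 v:GL N (K2 v)"
  and gg: "!!w. w:V0==>g w = mape N (b1 w) (g1 (s1 w))*[MR (K0 w) N]mape N (b2 w) (g2 (s2 w))"
  using fact[OF N,of g] g by blast
 define f1 where "f1 = (%v. chb (A1 v) N (inv\<^bsub>MR (K1 v) N\<^esub> g1 v) (e1 v))"
 define f2 where "f2 = (%v. chb (A2 v) N (g2 v) (e2 v))"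
 define d1 where "d1 = (%v i j. coord (K1 v) (A1 v) {..<N} (f1 v) (f1 v i*[A1 v]f1 v j))"
 define d2 where "d2 = (%v i j. coord (K2 v) (A2 v) {..<N} (f2 v) (f2 v i*[A2 v]f2 v j))"
 define u1 where "u1 = (%v. coord (K1 v) (A1 v) {..<N} (f1 v) 1[A1 v])"
 define u2 where "u2 = (%v. coord (K2 v) (A2 v) {..<N} (f2 v) 1[A2 v])"
 have eqs: "(ALL i<N. ALL j<N. ALL k<N. b1 w (d1 (s1 w) i j k) = b2 w (d2 (s2 w) i j k)) & (ALL k<N. b1 w (u1 (s1 w) k) = b2 w (u2 (s2 w) k))" if w: "w:V0" for w
  unfolding d1_def d2_def u1_def u2_def f1_def f2_def
  using g[rule_format,OF w,THEN conjunct2,rule_format,OF g1[OF s1[OF w]] g2[OF s2[OF w]] gg[OF w]] by (simp only: Let_def)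
 have sc1': "has_sc (K1 v) (A1 v) {..<N} (f1 v) (d1 v)" and u1c: "!!k. k < N==>u1 v k:.(K1 v)" and u1l: "lc (A1 v) {..<N} (u1 v) (f1 v) = 1[A1 v]" if v: "v:V1" for v
 proof -
  interpret A: assoc_algebra "K1 v" "A1 v" by (rule csaD(1)[OF A1(1)[OF v]])
  interpret M: ring "MR (K1 v) N" by (rule A.R.mat_ring_ring)
  have "inv\<^bsub>MR (K1 v) N\<^esub> g1 v:GL N (K1 v)" using g1[OF v] by (simp add: GL_def)
  then have b: "basis_family (K1 v) (A1 v) {..<N} (f1 v)" unfolding f1_def by (rule A.chb_basis[OF has_scD(1)[OF sc1[OF v]]])
  show "has_sc (K1 v) (A1 v) {..<N} (f1 v) (d1 v)" unfolding d1_def by (rule has_sc_exists[OF A.assoc_algebra_axioms b])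
  show "!!k. k < N==>u1 v k:.(K1 v)" "lc (A1 v) {..<N} (u1 v) (f1 v) = 1[A1 v]" unfolding u1_def using A.coord_closed[OF b A.one_closed] A.coord_props(2)[OF b A.one_closed] by auto
 qed
 have sc2': "has_sc (K2 v) (A2 v) {..<N} (f2 v) (d2 v)" and u2c: "!!k. k < N==>u2 v k:.(K2 v)" if v: "v:V2" for v
 proof -
  interpret A: assoc_algebra "K2 v" "A2 v" by (rule csaD(1)[OF A2(1)[OF v]])
  have b: "basis_family (K2 v) (A2 v) {..<N} (f2 v)" unfolding f2_def by (rule A.chb_basis[OF has_scD(1)[OF sc2[OF v]] g2[OF v]])
  show "has_sc (K2 v) (A2 v) {..<N} (f2 v) (d2 v)" unfolding d2_def by (rule has_sc_exists[OF A.assoc_algebra_axioms b])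
  show "!!k. k < N==>u2 v k:.(K2 v)" unfolding u2_def using A.coord_closed[OF b A.one_closed] by auto
 qed
 \<comment> \<open>The constants over F_1 and over F_2 agree in every factor of F_0, so they come
   from elements of F.\<close>
 have "ALL i j k. EX x. i < N --> j < N --> k < N --> x:.F & (ALL v:V1. a1 v x = d1 v i j k) & (ALL v:V2. a2 v x = d2 v i j k)"
 proof (intro allI)
  fix i j k
  show "EX x. i < N --> j < N --> k < N --> x:.F & (ALL v:V1. a1 v x = d1 v i j k) & (ALL v:V2. a2 v x = d2 v i j k)"
  proof (cases "i < N & j < N & k < N")
   case True
   have "EX x:carrier F. (ALL v:V1. a1 v x = d1 v i j k) & (ALL v:V2. a2 v x = d2 v i j k)"
    by (rule meet[of "%v. d1 v i j k" "%v. d2 v i j k"]) (use True eqs has_scD(5)[OF sc1'] has_scD(5)[OF sc2'] in auto)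
   then show ?thesis by blast
  qed auto
 qed
 then obtain c where c: "!!i j k. i < N==>j < N==>k < N==>c i j k:.F & (ALL v:V1. a1 v (c i j k) = d1 v i j k) & (ALL v:V2. a2 v (c i j k) = d2 v i j k)" by metis
 have "ALL k. EX x. k < N --> x:.F & (ALL v:V1. a1 v x = u1 v k)"
 proof
  fix k
  show "EX x. k < N --> x:.F & (ALL v:V1. a1 v x = u1 v k)"
  proof (cases "k < N")
   case True
   have "EX x:carrier F. (ALL v:V1. a1 v x = u1 v k) & (ALL v:V2. a2 v x = u2 v k)"
    by (rule meet[of "%v. u1 v k" "%v. u2 v k"]) (use True eqs u1c u2c in auto)
   then show ?thesis by blast
  qed auto
 qed
 then obtain u where u: "!!k. k < N==>u k:.F & (ALL v:V1. a1 v (u k) = u1 v k)" by metis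
 \<comment> \<open>A single factor of F_1 is enough to verify the algebra laws of the glued algebra
   by embedding and its central simplicity by descent.\<close>
 obtain v0 where v0: "v0:V1" using V1 by blast
 define A where "A = calg F {..<N} c u"
 define \<epsilon> where "\<epsilon> = (%i::nat. \<lambda>j\<in>{..<N}. if j = i then 1[F] else 0[F])"
 note aA1 = csaD(1)[OF A1(1)[OF v0]]
 interpret A0: assoc_algebra "K1 v0" "A1 v0" by (rule aA1)
 have l1: "lc (A1 v0) {..<N} (%i. a1 v0 (u i)) (f1 v0) = 1[A1 v0]"
  by (rule trans[OF A0.lc_cong u1l[OF v0]]) (use has_scD(3)[OF sc1'[OF v0]] u u1c[OF v0] v0 in auto)
 have A: "assoc_algebra F A" and scA: "has_sc F A {..<N} \<epsilon> c" unfolding A_def \<epsilon>_def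
  by (rule calg_embed[OF F aA1 sc1'[OF v0] a1[OF v0] _ _ _ l1]; use c u v0 in auto)+
 have s1': "has_sc (K1 v) (A1 v) {..<N} (f1 v) (%i j k. a1 v (c i j k))" if v: "v:V1" for v
  by (rule has_sc_cong[OF sc1'[OF v]]) (use c v assoc_algebra.vs[OF csaD(1)[OF A1(1)[OF v]]] in auto)
 have s2': "has_sc (K2 v) (A2 v) {..<N} (f2 v) (%i j k. a2 v (c i j k))" if v: "v:V2" for v
  by (rule has_sc_cong[OF sc2'[OF v]]) (use c v assoc_algebra.vs[OF csaD(1)[OF A2(1)[OF v]]] in auto)
 have csa: "csa F A" by (rule csa_descent[OF A scA A1(1)[OF v0] a1[OF v0] s1'[OF v0]])
 have dimA: "vdim F A = N" using has_sc_dim[OF A scA] by simp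
 show ?thesis
 proof (rule that[OF csa dimA])
  show "algebra_iso (K1 v) (base_change F (K1 v) (a1 v) A) (A1 v)" if v: "v:V1" for v
   by (rule algebra_iso_of_has_sc[OF base_change_alg[OF A K1[OF v] a1[OF v]] csaD(1)[OF A1(1)[OF v]] has_sc_base_change[OF A K1[OF v] a1[OF v] scA] s1'[OF v]])
  show "algebra_iso (K2 v) (base_change F (K2 v) (a2 v) A) (A2 v)" if v: "v:V2" for v
   by (rule algebra_iso_of_has_sc[OF base_change_alg[OF A K2[OF v] a2[OF v]] csaD(1)[OF A2(1)[OF v]] has_sc_base_change[OF A K2[OF v] a2[OF v] scA] s2'[OF v]])
 qed
qed

end

section \<open>Algebras split by every factor\<close>

context patching
begin

lemma split:
 assumes A: "csa F A"
  and sp1: "!!v. v:V1==>brauer_equiv (K1 v) (base_change F (K1 v) (a1 v) A) (self (K1 v))"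
  and sp2: "!!v. v:V2==>brauer_equiv (K2 v) (base_change F (K2 v) (a2 v) A) (self (K2 v))"
 shows "brauer_equiv F A (self F)"
proof -
 note aA = csaD(1)[OF A] and fA = csa_fd[OF A]
 let ?N = "vdim F A"
 obtain n where n: "?N = n * n" by (rule wedderburn_ind[OF A])
 have n1: "n >= 1" using csa_dim_pos[OF A] n by (cases n) auto
 obtain e c where sc: "has_sc F A {..<?N} e c" by (rule csa_has_sc[OF A])
 note c = has_scD(5)[OF sc]
 \<comment> \<open>A split form of \<open>A\<close> over \<open>L\<close> has the dimension of the n
   by n matrices and the same class, so it is isomorphic to them: there are matrices over
   \<open>L\<close> multiplying with the constants of \<open>A\<close>.\<close>
 have rep: "EX X. has_sc L (MA (self L) n) {..<?N} X (%i j k. h (c i j k))"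
  if L: "field L" and h: "h:ring_hom F L" and eq: "brauer_equiv L (base_change F L h A) (self L)" for L :: "'l ring" and h
 proof -
  note B = csa_base_change[OF A L h] and S = csa_self[OF L] and M = csa_mat_self[OF L n1]
  have "brauer_equiv L (base_change F L h A) (MA (self L) n)"
   by (rule brauer_equiv_trans[OF csa_fd[OF B] csa_fd[OF S] csa_fd[OF M] eq brauer_equiv_sym[OF csa_fd[OF M] brauer_equiv_mat[OF csa_fd[OF S] n1]]])
  then have i: "algebra_iso L (base_change F L h A) (MA (self L) n)"
   by (rule csa_iso_of_equiv[OF B M]) (simp add: base_change_dim[OF fA L h] mat_self_dim(1)[OF L] n)
  obtain X where "has_sc L (MA (self L) n) {..<?N} X (%i j k. h (c i j k))"
   by (rule has_sc_iso[OF csaD(1)[OF B] csaD(1)[OF M] has_sc_base_change[OF aA L h sc] i])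
  then show ?thesis by blast
 qed
 have "ALL v:V1. EX X. has_sc (K1 v) (MA (self (K1 v)) n) {..<?N} X (%i j k. a1 v (c i j k))" using rep[OF K1 a1 sp1] by blast
 from bchoice[OF this] obtain X1 where X1: "!!v. v:V1==>has_sc (K1 v) (MA (self (K1 v)) n) {..<?N} (X1 v) (%i j k. a1 v (c i j k))" by blast
 have "ALL v:V2. EX X. has_sc (K2 v) (MA (self (K2 v)) n) {..<?N} X (%i j k. a2 v (c i j k))" using rep[OF K2 a2 sp2] by blast
 from bchoice[OF this] obtain X2 where X2: "!!v. v:V2==>has_sc (K2 v) (MA (self (K2 v)) n) {..<?N} (X2 v) (%i j k. a2 v (c i j k))" by blast
 have nonzero: "EX k<?N. X k ~= 0[MR L n]" if L: "field L" and X: "basis_family L (MA (self L) n) {..<?N} X" for L :: "'l ring" and X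
 proof (rule ccontr)
  assume "~ ?thesis"
  then have 0: "!!k. k < ?N==>X k = 0[MA (self L) n]" by (auto simp: mat_self_sel)
  interpret M: assoc_algebra L "MA (self L) n" by (rule mat_self_alg[OF L])
  have "x = 0[MA (self L) n]" if x: "x:.(MA (self L) n)" for x
  proof -
   have "lc (MA (self L) n) {..<?N} (coord L (MA (self L) n) {..<?N} X x) X = 0[MA (self L) n]"
    unfolding lc_def by (rule M.M.finsum_all_zero) (use 0 M.coord_closed[OF X x] in auto)
   then show ?thesis using M.coord_props(2)[OF X x] by simp
  qed
  then show False using csaD(3)[OF csa_mat_self[OF L n1]] by (auto simp: simple_ring_def)
 qed
 \<comment> \<open>Over a factor of F_0 the images of these matrices satisfy the same relations and
   are not all zero, so they are again a basis; the two sides can be compared there by an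
   automorphism.\<close>
 have push: "has_sc L (MA (self L) n) {..<?N} (%k. mape n b (X k)) (%i j k. b (a (c i j k)))"
  if K: "field K" and L: "field L" and a: "a:ring_hom F K" and b: "b:ring_hom K L" and X: "has_sc K (MA (self K) n) {..<?N} X (%i j k. a (c i j k))"
  for K :: "'x ring" and L :: "'y ring" and a b X
 proof -
  interpret K: field K by (rule K)
  interpret L: field L by (rule L)
  note XD = has_scD[OF X]
  have ba: "(%x. b (a x)):ring_hom F L" by (rule ring_hom_memI) (use ring_hom_closed[OF a] ring_hom_mult[OF a] ring_hom_add[OF a] ring_hom_one[OF a] ring_hom_closed[OF b] ring_hom_mult[OF b] ring_hom_add[OF b] ring_hom_one[OF b] in auto)
  have Xc: "X k:.(MR K n)" if "k < ?N" for k using XD(3) that by (auto simp: mat_self_sel)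
  have Xm: "X:{..<?N}->.(MR K n)" using Xc by auto
  show ?thesis
  proof (rule csa_hom_basis[OF csa_base_change[OF A L ba] has_sc_base_change[OF aA L ba sc] csa_fd[OF csa_mat_self[OF L n1]]])
   show "vdim L (MA (self L) n) = ?N" by (simp add: mat_self_dim(1)[OF L] n)
   show "(%k. mape n b (X k)):{..<?N}->.(MA (self L) n)" using map_entries_closed[OF b Xc] by (auto simp: mat_self_sel)
   obtain k where k: "k < ?N" "X k ~= 0[MR K n]" using nonzero[OF K XD(1)] by blast
   have z: "mape n b 0[MR K n] = 0[MR L n]" unfolding map_entries_def mat_ring_sel(2)
    by (rule restrict_ext) (simp add: ring_hom_zero_ring[OF K.ring_axioms L.ring_axioms b])
   have "mape n b (X k) ~= 0[MR L n]"
   proof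
    assume "mape n b (X k) = 0[MR L n]"
    moreover have "0[MR K n]:.(MR K n)" by (auto simp: mat_ring_sel)
    ultimately have "X k = 0[MR K n]" by (intro map_entries_inj[OF K L b Xc[OF k(1)]]) (simp_all add: z)
    then show False using k(2) by simp
   qed
   then show "EX i<?N. mape n b (X i) ~= 0[MA (self L) n]" using k(1) by (auto simp: mat_self_sel)
   fix i j assume ij: "i < ?N" "j < ?N"
   have "mape n b (X i)*[MR L n]mape n b (X j) = mape n b (X i*[MR K n]X j)"
    by (rule map_entries_mult[symmetric,OF K.ring_axioms L.ring_axioms b Xc[OF ij(1)] Xc[OF ij(2)]])
   also have "X i*[MR K n]X j = lc (MA (self K) n) {..<?N} (%k. a (c i j k)) X" using XD(6)[of i j] ij by (simp add: mat_self_sel)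
   also have "mape n b ... = lc (MA (self L) n) {..<?N} (%k. b (a (c i j k))) (%k. mape n b (X k))"
    by (rule map_entries_lc[OF K L b Xm]) (use c ij ring_hom_closed[OF a] in auto)
   finally show "mape n b (X i)*[MA (self L) n]mape n b (X j) = lc (MA (self L) n) {..<?N} (%k. b (a (c i j k))) (%k. mape n b (X k))"
    by (simp add: mat_self_sel)
  qed
 qed
 \<comment> \<open>The images from F_1 and F_2 are two bases of one matrix algebra with equal
   constants. The isomorphism between them is an automorphism of that algebra, given by conjugation
   with \<open>P\<close>.\<close>
 have "ALL w:V0. EX P. P:GL n (K0 w) & (ALL k<?N. mape n (b1 w) (X1 (s1 w) k)*[MR (K0 w) n]P = P*[MR (K0 w) n]mape n (b2 w) (X2 (s2 w) k))"
 proof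
  fix w assume w: "w:V0"
  let ?M = "MA (self (K0 w)) n"
  note Y1 = push[OF K1[OF s1[OF w]] K0[OF w] a1[OF s1[OF w]] b1[OF w] X1[OF s1[OF w]]]
  note Y2 = push[OF K2[OF s2[OF w]] K0[OF w] a2[OF s2[OF w]] b2[OF w] X2[OF s2[OF w]]]
  note M = mat_self_alg[OF K0[OF w],of n]
  have Y2': "has_sc (K0 w) ?M {..<?N} (%k. mape n (b2 w) (X2 (s2 w) k)) (%i j k. b1 w (a1 (s1 w) (c i j k)))"
   by (rule has_sc_cong[OF Y2 _ assoc_algebra.vs[OF M]]) (use comm[OF w c] in auto)
  obtain h where h: "h:ring_iso ?M ?M" "h:module_hom (K0 w) ?M ?M" "!!k. k:{..<?N}==>h (mape n (b2 w) (X2 (s2 w) k)) = mape n (b1 w) (X1 (s1 w) k)"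
   by (rule iso_of_has_sc[OF M M Y2' Y1]) blast
  obtain P where P: "P:GL n (K0 w)" "!!x. x:.(MR (K0 w) n)==>h x*[MR (K0 w) n]P = P*[MR (K0 w) n]x"
   by (rule skolem_noether_mat[OF K0[OF w] n1 h(1,2)]) blast
  have "mape n (b1 w) (X1 (s1 w) k)*[MR (K0 w) n]P = P*[MR (K0 w) n]mape n (b2 w) (X2 (s2 w) k)" if k: "k < ?N" for k
   using P(2)[of "mape n (b2 w) (X2 (s2 w) k)"] h(3)[of k] k has_scD(3)[OF Y2] by (auto simp: mat_self_sel)
  then show "EX P. P:GL n (K0 w) & (ALL k<?N. mape n (b1 w) (X1 (s1 w) k)*[MR (K0 w) n]P = P*[MR (K0 w) n]mape n (b2 w) (X2 (s2 w) k))"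
   using P(1) by blast
 qed
 from bchoice[OF this] obtain P where P: "!!w. w:V0==>P w:GL n (K0 w)"
  "!!w k. w:V0==>k < ?N==>mape n (b1 w) (X1 (s1 w) k)*[MR (K0 w) n]P w = P w*[MR (K0 w) n]mape n (b2 w) (X2 (s2 w) k)" by blast
 obtain g1 g2 where g1: "!!v. v:V1==>g1 v:GL n (K1 v)" and g2: "!!v. v:V2==>g2 v:GL n (K2 v)"
  and gg: "!!w. w:V0==>P w = mape n (b1 w) (g1 (s1 w))*[MR (K0 w) n]mape n (b2 w) (g2 (s2 w))"
  using fact[OF n1,of P] P(1) by blast
 \<comment> \<open>From X_1 P = P X_2 and P = g_1 g_2 it follows that g_1^(-1) X_1 g_1 = g_2 X_2
   g_2^(-1) over F_0. The left side is defined over F_1 and the right side over F_2.\<close>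
 define Z1 where "Z1 = (%v k. inv\<^bsub>MR (K1 v) n\<^esub> g1 v*[MR (K1 v) n]X1 v k*[MR (K1 v) n]g1 v)"
 define Z2 where "Z2 = (%v k. g2 v*[MR (K2 v) n]X2 v k*[MR (K2 v) n]inv\<^bsub>MR (K2 v) n\<^esub> g2 v)"
 have X1c: "X1 v k:.(MR (K1 v) n)" if "v:V1" "k < ?N" for v k using has_scD(3)[OF X1[OF that(1)]] that(2) by (auto simp: mat_self_sel)
 have X2c: "X2 v k:.(MR (K2 v) n)" if "v:V2" "k < ?N" for v k using has_scD(3)[OF X2[OF that(1)]] that(2) by (auto simp: mat_self_sel)
 have u1: "g1 v:.(MR (K1 v) n)" "inv\<^bsub>MR (K1 v) n\<^esub> g1 v:.(MR (K1 v) n)" "inv\<^bsub>MR (K1 v) n\<^esub> g1 v*[MR (K1 v) n]g1 v = 1[MR (K1 v) n]"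
  "g1 v*[MR (K1 v) n]inv\<^bsub>MR (K1 v) n\<^esub> g1 v = 1[MR (K1 v) n]" "ring (MR (K1 v) n)" "ring (K1 v)" if v: "v:V1" for v
 proof -
  interpret K: field "K1 v" by (rule K1[OF v])
  show "ring (K1 v)" by (rule K.ring_axioms)
  interpret M: ring "MR (K1 v) n" by (rule K.mat_ring_ring)
  show "ring (MR (K1 v) n)" by (rule M.ring_axioms)
  have "g1 v:Units (MR (K1 v) n)" using g1[OF v] by (simp add: GL_def)
  then show "g1 v:.(MR (K1 v) n)" "inv\<^bsub>MR (K1 v) n\<^esub> g1 v:.(MR (K1 v) n)" "inv\<^bsub>MR (K1 v) n\<^esub> g1 v*[MR (K1 v) n]g1 v = 1[MR (K1 v) n]"
  "g1 v*[MR (K1 v) n]inv\<^bsub>MR (K1 v) n\<^esub> g1 v = 1[MR (K1 v) n]" by auto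
 qed
 have u2: "g2 v:.(MR (K2 v) n)" "inv\<^bsub>MR (K2 v) n\<^esub> g2 v:.(MR (K2 v) n)" "g2 v*[MR (K2 v) n]inv\<^bsub>MR (K2 v) n\<^esub> g2 v = 1[MR (K2 v) n]"
  "ring (MR (K2 v) n)" "ring (K2 v)" if v: "v:V2" for v
 proof -
  interpret K: field "K2 v" by (rule K2[OF v])
  show "ring (K2 v)" by (rule K.ring_axioms)
  interpret M: ring "MR (K2 v) n" by (rule K.mat_ring_ring)
  show "ring (MR (K2 v) n)" by (rule M.ring_axioms)
  have "g2 v:Units (MR (K2 v) n)" using g2[OF v] by (simp add: GL_def)
  then show "g2 v:.(MR (K2 v) n)" "inv\<^bsub>MR (K2 v) n\<^esub> g2 v:.(MR (K2 v) n)" "g2 v*[MR (K2 v) n]inv\<^bsub>MR (K2 v) n\<^esub> g2 v = 1[MR (K2 v) n]" by auto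
 qed
 have Z1c: "Z1 v k:.(MR (K1 v) n)" if "v:V1" "k < ?N" for v k
  unfolding Z1_def by (intro monoid.m_closed ring.is_monoid u1 X1c that)
 have Z2c: "Z2 v k:.(MR (K2 v) n)" if "v:V2" "k < ?N" for v k
  unfolding Z2_def by (intro monoid.m_closed ring.is_monoid u2 X2c that)
 have ZZ: "mape n (b1 w) (Z1 (s1 w) k) = mape n (b2 w) (Z2 (s2 w) k)" if w: "w:V0" and k: "k < ?N" for w k
 proof -
  interpret K: field "K0 w" by (rule K0[OF w])
  interpret M: ring "MR (K0 w) n" by (rule K.mat_ring_ring)
  let ?m1 = "mape n (b1 w)" and ?m2 = "mape n (b2 w)" and ?v = "s1 w" and ?v' = "s2 w"
  note v = s1[OF w] and v' = s2[OF w]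
  note mm1 = map_entries_mult[OF u1(6)[OF v] K.ring_axioms b1[OF w]] and mm2 = map_entries_mult[OF u2(5)[OF v'] K.ring_axioms b2[OF w]]
  note mc1 = map_entries_closed[OF b1[OF w]] and mc2 = map_entries_closed[OF b2[OF w]]
  note mo1 = map_entries_one[OF u1(6)[OF v] K.ring_axioms b1[OF w]] and mo2 = map_entries_one[OF u2(5)[OF v'] K.ring_axioms b2[OF w]]
  let ?G = "?m1 (g1 ?v)" and ?Gi = "?m1 (inv\<^bsub>MR (K1 ?v) n\<^esub> g1 ?v)" and ?H = "?m2 (g2 ?v')" and ?Hi = "?m2 (inv\<^bsub>MR (K2 ?v') n\<^esub> g2 ?v')"
  let ?X = "?m1 (X1 ?v k)" and ?Y = "?m2 (X2 ?v' k)"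
  have cl: "?G:.(MR (K0 w) n)" "?Gi:.(MR (K0 w) n)" "?H:.(MR (K0 w) n)" "?Hi:.(MR (K0 w) n)"
   "?X:.(MR (K0 w) n)" "?Y:.(MR (K0 w) n)" using mc1 mc2 u1[OF v] u2[OF v'] X1c[OF v k] X2c[OF v' k] by auto
  have GG: "?Gi*[MR (K0 w) n]?G = 1[MR (K0 w) n]" using mm1[OF u1(2)[OF v] u1(1)[OF v]] u1(3)[OF v] mo1 by simp
  have HH: "?H*[MR (K0 w) n]?Hi = 1[MR (K0 w) n]" using mm2[OF u2(1)[OF v'] u2(2)[OF v']] u2(3)[OF v'] mo2 by simp
  have XP: "?X*[MR (K0 w) n](?G*[MR (K0 w) n]?H) = ?G*[MR (K0 w) n]?H*[MR (K0 w) n]?Y" using P(2)[OF w k] gg[OF w] by simp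
  have "?m1 (Z1 ?v k) = ?Gi*[MR (K0 w) n]?X*[MR (K0 w) n]?G"
   unfolding Z1_def using mm1 u1[OF v] X1c[OF v k] monoid.m_closed[OF ring.is_monoid[OF u1(5)[OF v]] u1(2)[OF v] X1c[OF v k]] by simp
  also have "... = ?Gi*[MR (K0 w) n]?X*[MR (K0 w) n]?G*[MR (K0 w) n](?H*[MR (K0 w) n]?Hi)" unfolding HH using cl by simp
  also have "... = ?Gi*[MR (K0 w) n](?X*[MR (K0 w) n](?G*[MR (K0 w) n]?H))*[MR (K0 w) n]?Hi" using cl by (simp add: M.m_assoc)
  also have "... = (?Gi*[MR (K0 w) n]?G)*[MR (K0 w) n](?H*[MR (K0 w) n]?Y*[MR (K0 w) n]?Hi)" unfolding XP using cl by (simp add: M.m_assoc)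
  also have "... = ?H*[MR (K0 w) n]?Y*[MR (K0 w) n]?Hi" unfolding GG using cl by simp
  also have "... = ?m2 (Z2 ?v' k)"
   unfolding Z2_def using mm2 u2[OF v'] X2c[OF v' k] monoid.m_closed[OF ring.is_monoid[OF u2(4)[OF v']] u2(1)[OF v'] X2c[OF v' k]] by simp
  finally show ?thesis .
 qed
 \<comment> \<open>Entry by entry, the agreement over F_0 yields matrices with entries in F.\<close>
 have "ALL k p. EX x. k < ?N --> p:sq n --> x:.F & (ALL v:V1. a1 v x = Z1 v k p)"
 proof (intro allI)
  fix k p
  show "EX x. k < ?N --> p:sq n --> x:.F & (ALL v:V1. a1 v x = Z1 v k p)"
  proof (cases "k < ?N & p:sq n")
   case True
   then have kp: "k < ?N" "p:sq n" by auto
   have "EX x:carrier F. (ALL v:V1. a1 v x = Z1 v k p) & (ALL v:V2. a2 v x = Z2 v k p)"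
   proof (rule meet[of "%v. Z1 v k p" "%v. Z2 v k p"])
    show "b1 w (Z1 (s1 w) k p) = b2 w (Z2 (s2 w) k p)" if w: "w:V0" for w using fun_cong[OF ZZ[OF w kp(1)],of p] kp(2) by (simp add: map_entries_def)
   qed (use mat_entry'[OF Z1c _] mat_entry'[OF Z2c _] kp in auto)
   then show ?thesis by blast
  qed auto
 qed
 then obtain z where z: "!!k p. k < ?N==>p:sq n==>z k p:.F & (ALL v:V1. a1 v (z k p) = Z1 v k p)" by metis
 define Z where "Z = (%k. restrict (z k) (sq n))"
 have Zc: "Z k:.(MR F n)" if "k < ?N" for k unfolding Z_def mat_ring_sel(1) by (intro restrict_PiE_iff[THEN iffD2] ballI) (use z that in auto)
 obtain v where v: "v:V1" using V1 by blast
 have aZ: "mape n (a1 v) (Z k) = Z1 v k" if k: "k < ?N" for k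
  by (rule mat_eqI[OF map_entries_closed[OF a1[OF v] Zc[OF k]] Z1c[OF v k]]) (use z k v in "auto simp: map_entries_entry Z_def")
 interpret F: field F by (rule F)
 interpret K: field "K1 v" by (rule K1[OF v])
 let ?M = "MA (self (K1 v)) n"
 interpret M: assoc_algebra "K1 v" ?M by (rule mat_self_alg[OF K1[OF v]])
 note XD = has_scD[OF X1[OF v]]
 have uM: "g1 v:.?M" "inv\<^bsub>MR (K1 v) n\<^esub> g1 v:.?M" "inv\<^bsub>MR (K1 v) n\<^esub> g1 v*[?M]g1 v = 1[?M]" "g1 v*[?M]inv\<^bsub>MR (K1 v) n\<^esub> g1 v = 1[?M]"
  using u1[OF v] by (simp_all add: mat_self_sel)
 define \<gamma> where "\<gamma> = inv\<^bsub>MR (K1 v) n\<^esub> g1 v"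
 note uM = uM[folded \<gamma>_def]
 have Z1M: "Z1 v k = \<gamma>*[?M]X1 v k*[?M]g1 v" for k by (simp add: Z1_def \<gamma>_def mat_self_sel)
 have conj: "(%x. \<gamma>*[?M]x*[?M]g1 v):module_hom (K1 v) ?M ?M" by (rule module_hom_comp[OF M.left_mult_hom[OF uM(2)] M.right_mult_hom[OF uM(1)]])
 have XM: "!!k. k < ?N==>X1 v k:.?M" using XD(3) by auto
 \<comment> \<open>The relations between the matrices over F are checked after the injection into
   one factor of F_1, where the matrices are conjugates of \<open>X1\<close>.\<close>
 have "has_sc F (MA (self F) n) {..<?N} Z c"
 proof (rule csa_hom_basis[OF A sc csa_fd[OF csa_mat_self[OF F n1]]])
  show "vdim F (MA (self F) n) = ?N" by (simp add: mat_self_dim(1)[OF F] n)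
  show "Z:{..<?N}->.(MA (self F) n)" using Zc by (auto simp: mat_self_sel)
  obtain k where k: "k < ?N" "X1 v k ~= 0[MR (K1 v) n]" using nonzero[OF K1[OF v] XD(1)] by blast
  have "Z k ~= 0[MR F n]"
  proof
   assume 0: "Z k = 0[MR F n]"
   have "mape n (a1 v) 0[MR F n] = 0[MR (K1 v) n]" unfolding map_entries_def mat_ring_sel(2)
    by (rule restrict_ext) (simp add: ring_hom_zero_ring[OF F.ring_axioms K.ring_axioms a1[OF v]])
   then have "Z1 v k = 0[?M]" using aZ[OF k(1)] 0 by (simp add: mat_self_sel)
   moreover have "g1 v*[?M]Z1 v k*[?M]\<gamma> = (g1 v*[?M]\<gamma>)*[?M]X1 v k*[?M](g1 v*[?M]\<gamma>)"
    unfolding Z1M using uM(1,2) XM[OF k(1)] by (simp add: M.m_assoc)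
   ultimately have "X1 v k = 0[?M]" using uM XM[OF k(1)] by simp
   then show False using k(2) by (simp add: mat_self_sel)
  qed
  then show "EX i<?N. Z i ~= 0[MA (self F) n]" using k(1) by (auto simp: mat_self_sel)
  fix i j assume ij: "i < ?N" "j < ?N"
  interpret MF: assoc_algebra F "MA (self F) n" by (rule mat_self_alg[OF F])
  have cF: "c i j:{..<?N}->.F" using c ij by auto
  have "Z i*[MR F n]Z j = lc (MA (self F) n) {..<?N} (c i j) Z"
  proof (rule map_entries_inj[OF F K1[OF v] a1[OF v] F.mat_mult_closed[OF Zc[OF ij(1)] Zc[OF ij(2)]]])
   show "lc (MA (self F) n) {..<?N} (c i j) Z:.(MR F n)" using MF.lc_closed[of Z "{..<?N}" "c i j"] Zc cF by (auto simp: mat_self_sel)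
   have "mape n (a1 v) (Z i*[MR F n]Z j) = Z1 v i*[?M]Z1 v j"
    using map_entries_mult[OF F.ring_axioms K.ring_axioms a1[OF v] Zc[OF ij(1)] Zc[OF ij(2)]] aZ ij by (simp add: mat_self_sel)
   also have "... = \<gamma>*[?M]X1 v i*[?M](g1 v*[?M]\<gamma>)*[?M]X1 v j*[?M]g1 v" unfolding Z1M using uM(1,2) XM ij by (simp add: M.m_assoc)
   also have "... = \<gamma>*[?M](X1 v i*[?M]X1 v j)*[?M]g1 v" unfolding uM(4) using uM(1,2) XM ij by (simp add: M.m_assoc)
   also have "X1 v i*[?M]X1 v j = lc ?M {..<?N} (%k. a1 v (c i j k)) (X1 v)" using XD(6) ij by simp
   also have "\<gamma>*[?M]...*[?M]g1 v = lc ?M {..<?N} (%k. a1 v (c i j k)) (%k. \<gamma>*[?M]X1 v k*[?M]g1 v)"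
    by (rule module_hom_lc[OF M.vs M.vs conj XD(3)]) (use XD(4)[of i j] ij in auto)
   also have "... = lc ?M {..<?N} (%k. a1 v (c i j k)) (%k. mape n (a1 v) (Z k))"
    by (rule M.lc_cong) (use XM uM XD(4)[of i j] ij aZ Z1M in auto)
   also have "... = mape n (a1 v) (lc (MA (self F) n) {..<?N} (c i j) Z)"
    by (rule map_entries_lc[symmetric,OF F K1[OF v] a1[OF v] _ cF]) (use Zc in auto)
   finally show "mape n (a1 v) (Z i*[MR F n]Z j) = mape n (a1 v) (lc (MA (self F) n) {..<?N} (c i j) Z)" .
  qed
  then show "Z i*[MA (self F) n]Z j = lc (MA (self F) n) {..<?N} (c i j) Z" by (simp add: mat_self_sel)
 qed
 then have "algebra_iso F A (MA (self F) n)" by (rule algebra_iso_of_has_sc[OF aA mat_self_alg[OF F] sc])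
 then have 1: "brauer_equiv F A (MA (self F) n)" by (rule brauer_equiv_iso[OF fA mat_self_alg[OF F]])
 note fS = csa_fd[OF csa_self[OF F]] and fM = csa_fd[OF csa_mat_self[OF F n1]]
 show ?thesis by (rule brauer_equiv_trans[OF fA fM fS 1 brauer_equiv_mat[OF fS n1]])
qed

section \<open>Restriction of Brauer classes and the index\<close>

abbreviation "r1 v \<equiv> Br_res F (K1 v) (a1 v)"
abbreviation "r2 v \<equiv> Br_res F (K2 v) (a2 v)"
abbreviation "t1 w \<equiv> Br_res (K1 (s1 w)) (K0 w) (b1 w)"
abbreviation "t2 w \<equiv> Br_res (K2 (s2 w)) (K0 w) (b2 w)"

lemma res_trivial:
 assumes \<alpha>: "\<alpha>:.(Br F)" and "!!v. v:V1==>r1 v \<alpha> = 1[Br (K1 v)]" "!!v. v:V2==>r2 v \<alpha> = 1[Br (K2 v)]"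
 shows "\<alpha> = 1[Br F]"
proof -
 obtain A :: "('a,nat=>'a) module" where A: "csa F A" "\<alpha> = brauer_class F A" by (rule Br_carrierE[OF \<alpha>])
 have "brauer_equiv F A (self F)"
 proof (rule split[OF A(1)])
  show "brauer_equiv (K1 v) (base_change F (K1 v) (a1 v) A) (self (K1 v))" if v: "v:V1" for v
   using assms(2)[OF v] brauer_class_eq_iff[OF csa_base_change[OF A(1) K1[OF v] a1[OF v]] csa_self[OF K1[OF v]]]
   unfolding A(2) Br_res_class[OF A(1) K1[OF v] a1[OF v]] Br_one by simp
  show "brauer_equiv (K2 v) (base_change F (K2 v) (a2 v) A) (self (K2 v))" if v: "v:V2" for v
   using assms(3)[OF v] brauer_class_eq_iff[OF csa_base_change[OF A(1) K2[OF v] a2[OF v]] csa_self[OF K2[OF v]]]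
   unfolding A(2) Br_res_class[OF A(1) K2[OF v] a2[OF v]] Br_one by simp
 qed
 then show ?thesis unfolding A(2) Br_one using brauer_class_eq_iff[OF A(1) csa_self[OF F]] by simp
qed

lemma res_inj:
 assumes \<alpha>: "\<alpha>:.(Br F)" and \<beta>: "\<beta>:.(Br F)" and eq: "!!v. v:V1==>r1 v \<alpha> = r1 v \<beta>" "!!v. v:V2==>r2 v \<alpha> = r2 v \<beta>"
 shows "\<alpha> = \<beta>"
proof -
 interpret B: comm_group "Br F" by (rule Br_comm_group[OF F])
 have triv: "Br_res F L h (\<alpha>*[Br F]inv\<^bsub>Br F\<^esub> \<beta>) = 1[Br L]" if L: "field L" "h:ring_hom F L" and e: "Br_res F L h \<alpha> = Br_res F L h \<beta>" for L :: "'l ring" and h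
 proof -
  interpret L: comm_group "Br L" by (rule Br_comm_group[OF L(1)])
  interpret group_hom "Br F" "Br L" "Br_res F L h" by (intro group_hom.intro B.group_axioms L.group_axioms group_hom_axioms.intro Br_res_hom[OF L])
  show ?thesis using \<alpha> \<beta> e by simp
 qed
 have "\<alpha>*[Br F]inv\<^bsub>Br F\<^esub> \<beta> = 1[Br F]" by (rule res_trivial) (use \<alpha> \<beta> triv[OF K1 a1 eq(1)] triv[OF K2 a2 eq(2)] in auto)
 then show ?thesis using B.inv_equality[of \<alpha> "inv\<^bsub>Br F\<^esub> \<beta>"] \<alpha> \<beta> by simp
qed

text \<open>The degree \<open>l\<close>, a multiple of all local indices, gives every local class a
  representative of dimension l^2. Classes agreeing over a factor of F_0 then have isomorphic
  representatives there, as gluing requires.\<close>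

lemma res_glue:
 assumes l: "l >= 1" and \<beta>: "!!v. v:V1==>\<beta> v:.(Br (K1 v))" "!!v. v:V1==>ind (K1 v) (\<beta> v) dvd l"
  and \<gamma>: "!!v. v:V2==>\<gamma> v:.(Br (K2 v))" "!!v. v:V2==>ind (K2 v) (\<gamma> v) dvd l"
  and eq: "!!w. w:V0==>t1 w (\<beta> (s1 w)) = t2 w (\<gamma> (s2 w))"
 obtains A :: "('a,nat=>'a) module" where "csa F A" "vdim F A = l * l"
  "!!v. v:V1==>r1 v (brauer_class F A) = \<beta> v" "!!v. v:V2==>r2 v (brauer_class F A) = \<gamma> v"
proof -
 have "ALL v:V1. EX A :: ('b,nat=>'b) module. csa (K1 v) A & brauer_class (K1 v) A = \<beta> v & vdim (K1 v) A = l * l"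
  using csa_of_degree[OF \<beta>(1) \<beta>(2) l] by metis
 from bchoice[OF this] obtain A1 :: "'i=>('b,nat=>'b) module" where A1: "ALL v:V1. csa (K1 v) (A1 v) & brauer_class (K1 v) (A1 v) = \<beta> v & vdim (K1 v) (A1 v) = l * l" by (rule exE)
 have "ALL v:V2. EX A :: ('c,nat=>'c) module. csa (K2 v) A & brauer_class (K2 v) A = \<gamma> v & vdim (K2 v) A = l * l"
  using csa_of_degree[OF \<gamma>(1) \<gamma>(2) l] by metis
 from bchoice[OF this] obtain A2 :: "'j=>('c,nat=>'c) module" where A2: "ALL v:V2. csa (K2 v) (A2 v) & brauer_class (K2 v) (A2 v) = \<gamma> v & vdim (K2 v) (A2 v) = l * l" by (rule exE)
 have iso: "algebra_iso (K0 w) (base_change (K1 (s1 w)) (K0 w) (b1 w) (A1 (s1 w))) (base_change (K2 (s2 w)) (K0 w) (b2 w) (A2 (s2 w)))" if w: "w:V0" for w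
 proof -
  have c1: "csa (K1 (s1 w)) (A1 (s1 w))" "brauer_class (K1 (s1 w)) (A1 (s1 w)) = \<beta> (s1 w)" "vdim (K1 (s1 w)) (A1 (s1 w)) = l * l" using A1 s1[OF w] by auto
  have c2: "csa (K2 (s2 w)) (A2 (s2 w))" "brauer_class (K2 (s2 w)) (A2 (s2 w)) = \<gamma> (s2 w)" "vdim (K2 (s2 w)) (A2 (s2 w)) = l * l" using A2 s2[OF w] by auto
  note B1 = csa_base_change[OF c1(1) K0[OF w] b1[OF w]] and B2 = csa_base_change[OF c2(1) K0[OF w] b2[OF w]]
  show ?thesis
  proof (rule csa_iso_of_equiv[OF B1 B2])
   show "brauer_equiv (K0 w) (base_change (K1 (s1 w)) (K0 w) (b1 w) (A1 (s1 w))) (base_change (K2 (s2 w)) (K0 w) (b2 w) (A2 (s2 w)))"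
    using eq[OF w] Br_res_class[OF c1(1) K0[OF w] b1[OF w]] Br_res_class[OF c2(1) K0[OF w] b2[OF w]] brauer_class_eq_iff[OF B1 B2] c1(2) c2(2) by simp
  qed (simp add: base_change_dim[OF csa_fd[OF c1(1)] K0[OF w] b1[OF w]] base_change_dim[OF csa_fd[OF c2(1)] K0[OF w] b2[OF w]] c1(3) c2(3))
 qed
 have l2: "1 <= l * l" using l by simp
 obtain A :: "('a,nat=>'a) module" where A: "csa F A" "vdim F A = l * l"
  "!!v. v:V1==>algebra_iso (K1 v) (base_change F (K1 v) (a1 v) A) (A1 v)" "!!v. v:V2==>algebra_iso (K2 v) (base_change F (K2 v) (a2 v) A) (A2 v)"
  by (rule glue[of "l * l" A1 A2,OF l2]) (use A1 A2 iso in auto)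
 show ?thesis
 proof (rule that[OF A(1,2)])
  show "r1 v (brauer_class F A) = \<beta> v" if v: "v:V1" for v
   unfolding Br_res_class[OF A(1) K1[OF v] a1[OF v]] using brauer_class_iso[OF csa_base_change[OF A(1) K1[OF v] a1[OF v]] _ A(3)[OF v]] A1 v by simp
  show "r2 v (brauer_class F A) = \<gamma> v" if v: "v:V2" for v
   unfolding Br_res_class[OF A(1) K2[OF v] a2[OF v]] using brauer_class_iso[OF csa_base_change[OF A(1) K2[OF v] a2[OF v]] _ A(4)[OF v]] A2 v by simp
 qed
qed

lemma res_comm:
 assumes \<alpha>: "\<alpha>:.(Br F)" and w: "w:V0" shows "t1 w (r1 (s1 w) \<alpha>) = t2 w (r2 (s2 w) \<alpha>)"
proof -
 obtain A :: "('a,nat=>'a) module" where A: "csa F A" "\<alpha> = brauer_class F A" by (rule Br_carrierE[OF \<alpha>])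
 note a1w = a1[OF s1[OF w]] and a2w = a2[OF s2[OF w]] and k = K1[OF s1[OF w]] K2[OF s2[OF w]] K0[OF w]
 have h: "(%x. b1 w (a1 (s1 w) x)):ring_hom F (K0 w)"
  by (rule ring_hom_memI) (use ring_hom_closed[OF a1w] ring_hom_mult[OF a1w] ring_hom_add[OF a1w] ring_hom_one[OF a1w]
   ring_hom_closed[OF b1[OF w]] ring_hom_mult[OF b1[OF w]] ring_hom_add[OF b1[OF w]] ring_hom_one[OF b1[OF w]] in auto)
 note c1 = csa_base_change[OF A(1) k(1) a1w] and c2 = csa_base_change[OF A(1) k(2) a2w]
 have "t1 w (r1 (s1 w) \<alpha>) = brauer_class (K0 w) (base_change F (K0 w) (%x. b1 w (a1 (s1 w) x)) A)"
  unfolding A(2) Br_res_class[OF A(1) k(1) a1w] Br_res_class[OF c1 k(3) b1[OF w]]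
  by (rule brauer_class_iso[OF csa_base_change[OF c1 k(3) b1[OF w]] csa_base_change[OF A(1) k(3) h] base_change_trans[OF csa_fd[OF A(1)] k(1) a1w k(3) b1[OF w] h]]) simp
 also have "... = t2 w (r2 (s2 w) \<alpha>)"
  unfolding A(2) Br_res_class[OF A(1) k(2) a2w] Br_res_class[OF c2 k(3) b2[OF w]]
  by (rule brauer_class_iso[symmetric,OF csa_base_change[OF c2 k(3) b2[OF w]] csa_base_change[OF A(1) k(3) h] base_change_trans[OF csa_fd[OF A(1)] k(2) a2w k(3) b2[OF w] h]]) (rule comm[OF w])
 finally show ?thesis .
qed

lemma ind_pos: "\<alpha>:.(Br L)==>ind L \<alpha> >= 1"
 by (erule Br_carrierE,erule wedderburn_ind) simp

text \<open>An algebra of degree ind(\<alpha>) in the class keeps its dimension over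
  \<open>L\<close>, where it consists of r by r matrices over a division algebra of degree the
  restricted index.\<close>

lemma ind_res_dvd:
 fixes L :: "'l ring"
 assumes \<alpha>: "\<alpha>:.(Br F)" and L: "field L" "h:ring_hom F L" shows "ind L (Br_res F L h \<alpha>) dvd ind F \<alpha>"
proof -
 obtain A :: "('a,nat=>'a) module" where A: "csa F A" "brauer_class F A = \<alpha>" "vdim F A = ind F \<alpha> * ind F \<alpha>"
  by (rule csa_of_degree[OF \<alpha> dvd_refl ind_pos[OF \<alpha>]])
 note B = csa_base_change[OF A(1) L]
 let ?i = "ind L (brauer_class L (base_change F L h A))"
 obtain r where "vdim L (base_change F L h A) = (r * ?i) * (r * ?i)" by (rule wedderburn_ind[OF B])
 then have "(ind F \<alpha>)^2 = (r * ?i)^2" unfolding base_change_dim[OF csa_fd[OF A(1)] L] A(3) by (simp add: power2_eq_square)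
 then have "ind F \<alpha> = r * ?i" by (simp add: power2_eq_iff_nonneg)
 then show ?thesis using Br_res_class[OF A(1) L] A(2) by simp
qed

lemma ind_lcm:
 assumes fin: "finite V1" "finite V2" and \<alpha>: "\<alpha>:.(Br F)"
 shows "ind F \<alpha> = Lcm ((%v. ind (K1 v) (r1 v \<alpha>)) ` V1 \<union> (%v. ind (K2 v) (r2 v \<alpha>)) ` V2)" (is "_ = Lcm ?S")
proof (rule dvd_antisym)
 show "Lcm ?S dvd ind F \<alpha>" by (rule Lcm_least) (use ind_res_dvd[OF \<alpha> K1 a1] ind_res_dvd[OF \<alpha> K2 a2] in auto)
 have c: "v:V1==>r1 v \<alpha>:.(Br (K1 v))" "u:V2==>r2 u \<alpha>:.(Br (K2 u))" for v u
  using Br_res_closed[OF K1 a1 \<alpha>] Br_res_closed[OF K2 a2 \<alpha>] by auto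
 have 0: "0 \<notin> ?S" using ind_pos[OF c(1)] ind_pos[OF c(2)] by fastforce
 have "finite ?S" using fin by simp
 \<comment> \<open>The value of \<open>Lcm\<close> is 0 on an infinite set and on a set containing
   0. Finitely many factors and positive indices make it a genuine degree.\<close>
 then have "Lcm ?S ~= 0" using Lcm_0_iff[of ?S] 0 by blast
 then have l: "1 <= Lcm ?S" by linarith
 obtain A :: "('a,nat=>'a) module" where A: "csa F A" "vdim F A = Lcm ?S * Lcm ?S"
  "!!v. v:V1==>r1 v (brauer_class F A) = r1 v \<alpha>" "!!v. v:V2==>r2 v (brauer_class F A) = r2 v \<alpha>"
  by (rule res_glue[of "Lcm ?S" "%v. r1 v \<alpha>" "%v. r2 v \<alpha>", OF l]) (use c res_comm[OF \<alpha>] in "auto intro!: dvd_Lcm")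
 \<comment> \<open>The glued algebra restricts to \<alpha> at every factor, so injectivity puts it
   in the class \<alpha>; its degree, the least common multiple, is then a multiple of the index of
   \<alpha>.\<close>
 have eq: "brauer_class F A = \<alpha>" by (rule res_inj[OF brauer_class_carrier[OF A(1)] \<alpha> A(3,4)])
 obtain r where "vdim F A = (r * ind F \<alpha>) * (r * ind F \<alpha>)" by (rule wedderburn_ind[OF A(1)]) (simp add: eq)
 then have "(Lcm ?S)^2 = (r * ind F \<alpha>)^2" unfolding A(2) by (simp add: power2_eq_square)
 then have "Lcm ?S = r * ind F \<alpha>" by (simp add: power2_eq_iff_nonneg)
 then show "ind F \<alpha> dvd Lcm ?S" by simp
qed

end

section \<open>The exact sequence\<close>

lemma (in patching) exact:
 assumes fin: "finite V1" "finite V2"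
 shows "left_exact_seq (Br F) (Br_prod V1 K1 \<times>\<times> Br_prod V2 K2) (Br_prod V0 K0) (%\<alpha>. (\<lambda>v\<in>V1. r1 v \<alpha>,\<lambda>v\<in>V2. r2 v \<alpha>))
  (%(\<beta>,\<gamma>). (\<lambda>w\<in>V0. t1 w (\<beta> (s1 w)))*[Br_prod V0 K0]inv\<^bsub>Br_prod V0 K0\<^esub> (\<lambda>w\<in>V0. t2 w (\<gamma> (s2 w))))"
  (is "left_exact_seq ?B ?G ?H ?f ?g")
proof -
 interpret B: comm_group ?B by (rule Br_comm_group[OF F])
 have gr: "v:V1==>group (Br (K1 v))" "u:V2==>group (Br (K2 u))" "w:V0==>group (Br (K0 w))" for v u w
  using Br_comm_group[OF K1] Br_comm_group[OF K2] Br_comm_group[OF K0] by (auto simp: comm_group_def)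
 have G: "group ?G" unfolding Br_prod_def by (intro DirProd_group product_group gr)
 have H: "group ?H" unfolding Br_prod_def by (intro product_group gr)
 have f: "?f:hom ?B ?G"
 proof (rule homI)
  fix x assume "x:.?B"
  then show "?f x:.?G" using Br_res_closed[OF K1 a1] Br_res_closed[OF K2 a2] by (auto simp: Br_prod_def)
  fix y assume "y:.?B"
  then show "?f (x*[?B]y) = ?f x*[?G]?f y" using \<open>x:.?B\<close> hom_mult[OF Br_res_hom[OF K1 a1]] hom_mult[OF Br_res_hom[OF K2 a2]]
   by (auto simp: Br_prod_def intro!: restrict_ext)
 qed
 have t: "(\<lambda>w\<in>V0. t1 w (\<beta> (s1 w))):(\<Pi>\<^sub>E w\<in>V0. carrier (Br (K0 w)))" "(\<lambda>w\<in>V0. t2 w (\<gamma> (s2 w))):(\<Pi>\<^sub>E w\<in>V0. carrier (Br (K0 w)))"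
  if "(\<beta>,\<gamma>):.?G" for \<beta> \<gamma>
  using that s1 s2 Br_res_closed[OF K0 b1] Br_res_closed[OF K0 b2] by (auto simp: Br_prod_def PiE_iff)
 have g: "?g (\<beta>,\<gamma>) = (\<lambda>w\<in>V0. t1 w (\<beta> (s1 w))*[Br (K0 w)]inv\<^bsub>Br (K0 w)\<^esub> t2 w (\<gamma> (s2 w)))" if "(\<beta>,\<gamma>):.?G" for \<beta> \<gamma>
  unfolding Br_prod_def using inv_product_group[OF t(2)[OF that] gr(3)] by (auto intro!: restrict_ext)
 have tc: "t1 w (\<beta> (s1 w)):.(Br (K0 w))" "t2 w (\<gamma> (s2 w)):.(Br (K0 w))" "\<beta> (s1 w):.(Br (K1 (s1 w)))" "\<gamma> (s2 w):.(Br (K2 (s2 w)))"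
  if "(\<beta>,\<gamma>):.?G" "w:V0" for \<beta> \<gamma> w
  using t[OF that(1)] that s1[OF that(2)] s2[OF that(2)] by (auto simp: PiE_iff Br_prod_def)
 have gh: "?g:hom ?G ?H"
 proof (rule homI)
  fix x assume x: "x:.?G"
  obtain \<beta> \<gamma> where bg: "x = (\<beta>,\<gamma>)" by (cases x)
  interpret H: group ?H by (rule H)
  note t' = t[OF x[unfolded bg],folded carrier_product_group,folded Br_prod_def]
  show "?g x:.?H" unfolding bg using H.m_closed[OF t'(1) H.inv_closed[OF t'(2)]] by simp
  fix y assume y: "y:.?G"
  obtain \<beta>' \<gamma>' where bg': "y = (\<beta>',\<gamma>')" by (cases y)
  note xc = x[unfolded bg] and yc = y[unfolded bg']
  interpret G: group ?G by (rule G)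
  have xy: "x*[?G]y = (\<lambda>v\<in>V1. \<beta> v*[Br (K1 v)]\<beta>' v,\<lambda>v\<in>V2. \<gamma> v*[Br (K2 v)]\<gamma>' v)" unfolding bg bg' by (simp add: Br_prod_def)
  have xyc: "(\<lambda>v\<in>V1. \<beta> v*[Br (K1 v)]\<beta>' v,\<lambda>v\<in>V2. \<gamma> v*[Br (K2 v)]\<gamma>' v):.?G" using G.m_closed[OF x y] xy by simp
  show "?g (x*[?G]y) = ?g x*[?H]?g y"
   unfolding xy g[OF xyc] unfolding bg bg' g[OF xc] g[OF yc] unfolding Br_prod_def mult_product_group
  proof (rule restrict_ext)
   fix w assume w: "w:V0"
   interpret C: comm_group "Br (K0 w)" by (rule Br_comm_group[OF K0[OF w]])
   note c = tc[OF xc w] tc[OF yc w]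
   have h: "t1 w (\<beta> (s1 w)*[Br (K1 (s1 w))]\<beta>' (s1 w)) = t1 w (\<beta> (s1 w))*[Br (K0 w)]t1 w (\<beta>' (s1 w))"
    "t2 w (\<gamma> (s2 w)*[Br (K2 (s2 w))]\<gamma>' (s2 w)) = t2 w (\<gamma> (s2 w))*[Br (K0 w)]t2 w (\<gamma>' (s2 w))"
    using hom_mult[OF Br_res_hom[OF K0[OF w] b1[OF w]] c(3,7)] hom_mult[OF Br_res_hom[OF K0[OF w] b2[OF w]] c(4,8)] by auto
   show "t1 w ((\<lambda>v\<in>V1. \<beta> v*[Br (K1 v)]\<beta>' v) (s1 w))*[Br (K0 w)]inv\<^bsub>Br (K0 w)\<^esub> t2 w ((\<lambda>v\<in>V2. \<gamma> v*[Br (K2 v)]\<gamma>' v) (s2 w)) =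
    (\<lambda>w\<in>V0. t1 w (\<beta> (s1 w))*[Br (K0 w)]inv\<^bsub>Br (K0 w)\<^esub> t2 w (\<gamma> (s2 w))) w*[Br (K0 w)](\<lambda>w\<in>V0. t1 w (\<beta>' (s1 w))*[Br (K0 w)]inv\<^bsub>Br (K0 w)\<^esub> t2 w (\<gamma>' (s2 w))) w"
    using w s1[OF w] s2[OF w] c by (simp add: h C.inv_mult C.m_ac)
  qed
 qed
 have ker1: "kernel ?B ?G ?f = {1[?B]}"
 proof
  show "{1[?B]} <= kernel ?B ?G ?f" using hom_one[OF f B.group_axioms G] by (auto simp: kernel_def)
  show "kernel ?B ?G ?f <= {1[?B]}"
  proof
   fix x assume "x:kernel ?B ?G ?f"
   then have x: "x:.?B" and e: "(\<lambda>v\<in>V1. r1 v x) = (\<lambda>v\<in>V1. 1[Br (K1 v)])" "(\<lambda>v\<in>V2. r2 v x) = (\<lambda>v\<in>V2. 1[Br (K2 v)])" by (auto simp: kernel_def Br_prod_def)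
   have "x = 1[?B]"
   proof (rule res_trivial[OF x])
    show "r1 v x = 1[Br (K1 v)]" if "v:V1" for v using fun_cong[OF e(1),of v] that by simp
    show "r2 v x = 1[Br (K2 v)]" if "v:V2" for v using fun_cong[OF e(2),of v] that by simp
   qed
   then show "x:{1[?B]}" by simp
  qed
 qed
 have ker2: "kernel ?G ?H ?g = ?f ` carrier ?B"
 proof
  show "?f ` carrier ?B <= kernel ?G ?H ?g"
  proof
   fix y assume "y:?f ` carrier ?B"
   then obtain x where x: "x:.?B" "y = ?f x" by blast
   have y: "y:.?G" using x hom_in_carrier[OF f x(1)] by simp
   have "?g y = 1[?H]" unfolding x(2) g[OF y[unfolded x(2)]] unfolding Br_prod_def one_product_group
   proof (rule restrict_ext)
    fix w assume w: "w:V0"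
    interpret C: comm_group "Br (K0 w)" by (rule Br_comm_group[OF K0[OF w]])
    show "t1 w ((\<lambda>v\<in>V1. r1 v x) (s1 w))*[Br (K0 w)]inv\<^bsub>Br (K0 w)\<^esub> t2 w ((\<lambda>v\<in>V2. r2 v x) (s2 w)) = 1[Br (K0 w)]"
     using s1[OF w] s2[OF w] res_comm[OF x(1) w] C.r_inv[OF tc(2)[OF y[unfolded x(2)] w]] by simp
   qed
   then show "y:kernel ?G ?H ?g" using y by (simp add: kernel_def)
  qed
  show "kernel ?G ?H ?g <= ?f ` carrier ?B"
  proof
   fix y assume "y:kernel ?G ?H ?g"
   then have y: "y:.?G" "?g y = 1[?H]" by (auto simp: kernel_def)
   obtain \<beta> \<gamma> where bg: "y = (\<beta>,\<gamma>)" by (cases y)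
   note yc = y(1)[unfolded bg]
   have c: "\<beta>:(\<Pi>\<^sub>E v\<in>V1. carrier (Br (K1 v)))" "\<gamma>:(\<Pi>\<^sub>E v\<in>V2. carrier (Br (K2 v)))" using yc by (auto simp: Br_prod_def)
   have eq: "t1 w (\<beta> (s1 w)) = t2 w (\<gamma> (s2 w))" if w: "w:V0" for w
   proof -
    interpret C: comm_group "Br (K0 w)" by (rule Br_comm_group[OF K0[OF w]])
    have "t1 w (\<beta> (s1 w))*[Br (K0 w)]inv\<^bsub>Br (K0 w)\<^esub> t2 w (\<gamma> (s2 w)) = 1[Br (K0 w)]"
     using fun_cong[OF y(2)[unfolded bg g[OF yc]],of w] w by (simp add: Br_prod_def)
    then show ?thesis using C.inv_equality[of "t1 w (\<beta> (s1 w))" "inv\<^bsub>Br (K0 w)\<^esub> t2 w (\<gamma> (s2 w))"] tc[OF yc w] by simp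
   qed
   \<comment> \<open>Their least common multiple provides a common degree for all local
     representatives.\<close>
   let ?S = "(%v. ind (K1 v) (\<beta> v)) ` V1 \<union> (%v. ind (K2 v) (\<gamma> v)) ` V2"
   have "v:V1==>ind (K1 v) (\<beta> v) >= 1" "u:V2==>ind (K2 u) (\<gamma> u) >= 1" for v u
    using ind_pos[OF PiE_mem[OF c(1)]] ind_pos[OF PiE_mem[OF c(2)]] by auto
   then have 0: "0 \<notin> ?S" by fastforce
   have "finite ?S" using fin by simp
   then have "Lcm ?S ~= 0" using Lcm_0_iff[of ?S] 0 by blast
   then have l: "1 <= Lcm ?S" by linarith
   obtain A :: "('a,nat=>'a) module" where A: "csa F A" "vdim F A = Lcm ?S * Lcm ?S"
    "!!v. v:V1==>r1 v (brauer_class F A) = \<beta> v" "!!v. v:V2==>r2 v (brauer_class F A) = \<gamma> v"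
    by (rule res_glue[of "Lcm ?S" \<beta> \<gamma>,OF l]) (use c eq in "auto simp: PiE_iff intro!: dvd_Lcm")
   have "(\<lambda>v\<in>V1. r1 v (brauer_class F A)) = \<beta>" "(\<lambda>v\<in>V2. r2 v (brauer_class F A)) = \<gamma>"
    using A(3,4) c by (auto simp: fun_eq_iff PiE_iff extensional_def)
   then have "y = ?f (brauer_class F A)" using bg by simp
   then show "y:?f ` carrier ?B" using brauer_class_carrier[OF A(1)] by blast
  qed
 qed
 show ?thesis unfolding left_exact_seq_def
  by (intro conjI ker1 ker2 group_hom.intro group_hom_axioms.intro B.group_axioms G H f gh)
qed

section \<open>Finite products of fields\<close>

lemma product_ring_sel:
 "carrier (product_ring V K) = (\<Pi>\<^sub>E v\<in>V. carrier (K v))" "x*[product_ring V K]y = (\<lambda>v\<in>V. x v*[K v]y v)"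
 "1[product_ring V K] = (\<lambda>v\<in>V. 1[K v])" "0[product_ring V K] = (\<lambda>v\<in>V. 0[K v])" "x+[product_ring V K]y = (\<lambda>v\<in>V. x v+[K v]y v)"
 by (simp_all add: product_ring_def)

lemma product_proj: "v:V==>(%x. x v):ring_hom (product_ring V K) (K v)"
 by (rule ring_hom_memI) (auto simp: product_ring_sel)

lemma factor_elt_mem:
 assumes K: "!!v. v:V==>field (K v)" and v: "v:V" and x: "x:.(K v)" shows "factor_elt V K v x:.(product_ring V K)"
proof -
 have "0[K u]:.(K u)" if "u:V" for u
 proof -
  interpret field "K u" by (rule K[OF that])
  show ?thesis by simp
 qed
 then show ?thesis using v x by (auto simp: factor_elt_def product_ring_sel)
qed

text \<open>The idempotents of the factors sum to the unit and each maps to 0 or 1 in the field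
  \<open>L\<close>. They cannot all map to 0, and two of them cannot both map to 1 because their
  product is 0. The one that maps to 1 selects the factor, and multiplying by it shows that
  \<open>h\<close> sees only that coordinate.\<close>

lemma product_hom:
 assumes fin: "finite V" and K: "!!v. v:V==>field (K v)" and R: "ring (product_ring V K)" and L: "field L" and h: "h:ring_hom (product_ring V K) L"
 defines "s \<equiv> THE v. v:V & h (factor_elt V K v 1[K v]) = 1[L]"
 shows "s:V" "(%x. h (factor_elt V K s x)):ring_hom (K s) L" "!!x. x:.(product_ring V K)==>h x = h (factor_elt V K s (x s))"
proof -
 let ?R = "product_ring V K"
 interpret R: ring ?R by fact
 interpret L: field L by fact
 have ring: "ring (K v)" if "v:V" for v using K[OF that] by (simp add: field_def domain_def cring_def)
 have o: "1[K v]:.(K v)" if v: "v:V" for v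
 proof -
  interpret ring "K v" by (rule ring[OF v])
  show ?thesis by simp
 qed
 let ?e = "%v. factor_elt V K v 1[K v]"
 have em: "factor_elt V K v x:.?R" if "v:V" "x:.(K v)" for v x by (rule factor_elt_mem) (use K that in auto)
 have ec: "?e v:.?R" if "v:V" for v by (rule em[OF that o[OF that]])
 have xe: "x*[?R]?e v = factor_elt V K v (x v)" if x: "x:.?R" and v: "v:V" for x v
  unfolding product_ring_sel factor_elt_def
 proof (rule restrict_ext)
  fix u assume u: "u:V"
  interpret ring "K u" by (rule ring[OF u])
  have "x u:.(K u)" using x u by (auto simp: product_ring_sel)
  note xu = r_one[OF this] r_null[OF this]
  show "x u*[K u](\<lambda>u\<in>V. if u = v then 1[K v] else 0[K u]) u = (if u = v then x v else 0[K u])" using u xu by auto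
 qed
 have id: "h (?e v) = 0[L] | h (?e v) = 1[L]" if v: "v:V" for v
 proof -
  have "?e v*[?R]?e v = ?e v" using xe[OF ec[OF v] v] v by (simp add: factor_elt_def)
  then have "h (?e v)*[L]h (?e v) = h (?e v)*[L]1[L]" using ring_hom_mult[OF h ec[OF v] ec[OF v]] ring_hom_closed[OF h ec[OF v]] by simp
  then show ?thesis using L.m_lcancel[of "h (?e v)" "h (?e v)" "1[L]"] ring_hom_closed[OF h ec[OF v]] by auto
 qed
 have h0: "h 0[?R] = 0[L]" by (rule ring_hom_zero_ring[OF R L.ring_axioms h])
 have "EX v:V. h (?e v) = 1[L]"
 proof (rule ccontr)
  assume "~ ?thesis"
  then have z: "!!v. v:V==>h (?e v) = 0[L]" using id by blast
  have sum: "(\<Oplus>[?R]v:V. ?e v) = 1[?R]"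
  proof (rule PiE_ext[of _ V "%v. carrier (K v)"])
   show "(\<Oplus>[?R]v:V. ?e v):(\<Pi>\<^sub>E v\<in>V. carrier (K v))" using R.finsum_closed[of ?e V] ec by (simp add: product_ring_sel Pi_def)
   show "1[?R]:(\<Pi>\<^sub>E v\<in>V. carrier (K v))" using R.one_closed by (simp add: product_ring_sel(1))
   fix u assume u: "u:V"
   interpret U: ring "K u" by (rule ring[OF u])
   have "(\<Oplus>[?R]v:V. ?e v) u = (\<Oplus>[K u]v:V. ?e v u)" by (rule ring_hom_finsum[OF R ring[OF u] product_proj[OF u] ec])
   also have "... = (\<Oplus>[K u]v:V. if v = u then 1[K u] else 0[K u])" by (rule U.fcong) (use u in "auto simp: factor_elt_def")
   also have "... = 1[K u]" by (rule U.finsum_delta) (use fin u in auto)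
   finally show "(\<Oplus>[?R]v:V. ?e v) u = 1[?R] u" using u by (simp add: product_ring_sel)
  qed
  have "h (\<Oplus>[?R]v:V. ?e v) = (\<Oplus>[L]v:V. h (?e v))" by (rule ring_hom_finsum[OF R L.ring_axioms h ec])
  also have "... = 0[L]" by (rule L.finsum_all_zero) (use z in auto)
  finally show False using sum ring_hom_one[OF h] by simp
 qed
 then obtain v where v: "v:V" "h (?e v) = 1[L]" by blast
 have "s = v" unfolding s_def
 proof (rule the_equality)
  fix u assume u: "u:V & h (?e u) = 1[L]"
  show "u = v"
  proof (rule ccontr)
   assume ne: "u ~= v"
   have "?e u*[?R]?e v = 0[?R]" unfolding xe[OF ec v(1),of u,OF conjunct1[OF u]] unfolding factor_elt_def product_ring_sel
    by (rule restrict_ext) (use ne v in auto)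
   then have "1[L]*[L]1[L] = 0[L]" using ring_hom_mult[OF h ec[OF conjunct1[OF u]] ec[OF v(1)]] u v h0 by simp
   then show False by simp
  qed
 qed (use v in auto)
 then have s: "s:V" "h (?e s) = 1[L]" using v by auto
 interpret S: ring "K s" by (rule ring[OF s(1)])
 show "s:V" by (rule s)
 show "h x = h (factor_elt V K s (x s))" if x: "x:.?R" for x
  using ring_hom_mult[OF h x ec[OF s(1)]] xe[OF x s(1)] s(2) ring_hom_closed[OF h x] by simp
 show "(%x. h (factor_elt V K s x)):ring_hom (K s) L"
 proof (rule ring_hom_memI)
  show "h (factor_elt V K s 1[K s]) = 1[L]" by (rule s)
  fix x assume x: "x:.(K s)"
  note fx = em[OF s(1) x]
  show "h (factor_elt V K s x):.L" by (rule ring_hom_closed[OF h fx])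
  fix y assume y: "y:.(K s)"
  note fy = em[OF s(1) y]
  have "factor_elt V K s (x*[K s]y) = factor_elt V K s x*[?R]factor_elt V K s y & factor_elt V K s (x+[K s]y) = factor_elt V K s x+[?R]factor_elt V K s y"
   unfolding product_ring_sel factor_elt_def
  proof (intro conjI restrict_ext)
   fix u assume u: "u:V"
   interpret ring "K u" by (rule ring[OF u])
   show "(if u = s then x*[K s]y else 0[K u]) = (\<lambda>u\<in>V. if u = s then x else 0[K u]) u*[K u](\<lambda>u\<in>V. if u = s then y else 0[K u]) u"
    "(if u = s then x+[K s]y else 0[K u]) = (\<lambda>u\<in>V. if u = s then x else 0[K u]) u+[K u](\<lambda>u\<in>V. if u = s then y else 0[K u]) u" using u by auto
  qed
  then show "h (factor_elt V K s (x*[K s]y)) = h (factor_elt V K s x)*[L]h (factor_elt V K s y)"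
   "h (factor_elt V K s (x+[K s]y)) = h (factor_elt V K s x)+[L]h (factor_elt V K s y)"
   using ring_hom_mult[OF h fx fy] ring_hom_add[OF h fx fy] by simp_all
 qed
qed

text \<open>The inverses in the single factors assemble to an inverse over the product, since
  equality over the product ring is tested in each factor.\<close>

lemma GL_product:
 assumes K: "!!v. v:V==>field (K v)" and R: "ring (product_ring V K)" and g: "!!v. v:V==>g v:GL n (K v)"
 shows "(\<lambda>p\<in>sq n. \<lambda>v\<in>V. g v p):GL n (product_ring V K)"
proof -
 let ?R = "product_ring V K"
 interpret R: ring ?R by fact
 interpret M: ring "MR ?R n" by (rule R.mat_ring_ring)
 have ring: "ring (K v)" if "v:V" for v using K[OF that] by (simp add: field_def domain_def cring_def)
 define m where "m = (%g. \<lambda>p\<in>sq n. \<lambda>v\<in>V. g v p :: 'b)"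
 have mc: "m g:.(MR ?R n)" and mp: "!!v. v:V==>mape n (%x. x v) (m g) = g v" if g: "!!v. v:V==>g v:.(MR (K v) n)" for g
 proof -
  show "m g:.(MR ?R n)" unfolding m_def mat_ring_sel(1) product_ring_sel(1)
   by (intro restrict_PiE_iff[THEN iffD2] ballI) (rule mat_entry'[OF g])
  fix v assume v: "v:V"
  have "g v:extensional (sq n)" using g[OF v] by (auto simp: mat_ring_sel PiE_iff)
  then show "mape n (%x. x v) (m g) = g v" unfolding map_entries_def m_def by (rule extensionalityI[OF restrict_extensional]) (use v in auto)
 qed
 have "ALL v:V. EX k. k:.(MR (K v) n) & k*[MR (K v) n]g v = 1[MR (K v) n] & g v*[MR (K v) n]k = 1[MR (K v) n]"
  using g unfolding GL_def Units_def by blast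
 from bchoice[OF this] obtain k where k: "ALL v:V. k v:.(MR (K v) n) & k v*[MR (K v) n]g v = 1[MR (K v) n] & g v*[MR (K v) n]k v = 1[MR (K v) n]" by (rule exE)
 have gc: "!!v. v:V==>g v:.(MR (K v) n)" using g by (auto simp: GL_def Units_def)
 have kc: "!!v. v:V==>k v:.(MR (K v) n)" using k by blast
 have one: "m x*[MR ?R n]m y = 1[MR ?R n]"
  if x: "!!v. v:V==>x v:.(MR (K v) n)" and y: "!!v. v:V==>y v:.(MR (K v) n)"
   and xy: "!!v. v:V==>x v*[MR (K v) n]y v = 1[MR (K v) n]" for x y
 proof -
  have mxy: "m x:.(MR ?R n)" "m y:.(MR ?R n)" by (rule mc,erule x) (rule mc,erule y)
  have pxy: "mape n (%x. x v) (m x) = x v" "mape n (%x. x v) (m y) = y v" if v: "v:V" for v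
   by (rule mp[OF _ v],erule x) (rule mp[OF _ v],erule y)
  show ?thesis
 proof (rule mat_eqI[OF M.m_closed[OF mxy] M.one_closed])
  fix i j assume ij: "i < n" "j < n"
  have pc: "(m x*[MR ?R n]m y) (i,j):.?R" "1[MR ?R n] (i,j):.?R"
   using mat_entry[OF M.m_closed[OF mxy] ij] mat_entry[OF M.one_closed ij] by auto
  show "(m x*[MR ?R n]m y) (i,j) = 1[MR ?R n] (i,j)"
  proof (rule PiE_ext[OF pc[unfolded product_ring_sel(1)]])
   fix v assume v: "v:V"
   have "mape n (%x. x v) (m x*[MR ?R n]m y) = mape n (%x. x v) 1[MR ?R n]"
    unfolding map_entries_mult[OF R ring[OF v] product_proj[OF v] mxy] map_entries_one[OF R ring[OF v] product_proj[OF v]] pxy[OF v] by (rule xy[OF v])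
   from fun_cong[OF this,of "(i,j)"] show "(m x*[MR ?R n]m y) (i,j) v = 1[MR ?R n] (i,j) v" by (simp add: map_entries_entry[OF ij])
  qed
 qed
 qed
 have "m g:Units (MR ?R n)" unfolding Units_def
  using mc[OF gc] mc[OF kc] one[OF gc kc] one[OF kc gc] k by (intro CollectI conjI bexI[of _ "m k"]) auto
 then show ?thesis by (simp add: GL_def m_def)
qed

text \<open>Places an arbitrary ring element, invertible or not, in an invertible matrix; the
  inverse carries its negative. A statement about an intersection of groups GL_2 thereby becomes one
  about ring elements.\<close>

lemma (in ring) elementary_GL:
 assumes x: "x:.R" shows "(\<lambda>p\<in>sq 2. if p = (0,1) then x else 1[MR R 2] p):GL 2 R"
proof -
 define E where "E = (%x. \<lambda>p\<in>sq 2. if p = (0,1) then x else 1[MR R 2] p)"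
 have Ec: "E x:.(MR R 2)" if "x:.R" for x
  unfolding E_def mat_ring_sel(1) by (intro restrict_PiE_iff[THEN iffD2] ballI) (use that mat_entry'[OF mat_one_closed] in auto)
 have s2: "{..<2::nat} = {0,1}" by auto
 have EE: "E x*[MR R 2]E y = 1[MR R 2]" if xy: "x:.R" "y:.R" "x \<oplus> y = \<zero>" for x y
 proof (rule mat_eqI[OF mat_mult_closed[OF Ec[OF xy(1)] Ec[OF xy(2)]] mat_one_closed])
  fix i j :: nat assume ij: "i < 2" "j < 2"
  then have "i = 0 | i = 1" "j = 0 | j = 1" by auto
  then show "(E x*[MR R 2]E y) (i,j) = 1[MR R 2] (i,j)"
   unfolding mat_mult_entry[OF ij] s2 using xy by (auto simp: E_def mat_ring_sel(3) s2 a_comm)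
 qed
 have "E x:Units (MR R 2)" unfolding Units_def
  using Ec[OF x] Ec[of "\<ominus> x"] EE[of x "\<ominus> x"] EE[of "\<ominus> x" x] x by (intro CollectI conjI bexI[of _ "E (\<ominus> x)"]) (auto simp: r_neg l_neg)
 then show ?thesis by (simp add: GL_def E_def)
qed

theorem theorem4p15:
  fixes F :: "'a ring"
    and V1 :: "'i set" and K1 :: "'i \<Rightarrow> 'b ring"
    and V2 :: "'j set" and K2 :: "'j \<Rightarrow> 'c ring"
    and V0 :: "'k set" and K0 :: "'k \<Rightarrow> 'd ring"
    and i1 :: "'a \<Rightarrow> 'i \<Rightarrow> 'b" and i2 :: "'a \<Rightarrow> 'j \<Rightarrow> 'c"
    and j1 :: "('i \<Rightarrow> 'b) \<Rightarrow> 'k \<Rightarrow> 'd" and j2 :: "('j \<Rightarrow> 'c) \<Rightarrow> 'k \<Rightarrow> 'd"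
  assumes "field F"
    and "finite V1" and "\<And>v. v \<in> V1 \<Longrightarrow> field (K1 v)"
    and "finite V2" and "\<And>v. v \<in> V2 \<Longrightarrow> field (K2 v)"
    and "finite V0" and "\<And>v. v \<in> V0 \<Longrightarrow> field (K0 v)"
    and "injective_diamond F (product_ring V1 K1) (product_ring V2 K2) (product_ring V0 K0)
           i1 i2 j1 j2"
    and "patching_holds F (product_ring V1 K1) (product_ring V2 K2) (product_ring V0 K0)
           i1 i2 j1 j2"
  shows "left_exact_seq
           (Br F) (Br_prod V1 K1 \<times>\<times> Br_prod V2 K2) (Br_prod V0 K0)
           (\<lambda>\<alpha>. (Br_res_to_prod F V1 K1 i1 \<alpha>, Br_res_to_prod F V2 K2 i2 \<alpha>))
           (\<lambda>(\<beta>, \<gamma>). Br_res_prod V1 K1 V0 K0 j1 \<beta>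
              \<otimes>\<^bsub>Br_prod V0 K0\<^esub> inv\<^bsub>Br_prod V0 K0\<^esub> Br_res_prod V2 K2 V0 K0 j2 \<gamma>) \<and>
         (\<forall>\<alpha>\<in>carrier (Br F).
           ind F \<alpha> = Lcm ((\<lambda>v. ind (K1 v) (Br_res F (K1 v) (\<lambda>x. i1 x v) \<alpha>)) ` V1 \<union>
                          (\<lambda>v. ind (K2 v) (Br_res F (K2 v) (\<lambda>x. i2 x v) \<alpha>)) ` V2))"
proof -
 let ?R1 = "product_ring V1 K1" and ?R2 = "product_ring V2 K2" and ?R0 = "product_ring V0 K0"
 note dia = assms(8)[unfolded injective_diamond_def injective_ring_hom_def] and pat = assms(9)[unfolded patching_holds_def,rule_format]
 have R: "ring ?R1" "ring ?R2" "ring ?R0" and i1: "i1:ring_hom F ?R1" "inj_on i1 (carrier F)" and i2: "i2:ring_hom F ?R2" "inj_on i2 (carrier F)"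
  and j1: "j1:ring_hom ?R1 ?R0" "inj_on j1 (carrier ?R1)" and j2: "j2:ring_hom ?R2 ?R0" "inj_on j2 (carrier ?R2)"
  and cm: "!!x. x:.F==>j1 (i1 x) = j2 (i2 x)" using dia by blast+
 interpret F: field F by fact
 interpret R1: ring ?R1 by fact
 interpret R2: ring ?R2 by fact
 interpret R0: ring ?R0 by fact
 define s1 where "s1 = factor_below V1 K1 K0 j1"
 define s2 where "s2 = factor_below V2 K2 K0 j2"
 define b1 where "b1 = (%w x. j1 (factor_elt V1 K1 (s1 w) x) w)"
 define b2 where "b2 = (%w x. j2 (factor_elt V2 K2 (s2 w) x) w)"
 have jw: "(%x. j1 x w):ring_hom ?R1 (K0 w)" "(%x. j2 x w):ring_hom ?R2 (K0 w)" if "w:V0" for w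
  using ring_hom_trans[OF j1(1) product_proj[OF that]] ring_hom_trans[OF j2(1) product_proj[OF that]] by (simp_all add: comp_def)
 \<comment> \<open>The definite description in \<open>factor_below\<close> is the index singled out
   by \<open>product_hom\<close> for the composite of \<open>j1\<close> with the projection to the
   factor w.\<close>
 note h1 = product_hom[OF assms(2,3) R(1) assms(7) jw(1),folded factor_below_def[where L = K0 and h = j1],folded s1_def]
 note h2 = product_hom[OF assms(4,5) R(2) assms(7) jw(2),folded factor_below_def[where L = K0 and h = j2],folded s2_def]
 have s: "s1 w:V1" "s2 w:V2" if "w:V0" for w using h1(1) h2(1) that by auto
 have b: "b1 w:ring_hom (K1 (s1 w)) (K0 w)" "b2 w:ring_hom (K2 (s2 w)) (K0 w)" if "w:V0" for w
  unfolding b1_def b2_def using h1(2) h2(2) that by auto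
 have jb: "j1 x w = b1 w (x (s1 w))" "j2 y w = b2 w (y (s2 w))" if "w:V0" "x:.?R1" "y:.?R2" for w x y
  unfolding b1_def b2_def using h1(3) h2(3) that by auto
 have ic: "i1 x:.?R1" "i2 x:.?R2" if "x:.F" for x using ring_hom_closed[OF i1(1) that] ring_hom_closed[OF i2(1) that] by auto
 interpret patching F V1 K1 V2 K2 V0 K0 "%v x. i1 x v" "%v x. i2 x v" s1 s2 b1 b2
 proof (rule patching.intro)
  show "(%x. i1 x v):ring_hom F (K1 v)" if "v:V1" for v using ring_hom_trans[OF i1(1) product_proj[OF that]] by (simp add: comp_def)
  show "(%x. i2 x v):ring_hom F (K2 v)" if "v:V2" for v using ring_hom_trans[OF i2(1) product_proj[OF that]] by (simp add: comp_def)
  show "b1 w (i1 x (s1 w)) = b2 w (i2 x (s2 w))" if "w:V0" "x:.F" for w x using jb[OF that(1) ic[OF that(2)]] cm[OF that(2)] by simp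
  show "EX x:carrier F. (ALL v:V1. i1 x v = x1 v) & (ALL v:V2. i2 x v = x2 v)"
   if x1: "!!v. v:V1==>x1 v:.(K1 v)" and x2: "!!v. v:V2==>x2 v:.(K2 v)" and eq: "!!w. w:V0==>b1 w (x1 (s1 w)) = b2 w (x2 (s2 w))" for x1 x2
  proof -
   let ?x = "restrict x1 V1" and ?y = "restrict x2 V2"
   \<comment> \<open>Two elements with the same image in F_0 give elementary matrices with the same
     image in GL_2. Patching lifts this to a matrix over F, whose entry at (0,1) is the wanted
     element because \<open>j1\<close> and \<open>j2\<close> are injective.\<close>
   let ?E = "%R x. \<lambda>p\<in>sq 2. if p = (0,1) then x else 1[MR R 2] p"
   have xc: "?x:.?R1" and yc: "?y:.?R2" using x1 x2 by (auto simp: product_ring_sel)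
   have jx: "j1 ?x = j2 ?y"
   proof (rule PiE_ext[OF ring_hom_closed[OF j1(1) xc,unfolded product_ring_sel(1)] ring_hom_closed[OF j2(1) yc,unfolded product_ring_sel(1)]])
    fix w assume w: "w:V0"
    show "j1 ?x w = j2 ?y w" unfolding jb[OF w xc yc] using eq[OF w] s[OF w] by simp
   qed
   have m: "mape 2 j (?E R x) = (\<lambda>p\<in>sq 2. if p = (0,1) then j x else 1[MR ?R0 2] p)" if R': "ring R" and j: "j:ring_hom R ?R0" for R :: "'z ring" and j x
    unfolding map_entries_def
   proof (rule restrict_ext)
    fix p :: "nat \<times> nat" assume p: "p:sq 2"
    show "j (?E R x p) = (if p = (0,1) then j x else 1[MR ?R0 2] p)"
     using fun_cong[OF map_entries_one[OF R' R(3) j],of 2 p] p by (auto simp: map_entries_def)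
   qed
   have "mape 2 j1 (?E ?R1 ?x):mape 2 j1 ` GL 2 ?R1 \<inter> mape 2 j2 ` GL 2 ?R2"
   proof
    show "mape 2 j1 (?E ?R1 ?x):mape 2 j1 ` GL 2 ?R1" by (rule imageI[OF R1.elementary_GL[OF xc]])
    have "mape 2 j1 (?E ?R1 ?x) = mape 2 j2 (?E ?R2 ?y)" unfolding m[OF R(1) j1(1)] m[OF R(2) j2(1)] jx ..
    then show "mape 2 j1 (?E ?R1 ?x):mape 2 j2 ` GL 2 ?R2" using imageI[OF R2.elementary_GL[OF yc],of "mape 2 j2"] by simp
   qed
   then obtain M where M: "M:GL 2 F" "mape 2 j1 (?E ?R1 ?x) = mape 2 (j1 \<circ> i1) M" using pat[of 2] by auto
   let ?m = "M (0,1)"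
   have Mc: "?m:.F" using M(1) mat_entry[of M F 2 0 1] by (auto simp: GL_def Units_def)
   have "j1 ?x = j1 (i1 ?m)" using fun_cong[OF M(2),of "(0,1)"] by (simp add: map_entries_def)
   then have 1: "?x = i1 ?m" by (rule inj_onD[OF j1(2)]) (use xc ic[OF Mc] in auto)
   have "j2 ?y = j2 (i2 ?m)" using jx 1 cm[OF Mc] by simp
   then have 2: "?y = i2 ?m" by (rule inj_onD[OF j2(2)]) (use yc ic[OF Mc] in auto)
   have "i1 ?m v = x1 v" if "v:V1" for v using fun_cong[OF 1,of v] that by simp
   moreover have "i2 ?m v = x2 v" if "v:V2" for v using fun_cong[OF 2,of v] that by simp
   ultimately show ?thesis using Mc by blast
  qed
  show "EX g1 g2. (ALL v:V1. g1 v:GL n (K1 v)) & (ALL v:V2. g2 v:GL n (K2 v)) &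
   (ALL w:V0. g w = mape n (b1 w) (g1 (s1 w))*[MR (K0 w) n]mape n (b2 w) (g2 (s2 w)))"
   if n: "n >= 1" and g: "!!w. w:V0==>g w:GL n (K0 w)" for n g
  proof -
   have ring: "v:V1==>ring (K1 v)" "u:V2==>ring (K2 u)" "w:V0==>ring (K0 w)" for v u w
    using assms(3,5,7) by (auto simp: field_def domain_def cring_def)
   \<comment> \<open>The matrices over the factors of F_0 are assembled into one over the product
     ring, so that a single factorisation there restricts to all factors simultaneously.\<close>
   let ?g = "\<lambda>p\<in>sq n. \<lambda>w\<in>V0. g w p"
   have "?g:GL n ?R0" by (rule GL_product[OF assms(7) R(3) g])
   then obtain G1 G2 where G: "G1:GL n ?R1" "G2:GL n ?R2" "?g = mape n j1 G1*[MR ?R0 n]mape n j2 G2" using pat[OF n] by blast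
   have Gc: "G1:.(MR ?R1 n)" "G2:.(MR ?R2 n)" using G(1,2) by (auto simp: GL_def Units_def)
   have "g w = mape n (b1 w) (mape n (%x. x (s1 w)) G1)*[MR (K0 w) n]mape n (b2 w) (mape n (%x. x (s2 w)) G2)" if w: "w:V0" for w
   proof -
    have "g w:extensional (sq n)" using g[OF w] by (auto simp: GL_def Units_def mat_ring_sel PiE_iff)
    then have "g w = mape n (%x. x w) ?g" unfolding map_entries_def by (rule extensionalityI[OF _ restrict_extensional]) (use w in auto)
    also have "... = mape n (%x. x w) (mape n j1 G1)*[MR (K0 w) n]mape n (%x. x w) (mape n j2 G2)"
     unfolding G(3) by (rule map_entries_mult[OF R(3) ring(3)[OF w] product_proj[OF w] map_entries_closed[OF j1(1) Gc(1)] map_entries_closed[OF j2(1) Gc(2)]])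
    also have "mape n (%x. x w) (mape n j1 G1) = mape n (b1 w) (mape n (%x. x (s1 w)) G1)"
     unfolding map_entries_def by (rule restrict_ext) (use jb(1)[OF w mat_entry'[OF Gc(1)] R2.zero_closed] in auto)
    also have "mape n (%x. x w) (mape n j2 G2) = mape n (b2 w) (mape n (%x. x (s2 w)) G2)"
     unfolding map_entries_def by (rule restrict_ext) (use jb(2)[OF w R1.zero_closed mat_entry'[OF Gc(2)]] in auto)
    finally show ?thesis .
   qed
   then show ?thesis using GL_map[OF R(1) ring(1) product_proj G(1)] GL_map[OF R(2) ring(2) product_proj G(2)]
    by (intro exI[of _ "%v. mape n (%x. x v) G1"] exI[of _ "%v. mape n (%x. x v) G2"]) auto
  qed
  show "V1 ~= {}"
  proof
   \<comment> \<open>An empty product is the zero ring, into which a field does not embed.\<close>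
   assume "V1 = {}"
   then have "i1 0[F] = i1 1[F]" using ic[OF F.zero_closed] ic[OF F.one_closed] by (auto simp: product_ring_sel)
   then show False using inj_onD[OF i1(2)] by fastforce
  qed
  show "V2 ~= {}"
  proof
   assume "V2 = {}"
   then have "i2 0[F] = i2 1[F]" using ic[OF F.zero_closed] ic[OF F.one_closed] by (auto simp: product_ring_sel)
   then show False using inj_onD[OF i2(2)] by fastforce
  qed
 qed (use assms s b in auto)
 show ?thesis
 proof
  show "left_exact_seq (Br F) (Br_prod V1 K1 \<times>\<times> Br_prod V2 K2) (Br_prod V0 K0) (%\<alpha>. (Br_res_to_prod F V1 K1 i1 \<alpha>,Br_res_to_prod F V2 K2 i2 \<alpha>))
   (%(\<beta>,\<gamma>). Br_res_prod V1 K1 V0 K0 j1 \<beta>*[Br_prod V0 K0]inv\<^bsub>Br_prod V0 K0\<^esub> Br_res_prod V2 K2 V0 K0 j2 \<gamma>)"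
   using exact[OF assms(2,4)] unfolding Br_res_to_prod_def Br_res_prod_def Let_def s1_def[symmetric] s2_def[symmetric] b1_def[symmetric] b2_def[symmetric]
   by (simp add: b1_def b2_def)
  show "ALL \<alpha>:carrier (Br F). ind F \<alpha> = Lcm ((%v. ind (K1 v) (Br_res F (K1 v) (%x. i1 x v) \<alpha>)) ` V1 \<union> (%v. ind (K2 v) (Br_res F (K2 v) (%x. i2 x v) \<alpha>)) ` V2)"
   using ind_lcm[OF assms(2,4)] by blast
 qed
qed

end
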